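(* Let $\mathcal T$ be an essentially small triangulated category. (1) The assignment $\mathcal U\mapsto\mathrm{supp}_{\mathrm{cent}}\,\mathcal U$ induces an isomorphism between $Z(\mathrm{Thick}\,\mathcal T)$ and the frame of open subsets of $\mathrm{Spc}_{\mathrm{cent}}\,\mathcal T$. (2) For any pair $\mathcal U,\mathcal V$ in $\mathrm{Thick}\,\mathcal T$ there is a Mayer--Vietoris sequence $\lambda_{\mathcal U,\mathcal V}$ provided at least one of $\mathcal U$ and $\mathcal V$ is central.
   Context: Central subcategories: $\mathrm{Thick}\,\mathcal T$ is the lattice of thick subcategories (full triangulated, closed under direct summands) ordered by inclusion; $\wedge$ is intersection and joins $\vee$, $\bigvee$ are smallest thick subcategories containing the given ones. A pair $\mathcal U,\mathcal V$ is commuting if every morphism between objects of $\mathcal U$ and $\mathcal V$ (in either direction) factors through an object of $\mathcal U\wedge\mathcal V$; $\mathcal U$ is central if it commutes with all $\mathcal V\in\mathrm{Thick}\,\mathcal T$. $Z(\mathrm{Thick}\,\mathcal T)$ is the set of central elements, partially ordered by inclusion; it is a sublattice closed under arbitrary joins and a frame (complete lattice with $\bigvee_i(x_i\wedge y)=(\bigvee_ix_i)\wedge y$). Support: For a frame $F$, $\mathrm{Pt}\,F$ is the space of points, i.e. frame morphisms $p\colon F\to\{0,1\}$ (preserving finite meets and arbitrary joins), with open sets $U(a)=\{p\mid p(a)=1\}$, $a\in F$; points are identified with the prime elements of $F$ via $p\mapsto\bigvee_{p(a)=0}a$. Put $\mathrm{Spc}_{\mathrm{cent}}\,\mathcal T=\mathrm{Pt}\,Z(\mathrm{Thick}\,\mathcal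 T)$. For $X\in\mathcal T$, $\mathrm{supp}_{\mathrm{cent}}\,X=\{\mathcal P\in\mathrm{Spc}_{\mathrm{cent}}\,\mathcal T\mid X\notin\mathcal P\}$, where $\mathcal P$ is viewed as a prime element of $Z(\mathrm{Thick}\,\mathcal T)$, and for a class of objects $\mathcal X$, $\mathrm{supp}_{\mathrm{cent}}\,\mathcal X=\bigcup_{X\in\mathcal X}\mathrm{supp}_{\mathrm{cent}}\,X$. Mayer--Vietoris sequence: $\mathrm{Coh}\,\mathcal T$ is the category of cohomological functors $\mathcal T^{\mathrm{op}}\to\mathrm{Ab}$, with $\Sigma F=F\circ\Sigma^{-1}$. For a triangulated subcategory $\mathcal S$ with quotient functor $q\colon\mathcal T\to\mathcal T/\mathcal S$, let $q_*\colon\mathrm{Coh}\,\mathcal T/\mathcal S\to\mathrm{Coh}\,\mathcal T$ be restriction along $q$, $q^*$ its left adjoint (the filtered-colimit-preserving functor with $\mathrm{Hom}_{\mathcal T}(-,X)\mapsto\mathrm{Hom}_{\mathcal T/\mathcal S}(-,q(X))$), and $L_{\mathcal S}=q_*\circ q^*$. An inclusion $\mathcal S_1\subseteq\mathcal S_2$ induces a canonical morphism $L_{\mathcal S_1}\to L_{\mathcal S_2}$. $\lambda_{\mathcal U,\mathcal V}$ is a canonical long exact sequence of functors $\mathrm{Coh}\,\mathcal T\to\mathrm{Coh}\,\mathcal T$ $$\cdots\to\Sigma^{-1}L_{\mathcal U\vee\mathcal V}\to L_{\mathcal U\wedge\mathcal V}\to L_{\mathcal U}\oplus L_{\mathcal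 V}\to L_{\mathcal U\vee\mathcal V}\to\Sigma L_{\mathcal U\wedge\mathcal V}\to\cdots$$ (exact after evaluation at every $F\in\mathrm{Coh}\,\mathcal T$ and every object of $\mathcal T$) in which $L_{\mathcal U\wedge\mathcal V}\to L_{\mathcal U}\oplus L_{\mathcal V}$ is induced by the inclusions $\mathcal U\wedge\mathcal V\subseteq\mathcal U$ and $\mathcal U\wedge\mathcal V\subseteq\mathcal V$. *)

theory Defs
  imports "HOL-Algebra.Complete_Lattice" "HOL-Algebra.Coset" "HOL-Library.Equipollence"
begin

section \<open>Triangulated categories\<close>

text \<open>
  A category is given by a set of objects and one set of arrows with domain and codomain.
  The record also carries the remaining data of a triangulated category: sum and zero of
  parallel arrows, the suspension \<open>\<Sigma>\<close>, a quasi-inverse of \<open>\<Sigma>\<close>, and the distinguished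
  triangles \<open>X \<rightarrow> Y \<rightarrow> Z \<rightarrow> \<Sigma>X\<close>, recorded as triples of arrows.
\<close>

record ('o, 'm) tcat =
  Obj :: "'o set"
  Arr :: "'m set"
  Dom :: "'m \<Rightarrow> 'o"
  Cod :: "'m \<Rightarrow> 'o"
  Idn :: "'o \<Rightarrow> 'm"
  Cmp :: "'m \<Rightarrow> 'm \<Rightarrow> 'm" (infixr \<open>\<cdot>\<index>\<close> 75)
  Add :: "'m \<Rightarrow> 'm \<Rightarrow> 'm"
  Nul :: "'o \<Rightarrow> 'o \<Rightarrow> 'm"
  Sho :: "'o \<Rightarrow> 'o"
  Sha :: "'m \<Rightarrow> 'm"
  Usho :: "'o \<Rightarrow> 'o"
  Usha :: "'m \<Rightarrow> 'm"
  Tri :: "('m \<times> 'm \<times> 'm) set"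

definition Hom :: "('o, 'm) tcat \<Rightarrow> 'o \<Rightarrow> 'o \<Rightarrow> 'm set" where
  "Hom T X Y = {f \<in> Arr T. Dom T f = X \<and> Cod T f = Y}"

text \<open>The abelian group of arrows, in the multiplicative notation of the library.\<close>

definition Homgrp :: "('o, 'm) tcat \<Rightarrow> 'o \<Rightarrow> 'o \<Rightarrow> 'm monoid" where
  "Homgrp T X Y = \<lparr>carrier = Hom T X Y, mult = Add T, one = Nul T X Y\<rparr>"

definition Neg :: "('o, 'm) tcat \<Rightarrow> 'm \<Rightarrow> 'm" where
  "Neg T f = inv\<^bsub>Homgrp T (Dom T f) (Cod T f)\<^esub> f"

definition iso_arr :: "('o, 'm) tcat \<Rightarrow> 'm \<Rightarrow> bool" where
  "iso_arr T f \<longleftrightarrow> f \<in> Arr T \<and>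
     (\<exists>g \<in> Hom T (Cod T f) (Dom T f). g \<cdot>\<^bsub>T\<^esub> f = Idn T (Dom T f) \<and> f \<cdot>\<^bsub>T\<^esub> g = Idn T (Cod T f))"

definition isomorphic :: "('o, 'm) tcat \<Rightarrow> 'o \<Rightarrow> 'o \<Rightarrow> bool" where
  "isomorphic T X Y \<longleftrightarrow> (\<exists>f \<in> Hom T X Y. iso_arr T f)"

definition zero_object :: "('o, 'm) tcat \<Rightarrow> 'o \<Rightarrow> bool" where
  "zero_object T Z \<longleftrightarrow> Z \<in> Obj T \<and>
     (\<forall>X \<in> Obj T. (\<exists>!f. f \<in> Hom T Z X) \<and> (\<exists>!f. f \<in> Hom T X Z))"

definition biproduct :: "('o, 'm) tcat \<Rightarrow> 'o \<Rightarrow> 'o \<Rightarrow> 'o \<Rightarrow> bool" where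
  "biproduct T X Y B \<longleftrightarrow> X \<in> Obj T \<and> Y \<in> Obj T \<and> B \<in> Obj T \<and>
     (\<exists>i \<in> Hom T X B. \<exists>j \<in> Hom T Y B. \<exists>p \<in> Hom T B X. \<exists>q \<in> Hom T B Y.
        p \<cdot>\<^bsub>T\<^esub> i = Idn T X \<and> q \<cdot>\<^bsub>T\<^esub> j = Idn T Y \<and>
        p \<cdot>\<^bsub>T\<^esub> j = Nul T Y X \<and> q \<cdot>\<^bsub>T\<^esub> i = Nul T X Y \<and>
        Add T (i \<cdot>\<^bsub>T\<^esub> p) (j \<cdot>\<^bsub>T\<^esub> q) = Idn T B)"

definition endofunctor :: "('o, 'm) tcat \<Rightarrow> ('o \<Rightarrow> 'o) \<Rightarrow> ('m \<Rightarrow> 'm) \<Rightarrow> bool" where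
  "endofunctor T Ho Ha \<longleftrightarrow>
     (\<forall>X \<in> Obj T. Ho X \<in> Obj T \<and> Ha (Idn T X) = Idn T (Ho X)) \<and>
     (\<forall>f \<in> Arr T. Ha f \<in> Hom T (Ho (Dom T f)) (Ho (Cod T f))) \<and>
     (\<forall>f \<in> Arr T. \<forall>g \<in> Arr T. Cod T f = Dom T g \<longrightarrow> Ha (g \<cdot>\<^bsub>T\<^esub> f) = Ha g \<cdot>\<^bsub>T\<^esub> Ha f)"

definition iso_to_identity :: "('o, 'm) tcat \<Rightarrow> ('o \<Rightarrow> 'o) \<Rightarrow> ('m \<Rightarrow> 'm) \<Rightarrow> bool" where
  "iso_to_identity T Ho Ha \<longleftrightarrow>
     (\<exists>e. (\<forall>X \<in> Obj T. e X \<in> Hom T X (Ho X) \<and> iso_arr T (e X)) \<and>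
          (\<forall>f \<in> Arr T. Ha f \<cdot>\<^bsub>T\<^esub> e (Dom T f) = e (Cod T f) \<cdot>\<^bsub>T\<^esub> f))"

definition candidate_triangle :: "('o, 'm) tcat \<Rightarrow> 'm \<times> 'm \<times> 'm \<Rightarrow> bool" where
  "candidate_triangle T = (\<lambda>(f, g, h). f \<in> Arr T \<and> g \<in> Arr T \<and> h \<in> Arr T \<and>
     Cod T f = Dom T g \<and> Cod T g = Dom T h \<and> Cod T h = Sho T (Dom T f))"

definition triangle_mor ::
  "('o, 'm) tcat \<Rightarrow> 'm \<times> 'm \<times> 'm \<Rightarrow> 'm \<times> 'm \<times> 'm \<Rightarrow> 'm \<times> 'm \<times> 'm \<Rightarrow> bool" where
  "triangle_mor T = (\<lambda>(f, g, h) (f', g', h') (i, j, k).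
     i \<in> Hom T (Dom T f) (Dom T f') \<and> j \<in> Hom T (Dom T g) (Dom T g') \<and>
     k \<in> Hom T (Dom T h) (Dom T h') \<and>
     j \<cdot>\<^bsub>T\<^esub> f = f' \<cdot>\<^bsub>T\<^esub> i \<and> k \<cdot>\<^bsub>T\<^esub> g = g' \<cdot>\<^bsub>T\<^esub> j \<and> Sha T i \<cdot>\<^bsub>T\<^esub> h = h' \<cdot>\<^bsub>T\<^esub> k)"

definition triangles_isomorphic ::
  "('o, 'm) tcat \<Rightarrow> 'm \<times> 'm \<times> 'm \<Rightarrow> 'm \<times> 'm \<times> 'm \<Rightarrow> bool" where
  "triangles_isomorphic T t t' \<longleftrightarrow>
     (\<exists>i j k. triangle_mor T t t' (i, j, k) \<and> iso_arr T i \<and> iso_arr T j \<and> iso_arr T k)"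

locale category =
  fixes T :: "('o, 'm) tcat" (structure)
  assumes dom_cod: "f \<in> Arr T \<Longrightarrow> Dom T f \<in> Obj T \<and> Cod T f \<in> Obj T"
    and idn: "X \<in> Obj T \<Longrightarrow> Idn T X \<in> Hom T X X"
    and cmp: "\<lbrakk>f \<in> Hom T X Y; g \<in> Hom T Y Z\<rbrakk> \<Longrightarrow> g \<cdot> f \<in> Hom T X Z"
    and idn_left: "f \<in> Hom T X Y \<Longrightarrow> Idn T Y \<cdot> f = f"
    and idn_right: "f \<in> Hom T X Y \<Longrightarrow> f \<cdot> Idn T X = f"
    and assoc: "\<lbrakk>f \<in> Hom T W X; g \<in> Hom T X Y; h \<in> Hom T Y Z\<rbrakk> \<Longrightarrow> (h \<cdot> g) \<cdot> f = h \<cdot> (g \<cdot> f)"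

locale additive_category = category +
  assumes hom_group: "\<lbrakk>X \<in> Obj T; Y \<in> Obj T\<rbrakk> \<Longrightarrow> comm_group (Homgrp T X Y)"
    and distrib_left: "\<lbrakk>f \<in> Hom T X Y; f' \<in> Hom T X Y; g \<in> Hom T Y Z\<rbrakk>
          \<Longrightarrow> g \<cdot> Add T f f' = Add T (g \<cdot> f) (g \<cdot> f')"
    and distrib_right: "\<lbrakk>f \<in> Hom T X Y; g \<in> Hom T Y Z; g' \<in> Hom T Y Z\<rbrakk>
          \<Longrightarrow> Add T g g' \<cdot> f = Add T (g \<cdot> f) (g' \<cdot> f)"
    and zero_exists: "\<exists>Z. zero_object T Z"
    and biproduct_exists: "\<lbrakk>X \<in> Obj T; Y \<in> Obj T\<rbrakk> \<Longrightarrow> \<exists>B. biproduct T X Y B"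

locale triangulated_category = additive_category +
  assumes suspension: "endofunctor T (Sho T) (Sha T)"
    and desuspension: "endofunctor T (Usho T) (Usha T)"
    and suspension_equiv:
      "iso_to_identity T (Sho T \<circ> Usho T) (Sha T \<circ> Usha T)"
      "iso_to_identity T (Usho T \<circ> Sho T) (Usha T \<circ> Sha T)"
    and suspension_add: "\<lbrakk>f \<in> Hom T X Y; g \<in> Hom T X Y\<rbrakk>
          \<Longrightarrow> Sha T (Add T f g) = Add T (Sha T f) (Sha T g)"
    and candidate: "t \<in> Tri T \<Longrightarrow> candidate_triangle T t"
    and iso_closed: "\<lbrakk>t \<in> Tri T; candidate_triangle T t'; triangles_isomorphic T t t'\<rbrakk> \<Longrightarrow> t' \<in> Tri T"
    and TR1_identity: "\<lbrakk>X \<in> Obj T; zero_object T Z\<rbrakk>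
          \<Longrightarrow> (Idn T X, Nul T X Z, Nul T Z (Sho T X)) \<in> Tri T"
    and TR1_cone: "f \<in> Arr T \<Longrightarrow> \<exists>g h. (f, g, h) \<in> Tri T"
    and TR2: "candidate_triangle T (f, g, h)
          \<Longrightarrow> (f, g, h) \<in> Tri T \<longleftrightarrow> (g, h, Neg T (Sha T f)) \<in> Tri T"
    and TR3: "\<lbrakk>(f, g, h) \<in> Tri T; (f', g', h') \<in> Tri T;
            i \<in> Hom T (Dom T f) (Dom T f'); j \<in> Hom T (Dom T g) (Dom T g'); j \<cdot> f = f' \<cdot> i\<rbrakk>
          \<Longrightarrow> \<exists>k. triangle_mor T (f, g, h) (f', g', h') (i, j, k)"
    and TR4: "\<lbrakk>Cod T f = Dom T g; (f, f\<^sub>1, f\<^sub>2) \<in> Tri T; (g, g\<^sub>1, g\<^sub>2) \<in> Tri T; (g \<cdot> f, k\<^sub>1, k\<^sub>2) \<in> Tri T\<rbrakk>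
          \<Longrightarrow> \<exists>u v. (u, v, Sha T f\<^sub>1 \<cdot> g\<^sub>2) \<in> Tri T \<and>
                u \<in> Hom T (Cod T f\<^sub>1) (Cod T k\<^sub>1) \<and> v \<in> Hom T (Cod T k\<^sub>1) (Cod T g\<^sub>1) \<and>
                u \<cdot> f\<^sub>1 = k\<^sub>1 \<cdot> g \<and> k\<^sub>2 \<cdot> u = f\<^sub>2 \<and> v \<cdot> k\<^sub>1 = g\<^sub>1 \<and> g\<^sub>2 \<cdot> v = Sha T f \<cdot> k\<^sub>2"

text \<open>
  The set \<open>A\<close> fixes the meaning of ``small'': some family \<open>B\<close> of objects meets every
  isomorphism class, and the arrows between objects of \<open>B\<close> are no more numerous than \<open>A\<close>.
\<close>

definition essentially_small :: "('o, 'm) tcat \<Rightarrow> 'g set \<Rightarrow> bool" where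
  "essentially_small T A \<longleftrightarrow>
     (\<exists>B \<subseteq> Obj T. (\<forall>X \<in> Obj T. \<exists>Y \<in> B. isomorphic T X Y) \<and>
        {f \<in> Arr T. Dom T f \<in> B \<and> Cod T f \<in> B} \<lesssim> A)"


section \<open>Thick subcategories and central elements\<close>

text \<open>Full subcategories are represented by their sets of objects.\<close>

definition triangulated_subcategory :: "('o, 'm) tcat \<Rightarrow> 'o set \<Rightarrow> bool" where
  "triangulated_subcategory T S \<longleftrightarrow> S \<subseteq> Obj T \<and> S \<noteq> {} \<and>
     (\<forall>X \<in> S. \<forall>Y \<in> Obj T. isomorphic T X Y \<longrightarrow> Y \<in> S) \<and>
     (\<forall>X \<in> Obj T. Sho T X \<in> S \<longleftrightarrow> X \<in> S) \<and>
     (\<forall>(f, g, h) \<in> Tri T. Dom T f \<in> S \<and> Cod T f \<in> S \<longrightarrow> Cod T g \<in> S)"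

definition Thick :: "('o, 'm) tcat \<Rightarrow> 'o set set" where
  "Thick T = {S. triangulated_subcategory T S \<and>
     (\<forall>X Y B. biproduct T X Y B \<and> B \<in> S \<longrightarrow> X \<in> S)}"

definition thick_hull :: "('o, 'm) tcat \<Rightarrow> 'o set \<Rightarrow> 'o set" where
  "thick_hull T \<X> = \<Inter>{S \<in> Thick T. \<X> \<subseteq> S}"

definition commuting_pair :: "('o, 'm) tcat \<Rightarrow> 'o set \<Rightarrow> 'o set \<Rightarrow> bool" where
  "commuting_pair T \<U> \<V> \<longleftrightarrow>
     (\<forall>f \<in> Arr T. (Dom T f \<in> \<U> \<and> Cod T f \<in> \<V>) \<or> (Dom T f \<in> \<V> \<and> Cod T f \<in> \<U>) \<longrightarrow>
        (\<exists>W \<in> \<U> \<inter> \<V>. \<exists>g \<in> Hom T (Dom T f) W. \<exists>h \<in> Hom T W (Cod T f). f = h \<cdot>\<^bsub>T\<^esub> g))"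

definition central :: "('o, 'm) tcat \<Rightarrow> 'o set \<Rightarrow> bool" where
  "central T \<U> \<longleftrightarrow> \<U> \<in> Thick T \<and> (\<forall>\<V> \<in> Thick T. commuting_pair T \<U> \<V>)"

definition incl_order :: "'a set set \<Rightarrow> 'a set gorder" where
  "incl_order \<A> = \<lparr>carrier = \<A>, eq = (=), le = (\<subseteq>)\<rparr>"

definition ZThick :: "('o, 'm) tcat \<Rightarrow> 'o set gorder" where
  "ZThick T = incl_order {\<U>. central T \<U>}"


section \<open>Frames, points and support\<close>

definition frame :: "'a gorder \<Rightarrow> bool" where
  "frame L \<longleftrightarrow> complete_lattice L \<and>
     (\<forall>A \<subseteq> carrier L. \<forall>y \<in> carrier L. \<Squnion>\<^bsub>L\<^esub>((\<lambda>x. x \<sqinter>\<^bsub>L\<^esub> y) ` A) = (\<Squnion>\<^bsub>L\<^esub>A) \<sqinter>\<^bsub>L\<^esub> y)"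

definition frame_mor :: "'a gorder \<Rightarrow> 'b gorder \<Rightarrow> ('a \<Rightarrow> 'b) \<Rightarrow> bool" where
  "frame_mor L M p \<longleftrightarrow> p \<in> carrier L \<rightarrow> carrier M \<and>
     p \<top>\<^bsub>L\<^esub> = \<top>\<^bsub>M\<^esub> \<and>
     (\<forall>a \<in> carrier L. \<forall>b \<in> carrier L. p (a \<sqinter>\<^bsub>L\<^esub> b) = p a \<sqinter>\<^bsub>M\<^esub> p b) \<and>
     (\<forall>A \<subseteq> carrier L. p (\<Squnion>\<^bsub>L\<^esub>A) = \<Squnion>\<^bsub>M\<^esub>(p ` A))"

definition frame_iso :: "'a gorder \<Rightarrow> 'b gorder \<Rightarrow> ('a \<Rightarrow> 'b) \<Rightarrow> bool" where
  "frame_iso L M p \<longleftrightarrow> frame L \<and> frame M \<and> frame_mor L M p \<and> bij_betw p (carrier L) (carrier M)"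

text \<open>The frame \<open>{0, 1}\<close> is the type of truth values; \<open>p a = 1\<close> reads \<open>p a\<close>.\<close>

definition two :: "bool gorder" where
  "two = \<lparr>carrier = UNIV, eq = (=), le = (\<le>)\<rparr>"

definition Pt :: "'a gorder \<Rightarrow> ('a \<Rightarrow> bool) set" where
  "Pt L = {p \<in> extensional (carrier L). frame_mor L two p}"

definition pt_open :: "'a gorder \<Rightarrow> 'a \<Rightarrow> ('a \<Rightarrow> bool) set" where
  "pt_open L a = {p \<in> Pt L. p a}"

definition Opens :: "'a gorder \<Rightarrow> ('a \<Rightarrow> bool) set gorder" where
  "Opens L = incl_order (pt_open L ` carrier L)"

definition prime_of :: "'a gorder \<Rightarrow> ('a \<Rightarrow> bool) \<Rightarrow> 'a" where
  "prime_of L p = \<Squnion>\<^bsub>L\<^esub>{a \<in> carrier L. \<not> p a}"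

definition Spc_cent :: "('o, 'm) tcat \<Rightarrow> ('o set \<Rightarrow> bool) set" where
  "Spc_cent T = Pt (ZThick T)"

definition supp_cent_obj :: "('o, 'm) tcat \<Rightarrow> 'o \<Rightarrow> ('o set \<Rightarrow> bool) set" where
  "supp_cent_obj T X = {p \<in> Spc_cent T. X \<notin> prime_of (ZThick T) p}"

definition supp_cent :: "('o, 'm) tcat \<Rightarrow> 'o set \<Rightarrow> ('o set \<Rightarrow> bool) set" where
  "supp_cent T \<X> = (\<Union>X \<in> \<X>. supp_cent_obj T X)"


section \<open>Verdier quotients\<close>

text \<open>
  An arrow \<open>X \<rightarrow> Y\<close> of \<open>T/S\<close> is a class of roofs \<open>X \<leftarrow> X' \<rightarrow> Y\<close>, written \<open>(s, f)\<close>, where the cone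
  of \<open>s\<close> lies in \<open>S\<close>. Operations on classes collect the results for all choices of
  representatives (and of Ore squares or common denominators).
\<close>

definition cone_in :: "('o, 'm) tcat \<Rightarrow> 'o set \<Rightarrow> 'm set" where
  "cone_in T S = {s. \<exists>g h. (s, g, h) \<in> Tri T \<and> Cod T g \<in> S}"

definition roofs :: "('o, 'm) tcat \<Rightarrow> 'o set \<Rightarrow> ('m \<times> 'm) set" where
  "roofs T S = {(s, f). s \<in> cone_in T S \<and> f \<in> Arr T \<and> Dom T s = Dom T f}"

definition frac :: "('o, 'm) tcat \<Rightarrow> 'o set \<Rightarrow> 'm \<Rightarrow> 'm \<Rightarrow> ('m \<times> 'm) set" where
  "frac T S s f = {(s', f') \<in> roofs T S. \<exists>u \<in> Arr T. \<exists>v \<in> Arr T.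
     Dom T u = Dom T v \<and> Cod T u = Dom T s \<and> Cod T v = Dom T s' \<and>
     s \<cdot>\<^bsub>T\<^esub> u = s' \<cdot>\<^bsub>T\<^esub> v \<and> s \<cdot>\<^bsub>T\<^esub> u \<in> cone_in T S \<and> f \<cdot>\<^bsub>T\<^esub> u = f' \<cdot>\<^bsub>T\<^esub> v}"

definition frac_category :: "('o, 'm) tcat \<Rightarrow> 'o set \<Rightarrow> ('o, ('m \<times> 'm) set) tcat" where
  "frac_category T S = \<lparr>
     Obj = Obj T,
     Arr = {frac T S s f | s f. (s, f) \<in> roofs T S},
     Dom = (\<lambda>c. Cod T (fst (SOME r. r \<in> c))),
     Cod = (\<lambda>c. Cod T (snd (SOME r. r \<in> c))),
     Idn = (\<lambda>X. frac T S (Idn T X) (Idn T X)),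
     Cmp = (\<lambda>d c. \<Union>{frac T S (s \<cdot>\<^bsub>T\<^esub> u) (g \<cdot>\<^bsub>T\<^esub> k) | s f t g u k.
              (s, f) \<in> c \<and> (t, g) \<in> d \<and> u \<in> cone_in T S \<and> k \<in> Arr T \<and>
              Dom T u = Dom T k \<and> Cod T u = Dom T f \<and> Cod T k = Dom T t \<and>
              f \<cdot>\<^bsub>T\<^esub> u = t \<cdot>\<^bsub>T\<^esub> k}),
     Add = (\<lambda>c d. \<Union>{frac T S s (Add T f g) | s f g. (s, f) \<in> c \<and> (s, g) \<in> d}),
     Nul = (\<lambda>X Y. frac T S (Idn T X) (Nul T X Y)),
     Sho = Sho T,
     Sha = (\<lambda>c. \<Union>{frac T S (Sha T s) (Sha T f) | s f. (s, f) \<in> c}),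
     Usho = Usho T,
     Usha = (\<lambda>c. \<Union>{frac T S (Usha T s) (Usha T f) | s f. (s, f) \<in> c}),
     Tri = {}\<rparr>"

definition qmap :: "('o, 'm) tcat \<Rightarrow> 'o set \<Rightarrow> 'm \<Rightarrow> ('m \<times> 'm) set" where
  "qmap T S f = frac T S (Idn T (Dom T f)) f"

text \<open>The distinguished triangles are the triangles isomorphic to images of those of \<open>T\<close>.\<close>

definition quotient :: "('o, 'm) tcat \<Rightarrow> 'o set \<Rightarrow> ('o, ('m \<times> 'm) set) tcat" where
  "quotient T S = frac_category T S \<lparr>Tri := {t. candidate_triangle (frac_category T S) t \<and>
     (\<exists>(f, g, h) \<in> Tri T.
        triangles_isomorphic (frac_category T S) (qmap T S f, qmap T S g, qmap T S h) t)}\<rparr>"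


section \<open>Cohomological functors\<close>

text \<open>
  \<open>Ab\<close> consists of the abelian groups carried by subsets of the type \<open>'g\<close>.
  A functor \<open>F : T\<^sup>o\<^sup>p \<rightarrow> Ab\<close> has values \<open>Ev F X\<close> and restriction maps \<open>Re F f\<close>.
  Morphisms of functors matter only on objects and on carriers.
\<close>

record ('o, 'm, 'g) psh =
  Ev :: "'o \<Rightarrow> 'g monoid"
  Re :: "'m \<Rightarrow> 'g \<Rightarrow> 'g"

definition cohomological :: "('o, 'm) tcat \<Rightarrow> ('o, 'm, 'g) psh \<Rightarrow> bool" where
  "cohomological T F \<longleftrightarrow>
     (\<forall>X \<in> Obj T. comm_group (Ev F X) \<and> (\<forall>a \<in> carrier (Ev F X). Re F (Idn T X) a = a)) \<and>
     (\<forall>f \<in> Arr T. Re F f \<in> hom (Ev F (Cod T f)) (Ev F (Dom T f))) \<and>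
     (\<forall>f \<in> Arr T. \<forall>g \<in> Arr T. Cod T f = Dom T g \<longrightarrow>
        (\<forall>a \<in> carrier (Ev F (Cod T g)). Re F (g \<cdot>\<^bsub>T\<^esub> f) a = Re F f (Re F g a))) \<and>
     (\<forall>f \<in> Arr T. \<forall>g \<in> Hom T (Dom T f) (Cod T f). \<forall>a \<in> carrier (Ev F (Cod T f)).
        Re F (Add T f g) a = Re F f a \<otimes>\<^bsub>Ev F (Dom T f)\<^esub> Re F g a) \<and>
     (\<forall>(f, g, h) \<in> Tri T.
        Re F g ` carrier (Ev F (Cod T g)) = kernel (Ev F (Cod T f)) (Ev F (Dom T f)) (Re F f))"

definition psh_hom ::
  "('o, 'm) tcat \<Rightarrow> ('o, 'm, 'g) psh \<Rightarrow> ('o, 'm, 'h) psh \<Rightarrow> ('o \<Rightarrow> 'g \<Rightarrow> 'h) \<Rightarrow> bool" where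
  "psh_hom T F G \<phi> \<longleftrightarrow>
     (\<forall>X \<in> Obj T. \<phi> X \<in> hom (Ev F X) (Ev G X)) \<and>
     (\<forall>f \<in> Arr T. \<forall>a \<in> carrier (Ev F (Cod T f)).
        \<phi> (Dom T f) (Re F f a) = Re G f (\<phi> (Cod T f) a))"

definition mor_eq ::
  "('o, 'm) tcat \<Rightarrow> ('o, 'm, 'g) psh \<Rightarrow> ('o \<Rightarrow> 'g \<Rightarrow> 'h) \<Rightarrow> ('o \<Rightarrow> 'g \<Rightarrow> 'h) \<Rightarrow> bool" where
  "mor_eq T F \<phi> \<psi> \<longleftrightarrow> (\<forall>X \<in> Obj T. \<forall>a \<in> carrier (Ev F X). \<phi> X a = \<psi> X a)"

definition mor_comp :: "('o \<Rightarrow> 'h \<Rightarrow> 'k) \<Rightarrow> ('o \<Rightarrow> 'g \<Rightarrow> 'h) \<Rightarrow> 'o \<Rightarrow> 'g \<Rightarrow> 'k" where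
  "mor_comp \<psi> \<phi> X a = \<psi> X (\<phi> X a)"

text \<open>
  The functor \<open>q\<^sub>*\<close>. Since \<open>q\<close> is the identity on objects, \<open>q\<^sub>*\<close> does not change the family of
  maps that constitutes a morphism.
\<close>

definition restrict_q ::
  "('o, 'm) tcat \<Rightarrow> 'o set \<Rightarrow> ('o, ('m \<times> 'm) set, 'g) psh \<Rightarrow> ('o, 'm, 'g) psh" where
  "restrict_q T S G = \<lparr>Ev = Ev G, Re = (\<lambda>f. Re G (qmap T S f))\<rparr>"

record ('o, 'm, 'g) ladj =
  Lob :: "('o, 'm, 'g) psh \<Rightarrow> ('o, ('m \<times> 'm) set, 'g) psh"
  Lmor :: "('o, 'm, 'g) psh \<Rightarrow> ('o, 'm, 'g) psh \<Rightarrow> ('o \<Rightarrow> 'g \<Rightarrow> 'g) \<Rightarrow> 'o \<Rightarrow> 'g \<Rightarrow> 'g"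
  Unit :: "('o, 'm, 'g) psh \<Rightarrow> 'o \<Rightarrow> 'g \<Rightarrow> 'g"

text \<open>
  A left adjoint of \<open>q\<^sub>* : Coh T/S \<rightarrow> Coh T\<close>: a functor \<open>Coh T \<rightarrow> Coh T/S\<close> and a natural
  transformation \<open>Id \<rightarrow> q\<^sub>* q\<^sup>*\<close> whose components are universal arrows to \<open>q\<^sub>*\<close>.
\<close>

definition is_left_adjoint ::
  "('o, 'm) tcat \<Rightarrow> 'o set \<Rightarrow> ('o, 'm, 'g) ladj \<Rightarrow> bool" where
  "is_left_adjoint T S A \<longleftrightarrow>
     (\<forall>F. cohomological T F \<longrightarrow> cohomological (quotient T S) (Lob A F)) \<and>
     (\<forall>F G \<phi>. cohomological T F \<and> cohomological T G \<and> psh_hom T F G \<phi> \<longrightarrow>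
        psh_hom (quotient T S) (Lob A F) (Lob A G) (Lmor A F G \<phi>)) \<and>
     (\<forall>F. cohomological T F \<longrightarrow> mor_eq (quotient T S) (Lob A F) (Lmor A F F (\<lambda>X a. a)) (\<lambda>X a. a)) \<and>
     (\<forall>F G H \<phi> \<psi>. cohomological T F \<and> cohomological T G \<and> cohomological T H \<and>
        psh_hom T F G \<phi> \<and> psh_hom T G H \<psi> \<longrightarrow>
        mor_eq (quotient T S) (Lob A F) (Lmor A F H (mor_comp \<psi> \<phi>))
          (mor_comp (Lmor A G H \<psi>) (Lmor A F G \<phi>))) \<and>
     (\<forall>F. cohomological T F \<longrightarrow> psh_hom T F (restrict_q T S (Lob A F)) (Unit A F)) \<and>
     (\<forall>F G \<phi>. cohomological T F \<and> cohomological T G \<and> psh_hom T F G \<phi> \<longrightarrow>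
        mor_eq T F (mor_comp (Unit A G) \<phi>) (mor_comp (Lmor A F G \<phi>) (Unit A F))) \<and>
     (\<forall>F (G :: ('o, ('m \<times> 'm) set, 'g) psh) \<phi>. cohomological T F \<and> cohomological (quotient T S) G \<and>
        psh_hom T F (restrict_q T S G) \<phi> \<longrightarrow>
        (\<exists>\<psi>. psh_hom (quotient T S) (Lob A F) G \<psi> \<and> mor_eq T F (mor_comp \<psi> (Unit A F)) \<phi> \<and>
          (\<forall>\<psi>'. psh_hom (quotient T S) (Lob A F) G \<psi>' \<and> mor_eq T F (mor_comp \<psi>' (Unit A F)) \<phi> \<longrightarrow>
             mor_eq (quotient T S) (Lob A F) \<psi>' \<psi>)))"

text \<open>
  The left adjoint \<open>q\<^sup>*\<close> is unique up to isomorphism; it exists when \<open>'g\<close> is infinite and \<open>T\<close> is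
  essentially small with respect to \<open>'g\<close>.
\<close>

definition pull_q :: "('o, 'm) tcat \<Rightarrow> 'o set \<Rightarrow> ('o, 'm, 'g) ladj" where
  "pull_q T S = (SOME A. is_left_adjoint T S A)"


section \<open>Functors on the category of cohomological functors\<close>

record ('o, 'm, 'g, 'h) cohfun =
  Fo :: "('o, 'm, 'g) psh \<Rightarrow> ('o, 'm, 'h) psh"
  Fm :: "('o, 'm, 'g) psh \<Rightarrow> ('o, 'm, 'g) psh \<Rightarrow> ('o \<Rightarrow> 'g \<Rightarrow> 'g) \<Rightarrow> 'o \<Rightarrow> 'h \<Rightarrow> 'h"

definition Lfun :: "('o, 'm) tcat \<Rightarrow> 'o set \<Rightarrow> ('o, 'm, 'g, 'g) cohfun" where
  "Lfun T S = \<lparr>Fo = (\<lambda>F. restrict_q T S (Lob (pull_q T S) F)), Fm = Lmor (pull_q T S)\<rparr>"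

text \<open>
  The canonical morphism \<open>L\<^sub>S F \<rightarrow> L\<^sub>R F\<close> for \<open>S \<subseteq> R\<close>: the unique one under \<open>F\<close>. It corresponds
  under adjunction to the unit \<open>F \<rightarrow> L\<^sub>R F\<close>, since functors restricted from \<open>T/R\<close> are restricted
  from \<open>T/S\<close>.
\<close>

definition canon ::
  "('o, 'm) tcat \<Rightarrow> 'o set \<Rightarrow> 'o set \<Rightarrow> ('o, 'm, 'g) psh \<Rightarrow> 'o \<Rightarrow> 'g \<Rightarrow> 'g" where
  "canon T S R F = (SOME \<theta>. psh_hom T (Fo (Lfun T S) F) (Fo (Lfun T R) F) \<theta> \<and>
     mor_eq T F (mor_comp \<theta> (Unit (pull_q T S) F)) (Unit (pull_q T R) F))"

text \<open>The direct sum has values in the groups carried by \<open>'g \<times> 'h\<close>.\<close>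

definition dsum ::
  "('o, 'm, 'g, 'h) cohfun \<Rightarrow> ('o, 'm, 'g, 'k) cohfun \<Rightarrow> ('o, 'm, 'g, 'h \<times> 'k) cohfun" where
  "dsum P Q = \<lparr>
     Fo = (\<lambda>F. \<lparr>Ev = (\<lambda>X. Ev (Fo P F) X \<times>\<times> Ev (Fo Q F) X),
                Re = (\<lambda>f. map_prod (Re (Fo P F) f) (Re (Fo Q F) f))\<rparr>),
     Fm = (\<lambda>F G \<phi> X. map_prod (Fm P F G \<phi> X) (Fm Q F G \<phi> X))\<rparr>"

definition Sho_pow :: "('o, 'm) tcat \<Rightarrow> int \<Rightarrow> 'o \<Rightarrow> 'o" where
  "Sho_pow T n = (if n \<ge> 0 then Sho T ^^ nat n else Usho T ^^ nat (- n))"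

definition Sha_pow :: "('o, 'm) tcat \<Rightarrow> int \<Rightarrow> 'm \<Rightarrow> 'm" where
  "Sha_pow T n = (if n \<ge> 0 then Sha T ^^ nat n else Usha T ^^ nat (- n))"

text \<open>\<open>\<Sigma>\<^sup>n P\<close>, with \<open>\<Sigma>\<^sup>n F = F \<circ> \<Sigma>\<^sup>-\<^sup>n\<close>.\<close>

definition susp :: "('o, 'm) tcat \<Rightarrow> int \<Rightarrow> ('o, 'm, 'g, 'h) cohfun \<Rightarrow> ('o, 'm, 'g, 'h) cohfun" where
  "susp T n P = \<lparr>
     Fo = (\<lambda>F. \<lparr>Ev = (\<lambda>X. Ev (Fo P F) (Sho_pow T (- n) X)),
                Re = (\<lambda>f. Re (Fo P F) (Sha_pow T (- n) f))\<rparr>),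
     Fm = (\<lambda>F G \<phi> X. Fm P F G \<phi> (Sho_pow T (- n) X))\<rparr>"

definition susp_trans ::
  "('o, 'm) tcat \<Rightarrow> int \<Rightarrow> (('o, 'm, 'g) psh \<Rightarrow> 'o \<Rightarrow> 'h \<Rightarrow> 'k) \<Rightarrow> ('o, 'm, 'g) psh \<Rightarrow> 'o \<Rightarrow> 'h \<Rightarrow> 'k" where
  "susp_trans T n \<tau> F X = \<tau> F (Sho_pow T (- n) X)"

definition nat_trans ::
  "('o, 'm) tcat \<Rightarrow> ('o, 'm, 'g, 'h) cohfun \<Rightarrow> ('o, 'm, 'g, 'k) cohfun \<Rightarrow>
     (('o, 'm, 'g) psh \<Rightarrow> 'o \<Rightarrow> 'h \<Rightarrow> 'k) \<Rightarrow> bool" where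
  "nat_trans T P Q \<tau> \<longleftrightarrow>
     (\<forall>F. cohomological T F \<longrightarrow> psh_hom T (Fo P F) (Fo Q F) (\<tau> F)) \<and>
     (\<forall>F G \<phi>. cohomological T F \<and> cohomological T G \<and> psh_hom T F G \<phi> \<longrightarrow>
        mor_eq T (Fo P F) (mor_comp (\<tau> G) (Fm P F G \<phi>)) (mor_comp (Fm Q F G \<phi>) (\<tau> F)))"

definition exact_at ::
  "('o, 'm) tcat \<Rightarrow> ('o, 'm, 'g, 'h) cohfun \<Rightarrow> ('o, 'm, 'g, 'k) cohfun \<Rightarrow> ('o, 'm, 'g, 'l) cohfun \<Rightarrow>
     (('o, 'm, 'g) psh \<Rightarrow> 'o \<Rightarrow> 'h \<Rightarrow> 'k) \<Rightarrow> (('o, 'm, 'g) psh \<Rightarrow> 'o \<Rightarrow> 'k \<Rightarrow> 'l) \<Rightarrow> bool" where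
  "exact_at T P Q R \<sigma> \<tau> \<longleftrightarrow>
     (\<forall>F. cohomological T F \<longrightarrow> (\<forall>X \<in> Obj T.
        \<sigma> F X ` carrier (Ev (Fo P F) X) = kernel (Ev (Fo Q F) X) (Ev (Fo R F) X) (\<tau> F X)))"

definition canon_pair ::
  "('o, 'm) tcat \<Rightarrow> 'o set \<Rightarrow> 'o set \<Rightarrow> ('o, 'm, 'g) psh \<Rightarrow> 'o \<Rightarrow> 'g \<Rightarrow> 'g \<times> 'g" where
  "canon_pair T \<U> \<V> F X a = (canon T (\<U> \<inter> \<V>) \<U> F X a, canon T (\<U> \<inter> \<V>) \<V> F X a)"

text \<open>
  The Mayer--Vietoris sequence: with \<open>M = L\<^sub>\<U>\<^sub>\<and>\<^sub>\<V>\<close>, \<open>D = L\<^sub>\<U> \<oplus> L\<^sub>\<V>\<close>, \<open>J = L\<^sub>\<U>\<^sub>\<or>\<^sub>\<V>\<close> and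
  \<open>\<alpha> : M \<rightarrow> D\<close> induced by the inclusions, it runs through
  \<open>\<Sigma>\<^sup>n M \<rightarrow> \<Sigma>\<^sup>n D \<rightarrow> \<Sigma>\<^sup>n J \<rightarrow> \<Sigma>\<^sup>n\<^sup>+\<^sup>1 M\<close> for all integers \<open>n\<close>, with maps \<open>\<Sigma>\<^sup>n \<alpha>\<close>, \<open>\<Sigma>\<^sup>n \<beta>\<close>, \<open>\<gamma> n\<close>.
  The connecting maps are given degree by degree because \<open>\<Sigma>\<close> is only an equivalence, so that
  \<open>\<Sigma>\<^sup>n \<Sigma>\<close> and \<open>\<Sigma>\<^sup>n\<^sup>+\<^sup>1\<close> need not be equal for negative \<open>n\<close>.
\<close>

definition mayer_vietoris ::
  "('o, 'm) tcat \<Rightarrow> 'o set \<Rightarrow> 'o set \<Rightarrow>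
     (('o, 'm, 'g) psh \<Rightarrow> 'o \<Rightarrow> 'g \<times> 'g \<Rightarrow> 'g) \<Rightarrow>
     (int \<Rightarrow> ('o, 'm, 'g) psh \<Rightarrow> 'o \<Rightarrow> 'g \<Rightarrow> 'g) \<Rightarrow> bool" where
  "mayer_vietoris T \<U> \<V> \<beta> \<gamma> \<longleftrightarrow>
     (let M = Lfun T (\<U> \<inter> \<V>);
          D = dsum (Lfun T \<U>) (Lfun T \<V>);
          J = Lfun T (thick_hull T (\<U> \<union> \<V>));
          \<alpha> = canon_pair T \<U> \<V>
      in nat_trans T M D \<alpha> \<and> nat_trans T D J \<beta> \<and>
         (\<forall>n. nat_trans T (susp T n J) (susp T (n + 1) M) (\<gamma> n)) \<and>
         (\<forall>n. exact_at T (susp T n M) (susp T n D) (susp T n J)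
                (susp_trans T n \<alpha>) (susp_trans T n \<beta>)) \<and>
         (\<forall>n. exact_at T (susp T n D) (susp T n J) (susp T (n + 1) M)
                (susp_trans T n \<beta>) (\<gamma> n)) \<and>
         (\<forall>n. exact_at T (susp T n J) (susp T (n + 1) M) (susp T (n + 1) D)
                (\<gamma> n) (susp_trans T (n + 1) \<alpha>)))"

end

(*
  Fix a thick subcategory V and a thick D contained in V. The objects all of whose maps to and from
  V factor through D form a thick subcategory: in a triangle, a map that factors through D is
  corrected by a map from or to the third term, and the defect factors through D again. Applied to
  joins of subcategories commuting with V, this gives both that the central subcategories are closed
  under arbitrary joins and that they satisfy the frame law.
  The frame is spatial since a central subcategory that is maximal among those avoiding a given
  object X is prime: a union of a chain avoids X whenever all its members do, and if neither A nor B
  is contained in P, then X lies in (P \<or> A) \<inter> (P \<or> B) = P \<or> (A \<inter> B).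

  For a cohomological F write M, P, N, J for its localizations at U \<inter> V, U, V and U \<or> V. Both
  M -> P and N -> J are localizations at U. For commuting U and V every map with cone in
  U \<or> V is refined by a map with cone in V followed by one with cone in U, and M -> N is an
  isomorphism on the objects of U. The latter yields the connecting map: an element of J(\<Sigma>Z)
  lifts to N(X) after restriction along the last map of a triangle Z -> C -> X -> \<Sigma>Z with C in U;
  its restriction to N(C) = M(C) is then restricted to Z.
*)
theory Submission imports Defs begin

section \<open>Triangulated categories\<close>

text \<open>The functors L_S are given through a left adjoint picked by \<open>SOME\<close>, so
  nothing about them can be computed directly. The predicate \<open>localization\<close> replaces
  it: a cohomological functor under F that inverts the maps with cone in S, whose elements come from
  F after restriction along such a map, and in which an element of F vanishes only if such a
  restriction kills it. The model made of fractions takes values in sets of pairs and not in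
  \<open>'g\<close>; a cardinality count moves it into \<open>'g\<close>, and this is where
  essential smallness and infinity of \<open>'g\<close> enter. Uniqueness of adjoints then passes
  the criterion on to the chosen adjoint.

  Cones in T are not functorial, so the connecting map involves choices. It is described as a
  relation; totality, multiplicativity and triviality over 1 make it the graph of a homomorphism,
  and naturality becomes transport of the relation.

  In the second half, commutation enters at two places: to exchange a V-map and a U-map
  (\<open>swap\<close>), and to refine a V-map into an object of U by a map with cone in U \<inter>
  V (\<open>refine_Int\<close>).\<close>

lemma Hom_iff: "f \<in> Hom T X Y \<longleftrightarrow> f \<in> Arr T \<and> Dom T f = X \<and> Cod T f = Y"
  by (simp add: Hom_def)

section \<open>Composition, isomorphisms and cancellation\<close>

context category begin

lemma dom_obj [simp]: "f \<in> Arr T \<Longrightarrow> Dom T f \<in> Obj T"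
  and cod_obj [simp]: "f \<in> Arr T \<Longrightarrow> Cod T f \<in> Obj T"
  using dom_cod by auto

lemma idn_simps [simp]:
  assumes "X \<in> Obj T"
  shows "Idn T X \<in> Arr T" "Dom T (Idn T X) = X" "Cod T (Idn T X) = X"
  using idn[OF assms] by (auto simp: Hom_iff)

lemma cmp_simps [simp]:
  assumes "f \<in> Arr T" "g \<in> Arr T" "Cod T f = Dom T g"
  shows "g \<cdot> f \<in> Arr T" "Dom T (g \<cdot> f) = Dom T f" "Cod T (g \<cdot> f) = Cod T g"
  using cmp[of f "Dom T f" "Cod T f" g "Cod T g"] assms by (auto simp: Hom_iff)

lemma cmp_assoc [simp]:
  assumes "f \<in> Arr T" "g \<in> Arr T" "h \<in> Arr T" "Cod T f = Dom T g" "Cod T g = Dom T h"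
  shows "(h \<cdot> g) \<cdot> f = h \<cdot> (g \<cdot> f)"
  using assoc[of f "Dom T f" "Cod T f" g "Cod T g" h "Cod T h"] assms by (auto simp: Hom_iff)

lemma idn_cmp [simp]: "f \<in> Arr T \<Longrightarrow> Cod T f = Y \<Longrightarrow> Idn T Y \<cdot> f = f"
  using idn_left[of f "Dom T f" Y] by (auto simp: Hom_iff)

lemma cmp_idn [simp]: "f \<in> Arr T \<Longrightarrow> Dom T f = X \<Longrightarrow> f \<cdot> Idn T X = f"
  using idn_right[of f X "Cod T f"] by (auto simp: Hom_iff)

text \<open>Composites are kept nested to the right, where an equation between two-fold composites
  no longer matches; this form carries one more factor on the right. \<open>cmp_reduce1\<close> is
  the variant with a single arrow on one side.\<close>

lemma cmp_reduce:
  assumes "h \<cdot> g = h' \<cdot> g'" "f \<in> Arr T" "g \<in> Arr T" "h \<in> Arr T" "g' \<in> Arr T" "h' \<in> Arr T"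
    "Cod T f = Dom T g" "Cod T g = Dom T h" "Cod T f = Dom T g'" "Cod T g' = Dom T h'"
  shows "h \<cdot> (g \<cdot> f) = h' \<cdot> (g' \<cdot> f)"
  using assms cmp_assoc by metis

lemma cmp_reduce1:
  assumes "h \<cdot> g = k" "f \<in> Arr T" "g \<in> Arr T" "h \<in> Arr T" "Cod T f = Dom T g" "Cod T g = Dom T h"
  shows "h \<cdot> (g \<cdot> f) = k \<cdot> f"
  using assms cmp_assoc by metis

lemma iso_arrE:
  assumes "iso_arr T f"
  obtains g where "f \<in> Arr T" "g \<in> Arr T" "Dom T g = Cod T f" "Cod T g = Dom T f"
    "g \<cdot> f = Idn T (Dom T f)" "f \<cdot> g = Idn T (Cod T f)"
  using assms by (auto simp: iso_arr_def Hom_iff)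

lemma iso_arrI:
  assumes "f \<in> Arr T" "g \<in> Arr T" "Dom T g = Cod T f" "Cod T g = Dom T f"
    "g \<cdot> f = Idn T (Dom T f)" "f \<cdot> g = Idn T (Cod T f)"
  shows "iso_arr T f"
  using assms by (auto simp: iso_arr_def Hom_iff)

lemma iso_idn: "X \<in> Obj T \<Longrightarrow> iso_arr T (Idn T X)"
  by (rule iso_arrI[where g = "Idn T X"]) auto

lemma iso_monic:
  assumes "iso_arr T e" "f \<in> Arr T" "g \<in> Arr T" "Cod T f = Dom T e" "Cod T g = Dom T e" "e \<cdot> f = e \<cdot> g"
  shows "f = g"
proof -
  obtain i where i: "e \<in> Arr T" "i \<in> Arr T" "Dom T i = Cod T e" "Cod T i = Dom T e" "i \<cdot> e = Idn T (Dom T e)"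
    using iso_arrE[OF assms(1)] by metis
  have "f = i \<cdot> (e \<cdot> f)" using i assms(1-5) by (simp add: cmp_reduce1[OF i(5)])
  also have "\<dots> = i \<cdot> (e \<cdot> g)" using assms by simp
  also have "\<dots> = g" using i assms(1-5) by (simp add: cmp_reduce1[OF i(5)])
  finally show ?thesis .
qed

lemma iso_epic:
  assumes "iso_arr T e" "f \<in> Arr T" "g \<in> Arr T" "Dom T f = Cod T e" "Dom T g = Cod T e" "f \<cdot> e = g \<cdot> e"
  shows "f = g"
proof -
  obtain i where i: "e \<in> Arr T" "i \<in> Arr T" "Dom T i = Cod T e" "Cod T i = Dom T e" "e \<cdot> i = Idn T (Cod T e)"
    using iso_arrE[OF assms(1)] by metis
  have "f = (f \<cdot> e) \<cdot> i" using i assms(1-5) by simp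
  also have "\<dots> = (g \<cdot> e) \<cdot> i" by (simp only: assms(6))
  also have "\<dots> = g" using i assms(1-5) by simp
  finally show ?thesis .
qed

lemma isomorphicI: "f \<in> Hom T X Y \<Longrightarrow> iso_arr T f \<Longrightarrow> isomorphic T X Y"
  by (auto simp: isomorphic_def)

lemma isomorphic_sym:
  assumes "isomorphic T X Y" shows "isomorphic T Y X"
proof -
  obtain f where f: "f \<in> Hom T X Y" "iso_arr T f" using assms by (auto simp: isomorphic_def)
  obtain g where "f \<in> Arr T" "g \<in> Arr T" "Dom T g = Cod T f" "Cod T g = Dom T f"
    "g \<cdot> f = Idn T (Dom T f)" "f \<cdot> g = Idn T (Cod T f)" by (rule iso_arrE[OF f(2)]) blast
  then show ?thesis using f by (intro isomorphicI[of g] iso_arrI[of g f]) (auto simp: Hom_iff)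
qed

end

section \<open>Addition of arrows and zero objects\<close>

context additive_category begin

lemma
  assumes "f \<in> Arr T" "g \<in> Arr T" "Dom T f = Dom T g" "Cod T f = Cod T g"
  shows add_arr [simp]: "Add T f g \<in> Arr T" and dom_add [simp]: "Dom T (Add T f g) = Dom T g"
    and cod_add [simp]: "Cod T (Add T f g) = Cod T g" and add_comm: "Add T f g = Add T g f"
proof -
  interpret comm_group "Homgrp T (Dom T g) (Cod T g)" using assms by (simp add: hom_group)
  have "f \<in> carrier (Homgrp T (Dom T g) (Cod T g))" "g \<in> carrier (Homgrp T (Dom T g) (Cod T g))"
    using assms by (auto simp: Homgrp_def Hom_iff)
  from m_closed[OF this] m_comm[OF this]
  show "Add T f g \<in> Arr T" "Dom T (Add T f g) = Dom T g" "Cod T (Add T f g) = Cod T g"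
    "Add T f g = Add T g f"
    by (auto simp: Homgrp_def Hom_iff)
qed

lemma add_assoc:
  assumes "f \<in> Arr T" "g \<in> Arr T" "h \<in> Arr T" "Dom T f = Dom T h" "Cod T f = Cod T h"
    "Dom T g = Dom T h" "Cod T g = Cod T h"
  shows "Add T (Add T f g) h = Add T f (Add T g h)"
proof -
  interpret comm_group "Homgrp T (Dom T h) (Cod T h)" using assms by (simp add: hom_group)
  show ?thesis using m_assoc[of f g h] assms by (auto simp: Homgrp_def Hom_iff)
qed

lemma
  assumes "X \<in> Obj T" "Y \<in> Obj T"
  shows nul_arr [simp]: "Nul T X Y \<in> Arr T" and dom_nul [simp]: "Dom T (Nul T X Y) = X"
    and cod_nul [simp]: "Cod T (Nul T X Y) = Y"
proof -
  interpret comm_group "Homgrp T X Y" using assms by (simp add: hom_group)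
  show "Nul T X Y \<in> Arr T" "Dom T (Nul T X Y) = X" "Cod T (Nul T X Y) = Y"
    using one_closed by (auto simp: Homgrp_def Hom_iff)
qed

lemma
  assumes "f \<in> Arr T" "Dom T f = X" "Cod T f = Y"
  shows add_nul_left [simp]: "Add T (Nul T X Y) f = f"
    and add_nul_right [simp]: "Add T f (Nul T X Y) = f"
    and neg_aux: "Neg T f \<in> Arr T" "Dom T (Neg T f) = X" "Cod T (Neg T f) = Y"
      "Add T (Neg T f) f = Nul T X Y" "Add T f (Neg T f) = Nul T X Y" "Neg T (Neg T f) = f"
proof -
  interpret comm_group "Homgrp T X Y" using assms by (auto simp: hom_group)
  have f: "f \<in> carrier (Homgrp T X Y)" using assms by (auto simp: Homgrp_def Hom_iff)
  have N: "Neg T f = inv\<^bsub>Homgrp T X Y\<^esub> f" by (simp add: Neg_def assms)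
  show "Add T (Nul T X Y) f = f" "Add T f (Nul T X Y) = f" using l_one[OF f] r_one[OF f]
    by (auto simp: Homgrp_def)
  have n: "Neg T f \<in> carrier (Homgrp T X Y)" using f N by simp
  then show a: "Neg T f \<in> Arr T" "Dom T (Neg T f) = X" "Cod T (Neg T f) = Y"
    by (auto simp: Homgrp_def Hom_iff)
  show "Add T (Neg T f) f = Nul T X Y" "Add T f (Neg T f) = Nul T X Y"
    using l_inv[OF f] r_inv[OF f] unfolding N[symmetric] by (auto simp: Homgrp_def)
  have "Neg T (Neg T f) = inv\<^bsub>Homgrp T X Y\<^esub> (Neg T f)" by (simp add: Neg_def[of T "Neg T f"] a)
  then show "Neg T (Neg T f) = f" using f by (simp add: N)
qed

lemma
  assumes "f \<in> Arr T"
  shows neg_arr [simp]: "Neg T f \<in> Arr T" and dom_neg [simp]: "Dom T (Neg T f) = Dom T f"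
    and cod_neg [simp]: "Cod T (Neg T f) = Cod T f"
    and add_neg_left [simp]: "Add T (Neg T f) f = Nul T (Dom T f) (Cod T f)"
    and add_neg_right [simp]: "Add T f (Neg T f) = Nul T (Dom T f) (Cod T f)"
    and neg_neg [simp]: "Neg T (Neg T f) = f"
  using neg_aux[OF assms refl refl] by auto

lemma neg_unique:
  assumes "f \<in> Arr T" "g \<in> Arr T" "Dom T f = Dom T g" "Cod T f = Cod T g"
    "Add T f g = Nul T (Dom T g) (Cod T g)"
  shows "f = Neg T g"
proof -
  have "f = Add T f (Add T g (Neg T g))" using assms by simp
  also have "\<dots> = Add T (Add T f g) (Neg T g)" using assms(1-4) by (simp add: add_assoc)
  also have "\<dots> = Neg T g" using assms by simp
  finally show ?thesis .
qed

text \<open>Add \<open>Neg T f\<close>. An additive operation sends \<open>Nul\<close> to an arrow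
  equal to its own double, so this is how composition and suspension are seen to preserve
  zero.\<close>

lemma idem_nul:
  assumes "f \<in> Arr T" "Add T f f = f" shows "f = Nul T (Dom T f) (Cod T f)"
proof -
  have "f = Add T (Add T f f) (Neg T f)" using assms(1) by (simp add: add_assoc)
  also have "\<dots> = Nul T (Dom T f) (Cod T f)" using assms by simp
  finally show ?thesis .
qed

lemma cmp_add:
  assumes "f \<in> Arr T" "f' \<in> Arr T" "g \<in> Arr T" "Dom T f = Dom T f'" "Cod T f = Dom T g" "Cod T f' = Dom T g"
  shows "g \<cdot> Add T f f' = Add T (g \<cdot> f) (g \<cdot> f')"
  using distrib_left[of f "Dom T f" "Cod T f" f' g "Cod T g"] assms by (auto simp: Hom_iff)

lemma add_cmp:
  assumes "f \<in> Arr T" "g \<in> Arr T" "g' \<in> Arr T" "Dom T g = Cod T f" "Dom T g' = Cod T f" "Cod T g = Cod T g'"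
  shows "Add T g g' \<cdot> f = Add T (g \<cdot> f) (g' \<cdot> f)"
  using distrib_right[of f "Dom T f" "Cod T f" g "Cod T g" g'] assms by (auto simp: Hom_iff)

lemma cmp_nul [simp]:
  assumes "g \<in> Arr T" "X \<in> Obj T" "Dom T g = Y" shows "g \<cdot> Nul T X Y = Nul T X (Cod T g)"
proof -
  have Y: "Y \<in> Obj T" using assms dom_obj by blast
  have "Add T (g \<cdot> Nul T X Y) (g \<cdot> Nul T X Y) = g \<cdot> Add T (Nul T X Y) (Nul T X Y)"
    using assms Y by (intro cmp_add[symmetric]) auto
  also have "\<dots> = g \<cdot> Nul T X Y" using assms Y by simp
  finally show ?thesis using idem_nul[of "g \<cdot> Nul T X Y"] assms Y by simp
qed

lemma nul_cmp [simp]: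
  assumes "f \<in> Arr T" "Z \<in> Obj T" "Cod T f = Y" shows "Nul T Y Z \<cdot> f = Nul T (Dom T f) Z"
proof -
  have Y: "Y \<in> Obj T" using assms cod_obj by blast
  have "Add T (Nul T Y Z \<cdot> f) (Nul T Y Z \<cdot> f) = Add T (Nul T Y Z) (Nul T Y Z) \<cdot> f"
    using assms Y by (intro add_cmp[symmetric]) auto
  also have "\<dots> = Nul T Y Z \<cdot> f" using assms Y by simp
  finally show ?thesis using idem_nul[of "Nul T Y Z \<cdot> f"] assms Y by simp
qed

lemma neg_cmp [simp]:
  assumes "f \<in> Arr T" "g \<in> Arr T" "Cod T f = Dom T g"
  shows "Neg T g \<cdot> f = Neg T (g \<cdot> f)"
  by (rule neg_unique) (use assms in \<open>auto simp: add_cmp[symmetric]\<close>)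

lemma cmp_neg [simp]:
  assumes "f \<in> Arr T" "g \<in> Arr T" "Cod T f = Dom T g"
  shows "g \<cdot> Neg T f = Neg T (g \<cdot> f)"
  by (rule neg_unique) (use assms in \<open>auto simp: cmp_add[symmetric]\<close>)

lemma neg_nul [simp]: "X \<in> Obj T \<Longrightarrow> Y \<in> Obj T \<Longrightarrow> Neg T (Nul T X Y) = Nul T X Y"
  by (rule neg_unique[symmetric]) auto

lemma diff_nul_eq:
  assumes "f \<in> Arr T" "g \<in> Arr T" "Dom T f = Dom T g" "Cod T f = Cod T g"
    "Add T f (Neg T g) = Nul T (Dom T g) (Cod T g)"
  shows "f = g"
  using neg_unique[of f "Neg T g"] assms by simp

lemma neg_inj:
  assumes "f \<in> Arr T" "g \<in> Arr T" "Neg T f = Neg T g" shows "f = g"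
  using assms neg_neg by metis

lemma zero_objectD:
  assumes "zero_object T Z" "f \<in> Arr T" "g \<in> Arr T"
  shows "Dom T f = Z \<Longrightarrow> Dom T g = Z \<Longrightarrow> Cod T f = Cod T g \<Longrightarrow> f = g"
    "Cod T f = Z \<Longrightarrow> Cod T g = Z \<Longrightarrow> Dom T f = Dom T g \<Longrightarrow> f = g"
proof -
  show "f = g" if "Dom T f = Z" "Dom T g = Z" "Cod T f = Cod T g"
  proof -
    have "\<exists>!k. k \<in> Hom T Z (Cod T g)" using assms by (auto simp: zero_object_def)
    then show ?thesis using that assms by (auto simp: Hom_iff)
  qed
  show "f = g" if "Cod T f = Z" "Cod T g = Z" "Dom T f = Dom T g"
  proof -
    have "\<exists>!k. k \<in> Hom T (Dom T g) Z" using assms by (auto simp: zero_object_def)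
    then show ?thesis using that assms by (auto simp: Hom_iff)
  qed
qed

lemma zero_object_iff: "zero_object T Z \<longleftrightarrow> Z \<in> Obj T \<and> Idn T Z = Nul T Z Z"
proof
  assume z: "zero_object T Z"
  then have "Z \<in> Obj T" by (simp add: zero_object_def)
  then show "Z \<in> Obj T \<and> Idn T Z = Nul T Z Z" using zero_objectD(1)[OF z, of "Idn T Z" "Nul T Z Z"] by simp
next
  assume z: "Z \<in> Obj T \<and> Idn T Z = Nul T Z Z"
  show "zero_object T Z" unfolding zero_object_def
  proof (intro conjI ballI)
    show "Z \<in> Obj T" using z by simp
    fix X assume X: "X \<in> Obj T"
    have "f = Nul T Z X" if "f \<in> Hom T Z X" for f
    proof -
      have "f = f \<cdot> Idn T Z" using that by (simp add: Hom_iff)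
      then show ?thesis using that z by (auto simp: Hom_iff)
    qed
    then show "\<exists>!f. f \<in> Hom T Z X" using X z by (intro ex1I[of _ "Nul T Z X"]) (auto simp: Hom_iff)
    have "f = Nul T X Z" if "f \<in> Hom T X Z" for f
    proof -
      have "f = Idn T Z \<cdot> f" using that by (simp add: Hom_iff)
      then show ?thesis using that z by (auto simp: Hom_iff)
    qed
    then show "\<exists>!f. f \<in> Hom T X Z" using X z by (intro ex1I[of _ "Nul T X Z"]) (auto simp: Hom_iff)
  qed
qed

end

section \<open>The suspension as a fully faithful functor\<close>

context triangulated_category begin

lemma sho_obj [simp]: "X \<in> Obj T \<Longrightarrow> Sho T X \<in> Obj T"
  and sha_idn [simp]: "X \<in> Obj T \<Longrightarrow> Sha T (Idn T X) = Idn T (Sho T X)"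
  and usho_obj [simp]: "X \<in> Obj T \<Longrightarrow> Usho T X \<in> Obj T"
  and usha_idn [simp]: "X \<in> Obj T \<Longrightarrow> Usha T (Idn T X) = Idn T (Usho T X)"
  using suspension desuspension by (auto simp: endofunctor_def)

lemma
  assumes "f \<in> Arr T"
  shows sha_arr [simp]: "Sha T f \<in> Arr T" and dom_sha [simp]: "Dom T (Sha T f) = Sho T (Dom T f)"
    and cod_sha [simp]: "Cod T (Sha T f) = Sho T (Cod T f)"
    and usha_arr [simp]: "Usha T f \<in> Arr T" and dom_usha [simp]: "Dom T (Usha T f) = Usho T (Dom T f)"
    and cod_usha [simp]: "Cod T (Usha T f) = Usho T (Cod T f)"
  using suspension desuspension assms by (auto simp: endofunctor_def Hom_iff)

lemma
  assumes "f \<in> Arr T" "g \<in> Arr T" "Cod T f = Dom T g"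
  shows sha_cmp: "Sha T (g \<cdot> f) = Sha T g \<cdot> Sha T f"
    and usha_cmp: "Usha T (g \<cdot> f) = Usha T g \<cdot> Usha T f"
  using suspension desuspension assms by (auto simp: endofunctor_def)

lemma sha_add:
  assumes "f \<in> Arr T" "g \<in> Arr T" "Dom T f = Dom T g" "Cod T f = Cod T g"
  shows "Sha T (Add T f g) = Add T (Sha T f) (Sha T g)"
  using suspension_add[of f "Dom T f" "Cod T f" g] assms by (auto simp: Hom_iff)

lemma sha_nul [simp]:
  assumes "X \<in> Obj T" "Y \<in> Obj T"
  shows "Sha T (Nul T X Y) = Nul T (Sho T X) (Sho T Y)"
proof -
  have "Add T (Sha T (Nul T X Y)) (Sha T (Nul T X Y)) = Sha T (Nul T X Y)"
    using assms by (simp add: sha_add[symmetric])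
  then show ?thesis using idem_nul[of "Sha T (Nul T X Y)"] assms by simp
qed

lemma sha_neg [simp]: "f \<in> Arr T \<Longrightarrow> Sha T (Neg T f) = Neg T (Sha T f)"
  by (rule neg_unique) (auto simp: sha_add[symmetric])

lemma counitE:
  obtains e where "\<And>X. X \<in> Obj T \<Longrightarrow> e X \<in> Arr T \<and> Dom T (e X) = X \<and> Cod T (e X) = Sho T (Usho T X) \<and> iso_arr T (e X)"
    "\<And>f. f \<in> Arr T \<Longrightarrow> Sha T (Usha T f) \<cdot> e (Dom T f) = e (Cod T f) \<cdot> f"
proof -
  obtain e where "\<forall>X \<in> Obj T. e X \<in> Hom T X (Sho T (Usho T X)) \<and> iso_arr T (e X)"
    "\<forall>f \<in> Arr T. Sha T (Usha T f) \<cdot> e (Dom T f) = e (Cod T f) \<cdot> f"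
    using suspension_equiv(1) unfolding iso_to_identity_def o_apply by blast
  then show ?thesis by (intro that[of e]) (simp_all add: Hom_iff)
qed

lemma unitE:
  obtains e where "\<And>X. X \<in> Obj T \<Longrightarrow> e X \<in> Arr T \<and> Dom T (e X) = X \<and> Cod T (e X) = Usho T (Sho T X) \<and> iso_arr T (e X)"
    "\<And>f. f \<in> Arr T \<Longrightarrow> Usha T (Sha T f) \<cdot> e (Dom T f) = e (Cod T f) \<cdot> f"
proof -
  obtain e where "\<forall>X \<in> Obj T. e X \<in> Hom T X (Usho T (Sho T X)) \<and> iso_arr T (e X)"
    "\<forall>f \<in> Arr T. Usha T (Sha T f) \<cdot> e (Dom T f) = e (Cod T f) \<cdot> f"
    using suspension_equiv(2) unfolding iso_to_identity_def o_apply by blast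
  then show ?thesis by (intro that[of e]) (simp_all add: Hom_iff)
qed

text \<open>Apply \<open>Usha\<close> and cancel the natural isomorphism between the identity and
  \<open>Usha\<close> after \<open>Sha\<close>.\<close>

lemma sha_faithful:
  assumes "f \<in> Arr T" "g \<in> Arr T" "Dom T f = Dom T g" "Cod T f = Cod T g" "Sha T f = Sha T g"
  shows "f = g"
proof -
  obtain e where e: "\<And>X. X \<in> Obj T \<Longrightarrow> e X \<in> Arr T \<and> Dom T (e X) = X \<and> Cod T (e X) = Usho T (Sho T X) \<and> iso_arr T (e X)"
    "\<And>f. f \<in> Arr T \<Longrightarrow> Usha T (Sha T f) \<cdot> e (Dom T f) = e (Cod T f) \<cdot> f" by (rule unitE) blast
  show ?thesis by (rule iso_monic[of "e (Cod T f)"]) (use e(1) e(2)[of f] e(2)[of g] assms in auto)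
qed

lemma usha_faithful:
  assumes "f \<in> Arr T" "g \<in> Arr T" "Dom T f = Dom T g" "Cod T f = Cod T g" "Usha T f = Usha T g"
  shows "f = g"
proof -
  obtain e where e: "\<And>X. X \<in> Obj T \<Longrightarrow> e X \<in> Arr T \<and> Dom T (e X) = X \<and> Cod T (e X) = Sho T (Usho T X) \<and> iso_arr T (e X)"
    "\<And>f. f \<in> Arr T \<Longrightarrow> Sha T (Usha T f) \<cdot> e (Dom T f) = e (Cod T f) \<cdot> f" by (rule counitE) blast
  show ?thesis by (rule iso_monic[of "e (Cod T f)"]) (use e(1) e(2)[of f] e(2)[of g] assms in auto)
qed

text \<open>Conjugate \<open>Usha T h\<close> by the isomorphisms between X and
  \<open>Usho T (Sho T X)\<close>. The two natural isomorphisms of the equivalence are unrelated, so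
  \<open>Sha T f = h\<close> is not computed directly: both sides agree after \<open>Usha\<close>,
  which is faithful.\<close>

lemma sha_full:
  assumes "h \<in> Arr T" "Dom T h = Sho T X" "Cod T h = Sho T Y" "X \<in> Obj T" "Y \<in> Obj T"
  obtains f where "f \<in> Arr T" "Dom T f = X" "Cod T f = Y" "Sha T f = h"
proof -
  obtain e where e: "\<And>X. X \<in> Obj T \<Longrightarrow> e X \<in> Arr T \<and> Dom T (e X) = X \<and> Cod T (e X) = Usho T (Sho T X) \<and> iso_arr T (e X)"
    "\<And>f. f \<in> Arr T \<Longrightarrow> Usha T (Sha T f) \<cdot> e (Dom T f) = e (Cod T f) \<cdot> f" by (rule unitE) blast
  have "iso_arr T (e X)" "iso_arr T (e Y)" using e(1) assms by auto
  then obtain j where j: "j \<in> Arr T" "Dom T j = Usho T (Sho T Y)" "Cod T j = Y" "e Y \<cdot> j = Idn T (Usho T (Sho T Y))"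
    using e(1) assms(4,5) by (metis iso_arrE)
  define f where "f = j \<cdot> (Usha T h \<cdot> e X)"
  have f: "f \<in> Arr T" "Dom T f = X" "Cod T f = Y" using e(1)[OF assms(4)] assms j by (auto simp: f_def)
  have "Usha T (Sha T f) \<cdot> e X = e Y \<cdot> f" using e(2)[of f] f by simp
  also have "\<dots> = Usha T h \<cdot> e X"
    using e(1)[OF assms(4)] e(1)[OF assms(5)] assms j by (simp add: f_def cmp_reduce1[OF j(4)])
  finally have "Usha T (Sha T f) \<cdot> e X = Usha T h \<cdot> e X" .
  then have "Usha T (Sha T f) = Usha T h"
    using e(1)[OF assms(4)] assms f by - (rule iso_epic[of "e X"], auto)
  then have "Sha T f = h" using f assms by - (rule usha_faithful, auto)
  then show ?thesis using f that by blast
qed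

section \<open>Rotation, weak kernels and cokernels, and fill-ins of triangles\<close>

lemma tri_simps:
  assumes "(f, g, h) \<in> Tri T"
  shows "f \<in> Arr T" "g \<in> Arr T" "h \<in> Arr T" "Cod T f = Dom T g" "Cod T g = Dom T h" "Cod T h = Sho T (Dom T f)"
  using candidate[OF assms] by (auto simp: candidate_triangle_def)

lemma rotate: "(f, g, h) \<in> Tri T \<Longrightarrow> (g, h, Neg T (Sha T f)) \<in> Tri T"
  using TR2 candidate by blast

lemma coneE:
  assumes "f \<in> Arr T" obtains g h where "(f, g, h) \<in> Tri T"
  using TR1_cone assms by blast

text \<open>The third object need not be a suspension on the nose. It is replaced by the isomorphic
  \<Sigma>(\<open>Usho\<close> Z); fullness of \<Sigma> then writes the connecting arrow as
  \<Sigma>w up to sign, and \<open>TR2\<close> applies backwards.\<close>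

lemma rotate_back:
  assumes "(f, g, h) \<in> Tri T"
  obtains w e where "(w, f, e \<cdot> g) \<in> Tri T" "e \<in> Arr T" "iso_arr T e" "Dom T e = Cod T g"
    "Cod T e = Sho T (Usho T (Cod T g))" "w \<in> Arr T" "Dom T w = Usho T (Cod T g)" "Cod T w = Dom T f"
    "Sha T w \<cdot> e = Neg T h"
proof -
  note t = tri_simps[OF assms]
  obtain E where E: "\<And>X. X \<in> Obj T \<Longrightarrow> E X \<in> Arr T \<and> Dom T (E X) = X \<and> Cod T (E X) = Sho T (Usho T X) \<and> iso_arr T (E X)"
    by (rule counitE) blast
  define e where "e = E (Cod T g)"
  have e: "e \<in> Arr T" "Dom T e = Cod T g" "Cod T e = Sho T (Usho T (Cod T g))" "iso_arr T e"
    using E[of "Cod T g"] t by (auto simp: e_def)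
  obtain i where i: "i \<in> Arr T" "Dom T i = Cod T e" "Cod T i = Dom T e" "i \<cdot> e = Idn T (Dom T e)"
    by (rule iso_arrE[OF e(4)]) blast
  obtain w where w: "w \<in> Arr T" "Dom T w = Usho T (Cod T g)" "Cod T w = Dom T f" "Sha T w = Neg T (h \<cdot> i)"
    by (rule sha_full[of "Neg T (h \<cdot> i)" "Usho T (Cod T g)" "Dom T f"]) (use t e i in auto)
  have wh: "Sha T w \<cdot> e = Neg T h" using w t e i by simp
  have c: "candidate_triangle T (f, e \<cdot> g, Neg T (Sha T w))"
    using t e w(1-3) by (auto simp: candidate_triangle_def)
  have m: "triangle_mor T (f, g, h) (f, e \<cdot> g, Neg T (Sha T w)) (Idn T (Dom T f), Idn T (Cod T f), e)"
    using t e w(1-3) wh by (auto simp: triangle_mor_def Hom_iff)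
  have "(f, e \<cdot> g, Neg T (Sha T w)) \<in> Tri T"
    by (rule iso_closed[OF assms c]) (use m t e in \<open>auto simp: triangles_isomorphic_def intro!: iso_idn exI\<close>)
  moreover have "candidate_triangle T (w, f, e \<cdot> g)" using t e w by (auto simp: candidate_triangle_def)
  ultimately have "(w, f, e \<cdot> g) \<in> Tri T" using TR2 by blast
  then show ?thesis using that e w wh by blast
qed

lemma sho_zero: "zero_object T Z \<Longrightarrow> zero_object T (Sho T Z)"
  by (auto simp: zero_object_iff) (metis sha_idn sha_nul)

lemma zero_tri:
  assumes "zero_object T Z" "A \<in> Obj T"
  shows "(Idn T A, Nul T A Z, Nul T Z (Sho T A)) \<in> Tri T" "(Nul T Z A, Idn T A, Nul T A (Sho T Z)) \<in> Tri T"
    "(Nul T A Z, Nul T Z (Sho T A), Neg T (Idn T (Sho T A))) \<in> Tri T"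
proof -
  have Z: "Z \<in> Obj T" using assms zero_object_iff by blast
  show a: "(Idn T A, Nul T A Z, Nul T Z (Sho T A)) \<in> Tri T" using TR1_identity assms by blast
  have "(Idn T A, Nul T A (Sho T Z), Neg T (Sha T (Nul T Z A))) \<in> Tri T"
    using TR1_identity[OF assms(2) sho_zero[OF assms(1)]] assms Z by simp
  moreover have "candidate_triangle T (Nul T Z A, Idn T A, Nul T A (Sho T Z))"
    using Z assms by (auto simp: candidate_triangle_def)
  ultimately show "(Nul T Z A, Idn T A, Nul T A (Sho T Z)) \<in> Tri T" using TR2 by blast
  show "(Nul T A Z, Nul T Z (Sho T A), Neg T (Idn T (Sho T A))) \<in> Tri T" using rotate[OF a] assms by simp
qed

text \<open>Map the triangle to 0 -> B -> B -> \<Sigma>0, where B is the codomain of y;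
  \<open>TR3\<close> supplies the third component.\<close>

lemma weak_cokernel:
  assumes "(f, g, h) \<in> Tri T" "y \<in> Arr T" "Dom T y = Dom T g" "y \<cdot> f = Nul T (Dom T f) (Cod T y)"
  obtains x where "x \<in> Arr T" "Dom T x = Dom T h" "Cod T x = Cod T y" "x \<cdot> g = y"
proof -
  note t = tri_simps[OF assms(1)]
  obtain Z where z: "zero_object T Z" using zero_exists by blast
  then have Z: "Z \<in> Obj T" using zero_object_iff by blast
  have "\<exists>k. triangle_mor T (f, g, h) (Nul T Z (Cod T y), Idn T (Cod T y), Nul T (Cod T y) (Sho T Z)) (Nul T (Dom T f) Z, y, k)"
    by (rule TR3[OF assms(1) zero_tri(2)[OF z]]) (use assms t Z in \<open>auto simp: Hom_iff\<close>)
  then show ?thesis using that assms t Z by (auto simp: triangle_mor_def Hom_iff)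
qed

text \<open>Map A -> A -> 0 -> \<Sigma>A to the given triangle: the composite of its first two maps
  then passes through 0. The second equation is the first for the rotated triangle.\<close>

lemma tri_comp:
  assumes "(f, g, h) \<in> Tri T"
  shows "g \<cdot> f = Nul T (Dom T f) (Dom T h)" "h \<cdot> g = Nul T (Dom T g) (Cod T h)"
proof -
  have *: "g \<cdot> f = Nul T (Dom T f) (Dom T h)" if "(f, g, h) \<in> Tri T" for f g h
  proof -
    note t = tri_simps[OF that]
    obtain Z where z: "zero_object T Z" using zero_exists by blast
    then have Z: "Z \<in> Obj T" using zero_object_iff by blast
    have "\<exists>k. triangle_mor T (Idn T (Dom T f), Nul T (Dom T f) Z, Nul T Z (Sho T (Dom T f))) (f, g, h) (Idn T (Dom T f), f, k)"
      by (rule TR3[OF zero_tri(1)[OF z] that]) (use t Z in \<open>auto simp: Hom_iff\<close>)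
    then obtain k where k: "k \<in> Arr T" "Dom T k = Z" "Cod T k = Dom T h" "k \<cdot> Nul T (Dom T f) Z = g \<cdot> f"
      using t Z by (auto simp: triangle_mor_def Hom_iff)
    from k(4) show ?thesis using k(1,2,3) t by simp
  qed
  show "g \<cdot> f = Nul T (Dom T f) (Dom T h)" using * assms by blast
  show "h \<cdot> g = Nul T (Dom T g) (Cod T h)" using *[OF rotate[OF assms]] tri_simps[OF assms] by simp
qed

text \<open>\<open>TR3\<close> produces third components only, so the comparison is made between A
  -> 0 -> \<Sigma>A and the rotated triangle, and the resulting arrow between suspensions is
  desuspended.\<close>

lemma weak_kernel:
  assumes "(f, g, h) \<in> Tri T" "y \<in> Arr T" "Cod T y = Dom T g" "g \<cdot> y = Nul T (Dom T y) (Dom T h)"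
  obtains x where "x \<in> Arr T" "Dom T x = Dom T y" "Cod T x = Dom T f" "f \<cdot> x = y"
proof -
  note t = tri_simps[OF assms(1)]
  obtain Z where z: "zero_object T Z" using zero_exists by blast
  then have Z: "Z \<in> Obj T" using zero_object_iff by blast
  let ?A = "Dom T y"
  have "\<exists>k. triangle_mor T (Nul T ?A Z, Nul T Z (Sho T ?A), Neg T (Idn T (Sho T ?A))) (g, h, Neg T (Sha T f)) (y, Nul T Z (Dom T h), k)"
    by (rule TR3[OF zero_tri(3)[OF z] rotate[OF assms(1)]]) (use t Z assms in \<open>auto simp: Hom_iff\<close>)
  then obtain k where k: "k \<in> Arr T" "Dom T k = Sho T ?A" "Cod T k = Sho T (Dom T f)"
    "Sha T y \<cdot> Neg T (Idn T (Sho T ?A)) = Neg T (Sha T f) \<cdot> k"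
    using t Z assms by (auto simp: triangle_mor_def Hom_iff)
  have "Sha T y = Sha T f \<cdot> k" using k t assms by - (rule neg_inj, auto)
  moreover obtain x where x: "x \<in> Arr T" "Dom T x = ?A" "Cod T x = Dom T f" "Sha T x = k"
    by (rule sha_full[of k ?A "Dom T f"]) (use k t assms in auto)
  ultimately have "Sha T (f \<cdot> x) = Sha T y" using t by (simp add: sha_cmp)
  then have "f \<cdot> x = y" using t x assms by - (rule sha_faithful, auto)
  then show ?thesis using x that by blast
qed

text \<open>Rotate both triangles twice, apply \<open>TR3\<close> and desuspend; the signs cancel.
  \<open>tri_fill_first\<close> does the same with one rotation.\<close>

lemma tri_fill_mid:
  assumes "(f, g, h) \<in> Tri T" "(f', g', h') \<in> Tri T" "i \<in> Arr T" "Dom T i = Dom T f" "Cod T i = Dom T f'"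
    "k \<in> Arr T" "Dom T k = Dom T h" "Cod T k = Dom T h'" "Sha T i \<cdot> h = h' \<cdot> k"
  obtains j where "j \<in> Arr T" "Dom T j = Dom T g" "Cod T j = Dom T g'" "j \<cdot> f = f' \<cdot> i" "k \<cdot> g = g' \<cdot> j"
proof -
  note t = tri_simps[OF assms(1)] and t' = tri_simps[OF assms(2)]
  have "\<exists>l. triangle_mor T (h, Neg T (Sha T f), Neg T (Sha T g)) (h', Neg T (Sha T f'), Neg T (Sha T g')) (k, Sha T i, l)"
    by (rule TR3[OF rotate[OF rotate[OF assms(1)]] rotate[OF rotate[OF assms(2)]]])
      (use assms t t' in \<open>auto simp: Hom_iff\<close>)
  then obtain l where l: "l \<in> Arr T" "Dom T l = Sho T (Cod T f)" "Cod T l = Sho T (Cod T f')"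
    "l \<cdot> Neg T (Sha T f) = Neg T (Sha T f') \<cdot> Sha T i" "Sha T k \<cdot> Neg T (Sha T g) = Neg T (Sha T g') \<cdot> l"
    using t t' assms by (auto simp: triangle_mor_def Hom_iff)
  obtain j where j: "j \<in> Arr T" "Dom T j = Cod T f" "Cod T j = Cod T f'" "Sha T j = l"
    by (rule sha_full[of l "Cod T f" "Cod T f'"]) (use l t t' in auto)
  have "Sha T (j \<cdot> f) = Sha T (f' \<cdot> i)" using l j assms t t' by - (rule neg_inj, auto simp: sha_cmp)
  then have "j \<cdot> f = f' \<cdot> i" using j assms t t' by - (rule sha_faithful, auto)
  moreover have "Sha T (k \<cdot> g) = Sha T (g' \<cdot> j)" using l j assms t t' by - (rule neg_inj, auto simp: sha_cmp)
  then have "k \<cdot> g = g' \<cdot> j" using j assms t t' by - (rule sha_faithful, auto)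
  ultimately show ?thesis using that j t t' by auto
qed

lemma tri_fill_last:
  assumes "(f, g, h) \<in> Tri T" "(f', g', h') \<in> Tri T" "i \<in> Arr T" "Dom T i = Dom T f" "Cod T i = Dom T f'"
    "j \<in> Arr T" "Dom T j = Dom T g" "Cod T j = Dom T g'" "j \<cdot> f = f' \<cdot> i"
  obtains k where "k \<in> Arr T" "Dom T k = Dom T h" "Cod T k = Dom T h'" "k \<cdot> g = g' \<cdot> j" "Sha T i \<cdot> h = h' \<cdot> k"
  using TR3[OF assms(1,2), of i j] assms by (auto simp: triangle_mor_def Hom_iff)

lemma tri_fill_first:
  assumes "(f, g, h) \<in> Tri T" "(f', g', h') \<in> Tri T" "j \<in> Arr T" "Dom T j = Dom T g" "Cod T j = Dom T g'"
    "k \<in> Arr T" "Dom T k = Dom T h" "Cod T k = Dom T h'" "k \<cdot> g = g' \<cdot> j"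
  obtains i where "i \<in> Arr T" "Dom T i = Dom T f" "Cod T i = Dom T f'" "j \<cdot> f = f' \<cdot> i" "Sha T i \<cdot> h = h' \<cdot> k"
proof -
  note t = tri_simps[OF assms(1)] and t' = tri_simps[OF assms(2)]
  have "\<exists>l. triangle_mor T (g, h, Neg T (Sha T f)) (g', h', Neg T (Sha T f')) (j, k, l)"
    by (rule TR3[OF rotate[OF assms(1)] rotate[OF assms(2)]])
      (use assms t t' in \<open>auto simp: Hom_iff\<close>)
  then obtain l where l: "l \<in> Arr T" "Dom T l = Sho T (Dom T f)" "Cod T l = Sho T (Dom T f')"
    "l \<cdot> h = h' \<cdot> k" "Sha T j \<cdot> Neg T (Sha T f) = Neg T (Sha T f') \<cdot> l"
    using t t' assms by (auto simp: triangle_mor_def Hom_iff)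
  obtain i where i: "i \<in> Arr T" "Dom T i = Dom T f" "Cod T i = Dom T f'" "Sha T i = l"
    by (rule sha_full[of l "Dom T f" "Dom T f'"]) (use l t t' in auto)
  have "Sha T (j \<cdot> f) = Sha T (f' \<cdot> i)" using l i assms t t' by - (rule neg_inj, auto simp: sha_cmp)
  then have "j \<cdot> f = f' \<cdot> i" using i assms t t' by - (rule sha_faithful, auto)
  then show ?thesis using that i l by blast
qed

end

section \<open>Thick subcategories\<close>

context triangulated_category begin

text \<open>The composite of h with \<Sigma>i is zero and \<Sigma>i has a retraction, so h = 0 and g
  has a section j. Subtracting i p j makes the section invisible to p. The defect of i p + j g from
  the identity factors through i because g kills it, and it is killed by p as well, so it
  vanishes.\<close>

lemma split_triangle:
  assumes "(i, g, h) \<in> Tri T" "p \<in> Arr T" "Dom T p = Dom T g" "Cod T p = Dom T i" "p \<cdot> i = Idn T (Dom T i)"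
  obtains j where "j \<in> Arr T" "Dom T j = Cod T g" "Cod T j = Dom T g" "g \<cdot> j = Idn T (Cod T g)"
    "p \<cdot> j = Nul T (Cod T g) (Dom T i)" "Add T (i \<cdot> p) (j \<cdot> g) = Idn T (Dom T g)"
proof -
  note t = tri_simps[OF assms(1)]
  have "Sha T i \<cdot> h = Nul T (Dom T h) (Sho T (Cod T i))"
    using tri_comp(2)[OF rotate[OF assms(1)]] t neg_inj[of "Sha T i \<cdot> h" "Nul T (Dom T h) (Sho T (Cod T i))"] by simp
  then have "Sha T p \<cdot> (Sha T i \<cdot> h) = Nul T (Dom T h) (Sho T (Dom T i))" using t assms by simp
  moreover have "Sha T p \<cdot> (Sha T i \<cdot> h) = Sha T (p \<cdot> i) \<cdot> h" using t assms(2-4) by (simp add: sha_cmp)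
  ultimately have h: "h = Nul T (Dom T h) (Sho T (Dom T i))" using t assms by simp
  have "h \<cdot> Idn T (Cod T g) = Nul T (Dom T (Idn T (Cod T g))) (Dom T (Neg T (Sha T i)))" using h t by simp
  then obtain j where j: "j \<in> Arr T" "Dom T j = Cod T g" "Cod T j = Dom T g" "g \<cdot> j = Idn T (Cod T g)"
    by (rule weak_kernel[OF rotate[OF assms(1)], rotated 2]) (use t in auto)
  define j' where "j' = Add T j (Neg T (i \<cdot> (p \<cdot> j)))"
  have gi: "g \<cdot> i = Nul T (Dom T i) (Dom T h)" using tri_comp[OF assms(1)] by simp
  have j': "j' \<in> Arr T" "Dom T j' = Cod T g" "Cod T j' = Dom T g" using j t assms by (auto simp: j'_def)
  have gj': "g \<cdot> j' = Idn T (Cod T g)"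
    using j t assms(2-4) by (simp add: j'_def cmp_add cmp_reduce1[OF gi])
  have pj': "p \<cdot> j' = Nul T (Cod T g) (Dom T i)"
    using j t assms(2-4) by (simp add: j'_def cmp_add cmp_reduce1[OF assms(5)])
  let ?d = "Add T (Idn T (Dom T g)) (Neg T (Add T (i \<cdot> p) (j' \<cdot> g)))"
  have d: "?d \<in> Arr T" "Dom T ?d = Dom T g" "Cod T ?d = Dom T g" using t j' assms by auto
  have "g \<cdot> Add T (i \<cdot> p) (j' \<cdot> g) = g"
    using t j' assms(2-4) by (simp add: cmp_add cmp_reduce1[OF gi] cmp_reduce1[OF gj'])
  then have "g \<cdot> ?d = Nul T (Dom T ?d) (Dom T h)" using t j' assms(2-4) d by (simp add: cmp_add)
  then obtain m where m: "m \<in> Arr T" "Dom T m = Dom T ?d" "Cod T m = Dom T i" "i \<cdot> m = ?d"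
    by (rule weak_kernel[OF assms(1), rotated 2]) (use d in auto)
  have "p \<cdot> Add T (i \<cdot> p) (j' \<cdot> g) = p"
    using t j' assms(2-4) by (simp add: cmp_add cmp_reduce1[OF assms(5)] cmp_reduce1[OF pj'])
  then have "p \<cdot> ?d = Nul T (Dom T g) (Dom T i)" using t j' assms(2-4) d by (simp add: cmp_add)
  moreover have "p \<cdot> (i \<cdot> m) = m" using t m(1-3) d(2) assms(2-4) by (simp add: cmp_reduce1[OF assms(5)])
  ultimately have "m = Nul T (Dom T g) (Dom T i)" using m(4) by simp
  then have "i \<cdot> m = Nul T (Dom T g) (Dom T g)" using t by simp
  then have "?d = Nul T (Dom T g) (Dom T g)" by (simp only: m(4))
  then have "Idn T (Dom T g) = Add T (i \<cdot> p) (j' \<cdot> g)"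
    using t j' assms by - (rule diff_nul_eq, auto)
  then show ?thesis using that[of j'] j' gj' pj' by simp
qed

lemma subcat_obj: "triangulated_subcategory T S \<Longrightarrow> X \<in> S \<Longrightarrow> X \<in> Obj T"
  by (auto simp: triangulated_subcategory_def)

lemma subcat_iso:
  assumes "triangulated_subcategory T S" "X \<in> S" "f \<in> Arr T" "iso_arr T f" "Dom T f = X \<and> Cod T f = Y \<or> Dom T f = Y \<and> Cod T f = X"
  shows "Y \<in> S"
proof -
  have "isomorphic T X Y" using isomorphicI[of f] isomorphic_sym assms(3-5) by (auto simp: Hom_iff)
  moreover have "Y \<in> Obj T" using assms by auto
  ultimately show ?thesis using assms by (auto simp: triangulated_subcategory_def)
qed

lemma subcat_sho: "triangulated_subcategory T S \<Longrightarrow> X \<in> Obj T \<Longrightarrow> Sho T X \<in> S \<longleftrightarrow> X \<in> S"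
  by (auto simp: triangulated_subcategory_def)

lemma counit_isoE:
  assumes "X \<in> Obj T"
  obtains e i where "e \<in> Arr T" "Dom T e = X" "Cod T e = Sho T (Usho T X)" "iso_arr T e"
    "i \<in> Arr T" "Dom T i = Sho T (Usho T X)" "Cod T i = X" "i \<cdot> e = Idn T X" "e \<cdot> i = Idn T (Sho T (Usho T X))"
proof -
  obtain E where E: "\<And>X. X \<in> Obj T \<Longrightarrow> E X \<in> Arr T \<and> Dom T (E X) = X \<and> Cod T (E X) = Sho T (Usho T X) \<and> iso_arr T (E X)"
    by (rule counitE) blast
  show ?thesis by (rule iso_arrE[of "E X"]) (use E[OF assms] that in auto)
qed

lemma subcat_usho:
  assumes "triangulated_subcategory T S" "X \<in> Obj T" shows "Usho T X \<in> S \<longleftrightarrow> X \<in> S"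
proof -
  obtain e i where e: "e \<in> Arr T" "Dom T e = X" "Cod T e = Sho T (Usho T X)" "iso_arr T e"
    by (rule counit_isoE[OF assms(2)])
  have "Sho T (Usho T X) \<in> S \<longleftrightarrow> X \<in> S"
    using subcat_iso[OF assms(1) _ e(1,4)] e(2,3) by blast
  then show ?thesis using subcat_sho[OF assms(1), of "Usho T X"] assms by simp
qed

lemma sha_iso_reflect:
  assumes "f \<in> Arr T" "iso_arr T (Sha T f)" shows "iso_arr T f"
proof -
  obtain g where g: "g \<in> Arr T" "Dom T g = Sho T (Cod T f)" "Cod T g = Sho T (Dom T f)"
    "g \<cdot> Sha T f = Idn T (Sho T (Dom T f))" "Sha T f \<cdot> g = Idn T (Sho T (Cod T f))"
    using iso_arrE[OF assms(2)] assms(1) by (metis dom_sha cod_sha)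
  obtain k where k: "k \<in> Arr T" "Dom T k = Cod T f" "Cod T k = Dom T f" "Sha T k = g"
    by (rule sha_full[of g "Cod T f" "Dom T f"]) (use g assms in auto)
  have "Sha T (k \<cdot> f) = Sha T (Idn T (Dom T f))" "Sha T (f \<cdot> k) = Sha T (Idn T (Cod T f))"
    using k g assms(1) by (simp_all add: sha_cmp)
  then have "k \<cdot> f = Idn T (Dom T f)" "f \<cdot> k = Idn T (Cod T f)"
    using sha_faithful[of "k \<cdot> f" "Idn T (Dom T f)"] sha_faithful[of "f \<cdot> k" "Idn T (Cod T f)"] k assms(1) by auto
  then show ?thesis using iso_arrI k assms by blast
qed

text \<open>Two backward rotations give a triangle whose first object is only isomorphic to A, by
  the desuspension of an isomorphism between suspensions. Transport along it makes the first object
  equal to A.\<close>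

lemma third_mapE:
  assumes "d \<in> Arr T" "Cod T d = Sho T A" "A \<in> Obj T"
  obtains n m where "(n, m, d) \<in> Tri T" "Dom T n = A"
proof -
  obtain x y where "(d, x, y) \<in> Tri T" using coneE[OF assms(1)] by auto
  then obtain m e where m: "(m, d, e \<cdot> x) \<in> Tri T" by (rule rotate_back) blast
  obtain n e' where n: "(n, m, e' \<cdot> d) \<in> Tri T" and e': "e' \<in> Arr T" "iso_arr T e'"
    "Dom T e' = Sho T A" "Cod T e' = Sho T (Dom T n)" "n \<in> Arr T"
    using rotate_back[OF m] assms by metis
  note ns = tri_simps[OF n] and ms = tri_simps[OF m]
  obtain a where a: "a \<in> Arr T" "Dom T a = A" "Cod T a = Dom T n" "Sha T a = e'"
    by (rule sha_full[of e' A "Dom T n"]) (use e' assms in auto)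
  have "iso_arr T a" using sha_iso_reflect[of a] a e' by simp
  then obtain b where b: "b \<in> Arr T" "Dom T b = Dom T n" "Cod T b = A" "b \<cdot> a = Idn T A" "a \<cdot> b = Idn T (Dom T n)"
    using iso_arrE a by metis
  have "Sha T b \<cdot> (Sha T a \<cdot> d) = Sha T (b \<cdot> a) \<cdot> d" using a(1-3) b(1-3) assms by (simp add: sha_cmp)
  then have be: "Sha T b \<cdot> (e' \<cdot> d) = d" using a b assms by simp
  have "(n \<cdot> a, m, d) \<in> Tri T"
  proof (rule iso_closed[OF n])
    show "candidate_triangle T (n \<cdot> a, m, d)" using a ns ms assms by (auto simp: candidate_triangle_def)
    have "iso_arr T b" using a b by (intro iso_arrI[of b a]) auto
    moreover have "triangle_mor T (n, m, e' \<cdot> d) (n \<cdot> a, m, d) (b, Idn T (Cod T n), Idn T (Cod T m))"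
      using a(1-3) b ns ms be assms e' by (auto simp: triangle_mor_def Hom_iff)
    ultimately show "triangles_isomorphic T (n, m, e' \<cdot> d) (n \<cdot> a, m, d)"
      unfolding triangles_isomorphic_def using ns ms iso_idn cod_obj by blast
  qed
  then show ?thesis using that a ns by auto
qed

lemma subcat_cone:
  assumes "triangulated_subcategory T S" "(f, g, h) \<in> Tri T" "Dom T f \<in> S" "Cod T f \<in> S"
  shows "Cod T g \<in> S"
  using assms by (auto simp: triangulated_subcategory_def)

lemma subcat_mid:
  assumes "triangulated_subcategory T S" "(f, g, h) \<in> Tri T" "Dom T f \<in> S" "Cod T g \<in> S"
  shows "Cod T f \<in> S"
proof -
  note t = tri_simps[OF assms(2)]
  have "Cod T (Neg T (Sha T f)) \<in> S"
    by (rule subcat_cone[OF assms(1) rotate[OF rotate[OF assms(2)]]]) (use assms t subcat_sho[OF assms(1)] in auto)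
  then show ?thesis using t subcat_sho[OF assms(1)] by simp
qed

lemma subcat_zero:
  assumes "triangulated_subcategory T S" "zero_object T Z" shows "Z \<in> S"
proof -
  obtain X where "X \<in> S" using assms by (auto simp: triangulated_subcategory_def)
  moreover from this have "X \<in> Obj T" using subcat_obj assms by blast
  moreover have "Z \<in> Obj T" using assms zero_object_iff by blast
  ultimately show ?thesis using subcat_cone[OF assms(1) zero_tri(1)[OF assms(2)]] by simp
qed

lemma thick_subcat: "S \<in> Thick T \<Longrightarrow> triangulated_subcategory T S"
  by (simp add: Thick_def)

lemma thick_obj: "S \<in> Thick T \<Longrightarrow> X \<in> S \<Longrightarrow> X \<in> Obj T"
  using thick_subcat subcat_obj by blast

lemma thick_sho: "S \<in> Thick T \<Longrightarrow> X \<in> Obj T \<Longrightarrow> Sho T X \<in> S \<longleftrightarrow> X \<in> S"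
  using thick_subcat subcat_sho by blast

lemma thick_zero: "S \<in> Thick T \<Longrightarrow> zero_object T Z \<Longrightarrow> Z \<in> S"
  using thick_subcat subcat_zero by blast

text \<open>Thickness is defined through biproducts. A retract is such a summand because its
  inclusion splits the triangle, with the cone of the inclusion as complement.\<close>

lemma thick_retract:
  assumes "S \<in> Thick T" "B \<in> S" "i \<in> Arr T" "p \<in> Arr T" "Dom T i = X" "Cod T i = B" "Dom T p = B" "Cod T p = X"
    "p \<cdot> i = Idn T X"
  shows "X \<in> S"
proof -
  obtain g h where t: "(i, g, h) \<in> Tri T" using coneE assms by blast
  note t' = tri_simps[OF t]
  obtain j where j: "j \<in> Arr T" "Dom T j = Cod T g" "Cod T j = Dom T g" "g \<cdot> j = Idn T (Cod T g)"
    "p \<cdot> j = Nul T (Cod T g) (Dom T i)" "Add T (i \<cdot> p) (j \<cdot> g) = Idn T (Dom T g)"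
    by (rule split_triangle[OF t]) (use assms t' in auto)
  have "biproduct T X (Cod T g) B"
    unfolding biproduct_def
    by (intro conjI bexI[of _ i] bexI[of _ j] bexI[of _ p] bexI[of _ g])
      (use assms j t' tri_comp[OF t] in \<open>auto simp: Hom_iff\<close>)
  then show ?thesis using assms by (auto simp: Thick_def)
qed

text \<open>Closure under retracts covers isomorphic objects and summands, and closure under cones
  follows from closure under middle terms by rotation. This is the form in which thickness is
  checked below.\<close>

lemma thickI:
  assumes obj: "S \<subseteq> Obj T" and zero: "\<And>Z. zero_object T Z \<Longrightarrow> Z \<in> S"
    and retract: "\<And>B i p X. \<lbrakk>B \<in> S; i \<in> Arr T; p \<in> Arr T; Dom T i = X; Cod T i = B; Dom T p = B; Cod T p = X;
      p \<cdot> i = Idn T X\<rbrakk> \<Longrightarrow> X \<in> S"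
    and sho: "\<And>X. X \<in> Obj T \<Longrightarrow> X \<in> S \<Longrightarrow> Sho T X \<in> S" "\<And>X. X \<in> Obj T \<Longrightarrow> Sho T X \<in> S \<Longrightarrow> X \<in> S"
    and ext: "\<And>f g h. \<lbrakk>(f, g, h) \<in> Tri T; Dom T f \<in> S; Cod T g \<in> S\<rbrakk> \<Longrightarrow> Cod T f \<in> S"
  shows "S \<in> Thick T"
proof -
  have 1: "Y \<in> S" if X: "X \<in> S" and iso: "isomorphic T X Y" for X Y
  proof -
    obtain f where f: "f \<in> Hom T X Y" "iso_arr T f" using iso by (auto simp: isomorphic_def)
    obtain g where g: "f \<in> Arr T" "g \<in> Arr T" "Dom T g = Cod T f" "Cod T g = Dom T f"
      "g \<cdot> f = Idn T (Dom T f)" "f \<cdot> g = Idn T (Cod T f)" using iso_arrE[OF f(2)] by metis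
    show ?thesis by (rule retract[OF X, of g f]) (use f g in \<open>auto simp: Hom_iff\<close>)
  qed
  have 2: "Cod T g \<in> S" if t: "(f, g, h) \<in> Tri T" and "Dom T f \<in> S" "Cod T f \<in> S" for f g h
  proof -
    note ts = tri_simps[OF t]
    have "Cod T h \<in> S" using sho(1)[of "Dom T f"] that(2) ts by simp
    then show ?thesis using ext[OF rotate[OF t]] that(3) ts by simp
  qed
  have 3: "X \<in> S" if b: "biproduct T X Y B" and B: "B \<in> S" for X Y B
  proof -
    obtain i p where "i \<in> Hom T X B" "p \<in> Hom T B X" "p \<cdot> i = Idn T X"
      using b unfolding biproduct_def by blast
    then show ?thesis using retract[OF B, of i p X] by (simp add: Hom_iff)
  qed
  have 4: "S \<noteq> {}" using zero_exists zero by blast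
  show ?thesis unfolding Thick_def triangulated_subcategory_def
  proof (intro CollectI conjI ballI impI allI)
    show "S \<subseteq> Obj T" "S \<noteq> {}" by fact+
    show "Y \<in> S" if "X \<in> S" "isomorphic T X Y" for X Y using 1 that .
    show "Sho T X \<in> S \<longleftrightarrow> X \<in> S" if "X \<in> Obj T" for X using sho that by blast
    show "case t of (f, g, h) \<Rightarrow> Dom T f \<in> S \<and> Cod T f \<in> S \<longrightarrow> Cod T g \<in> S" if "t \<in> Tri T" for t
      using 2 that by (cases t) blast
    show "X \<in> S" if "biproduct T X Y B \<and> B \<in> S" for X Y B using 3 that by blast
  qed
qed

lemma thick_Obj: "Obj T \<in> Thick T"
  by (rule thickI) (auto simp: zero_object_iff dest: tri_simps)

lemma thick_Inter:
  assumes "A \<subseteq> Thick T" "A \<noteq> {}" shows "\<Inter>A \<in> Thick T"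
proof (rule thickI)
  show "\<Inter>A \<subseteq> Obj T" using assms thick_obj by blast
  show "Z \<in> \<Inter>A" if "zero_object T Z" for Z using that thick_zero[OF subsetD[OF assms(1)]] assms(2) by auto
  show "X \<in> \<Inter>A" if "B \<in> \<Inter>A" "i \<in> Arr T" "p \<in> Arr T" "Dom T i = X" "Cod T i = B" "Dom T p = B" "Cod T p = X"
      "p \<cdot> i = Idn T X" for B i p X
  proof
    fix a assume a: "a \<in> A"
    then have "a \<in> Thick T" "B \<in> a" using that(1) assms by auto
    then show "X \<in> a" using thick_retract[OF _ _ that(2-8)] by blast
  qed
  show "Sho T X \<in> \<Inter>A" if "X \<in> Obj T" "X \<in> \<Inter>A" for X using that thick_sho[OF subsetD[OF assms(1)]] by auto
  show "X \<in> \<Inter>A" if "X \<in> Obj T" "Sho T X \<in> \<Inter>A" for X using that thick_sho[OF subsetD[OF assms(1)]] by auto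
  show "Cod T f \<in> \<Inter>A" if "(f, g, h) \<in> Tri T" "Dom T f \<in> \<Inter>A" "Cod T g \<in> \<Inter>A" for f g h
  proof
    fix a assume a: "a \<in> A"
    then have "triangulated_subcategory T a" "Dom T f \<in> a" "Cod T g \<in> a" using that assms thick_subcat by auto
    then show "Cod T f \<in> a" using subcat_mid[OF _ that(1)] by blast
  qed
qed

lemma thick_Int: "U \<in> Thick T \<Longrightarrow> V \<in> Thick T \<Longrightarrow> U \<inter> V \<in> Thick T"
  using thick_Inter[of "{U, V}"] by auto

lemma thick_hull_thick: "X \<subseteq> Obj T \<Longrightarrow> thick_hull T X \<in> Thick T"
  unfolding thick_hull_def by (rule thick_Inter) (use thick_Obj in auto)

lemma thick_hull_superset: "X \<subseteq> thick_hull T X"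
  by (auto simp: thick_hull_def)

lemma thick_hull_least: "S \<in> Thick T \<Longrightarrow> X \<subseteq> S \<Longrightarrow> thick_hull T X \<subseteq> S"
  by (auto simp: thick_hull_def)

text \<open>Each closure condition involves at most two given objects, and these lie in one member
  of the chain. Zorn's lemma for central subcategories rests on this.\<close>

lemma thick_chain_Union:
  assumes "C \<subseteq> Thick T" "C \<noteq> {}" "\<And>a b. a \<in> C \<Longrightarrow> b \<in> C \<Longrightarrow> a \<subseteq> b \<or> b \<subseteq> a"
  shows "\<Union>C \<in> Thick T"
proof (rule thickI)
  show "\<Union>C \<subseteq> Obj T" using assms thick_obj by blast
  show "Z \<in> \<Union>C" if "zero_object T Z" for Z using that thick_zero[OF subsetD[OF assms(1)]] assms(2) by auto
  show "X \<in> \<Union>C" if "B \<in> \<Union>C" "i \<in> Arr T" "p \<in> Arr T" "Dom T i = X" "Cod T i = B" "Dom T p = B" "Cod T p = X"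
      "p \<cdot> i = Idn T X" for B i p X
  proof -
    from that(1) obtain a where a: "a \<in> C" "B \<in> a" by blast
    then have "X \<in> a" using thick_retract[OF _ a(2) that(2-8)] assms(1) by blast
    with a show ?thesis by blast
  qed
  show "Sho T X \<in> \<Union>C" if "X \<in> Obj T" "X \<in> \<Union>C" for X using that thick_sho[OF subsetD[OF assms(1)]] by auto
  show "X \<in> \<Union>C" if "X \<in> Obj T" "Sho T X \<in> \<Union>C" for X using that thick_sho[OF subsetD[OF assms(1)]] by auto
  show "Cod T f \<in> \<Union>C" if "(f, g, h) \<in> Tri T" "Dom T f \<in> \<Union>C" "Cod T g \<in> \<Union>C" for f g h
  proof -
    from that(2,3) obtain a b where "a \<in> C" "b \<in> C" "Dom T f \<in> a" "Cod T g \<in> b" by blast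
    then obtain c where c: "c \<in> C" "Dom T f \<in> c" "Cod T g \<in> c" using assms(3)[of a b] by blast
    then have "Cod T f \<in> c" using assms(1) thick_subcat subcat_mid[OF _ that(1) c(2,3)] by blast
    then show ?thesis using c by blast
  qed
qed

end

section \<open>Maps factoring through a subcategory\<close>

definition factors_through :: "('o, 'm) tcat \<Rightarrow> 'o set \<Rightarrow> 'm \<Rightarrow> bool" where
  "factors_through T D f \<longleftrightarrow> (\<exists>g h. g \<in> Arr T \<and> h \<in> Arr T \<and> Cod T g = Dom T h \<and> Cod T g \<in> D \<and>
     Dom T g = Dom T f \<and> Cod T h = Cod T f \<and> f = h \<cdot>\<^bsub>T\<^esub> g)"

lemma commuting_pair_iff:
  "commuting_pair T U V \<longleftrightarrow> (\<forall>f \<in> Arr T. (Dom T f \<in> U \<and> Cod T f \<in> V) \<or> (Dom T f \<in> V \<and> Cod T f \<in> U) \<longrightarrow>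
     factors_through T (U \<inter> V) f)"
proof -
  have "(\<exists>W \<in> D. \<exists>g \<in> Hom T (Dom T f) W. \<exists>h \<in> Hom T W (Cod T f). f = h \<cdot>\<^bsub>T\<^esub> g) \<longleftrightarrow> factors_through T D f" for D f
    unfolding factors_through_def Hom_iff Bex_def by metis
  then show ?thesis unfolding commuting_pair_def by simp
qed

lemma factors_through_mono: "D \<subseteq> E \<Longrightarrow> factors_through T D f \<Longrightarrow> factors_through T E f"
  by (auto simp: factors_through_def)

section \<open>Factorizations through D: composition, sums and extensions\<close>

context triangulated_category begin

lemma factors_cmp_left:
  assumes "factors_through T D f" "f \<in> Arr T" "k \<in> Arr T" "Cod T f = Dom T k"
  shows "factors_through T D (k \<cdot> f)"
proof -
  obtain g h where "g \<in> Arr T" "h \<in> Arr T" "Cod T g = Dom T h" "Cod T g \<in> D"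
     "Dom T g = Dom T f" "Cod T h = Cod T f" "f = h \<cdot> g" using assms(1) by (auto simp: factors_through_def)
  then show ?thesis unfolding factors_through_def using assms(2-4)
    by (intro exI[of _ g] exI[of _ "k \<cdot> h"]) auto
qed

lemma factors_cmp_right:
  assumes "factors_through T D f" "f \<in> Arr T" "k \<in> Arr T" "Cod T k = Dom T f"
  shows "factors_through T D (f \<cdot> k)"
proof -
  obtain g h where "g \<in> Arr T" "h \<in> Arr T" "Cod T g = Dom T h" "Cod T g \<in> D"
     "Dom T g = Dom T f" "Cod T h = Cod T f" "f = h \<cdot> g" using assms(1) by (auto simp: factors_through_def)
  then show ?thesis unfolding factors_through_def using assms(2-4)
    by (intro exI[of _ "g \<cdot> k"] exI[of _ "h"]) auto
qed

text \<open>Both maps pass through the sum of the two middle objects, realised as the cone of a zero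
  map so that closure of D under cones applies to it.\<close>

lemma factors_add:
  assumes D: "triangulated_subcategory T D" and f: "factors_through T D f" "factors_through T D f'"
    "f \<in> Arr T" "f' \<in> Arr T" "Dom T f = Dom T f'" "Cod T f = Cod T f'"
  shows "factors_through T D (Add T f f')"
proof -
  obtain g h where g: "g \<in> Arr T" "h \<in> Arr T" "Cod T g = Dom T h" "Cod T g \<in> D"
     "Dom T g = Dom T f" "Cod T h = Cod T f" "f = h \<cdot> g" using f(1) by (auto simp: factors_through_def)
  obtain g' h' where g': "g' \<in> Arr T" "h' \<in> Arr T" "Cod T g' = Dom T h'" "Cod T g' \<in> D"
     "Dom T g' = Dom T f'" "Cod T h' = Cod T f'" "f' = h' \<cdot> g'" using f(2) by (auto simp: factors_through_def)
  obtain X Y where X: "X \<in> Obj T" "X \<in> D" "Cod T g = X" "Dom T h = X"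
    and Y: "Y \<in> Obj T" "Y \<in> D" "Cod T g' = Y" "Dom T h' = Y"
    using that[of "Cod T g" "Cod T g'"] g(1-4) g'(1-4) by (metis cod_obj)
  note g = g(1,2,5-7) and g' = g'(1,2,5-7)
  obtain e k where e: "e \<in> Arr T" "Dom T e = Y" "Cod T e = Sho T (Usho T Y)"
    and k: "k \<in> Arr T" "Dom T k = Sho T (Usho T Y)" "Cod T k = Y" "k \<cdot> e = Idn T Y"
    by (rule counit_isoE[OF Y(1)]) blast
  \<comment> \<open>The second summand appears as \<Sigma>(\<open>Usho\<close> Y); \<open>e\<close>
    and \<open>k\<close> translate between it and Y.\<close>
  obtain i q where t: "(Nul T (Usho T Y) X, i, q) \<in> Tri T" using coneE[of "Nul T (Usho T Y) X"] X Y by auto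
  note ts = tri_simps[OF t]
  have i: "i \<in> Arr T" "Dom T i = X" and q: "q \<in> Arr T" "Dom T q = Cod T i" "Cod T q = Sho T (Usho T Y)"
    using ts X Y by auto
  obtain p where p: "p \<in> Arr T" "Dom T p = Dom T q" "Cod T p = X" "p \<cdot> i = Idn T X"
    by (rule weak_cokernel[OF t, of "Idn T X"]) (use X Y i in auto)
  obtain j where j: "j \<in> Arr T" "Dom T j = Cod T q" "Cod T j = Dom T q" "q \<cdot> j = Idn T (Cod T q)"
    "p \<cdot> j = Nul T (Cod T q) (Dom T i)"
    by (rule split_triangle[OF rotate[OF t], of p]) (use p i in auto)
  have qi: "q \<cdot> i = Nul T X (Cod T q)" using tri_comp(2)[OF t] i by simp
  have iD: "Cod T i \<in> D" using subcat_cone[OF D t] X Y subcat_usho[OF D, of Y] by simp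
  define a b where "a = Add T (i \<cdot> g) (j \<cdot> (e \<cdot> g'))" and "b = Add T (h \<cdot> p) (h' \<cdot> (k \<cdot> q))"
  have a: "a \<in> Arr T" "Dom T a = Dom T f" "Cod T a = Cod T i"
    using i q p j e k g g' X Y f(3-6) by (auto simp: a_def)
  have b: "b \<in> Arr T" "Dom T b = Cod T i" "Cod T b = Cod T f"
    using i q p j e k g g' X Y f(3-6) by (auto simp: b_def)
  have pa: "p \<cdot> a = g"
    unfolding a_def using i q p(1-3) j e k g(1-4) g'(1-4) X Y f(3-6)
    by (simp add: cmp_add cmp_reduce1[OF p(4)] cmp_reduce1[OF j(5)])
  have qa: "q \<cdot> a = e \<cdot> g'"
    unfolding a_def using i q p(1-3) j e k g(1-4) g'(1-4) X Y f(3-6)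
    by (simp add: cmp_add cmp_reduce1[OF qi] cmp_reduce1[OF j(4)])
  have "b \<cdot> a = Add T (h \<cdot> (p \<cdot> a)) (h' \<cdot> (k \<cdot> (q \<cdot> a)))"
    unfolding b_def using i q p(1-3) j e k g(1-4) g'(1-4) X Y f(3-6) a by (simp add: add_cmp)
  also have "\<dots> = Add T f f'" unfolding pa qa
    using g g' e k(1-3) Y by (simp add: cmp_reduce1[OF k(4)])
  finally have "b \<cdot> a = Add T f f'" .
  with iD a b show ?thesis unfolding factors_through_def using f(3-6)
    by (intro exI[of _ a] exI[of _ b]) auto
qed

text \<open>Write A -> B -> C for the triangle. On A the map passes through D, say f u = b a, and
  this induces k from C to the cone of b. That cone lies in V since D does, so k passes through an
  object of D; pulling the triangle of b back along this factorization gives an extension E of two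
  objects of D. The maps of triangles yield B -> E -> \<open>Cod T f\<close>, which agrees with f on
  A. The difference vanishes on A, hence comes from C and passes through D again.\<close>

lemma factors_ext_out:
  assumes D: "triangulated_subcategory T D" and V: "triangulated_subcategory T V" and DV: "D \<subseteq> V"
    and t: "(u, v, w) \<in> Tri T"
    and l: "\<And>f. \<lbrakk>f \<in> Arr T; Dom T f = Dom T u; Cod T f \<in> V\<rbrakk> \<Longrightarrow> factors_through T D f"
    and r: "\<And>f. \<lbrakk>f \<in> Arr T; Dom T f = Cod T v; Cod T f \<in> V\<rbrakk> \<Longrightarrow> factors_through T D f"
    and f: "f \<in> Arr T" "Dom T f = Cod T u" "Cod T f \<in> V"
  shows "factors_through T D f"
proof -
  note ts = tri_simps[OF t]
  have "factors_through T D (f \<cdot> u)" using l ts f by simp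
  then obtain a b where ab: "a \<in> Arr T" "b \<in> Arr T" "Cod T a = Dom T b" "Cod T a \<in> D"
     "Dom T a = Dom T u" "Cod T b = Cod T f" "f \<cdot> u = b \<cdot> a"
    using f ts by (auto simp: factors_through_def)
  obtain b' b'' where tb: "(b, b', b'') \<in> Tri T" using coneE ab by blast
  note tbs = tri_simps[OF tb]
  have W1: "Cod T b' \<in> V" using subcat_cone[OF V tb] ab f DV by auto
  obtain k where k: "k \<in> Arr T" "Dom T k = Dom T w" "Cod T k = Dom T b''" "k \<cdot> v = b' \<cdot> f" "Sha T a \<cdot> w = b'' \<cdot> k"
    by (rule tri_fill_last[OF t tb, of a f]) (use ab f ts tbs in auto)
  have "factors_through T D k" using r k ts tbs W1 by auto
  then obtain c d where cd: "c \<in> Arr T" "d \<in> Arr T" "Cod T c = Dom T d" "Cod T c \<in> D"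
     "Dom T c = Dom T w" "Cod T d = Dom T b''" "k = d \<cdot> c" using k by (auto simp: factors_through_def)
  obtain n m where n: "(n, m, b'' \<cdot> d) \<in> Tri T" "Dom T n = Dom T b"
    by (rule third_mapE[of "b'' \<cdot> d" "Dom T b"]) (use cd tbs ab in auto)
  note ns = tri_simps[OF n(1)]
  have ED: "Cod T n \<in> D" using subcat_mid[OF D n(1)] n ns ab cd tbs by simp
  obtain j where j: "j \<in> Arr T" "Dom T j = Dom T v" "Cod T j = Dom T m" "j \<cdot> u = n \<cdot> a" "c \<cdot> v = m \<cdot> j"
    by (rule tri_fill_mid[OF t n(1), of a c]) (use n ns ab cd ts tbs k in auto)
  obtain z where z: "z \<in> Arr T" "Dom T z = Dom T m" "Cod T z = Dom T b'" "z \<cdot> n = b \<cdot> Idn T (Dom T b)"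
    by (rule tri_fill_mid[OF n(1) tb, of "Idn T (Dom T b)" d]) (use n ns ab cd tbs in auto)
  have zj: "z \<cdot> j \<in> Arr T" "Dom T (z \<cdot> j) = Cod T u" "Cod T (z \<cdot> j) = Cod T f"
    using z j ts tbs ab by auto
  have zju: "(z \<cdot> j) \<cdot> u = f \<cdot> u"
  proof -
    have "(z \<cdot> j) \<cdot> u = z \<cdot> (n \<cdot> a)" using z(1-3) j ts by simp
    also have "\<dots> = b \<cdot> a"
      using cmp_reduce1[OF z(4), of a] z(1-3) ab ns n by simp
    finally show ?thesis using ab by simp
  qed
  let ?g = "Add T f (Neg T (z \<cdot> j))"
  have g: "?g \<in> Arr T" "Dom T ?g = Cod T u" "Cod T ?g = Cod T f" using f zj by auto
  have "?g \<cdot> u = Nul T (Dom T u) (Cod T ?g)" using f zj zju ts by (simp add: add_cmp)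
  then obtain s where s: "s \<in> Arr T" "Dom T s = Dom T w" "Cod T s = Cod T ?g" "s \<cdot> v = ?g"
    by (rule weak_cokernel[OF t, rotated 2]) (use g ts in auto)
  have "factors_through T D s" using r s ts g f by simp
  then have "factors_through T D ?g" using factors_cmp_right[of D s v] s ts by simp
  moreover have "factors_through T D (z \<cdot> j)"
    unfolding factors_through_def using z j zj ED ns by (intro exI[of _ j] exI[of _ z]) auto
  ultimately have "factors_through T D (Add T ?g (z \<cdot> j))" using factors_add[OF D] g zj by simp
  moreover have "Add T ?g (z \<cdot> j) = f" using f zj by (simp add: add_assoc)
  ultimately show ?thesis by simp
qed

text \<open>Dual to \<open>factors_ext_out\<close>: now v f = b a, the fibre of a replaces the cone
  of b, and E is obtained by pushing the triangle of a out along the factorization of k. The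
  composite through E agrees with f after v, so the difference comes from the first object of the
  triangle.\<close>

lemma factors_ext_in:
  assumes D: "triangulated_subcategory T D" and V: "triangulated_subcategory T V" and DV: "D \<subseteq> V"
    and t: "(u, v, w) \<in> Tri T"
    and l: "\<And>f. \<lbrakk>f \<in> Arr T; Cod T f = Dom T u; Dom T f \<in> V\<rbrakk> \<Longrightarrow> factors_through T D f"
    and r: "\<And>f. \<lbrakk>f \<in> Arr T; Cod T f = Cod T v; Dom T f \<in> V\<rbrakk> \<Longrightarrow> factors_through T D f"
    and f: "f \<in> Arr T" "Cod T f = Cod T u" "Dom T f \<in> V"
  shows "factors_through T D f"
proof -
  note ts = tri_simps[OF t]
  have "factors_through T D (v \<cdot> f)" using r ts f by simp
  then obtain a b where ab: "a \<in> Arr T" "b \<in> Arr T" "Cod T a = Dom T b" "Cod T a \<in> D"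
     "Dom T a = Dom T f" "Cod T b = Cod T v" "v \<cdot> f = b \<cdot> a"
    using f ts by (auto simp: factors_through_def)
  obtain x0 y0 where ta0: "(a, x0, y0) \<in> Tri T" using coneE ab by blast
  obtain c' a' where ta: "(c', a, a') \<in> Tri T" "Cod T c' = Dom T f"
    using rotate_back[OF ta0] ab by metis
  note tas = tri_simps[OF ta(1)]
  have W1: "Dom T c' \<in> V"
  proof -
    have "Cod T a' \<in> V" using subcat_cone[OF V rotate[OF ta(1)]] ab f DV tas by auto
    then show ?thesis using tas subcat_sho[OF V] by auto
  qed
  obtain k where k: "k \<in> Arr T" "Dom T k = Dom T c'" "Cod T k = Dom T u" "f \<cdot> c' = u \<cdot> k" "Sha T k \<cdot> a' = w \<cdot> b"
    by (rule tri_fill_first[OF ta(1) t, of f b]) (use ab f ts ta tas in auto)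
  have "factors_through T D k" using l k W1 by auto
  then obtain c d where cd: "c \<in> Arr T" "d \<in> Arr T" "Cod T c = Dom T d" "Cod T c \<in> D"
     "Dom T c = Dom T c'" "Cod T d = Dom T u" "k = d \<cdot> c" using k by (auto simp: factors_through_def)
  have sc: "Sha T c \<cdot> a' \<in> Arr T" "Dom T (Sha T c \<cdot> a') = Cod T a" "Cod T (Sha T c \<cdot> a') = Sho T (Cod T c)"
    using cd tas by auto
  obtain n m where n: "(n, m, Sha T c \<cdot> a') \<in> Tri T" "Dom T n = Cod T c"
    by (rule third_mapE[OF sc(1) sc(3)]) (use cd in auto)
  note ns = tri_simps[OF n(1)]
  have mc: "Cod T m = Cod T a" using ns sc by simp
  have ED: "Cod T n \<in> D" by (rule subcat_mid[OF D n(1)]) (use n(2) mc ab(3,4) cd(3,4) in simp_all)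
  obtain j where j: "j \<in> Arr T" "Dom T j = Dom T a" "Cod T j = Dom T m" "j \<cdot> c' = n \<cdot> c"
    "Idn T (Cod T a) \<cdot> a = m \<cdot> j"
    by (rule tri_fill_mid[OF ta(1) n(1), of c "Idn T (Cod T a)"]) (use n(2) mc ns(1,2,4) ab(1-6) cd(1-6) tas sc in auto)
  obtain z where z: "z \<in> Arr T" "Dom T z = Dom T m" "Cod T z = Dom T v" "z \<cdot> n = u \<cdot> d" "b \<cdot> m = v \<cdot> z"
    by (rule tri_fill_mid[OF n(1) t, of d b]) (use n(2) mc ns(1,2,4) ab(1-6) cd tas ts k(5) in \<open>auto simp: sha_cmp\<close>)
  have zj: "z \<cdot> j \<in> Arr T" "Dom T (z \<cdot> j) = Dom T f" "Cod T (z \<cdot> j) = Cod T u"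
    using z j ts ab by auto
  have vzj: "v \<cdot> (z \<cdot> j) = v \<cdot> f"
  proof -
    have "v \<cdot> (z \<cdot> j) = b \<cdot> (m \<cdot> j)" using cmp_reduce[OF z(5)[symmetric], of j] z(1-3) j(1-3) ts ab ns mc by simp
    then show ?thesis using j ab by simp
  qed
  let ?g = "Add T f (Neg T (z \<cdot> j))"
  have g: "?g \<in> Arr T" "Dom T ?g = Dom T f" "Cod T ?g = Cod T u" using f zj by auto
  have "v \<cdot> ?g = Nul T (Dom T ?g) (Dom T w)" using f zj vzj ts by (simp add: cmp_add)
  then obtain r' where r': "r' \<in> Arr T" "Dom T r' = Dom T ?g" "Cod T r' = Dom T u" "u \<cdot> r' = ?g"
    by (rule weak_kernel[OF t, rotated 2]) (use g ts in auto)
  have "factors_through T D r'" using l r' g f by simp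
  then have "factors_through T D ?g" using factors_cmp_left[of D r' u] r' ts by simp
  moreover have "factors_through T D (z \<cdot> j)"
    unfolding factors_through_def using z j zj ED ns by (intro exI[of _ j] exI[of _ z]) auto
  ultimately have "factors_through T D (Add T ?g (z \<cdot> j))" using factors_add[OF D] g zj by simp
  moreover have "Add T ?g (z \<cdot> j) = f" using f zj by (simp add: add_assoc)
  ultimately show ?thesis by simp
qed

end

section \<open>The thick subcategory of objects whose maps to and from V pass through D\<close>

context triangulated_category begin

definition absorbs :: "'a set \<Rightarrow> 'a set \<Rightarrow> 'a \<Rightarrow> bool" where
  "absorbs D V X \<longleftrightarrow> X \<in> Obj T \<and> (\<forall>f \<in> Arr T. Dom T f = X \<and> Cod T f \<in> V \<or> Dom T f \<in> V \<and> Cod T f = X \<longrightarrow>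
     factors_through T D f)"

lemma factors_sha:
  assumes D: "triangulated_subcategory T D" and f: "f \<in> Arr T"
  shows "factors_through T D (Sha T f) \<longleftrightarrow> factors_through T D f"
proof
  assume "factors_through T D f"
  then obtain g h where g: "g \<in> Arr T" "h \<in> Arr T" "Cod T g = Dom T h" "Cod T g \<in> D"
     "Dom T g = Dom T f" "Cod T h = Cod T f" "f = h \<cdot> g" by (auto simp: factors_through_def)
  have "Cod T (Sha T g) \<in> D" using g subcat_sho[OF D] by simp
  then show "factors_through T D (Sha T f)" unfolding factors_through_def
    using g sha_cmp[OF g(1-3)] by (intro exI[of _ "Sha T g"] exI[of _ "Sha T h"]) simp
next
  assume "factors_through T D (Sha T f)"
  then obtain g h where g: "g \<in> Arr T" "h \<in> Arr T" "Cod T g = Dom T h" "Cod T g \<in> D"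
     "Dom T g = Sho T (Dom T f)" "Cod T h = Sho T (Cod T f)" "Sha T f = h \<cdot> g"
    using f by (auto simp: factors_through_def)
  define W where "W = Cod T g"
  have W: "W \<in> Obj T" "Dom T h = W" "Cod T g = W" "W \<in> D" using g by (auto simp: W_def)
  \<comment> \<open>The middle object W need not be a suspension; passing to
    \<Sigma>(\<open>Usho\<close> W) lets both factors be desuspended.\<close>
  obtain e i where e: "e \<in> Arr T" "Dom T e = W" "Cod T e = Sho T (Usho T W)"
    and i: "i \<in> Arr T" "Dom T i = Sho T (Usho T W)" "Cod T i = W" "i \<cdot> e = Idn T W"
    by (rule counit_isoE[OF W(1)]) blast
  obtain a where a: "a \<in> Arr T" "Dom T a = Dom T f" "Cod T a = Usho T W" "Sha T a = e \<cdot> g"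
    by (rule sha_full[of "e \<cdot> g" "Dom T f" "Usho T W"]) (use g(1,5) e f W in auto)
  obtain b where b: "b \<in> Arr T" "Dom T b = Usho T W" "Cod T b = Cod T f" "Sha T b = h \<cdot> i"
    by (rule sha_full[of "h \<cdot> i" "Usho T W" "Cod T f"]) (use g(2,6) i f W in auto)
  have "Sha T (b \<cdot> a) = (h \<cdot> i) \<cdot> (e \<cdot> g)" using a b by (simp add: sha_cmp)
  also have "\<dots> = h \<cdot> (i \<cdot> (e \<cdot> g))" using g(1,2) e i W by simp
  also have "\<dots> = Sha T f" using cmp_reduce1[OF i(4), of g] g(1,2,7) e i(1-3) W by simp
  finally have "b \<cdot> a = f" by - (rule sha_faithful, use a b f in auto)
  moreover have "Usho T W \<in> D" using W subcat_usho[OF D] by simp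
  ultimately show "factors_through T D f" unfolding factors_through_def
    using a b by (intro exI[of _ a] exI[of _ b]) auto
qed

text \<open>Extensions are the two preceding lemmas, and retracts are a matter of composition. For a
  suspended object the other end W of the map, in V, is replaced by \<Sigma>(\<open>Usho\<close> W),
  after which \<open>factors_sha\<close> moves the factorization.\<close>

lemma absorbs_thick:
  assumes D: "D \<in> Thick T" and V: "V \<in> Thick T" and DV: "D \<subseteq> V"
  shows "{X. absorbs D V X} \<in> Thick T"
proof (rule thickI)
  note D' = thick_subcat[OF D] and V' = thick_subcat[OF V]
  let ?C = "{X. absorbs D V X}"
  show "?C \<subseteq> Obj T" by (auto simp: absorbs_def)
  show "Z \<in> ?C" if z: "zero_object T Z" for Z
  proof -
    have Z: "Z \<in> D" "Z \<in> Obj T" using z thick_zero[OF D] zero_object_iff by blast+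
    have "factors_through T D f" if "f \<in> Arr T" "Dom T f = Z \<or> Cod T f = Z" for f
    proof (cases "Dom T f = Z")
      case True then show ?thesis unfolding factors_through_def using Z that
        by (intro exI[of _ "Idn T Z"] exI[of _ f]) auto
    next
      case False then show ?thesis unfolding factors_through_def using Z that
        by (intro exI[of _ f] exI[of _ "Idn T Z"]) auto
    qed
    then show ?thesis using Z by (auto simp: absorbs_def)
  qed
  show "X \<in> ?C" if B: "B \<in> ?C" and i: "i \<in> Arr T" "p \<in> Arr T" "Dom T i = X" "Cod T i = B" "Dom T p = B" "Cod T p = X"
    "p \<cdot> i = Idn T X" for B i p X
  proof -
    have X: "X \<in> Obj T" using i by auto
    have "factors_through T D f" if f: "f \<in> Arr T" "Dom T f = X" "Cod T f \<in> V" for f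
    proof -
      have "factors_through T D (f \<cdot> p)" using B f i by (simp add: absorbs_def)
      then have "factors_through T D ((f \<cdot> p) \<cdot> i)" using f i by - (rule factors_cmp_right, auto)
      then show ?thesis using f i by simp
    qed
    moreover have "factors_through T D f" if f: "f \<in> Arr T" "Cod T f = X" "Dom T f \<in> V" for f
    proof -
      have "factors_through T D (i \<cdot> f)" using B f i by (simp add: absorbs_def)
      then have "factors_through T D (p \<cdot> (i \<cdot> f))" using f i by - (rule factors_cmp_left, auto)
      then show ?thesis using f i by (simp add: cmp_reduce1[OF i(7)])
    qed
    ultimately show ?thesis using X by (auto simp: absorbs_def)
  qed
  show "X \<in> ?C" if X: "X \<in> Obj T" and S: "Sho T X \<in> ?C" for X
  proof -
    have "factors_through T D f" if f: "f \<in> Arr T" "Dom T f = X \<and> Cod T f \<in> V \<or> Dom T f \<in> V \<and> Cod T f = X" for f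
    proof -
      have "factors_through T D (Sha T f)" using S f subcat_sho[OF V'] by (auto simp: absorbs_def)
      then show ?thesis using factors_sha[OF D' f(1)] by simp
    qed
    then show ?thesis using X by (auto simp: absorbs_def)
  qed
  show "Sho T X \<in> ?C" if X: "X \<in> Obj T" and S: "X \<in> ?C" for X
  proof -
    have "factors_through T D f" if f: "f \<in> Arr T" "Dom T f = Sho T X" "Cod T f \<in> V" for f
    proof -
      obtain W where W: "W \<in> Obj T" "Cod T f = W" "W \<in> V" using f cod_obj by blast
      obtain e i where e: "e \<in> Arr T" "Dom T e = W" "Cod T e = Sho T (Usho T W)"
        and i: "i \<in> Arr T" "Dom T i = Sho T (Usho T W)" "Cod T i = W" "i \<cdot> e = Idn T W"
        by (rule counit_isoE[OF W(1)]) blast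
      obtain a where a: "a \<in> Arr T" "Dom T a = X" "Cod T a = Usho T W" "Sha T a = e \<cdot> f"
        by (rule sha_full[of "e \<cdot> f" "X" "Usho T W"]) (use f e X W in auto)
      have "factors_through T D a" using S a W subcat_usho[OF V'] by (auto simp: absorbs_def)
      then have "factors_through T D (e \<cdot> f)" using factors_sha[OF D' a(1)] a by simp
      then have "factors_through T D (i \<cdot> (e \<cdot> f))" using f e i W by - (rule factors_cmp_left, auto)
      then show ?thesis using f e i(1-3) W by (simp add: cmp_reduce1[OF i(4)])
    qed
    moreover have "factors_through T D f" if f: "f \<in> Arr T" "Cod T f = Sho T X" "Dom T f \<in> V" for f
    proof -
      obtain W where W: "W \<in> Obj T" "Dom T f = W" "W \<in> V" using f dom_obj by blast
      obtain e i where e: "e \<in> Arr T" "Dom T e = W" "Cod T e = Sho T (Usho T W)"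
        and i: "i \<in> Arr T" "Dom T i = Sho T (Usho T W)" "Cod T i = W" "i \<cdot> e = Idn T W"
        by (rule counit_isoE[OF W(1)]) blast
      obtain a where a: "a \<in> Arr T" "Dom T a = Usho T W" "Cod T a = X" "Sha T a = f \<cdot> i"
        by (rule sha_full[of "f \<cdot> i" "Usho T W" X]) (use f i X W in auto)
      have "factors_through T D a" using S a W subcat_usho[OF V'] by (auto simp: absorbs_def)
      then have "factors_through T D (f \<cdot> i)" using factors_sha[OF D' a(1)] a by simp
      then have "factors_through T D ((f \<cdot> i) \<cdot> e)" using f e i W by - (rule factors_cmp_right, auto)
      then show ?thesis using f e i W by simp
    qed
    ultimately show ?thesis using X by (auto simp: absorbs_def)
  qed
  show "Cod T u \<in> ?C" if t: "(u, v, w) \<in> Tri T" and S: "Dom T u \<in> ?C" "Cod T v \<in> ?C" for u v w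
  proof -
    have "factors_through T D f" if "f \<in> Arr T" "Dom T f = Cod T u" "Cod T f \<in> V" for f
      by (rule factors_ext_out[OF D' V' DV t]) (use S that in \<open>auto simp: absorbs_def\<close>)
    moreover have "factors_through T D f" if "f \<in> Arr T" "Cod T f = Cod T u" "Dom T f \<in> V" for f
      by (rule factors_ext_in[OF D' V' DV t]) (use S that in \<open>auto simp: absorbs_def\<close>)
    ultimately show ?thesis using tri_simps[OF t] by (auto simp: absorbs_def)
  qed
qed

section \<open>The frame of central subcategories\<close>

text \<open>The absorbing objects form a thick subcategory, so it suffices to find the members of A
  in it. Two choices of D matter: the join intersected with V gives centrality of joins, and the
  join of the intersections gives the frame law.\<close>

lemma hull_Union_absorbs:
  assumes A: "\<And>U. U \<in> A \<Longrightarrow> U \<subseteq> Obj T \<and> commuting_pair T U V \<and> U \<inter> V \<subseteq> D"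
    and D: "D \<in> Thick T" and V: "V \<in> Thick T" and DV: "D \<subseteq> V"
    and X: "X \<in> thick_hull T (\<Union>A)"
  shows "absorbs D V X"
proof -
  have "\<Union>A \<subseteq> {X. absorbs D V X}"
  proof clarify
    fix X U assume U: "U \<in> A" "X \<in> U"
    have "factors_through T D f" if "f \<in> Arr T" "Dom T f = X \<and> Cod T f \<in> V \<or> Dom T f \<in> V \<and> Cod T f = X" for f
      using factors_through_mono[of "U \<inter> V" D T f] A[OF U(1)] U that unfolding commuting_pair_iff by auto
    then show "absorbs D V X" using A[OF U(1)] U by (auto simp: absorbs_def)
  qed
  then show ?thesis using thick_hull_least[OF absorbs_thick[OF D V DV]] X by blast
qed

lemma central_thick: "central T U \<Longrightarrow> U \<in> Thick T"
  by (simp add: central_def)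

lemma central_join:
  assumes "\<And>U. U \<in> A \<Longrightarrow> central T U" shows "central T (thick_hull T (\<Union>A))"
  unfolding central_def
proof (intro conjI ballI)
  let ?J = "thick_hull T (\<Union>A)"
  have sub: "\<Union>A \<subseteq> Obj T" using assms central_thick thick_obj by blast
  show J: "?J \<in> Thick T" using sub by (rule thick_hull_thick)
  fix V assume V: "V \<in> Thick T"
  have "absorbs (?J \<inter> V) V X" if "X \<in> ?J" for X
  proof (rule hull_Union_absorbs[OF _ thick_Int[OF J V] V _ that])
    show "U \<subseteq> Obj T \<and> commuting_pair T U V \<and> U \<inter> V \<subseteq> ?J \<inter> V" if "U \<in> A" for U
      using that assms[OF that] V thick_hull_superset[of "\<Union>A"] sub by (auto simp: central_def)
  qed auto
  then show "commuting_pair T ?J V" unfolding commuting_pair_iff absorbs_def by blast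
qed

text \<open>A map from U \<inter> V to W first passes through U \<inter> W. The part between U
  \<inter> V and U \<inter> W connects V with the thick subcategory U \<inter> W, so it passes
  through their intersection.\<close>

lemma central_Int:
  assumes U: "central T U" and V: "central T V" shows "central T (U \<inter> V)"
  unfolding central_def
proof (intro conjI ballI)
  note UT = central_thick[OF U] and VT = central_thick[OF V]
  show "U \<inter> V \<in> Thick T" using UT VT by (rule thick_Int)
  fix W assume W: "W \<in> Thick T"
  have c1: "commuting_pair T U W" using U W by (simp add: central_def)
  have c2: "commuting_pair T V (U \<inter> W)" using V thick_Int[OF UT W] by (simp add: central_def)
  have "factors_through T (U \<inter> V \<inter> W) f"
    if f: "f \<in> Arr T" "Dom T f \<in> U \<inter> V" "Cod T f \<in> W" for f
  proof -
    have "factors_through T (U \<inter> W) f" using c1 f by (auto simp: commuting_pair_iff)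
    then obtain g h where g: "g \<in> Arr T" "h \<in> Arr T" "Cod T g = Dom T h" "Cod T g \<in> U \<inter> W"
      "Dom T g = Dom T f" "Cod T h = Cod T f" "f = h \<cdot> g" by (auto simp: factors_through_def)
    have "factors_through T (V \<inter> (U \<inter> W)) g" using c2 f g(1-5) unfolding commuting_pair_iff by auto
    then have "factors_through T (V \<inter> (U \<inter> W)) (h \<cdot> g)" using g by - (rule factors_cmp_left, auto)
    then have "factors_through T (V \<inter> (U \<inter> W)) f" using g by simp
    then show ?thesis by (rule factors_through_mono[rotated]) auto
  qed
  moreover have "factors_through T (U \<inter> V \<inter> W) f"
    if f: "f \<in> Arr T" "Cod T f \<in> U \<inter> V" "Dom T f \<in> W" for f
  proof -
    have "factors_through T (U \<inter> W) f" using c1 f by (auto simp: commuting_pair_iff)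
    then obtain g h where g: "g \<in> Arr T" "h \<in> Arr T" "Cod T g = Dom T h" "Cod T g \<in> U \<inter> W"
      "Dom T g = Dom T f" "Cod T h = Cod T f" "f = h \<cdot> g" by (auto simp: factors_through_def)
    have "factors_through T (V \<inter> (U \<inter> W)) h" using c2 f g(1-6) unfolding commuting_pair_iff by auto
    then have "factors_through T (V \<inter> (U \<inter> W)) (h \<cdot> g)" using g by - (rule factors_cmp_right, auto)
    then have "factors_through T (V \<inter> (U \<inter> W)) f" using g by simp
    then show ?thesis by (rule factors_through_mono[rotated]) auto
  qed
  ultimately show "commuting_pair T (U \<inter> V) W" unfolding commuting_pair_iff by blast
qed

text \<open>The identity of an object of V is a map into V, so it passes through the join of the
  intersections; the object is therefore a retract of an object of that join.\<close>

lemma central_distrib: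
  assumes A: "\<And>U. U \<in> A \<Longrightarrow> central T U" and V: "V \<in> Thick T"
  shows "thick_hull T (\<Union>A) \<inter> V \<subseteq> thick_hull T (\<Union>((\<lambda>U. U \<inter> V) ` A))"
proof
  let ?D = "thick_hull T (\<Union>((\<lambda>U. U \<inter> V) ` A))"
  fix X assume X: "X \<in> thick_hull T (\<Union>A) \<inter> V"
  have sub: "(\<Union>((\<lambda>U. U \<inter> V) ` A)) \<subseteq> Obj T" using V thick_obj by blast
  have D: "?D \<in> Thick T" using sub by (rule thick_hull_thick)
  have DV: "?D \<subseteq> V" using V by (intro thick_hull_least) auto
  have "absorbs ?D V X"
  proof (rule hull_Union_absorbs[OF _ D V DV])
    show "U \<subseteq> Obj T \<and> commuting_pair T U V \<and> U \<inter> V \<subseteq> ?D" if "U \<in> A" for U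
      using that A[OF that] V thick_hull_superset[of "\<Union>((\<lambda>U. U \<inter> V) ` A)"] thick_obj
      by (auto simp: central_def)
  qed (use X in auto)
  then have XO: "X \<in> Obj T" and "factors_through T ?D (Idn T X)" using X by (auto simp: absorbs_def)
  then obtain g h where g: "g \<in> Arr T" "h \<in> Arr T" "Cod T g = Dom T h" "Cod T g \<in> ?D"
      "Dom T g = Dom T (Idn T X)" "Cod T h = Cod T (Idn T X)" "Idn T X = h \<cdot> g"
    unfolding factors_through_def by blast
  show "X \<in> ?D"
    by (rule thick_retract[OF D g(4,1,2)]) (use g(3,5,6) XO in \<open>simp_all add: g(7)[symmetric]\<close>)
qed

lemma commuting_sym: "commuting_pair T U V \<longleftrightarrow> commuting_pair T V U"
  unfolding commuting_pair_iff by (auto simp: Int_commute)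

end

text \<open>Both frames of the theorem are families of sets under inclusion with intersection as
  binary meet: the central subcategories, whose join is the thick hull of the union, and the open
  sets of the space of points, whose join is the union. One half of the frame law is assumed; the
  other half is monotonicity.\<close>

locale set_frame =
  fixes \<A> :: "'a set set" and J :: "'a set set \<Rightarrow> 'a set" and E :: "'a set"
  assumes J_closed: "A \<subseteq> \<A> \<Longrightarrow> J A \<in> \<A>"
    and J_upper: "A \<subseteq> \<A> \<Longrightarrow> a \<in> A \<Longrightarrow> a \<subseteq> J A"
    and J_least: "A \<subseteq> \<A> \<Longrightarrow> b \<in> \<A> \<Longrightarrow> (\<And>a. a \<in> A \<Longrightarrow> a \<subseteq> b) \<Longrightarrow> J A \<subseteq> b"
    and Int_closed: "a \<in> \<A> \<Longrightarrow> b \<in> \<A> \<Longrightarrow> a \<inter> b \<in> \<A>"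
    and distrib: "A \<subseteq> \<A> \<Longrightarrow> b \<in> \<A> \<Longrightarrow> J A \<inter> b \<subseteq> J ((\<lambda>x. x \<inter> b) ` A)"
    and E_closed: "E \<in> \<A>" and E_greatest: "a \<in> \<A> \<Longrightarrow> a \<subseteq> E"
begin

abbreviation L where "L \<equiv> incl_order \<A>"

lemma L_simps [simp]: "carrier L = \<A>" "le L = (\<subseteq>)" "eq L = (=)"
  by (auto simp: incl_order_def)

lemma partial_order_L: "partial_order L"
  by unfold_locales auto

lemma least_J: "A \<subseteq> \<A> \<Longrightarrow> least L (J A) (Upper L A)"
proof -
  assume A: "A \<subseteq> \<A>"
  have "J A \<subseteq> b" if "b \<in> \<A>" "\<forall>a. a \<in> A \<and> a \<in> \<A> \<longrightarrow> a \<subseteq> b" for b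
    by (rule J_least) (use A that in auto)
  then show ?thesis unfolding least_def Upper_def using J_closed[OF A] J_upper[OF A] by auto
qed

text \<open>Infinite intersections need not belong to the family, so infima are joins of lower
  bounds.\<close>

lemma greatest_lower:
  assumes "A \<subseteq> \<A>" shows "greatest L (J {b \<in> \<A>. \<forall>a \<in> A. b \<subseteq> a}) (Lower L A)"
proof -
  have "J {b \<in> \<A>. \<forall>a \<in> A. b \<subseteq> a} \<subseteq> a" if "a \<in> A" for a
    by (rule J_least) (use assms that in auto)
  moreover have "b \<subseteq> J {b \<in> \<A>. \<forall>a \<in> A. b \<subseteq> a}" if "b \<in> \<A>" "\<forall>a. a \<in> A \<and> a \<in> \<A> \<longrightarrow> b \<subseteq> a" for b
    by (rule J_upper) (use that assms in auto)
  moreover have "J {b \<in> \<A>. \<forall>a \<in> A. b \<subseteq> a} \<in> \<A>" by (rule J_closed) auto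
  ultimately show ?thesis unfolding greatest_def Lower_def using assms by auto
qed

sublocale complete_lattice L
proof -
  interpret partial_order L by (rule partial_order_L)
  show "complete_lattice L"
    by (rule complete_latticeI) (use least_J greatest_lower in auto)
qed

lemma sup_eq: "A \<subseteq> \<A> \<Longrightarrow> \<Squnion>\<^bsub>L\<^esub>A = J A"
  using least_J least_unique sup_lub by (metis L_simps(1))

lemma meet_eq:
  assumes "a \<in> \<A>" "b \<in> \<A>" shows "a \<sqinter>\<^bsub>L\<^esub> b = a \<inter> b"
proof (rule antisym)
  show "a \<sqinter>\<^bsub>L\<^esub> b \<subseteq> a \<inter> b" using meet_left[of a b] meet_right[of a b] assms by simp
  show "a \<inter> b \<subseteq> a \<sqinter>\<^bsub>L\<^esub> b" using meet_le[of "a \<inter> b" a b] assms Int_closed by simp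
qed

lemma top_eq: "\<top>\<^bsub>L\<^esub> = E"
  using top_higher[of E] E_closed top_closed E_greatest by auto

lemma frame_L: "frame L"
  unfolding frame_def
proof (intro conjI allI impI ballI)
  show "complete_lattice L" by unfold_locales
  fix A y assume A: "A \<subseteq> carrier L" and y: "y \<in> carrier L"
  have im: "(\<lambda>x. x \<sqinter>\<^bsub>L\<^esub> y) ` A = (\<lambda>x. x \<inter> y) ` A"
    by (rule image_cong) (use A y in \<open>simp_all add: meet_eq subset_iff\<close>)
  have sub: "(\<lambda>x. x \<inter> y) ` A \<subseteq> \<A>" using A y Int_closed by auto
  have "J ((\<lambda>x. x \<inter> y) ` A) \<subseteq> J A \<inter> y"
    by (rule J_least[OF sub]) (use A y Int_closed J_closed J_upper in \<open>auto dest: J_upper\<close>)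
  then have "J ((\<lambda>x. x \<inter> y) ` A) = J A \<inter> y" using distrib A y by auto
  then show "\<Squnion>\<^bsub>L\<^esub>((\<lambda>x. x \<sqinter>\<^bsub>L\<^esub> y) ` A) = (\<Squnion>\<^bsub>L\<^esub>A) \<sqinter>\<^bsub>L\<^esub> y"
    using im A y sub by (simp add: sup_eq meet_eq J_closed)
qed

end

lemma two_simps:
  shows "\<Squnion>\<^bsub>two\<^esub>B \<longleftrightarrow> True \<in> B" "(a \<sqinter>\<^bsub>two\<^esub> b) \<longleftrightarrow> a \<and> b" "\<top>\<^bsub>two\<^esub>"
proof -
  have U: "Upper two B = {u. True \<in> B \<longrightarrow> u}" for B
    by (simp add: Upper_def two_def all_bool_eq)
  have l: "least two l (Upper two B) \<longleftrightarrow> l = (True \<in> B)" for l B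
    unfolding U by (auto simp: least_def two_def Ball_def all_bool_eq)
  have D: "Lower two B = {u. False \<in> B \<longrightarrow> \<not> u}" for B
    by (auto simp: Lower_def two_def all_bool_eq)
  have g: "greatest two l (Lower two B) \<longleftrightarrow> l = (False \<notin> B)" for l B
    unfolding D by (auto simp: greatest_def two_def Ball_def all_bool_eq)
  show "\<Squnion>\<^bsub>two\<^esub>B \<longleftrightarrow> True \<in> B" unfolding sup_def l by simp
  show "(a \<sqinter>\<^bsub>two\<^esub> b) \<longleftrightarrow> a \<and> b" unfolding meet_def inf_def g by auto
  have "greatest two l (carrier two) \<longleftrightarrow> l" for l
    unfolding greatest_def two_def by (auto simp: le_bool_def)
  then show "\<top>\<^bsub>two\<^esub>" unfolding top_def by (simp add: someI[of "\<lambda>x. x" True])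
qed

section \<open>Points, primes and spatiality\<close>

context set_frame begin

lemma PtD:
  assumes "p \<in> Pt L"
  shows "p E" "a \<in> \<A> \<Longrightarrow> b \<in> \<A> \<Longrightarrow> p (a \<inter> b) \<longleftrightarrow> p a \<and> p b" "A \<subseteq> \<A> \<Longrightarrow> p (J A) \<longleftrightarrow> (\<exists>a \<in> A. p a)"
  using assms unfolding Pt_def frame_mor_def by (auto simp: two_simps top_eq meet_eq sup_eq image_iff)

lemma PtI:
  assumes "p \<in> extensional \<A>" "p E" "\<And>a b. a \<in> \<A> \<Longrightarrow> b \<in> \<A> \<Longrightarrow> p (a \<inter> b) \<longleftrightarrow> p a \<and> p b"
    "\<And>A. A \<subseteq> \<A> \<Longrightarrow> p (J A) \<longleftrightarrow> (\<exists>a \<in> A. p a)"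
  shows "p \<in> Pt L"
  using assms unfolding Pt_def frame_mor_def
  by (auto simp: two_simps top_eq meet_eq sup_eq image_iff) (auto simp: two_def)

text \<open>A point preserves joins, so it vanishes at the join of all elements at which it
  vanishes, and that join is the largest of them. This is what identifies the support of a central
  subcategory with a basic open set.\<close>

lemma Pt_prime:
  assumes "p \<in> Pt L" "U \<in> \<A>" shows "p U \<longleftrightarrow> \<not> U \<subseteq> prime_of L p"
proof -
  have P: "prime_of L p = J {a \<in> \<A>. \<not> p a}" unfolding prime_of_def by (simp add: sup_eq)
  have Pc: "J {a \<in> \<A>. \<not> p a} \<in> \<A>" by (rule J_closed) auto
  have np: "\<not> p (J {a \<in> \<A>. \<not> p a})" using PtD(3)[OF assms(1)] by auto
  show ?thesis
  proof
    assume U: "p U"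
    show "\<not> U \<subseteq> prime_of L p"
    proof
      assume "U \<subseteq> prime_of L p"
      then have "U \<inter> J {a \<in> \<A>. \<not> p a} = U" using P by auto
      then show False using PtD(2)[OF assms(1) assms(2) Pc] U np by simp
    qed
  next
    assume "\<not> U \<subseteq> prime_of L p"
    then show "p U" using J_upper[of "{a \<in> \<A>. \<not> p a}" U] assms P by auto
  qed
qed

lemma spatial:
  assumes chain: "\<And>C. C \<subseteq> \<A> \<Longrightarrow> C \<noteq> {} \<Longrightarrow> (\<And>a b. a \<in> C \<Longrightarrow> b \<in> C \<Longrightarrow> a \<subseteq> b \<or> b \<subseteq> a) \<Longrightarrow> \<Union>C \<in> \<A>"
    and U: "U \<in> \<A>" and V: "V \<in> \<A>" and X: "X \<in> U" "X \<notin> V"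
  shows "\<exists>p \<in> Pt L. p U \<and> \<not> p V"
proof -
  \<comment> \<open>Containing V will make the point vanish at V, and avoiding X, an element of U,
    will make it 1 at U.\<close>
  define \<B> where "\<B> = {P \<in> \<A>. V \<subseteq> P \<and> X \<notin> P}"
  have "\<exists>M \<in> \<B>. \<forall>P \<in> \<B>. M \<subseteq> P \<longrightarrow> P = M"
  proof (rule subset_Zorn_nonempty)
    show "\<B> \<noteq> {}" using V X by (auto simp: \<B>_def)
    fix C assume C: "C \<noteq> {}" "subset.chain \<B> C"
    then have "C \<subseteq> \<B>" "\<And>a b. a \<in> C \<Longrightarrow> b \<in> C \<Longrightarrow> a \<subseteq> b \<or> b \<subseteq> a" by (auto simp: subset_chain_def)
    moreover from this have "\<Union>C \<in> \<A>" using C by (intro chain) (auto simp: \<B>_def)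
    ultimately show "\<Union>C \<in> \<B>" using C by (auto simp: \<B>_def)
  qed
  then obtain P where PB: "P \<in> \<B>" and maxB: "\<And>Q. Q \<in> \<B> \<Longrightarrow> P \<subseteq> Q \<Longrightarrow> Q = P" by blast
  from PB have P: "P \<in> \<A>" "V \<subseteq> P" "X \<notin> P" by (auto simp: \<B>_def)
  have max: "Q = P" if "Q \<in> \<A>" "P \<subseteq> Q" "X \<notin> Q" for Q
    by (rule maxB) (use that P in \<open>auto simp: \<B>_def\<close>)
  have XJ: "X \<in> J {a, P}" if a: "a \<in> \<A>" "\<not> a \<subseteq> P" for a
  proof (rule ccontr)
    assume "X \<notin> J {a, P}"
    moreover have s: "{a, P} \<subseteq> \<A>" using a P by auto
    ultimately have "J {a, P} = P" using J_upper[OF s] by (intro max J_closed) auto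
    then show False using J_upper[OF s, of a] a by auto
  qed
  have prime: "a \<subseteq> P \<or> b \<subseteq> P" if a: "a \<in> \<A>" and b: "b \<in> \<A>" and ab: "a \<inter> b \<subseteq> P" for a b
  proof (rule ccontr)
    assume "\<not> (a \<subseteq> P \<or> b \<subseteq> P)"
    then have "X \<in> J {a, P} \<inter> J {b, P}" using XJ a b by auto
    moreover have Jb: "J {b, P} \<in> \<A>" using b P by (intro J_closed) auto
    \<comment> \<open>The meet of a \<or> P and b \<or> P is expanded by the frame law in one
      variable at a time; every term lies in P.\<close>
    ultimately have X1: "X \<in> J ((\<lambda>x. x \<inter> J {b, P}) ` {a, P})" using distrib[of "{a, P}" "J {b, P}"] a P by auto
    have "J {b, P} \<inter> a \<subseteq> J ((\<lambda>x. x \<inter> a) ` {b, P})" using a b P by (intro distrib) auto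
    also have "\<dots> \<subseteq> P" by (rule J_least) (use a b P ab Int_closed in auto)
    finally have "a \<inter> J {b, P} \<subseteq> P" by auto
    then have "J ((\<lambda>x. x \<inter> J {b, P}) ` {a, P}) \<subseteq> P"
      by (intro J_least) (use a b P Jb Int_closed in auto)
    then show False using X1 P by auto
  qed
  define p where "p = (\<lambda>a \<in> \<A>. \<not> a \<subseteq> P)"
  have "p \<in> Pt L"
  proof (rule PtI)
    show "p \<in> extensional \<A>" by (simp add: p_def)
    show "p E" using E_closed E_greatest[OF U] X P by (auto simp: p_def)
    show "p (a \<inter> b) \<longleftrightarrow> p a \<and> p b" if "a \<in> \<A>" "b \<in> \<A>" for a b
      using that prime[of a b] Int_closed by (auto simp: p_def)
    show "p (J A) \<longleftrightarrow> (\<exists>a \<in> A. p a)" if A: "A \<subseteq> \<A>" for A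
    proof -
      have "J A \<subseteq> P \<longleftrightarrow> (\<forall>a \<in> A. a \<subseteq> P)" using J_upper[OF A] J_least[OF A P(1)] by blast
      then show ?thesis using A J_closed[OF A] by (auto simp: p_def subset_iff)
    qed
  qed
  moreover have "p U" "\<not> p V" using U V X P by (auto simp: p_def)
  ultimately show ?thesis by blast
qed

text \<open>By \<open>Pt_prime\<close> the map sends U to the open set of U, which respects finite
  meets and joins because points do, and it is onto by the definition of the opens. Injectivity is
  where enough points are required, which is \<open>spatial\<close>.\<close>

lemma Opens_frame_iso:
  assumes chain: "\<And>C. C \<subseteq> \<A> \<Longrightarrow> C \<noteq> {} \<Longrightarrow> (\<And>a b. a \<in> C \<Longrightarrow> b \<in> C \<Longrightarrow> a \<subseteq> b \<or> b \<subseteq> a) \<Longrightarrow> \<Union>C \<in> \<A>"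
  shows "frame_iso L (Opens L) (\<lambda>U. \<Union>X \<in> U. {p \<in> Pt L. X \<notin> prime_of L p})"
proof -
  let ?f = "\<lambda>U. \<Union>X \<in> U. {p \<in> Pt L. X \<notin> prime_of L p}"
  have f: "?f U = pt_open L U" if "U \<in> \<A>" for U
    using Pt_prime[OF _ that] by (auto simp: pt_open_def)
  let ?O = "pt_open L ` \<A>"
  have oJ: "pt_open L (J A) = \<Union>(pt_open L ` A)" if "A \<subseteq> \<A>" for A
    using PtD(3)[OF _ that] by (auto simp: pt_open_def)
  have oI: "pt_open L (a \<inter> b) = pt_open L a \<inter> pt_open L b" if "a \<in> \<A>" "b \<in> \<A>" for a b
    using PtD(2)[OF _ that] by (auto simp: pt_open_def)
  have oE: "pt_open L E = Pt L" using PtD(1) by (auto simp: pt_open_def)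
  interpret O: set_frame ?O Union "Pt L"
  proof
    show "\<Union>A \<in> ?O" if A: "A \<subseteq> ?O" for A
    proof -
      obtain B where B: "B \<subseteq> \<A>" "A = pt_open L ` B" using A by (auto simp: subset_image_iff)
      then show ?thesis using oJ[OF B(1)] J_closed[OF B(1)] by (metis imageI)
    qed
    show "a \<inter> b \<in> ?O" if ab: "a \<in> ?O" "b \<in> ?O" for a b
    proof -
      from ab obtain c d where "c \<in> \<A>" "a = pt_open L c" "d \<in> \<A>" "b = pt_open L d" by blast
      then show ?thesis using oI[of c d] Int_closed[of c d] by auto
    qed
    show "Pt L \<in> ?O" using oE E_closed by (metis imageI)
    show "a \<subseteq> Pt L" if "a \<in> ?O" for a using that by (auto simp: pt_open_def)
  qed auto
  have O: "Opens L = incl_order ?O" by (simp add: Opens_def)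
  have sp: "\<exists>p \<in> Pt L. p U \<and> \<not> p V" if "U \<in> \<A>" "V \<in> \<A>" "X \<in> U" "X \<notin> V" for U V X
    by (rule spatial[OF _ that]) (rule chain)
  have inj: "U \<subseteq> V" if UV: "U \<in> \<A>" "V \<in> \<A>" "pt_open L U = pt_open L V" for U V
  proof
    fix X assume X: "X \<in> U"
    show "X \<in> V"
    proof (rule ccontr)
      assume "X \<notin> V"
      then obtain p where "p \<in> Pt L" "p U" "\<not> p V" using sp[OF UV(1,2) X] by blast
      then have "p \<in> pt_open L U" "p \<notin> pt_open L V" by (auto simp: pt_open_def)
      then show False using UV by simp
    qed
  qed
  have bij: "bij_betw ?f \<A> ?O"
  proof -
    have "inj_on (pt_open L) \<A>" using inj by (auto intro!: inj_onI)
    then have "bij_betw (pt_open L) \<A> ?O" by (simp add: bij_betw_def)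
    then show ?thesis using f by (subst bij_betw_cong[where g = "pt_open L"]) auto
  qed
  have mor: "frame_mor L (Opens L) ?f"
    unfolding frame_mor_def O
  proof (intro conjI ballI allI impI)
    show "?f \<in> carrier L \<rightarrow> carrier (incl_order ?O)" using f by auto
    show "?f \<top>\<^bsub>L\<^esub> = \<top>\<^bsub>incl_order ?O\<^esub>" using f[OF E_closed] oE by (simp add: top_eq O.top_eq)
    show "?f (a \<sqinter>\<^bsub>L\<^esub> b) = ?f a \<sqinter>\<^bsub>incl_order ?O\<^esub> ?f b" if "a \<in> carrier L" "b \<in> carrier L" for a b
      using that f oI Int_closed by (simp add: meet_eq O.meet_eq)
    show "?f (\<Squnion>\<^bsub>L\<^esub>A) = \<Squnion>\<^bsub>incl_order ?O\<^esub> (?f ` A)" if "A \<subseteq> carrier L" for A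
    proof -
      have "?f ` A = pt_open L ` A" using f that by (intro image_cong) auto
      moreover have "pt_open L ` A \<subseteq> ?O" using that by auto
      ultimately show ?thesis using that f[OF J_closed] oJ by (simp add: sup_eq O.sup_eq)
    qed
  qed
  show ?thesis unfolding frame_iso_def using frame_L O.frame_L mor bij by (simp add: O)
qed

end

lemma (in triangulated_category) central_frame_iso:
  "frame_iso (ZThick T) (Opens (ZThick T)) (supp_cent T)"
proof -
  let ?J = "\<lambda>A. thick_hull T (\<Union>A)"
  interpret Z: set_frame "{U. central T U}" ?J "?J {U. central T U}"
  proof
    show "?J A \<in> {U. central T U}" if "A \<subseteq> {U. central T U}" for A using that central_join by auto
    show "a \<subseteq> ?J A" if "a \<in> A" for a A using that thick_hull_superset[of "\<Union>A"] by auto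
    show "?J A \<subseteq> b" if "b \<in> {U. central T U}" "\<And>a. a \<in> A \<Longrightarrow> a \<subseteq> b" for A b
      using that central_thick by (intro thick_hull_least) auto
    show "a \<inter> b \<in> {U. central T U}" if "a \<in> {U. central T U}" "b \<in> {U. central T U}" for a b
      using that central_Int by auto
    show "?J A \<inter> b \<subseteq> ?J ((\<lambda>x. x \<inter> b) ` A)" if "A \<subseteq> {U. central T U}" "b \<in> {U. central T U}" for A b
      using that central_thick by (intro central_distrib) auto
    show "?J {U. central T U} \<in> {U. central T U}" using central_join by auto
    show "a \<subseteq> ?J {U. central T U}" if "a \<in> {U. central T U}" for a
      using that thick_hull_superset[of "\<Union>{U. central T U}"] by auto
  qed
  have "supp_cent T = (\<lambda>U. \<Union>X \<in> U. {p \<in> Pt Z.L. X \<notin> prime_of Z.L p})"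
    unfolding supp_cent_def supp_cent_obj_def Spc_cent_def ZThick_def by auto
  moreover have "frame_iso Z.L (Opens Z.L) (\<lambda>U. \<Union>X \<in> U. {p \<in> Pt Z.L. X \<notin> prime_of Z.L p})"
  proof (rule Z.Opens_frame_iso)
    fix C assume C: "C \<subseteq> {U. central T U}" "C \<noteq> {}" "\<And>a b. a \<in> C \<Longrightarrow> b \<in> C \<Longrightarrow> a \<subseteq> b \<or> b \<subseteq> a"
    \<comment> \<open>The union of a chain is already thick, so it equals its own join and is
      central as a join of central subcategories.\<close>
    have "\<Union>C \<in> Thick T" using C central_thick by (intro thick_chain_Union) auto
    then have "?J C = \<Union>C" using thick_hull_superset[of "\<Union>C"] thick_hull_least[of "\<Union>C" "\<Union>C"] by auto
    then show "\<Union>C \<in> {U. central T U}" using central_join[of C] C by auto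
  qed
  ultimately show ?thesis by (simp add: ZThick_def)
qed

section \<open>Calculus of fractions\<close>

locale verdier = triangulated_category T for T :: "('o, 'm) tcat" (structure) +
  fixes S :: "'o set"
  assumes subcat: "triangulated_subcategory T S"
begin

abbreviation W where "W \<equiv> cone_in T S"

lemma W_arr [simp]: "s \<in> W \<Longrightarrow> s \<in> Arr T"
  unfolding cone_in_def using tri_simps(1) by blast

lemma fibreE:
  assumes "h \<in> Arr T" obtains w g where "(w, h, g) \<in> Tri T"
proof -
  obtain x y where "(h, x, y) \<in> Tri T" using coneE[OF assms] by blast
  then show ?thesis using rotate_back that by metis
qed

lemma W_I: "(s, g, h) \<in> Tri T \<Longrightarrow> Cod T g \<in> S \<Longrightarrow> s \<in> W"
  by (auto simp: cone_in_def)

lemma W_E: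
  assumes "s \<in> W" obtains g h where "(s, g, h) \<in> Tri T" "Cod T g \<in> S"
  using assms by (auto simp: cone_in_def)

text \<open>The fibre of h has cone \<open>Cod T h\<close>, hence lies in W, and h vanishes on
  it.\<close>

lemma killE:
  assumes "h \<in> Arr T" "Cod T h \<in> S"
  obtains w where "w \<in> W" "Cod T w = Dom T h" "h \<cdot> w = Nul T (Dom T w) (Cod T h)"
proof -
  obtain w g where t: "(w, h, g) \<in> Tri T" using fibreE assms by blast
  show ?thesis by (rule that[of w]) (use W_I[OF t] tri_simps[OF t] tri_comp[OF t] assms in auto)
qed

lemma idn_W [simp]: "X \<in> Obj T \<Longrightarrow> Idn T X \<in> W"
proof -
  assume X: "X \<in> Obj T"
  obtain Z where z: "zero_object T Z" using zero_exists by blast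
  then have "Z \<in> S" "Z \<in> Obj T" using subcat_zero[OF subcat] zero_object_iff by blast+
  then show ?thesis using W_I[OF zero_tri(1)[OF z X]] X by simp
qed

lemma iso_W:
  assumes "iso_arr T s" shows "s \<in> W"
proof -
  have s: "s \<in> Arr T" using assms by (simp add: iso_arr_def)
  obtain Z where z: "zero_object T Z" using zero_exists by blast
  then have Z: "Z \<in> S" "Z \<in> Obj T" using subcat_zero[OF subcat] zero_object_iff by blast+
  have "(s, Nul T (Cod T s) Z, Nul T Z (Sho T (Dom T s))) \<in> Tri T"
  proof (rule iso_closed[OF zero_tri(1)[OF z, of "Dom T s"]])
    show "Dom T s \<in> Obj T" using s by simp
    show "candidate_triangle T (s, Nul T (Cod T s) Z, Nul T Z (Sho T (Dom T s)))"
      using s Z by (simp add: candidate_triangle_def)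
    have "triangle_mor T (Idn T (Dom T s), Nul T (Dom T s) Z, Nul T Z (Sho T (Dom T s)))
      (s, Nul T (Cod T s) Z, Nul T Z (Sho T (Dom T s))) (Idn T (Dom T s), s, Idn T Z)"
      using s Z by (simp add: triangle_mor_def Hom_iff)
    then show "triangles_isomorphic T (Idn T (Dom T s), Nul T (Dom T s) Z, Nul T Z (Sho T (Dom T s)))
      (s, Nul T (Cod T s) Z, Nul T Z (Sho T (Dom T s)))"
      unfolding triangles_isomorphic_def using assms iso_idn Z s dom_obj by blast
  qed
  then show ?thesis using W_I Z s by simp
qed

lemma octahedron:
  assumes "f \<in> Arr T" "Cod T f = Dom T g" "(f, f1, f2) \<in> Tri T" "(g, g1, g2) \<in> Tri T" "(g \<cdot> f, k1, k2) \<in> Tri T"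
  obtains u v w where "(u, v, w) \<in> Tri T" "Dom T u = Cod T f1" "Cod T u = Cod T k1" "Cod T v = Cod T g1"
    "u \<cdot> f1 = k1 \<cdot> g" "v \<cdot> k1 = g1"
proof -
  obtain u v where "(u, v, Sha T f1 \<cdot> g2) \<in> Tri T" "u \<in> Hom T (Cod T f1) (Cod T k1)" "v \<in> Hom T (Cod T k1) (Cod T g1)"
    "u \<cdot> f1 = k1 \<cdot> g" "v \<cdot> k1 = g1" using TR4[OF assms(2-5)] by blast
  then show ?thesis using that by (auto simp: Hom_iff)
qed

text \<open>By the octahedral axiom the cone of the composite is an extension of the two
  cones.\<close>

lemma cmp_W [simp]:
  assumes "s \<in> W" "t \<in> W" "Cod T s = Dom T t" shows "t \<cdot> s \<in> W"
proof -
  obtain f1 f2 where f: "(s, f1, f2) \<in> Tri T" "Cod T f1 \<in> S" using W_E assms by blast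
  obtain g1 g2 where g: "(t, g1, g2) \<in> Tri T" "Cod T g1 \<in> S" using W_E assms by blast
  obtain k1 k2 where k: "(t \<cdot> s, k1, k2) \<in> Tri T" using coneE[of "t \<cdot> s"] assms by auto
  obtain u v w where u: "(u, v, w) \<in> Tri T" "Dom T u = Cod T f1" "Cod T u = Cod T k1" "Cod T v = Cod T g1"
    using octahedron[OF W_arr[OF assms(1)] assms(3) f(1) g(1) k] by metis
  have "Cod T k1 \<in> S" using subcat_mid[OF subcat u(1)] u f g by simp
  then show ?thesis using W_I[OF k] by simp
qed

text \<open>Restrict f along a map of W on which its composite into the cone of s vanishes; the
  restriction lifts through s.\<close>

lemma ore:
  assumes "s \<in> W" "f \<in> Arr T" "Cod T f = Cod T s"
  obtains w k where "w \<in> W" "k \<in> Arr T" "Dom T w = Dom T k" "Cod T w = Dom T f" "Cod T k = Dom T s" "f \<cdot> w = s \<cdot> k"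
proof -
  obtain g h where t: "(s, g, h) \<in> Tri T" "Cod T g \<in> S" using W_E assms by blast
  note ts = tri_simps[OF t(1)]
  obtain w where w: "w \<in> W" "Cod T w = Dom T f" "(g \<cdot> f) \<cdot> w = Nul T (Dom T w) (Cod T g)"
    by (rule killE[of "g \<cdot> f"]) (use ts assms t in auto)
  obtain k where "k \<in> Arr T" "Dom T k = Dom T (f \<cdot> w)" "Cod T k = Dom T s" "s \<cdot> k = f \<cdot> w"
    by (rule weak_kernel[OF t(1), of "f \<cdot> w"]) (use ts assms w in auto)
  then show ?thesis using that[of w k] w assms by simp
qed

text \<open>The difference of the two maps lifts to the fibre of s, whose source is an object of S,
  and the lift is killed by \<open>killE\<close>.\<close>

lemma cancel:
  assumes "s \<in> W" "f \<in> Arr T" "f' \<in> Arr T" "Cod T f = Dom T s" "Cod T f' = Dom T s" "Dom T f = Dom T f'"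
    "s \<cdot> f = s \<cdot> f'"
  obtains t where "t \<in> W" "Cod T t = Dom T f'" "f \<cdot> t = f' \<cdot> t"
proof -
  obtain g h where t: "(s, g, h) \<in> Tri T" "Cod T g \<in> S" using W_E assms by blast
  note ts = tri_simps[OF t(1)]
  obtain i e where i: "(i, s, e \<cdot> g) \<in> Tri T" "Dom T i = Usho T (Cod T g)" using rotate_back[OF t(1)] by metis
  note its = tri_simps[OF i(1)]
  let ?d = "Add T f (Neg T f')"
  have d: "?d \<in> Arr T" "Dom T ?d = Dom T f'" "Cod T ?d = Dom T s" using assms by auto
  have "s \<cdot> ?d = Nul T (Dom T ?d) (Dom T (e \<cdot> g))" using assms its by (simp add: cmp_add)
  then obtain m where m: "m \<in> Arr T" "Dom T m = Dom T ?d" "Cod T m = Dom T i" "i \<cdot> m = ?d"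
    by (rule weak_kernel[OF i(1), rotated 2]) (use d in auto)
  have "Dom T i \<in> S" using i t subcat_usho[OF subcat] ts by simp
  then obtain w where w: "w \<in> W" "Cod T w = Dom T m" "m \<cdot> w = Nul T (Dom T w) (Cod T m)"
    using killE[of m] m by auto
  have "?d \<cdot> w = i \<cdot> (m \<cdot> w)" using m(1-3) w(1,2) its by (simp add: m(4)[symmetric])
  also have "\<dots> = Nul T (Dom T w) (Dom T s)" using w m(1-3) its by simp
  finally have "Add T (f \<cdot> w) (Neg T (f' \<cdot> w)) = Nul T (Dom T w) (Dom T s)"
    using assms(1-6) w(1,2) m(2) d by (simp add: add_cmp)
  then have "f \<cdot> w = f' \<cdot> w"
    using diff_nul_eq[of "f \<cdot> w" "f' \<cdot> w"] assms(1-6) w(1,2) m(2) d by simp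
  then show ?thesis using that[of w] w m d by simp
qed

end

section \<open>Presheaves and classes of fractions\<close>

definition presheaf :: "('o, 'm) tcat \<Rightarrow> ('o, 'm, 'g) psh \<Rightarrow> bool" where
  "presheaf T F \<longleftrightarrow>
     (\<forall>X \<in> Obj T. comm_group (Ev F X) \<and> (\<forall>a \<in> carrier (Ev F X). Re F (Idn T X) a = a)) \<and>
     (\<forall>f \<in> Arr T. Re F f \<in> hom (Ev F (Cod T f)) (Ev F (Dom T f))) \<and>
     (\<forall>f \<in> Arr T. \<forall>g \<in> Arr T. Cod T f = Dom T g \<longrightarrow>
        (\<forall>a \<in> carrier (Ev F (Cod T g)). Re F (g \<cdot>\<^bsub>T\<^esub> f) a = Re F f (Re F g a)))"

lemma cohomological_presheaf: "cohomological T F \<Longrightarrow> presheaf T F"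
  by (auto simp: cohomological_def presheaf_def)

lemma presheafD:
  assumes "presheaf T F"
  shows "X \<in> Obj T \<Longrightarrow> comm_group (Ev F X)"
    and "X \<in> Obj T \<Longrightarrow> a \<in> carrier (Ev F X) \<Longrightarrow> Re F (Idn T X) a = a"
    and "f \<in> Arr T \<Longrightarrow> a \<in> carrier (Ev F (Cod T f)) \<Longrightarrow> Re F f a \<in> carrier (Ev F (Dom T f))"
    and "f \<in> Arr T \<Longrightarrow> a \<in> carrier (Ev F (Cod T f)) \<Longrightarrow> b \<in> carrier (Ev F (Cod T f)) \<Longrightarrow>
      Re F f (a \<otimes>\<^bsub>Ev F (Cod T f)\<^esub> b) = Re F f a \<otimes>\<^bsub>Ev F (Dom T f)\<^esub> Re F f b"
    and "f \<in> Arr T \<Longrightarrow> g \<in> Arr T \<Longrightarrow> Cod T f = Dom T g \<Longrightarrow> a \<in> carrier (Ev F (Cod T g)) \<Longrightarrow>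
      Re F (g \<cdot>\<^bsub>T\<^esub> f) a = Re F f (Re F g a)"
  using assms by (auto simp: presheaf_def hom_def)

lemma (in category) presheaf_group_hom:
  assumes "presheaf T F" "f \<in> Arr T" shows "group_hom (Ev F (Cod T f)) (Ev F (Dom T f)) (Re F f)"
proof -
  interpret G: comm_group "Ev F (Cod T f)" using assms(2) presheafD(1)[OF assms(1)] by simp
  interpret H: comm_group "Ev F (Dom T f)" using assms(2) presheafD(1)[OF assms(1)] by simp
  show ?thesis by unfold_locales (use assms in \<open>auto simp: presheaf_def\<close>)
qed

lemma (in category) presheaf_one:
  assumes "presheaf T F" "f \<in> Arr T" shows "Re F f \<one>\<^bsub>Ev F (Cod T f)\<^esub> = \<one>\<^bsub>Ev F (Dom T f)\<^esub>"
  using group_hom.hom_one[OF presheaf_group_hom[OF assms]] .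

lemma (in category) presheaf_inv:
  assumes "presheaf T F" "f \<in> Arr T" "a \<in> carrier (Ev F (Cod T f))"
  shows "Re F f (inv\<^bsub>Ev F (Cod T f)\<^esub> a) = inv\<^bsub>Ev F (Dom T f)\<^esub> (Re F f a)"
  using group_hom.hom_inv[OF presheaf_group_hom[OF assms(1,2)] assms(3)] .

text \<open>A roof (s, f) with target Y is a fraction of the functor represented by Y. Arrows of the
  quotient category and elements of localized functors thus share one equivalence relation.\<close>

definition yoneda :: "('o, 'm) tcat \<Rightarrow> 'o \<Rightarrow> ('o, 'm, 'm) psh" where
  "yoneda T Y = \<lparr>Ev = (\<lambda>X. Homgrp T X Y), Re = (\<lambda>u f. f \<cdot>\<^bsub>T\<^esub> u)\<rparr>"

lemma yoneda_simps [simp]: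
  "carrier (Ev (yoneda T Y) X) = Hom T X Y" "mult (Ev (yoneda T Y) X) = Add T" "one (Ev (yoneda T Y) X) = Nul T X Y"
  "Re (yoneda T Y) u f = f \<cdot>\<^bsub>T\<^esub> u"
  by (auto simp: yoneda_def Homgrp_def)

lemma (in additive_category) yoneda_presheaf: "Y \<in> Obj T \<Longrightarrow> presheaf T (yoneda T Y)"
  unfolding presheaf_def
  by (auto simp: hom_def Hom_iff add_cmp) (auto simp: yoneda_def hom_group)

section \<open>The equivalence relation on fractions\<close>

context verdier begin

text \<open>The pair (s, a) stands for the fraction a / s, an element of the filtered colimit of
  F(X') over the maps s from X' to X with cone in S. As in \<open>frac\<close>, it is the composite
  s u that is asked to lie in W.\<close>

definition rel :: "('o, 'm, 'g) psh \<Rightarrow> 'm \<Rightarrow> 'g \<Rightarrow> 'm \<Rightarrow> 'g \<Rightarrow> bool" where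
  "rel F s a s' a' \<longleftrightarrow> (\<exists>u \<in> Arr T. \<exists>v \<in> Arr T. Dom T u = Dom T v \<and> Cod T u = Dom T s \<and> Cod T v = Dom T s' \<and>
     s \<cdot> u = s' \<cdot> v \<and> s \<cdot> u \<in> W \<and> Re F u a = Re F v a')"

definition elt :: "('o, 'm, 'g) psh \<Rightarrow> 'm \<Rightarrow> 'g \<Rightarrow> bool" where
  "elt F s a \<longleftrightarrow> s \<in> W \<and> a \<in> carrier (Ev F (Dom T s))"

definition cls :: "('o, 'm, 'g) psh \<Rightarrow> 'm \<Rightarrow> 'g \<Rightarrow> ('m \<times> 'g) set" where
  "cls F s a = {(s', a'). elt F s' a' \<and> rel F s a s' a'}"

lemma relI:
  assumes "u \<in> Arr T" "v \<in> Arr T" "Dom T u = Dom T v" "Cod T u = Dom T s" "Cod T v = Dom T s'"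
     "s \<cdot> u = s' \<cdot> v" "s \<cdot> u \<in> W" "Re F u a = Re F v a'"
  shows "rel F s a s' a'"
  unfolding rel_def using assms by blast

lemma relE:
  assumes "rel F s a s' a'"
  obtains u v where "u \<in> Arr T" "v \<in> Arr T" "Dom T u = Dom T v" "Cod T u = Dom T s" "Cod T v = Dom T s'"
     "s \<cdot> u = s' \<cdot> v" "s \<cdot> u \<in> W" "Re F u a = Re F v a'"
  using assms unfolding rel_def by blast

lemma rel_refl:
  assumes "s \<in> W" shows "rel F s a s a"
  by (rule relI[of "Idn T (Dom T s)" "Idn T (Dom T s)"]) (use assms in auto)

lemma rel_sym: "rel F s a s' a' \<Longrightarrow> rel F s' a' s a"
  unfolding rel_def by metis

lemma rel_refine:
  assumes "presheaf T F" "elt F s a" "u \<in> Arr T" "Cod T u = Dom T s" "s \<cdot> u \<in> W"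
  shows "rel F s a (s \<cdot> u) (Re F u a)" "elt F (s \<cdot> u) (Re F u a)"
proof -
  show "elt F (s \<cdot> u) (Re F u a)" using assms presheafD(3)[OF assms(1), of u a] by (simp add: elt_def)
  show "rel F s a (s \<cdot> u) (Re F u a)"
    by (rule relI[of u "Idn T (Dom T u)"])
      (use assms presheafD(2,3)[OF assms(1)] in \<open>auto simp: elt_def\<close>)
qed

text \<open>The common source of well-definedness: with identity denominators it gives the
  restriction of classes along arrows of T, and for represented functors it gives the composition of
  roofs. Both Ore squares are brought to a common source, where the arrows into the sources of t and
  t0 have equal composites with t and t0. Cancelling t and then t0 makes both arrows factor through
  the given comparison (c, d) of the two fractions.\<close>

lemma rel_act:
  assumes F: "presheaf T F"
    and p: "s \<in> W" "s0 \<in> W" "f \<in> Arr T" "f0 \<in> Arr T" "Dom T f = Dom T s" "Dom T f0 = Dom T s0"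
      "p \<in> Arr T" "q \<in> Arr T" "Dom T p = Dom T q" "Cod T p = Dom T s" "Cod T q = Dom T s0"
      "s \<cdot> p = s0 \<cdot> q" "s \<cdot> p \<in> W" "f \<cdot> p = f0 \<cdot> q"
    and r: "rel F t x t0 x0" and t: "elt F t x" "elt F t0 x0"
    and u: "u \<in> W" "k \<in> Arr T" "Dom T u = Dom T k" "Cod T u = Dom T f" "Cod T k = Dom T t" "f \<cdot> u = t \<cdot> k"
    and u0: "u0 \<in> W" "k0 \<in> Arr T" "Dom T u0 = Dom T k0" "Cod T u0 = Dom T f0" "Cod T k0 = Dom T t0" "f0 \<cdot> u0 = t0 \<cdot> k0"
  shows "rel F (s \<cdot> u) (Re F k x) (s0 \<cdot> u0) (Re F k0 x0)"
proof -
  have t': "t \<in> W" "t0 \<in> W" "x \<in> carrier (Ev F (Dom T t))" "x0 \<in> carrier (Ev F (Dom T t0))"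
    using t by (auto simp: elt_def)
  obtain c d where c: "c \<in> Arr T" "d \<in> Arr T" "Dom T c = Dom T d" "Cod T c = Dom T t" "Cod T d = Dom T t0"
     "t \<cdot> c = t0 \<cdot> d" "t \<cdot> c \<in> W" "Re F c x = Re F d x0" using r by (rule relE)
  have cod_t: "Cod T t = Cod T f" "Cod T t0 = Cod T f0" "Cod T f = Cod T f0"
    using cmp_simps(3)[of k t] cmp_simps(3)[of u f] cmp_simps(3)[of k0 t0] cmp_simps(3)[of u0 f0]
      cmp_simps(3)[of p f] cmp_simps(3)[of q f0] u u0 t' p by auto
  obtain w1 k1 where 1: "w1 \<in> W" "k1 \<in> Arr T" "Dom T w1 = Dom T k1" "Cod T w1 = Dom T p" "Cod T k1 = Dom T u"
    "p \<cdot> w1 = u \<cdot> k1" by (rule ore[of u p]) (use u p in auto)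
  obtain w2 k2 where 2: "w2 \<in> W" "k2 \<in> Arr T" "Dom T w2 = Dom T k2" "Cod T w2 = Dom T (q \<cdot> w1)" "Cod T k2 = Dom T u0"
    "(q \<cdot> w1) \<cdot> w2 = u0 \<cdot> k2" by (rule ore[of u0 "q \<cdot> w1"]) (use u0 p 1 in auto)
  define e where "e = k1 \<cdot> w2"
  define m where "m = w1 \<cdot> w2"
  have m: "m \<in> W" "Dom T m = Dom T k2" "Cod T m = Dom T p" using 1 2 p by (auto simp: m_def)
  have e: "e \<in> Arr T" "Dom T e = Dom T k2" "Cod T e = Dom T u" using 1 2 p by (auto simp: e_def)
  have ue: "u \<cdot> e = p \<cdot> m"
    unfolding e_def m_def using cmp_reduce[OF 1(6), of w2] 1 2(1-5) p(7-11) u(1) by simp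
  have ue': "u0 \<cdot> k2 = q \<cdot> m" unfolding m_def using 2 1(1-5) p by simp
  have tke: "t \<cdot> (k \<cdot> e) = t0 \<cdot> (k0 \<cdot> k2)"
  proof -
    have "t \<cdot> (k \<cdot> e) = f \<cdot> (u \<cdot> e)" using cmp_reduce[OF u(6), of e] u e p t' by simp
    also have "\<dots> = f \<cdot> (p \<cdot> m)" by (simp only: ue)
    also have "\<dots> = f0 \<cdot> (q \<cdot> m)" using cmp_reduce[OF p(14), of m] m p by simp
    also have "\<dots> = f0 \<cdot> (u0 \<cdot> k2)" by (simp only: ue')
    also have "\<dots> = t0 \<cdot> (k0 \<cdot> k2)" using cmp_reduce[OF u0(6), of k2] u0 2 p t' by simp
    finally show ?thesis .
  qed
  define h where "h = t \<cdot> (k \<cdot> e)"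
  have h: "h \<in> Arr T" "Dom T h = Dom T k2" "Cod T h = Cod T t" using u e t' by (auto simp: h_def)
  obtain w3 l where 3: "w3 \<in> W" "l \<in> Arr T" "Dom T w3 = Dom T l" "Cod T w3 = Dom T h" "Cod T l = Dom T (t \<cdot> c)"
    "h \<cdot> w3 = (t \<cdot> c) \<cdot> l" by (rule ore[of "t \<cdot> c" h]) (use h c(1-5,7) t' in auto)
  have l: "Cod T l = Dom T c" using 3(5) c(1-5) t' by simp
  have "t \<cdot> (k \<cdot> (e \<cdot> w3)) = t \<cdot> (c \<cdot> l)"
    using 3(6) 3(1-4) u(1-5) e t' c(1-5) l h(2) by (simp add: h_def)
  then obtain z where z: "z \<in> W" "Cod T z = Dom T (c \<cdot> l)" "(k \<cdot> (e \<cdot> w3)) \<cdot> z = (c \<cdot> l) \<cdot> z"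
    by (rule cancel[rotated -2]) (use 3(1-4) u(1-5) e t' c(1-5) l h(2) in auto)
  have zc: "Cod T z = Dom T l" using z l 3 c by simp
  have "t0 \<cdot> (d \<cdot> (l \<cdot> z)) = t \<cdot> ((c \<cdot> l) \<cdot> z)"
    using cmp_reduce[OF c(6), of "l \<cdot> z"] c(1-5) 3(2) l z(1) zc t' by simp
  also have "\<dots> = t \<cdot> ((k \<cdot> (e \<cdot> w3)) \<cdot> z)" by (simp only: z(3))
  also have "\<dots> = t0 \<cdot> (k0 \<cdot> (k2 \<cdot> (w3 \<cdot> z)))"
    using cmp_reduce[OF tke, of "w3 \<cdot> z"] 3(1-4) u(1-5) e t' c(1-5) l h(2) z(1) zc u0(1-5) 2(1-5) by simp
  finally have "t0 \<cdot> (d \<cdot> (l \<cdot> z)) = t0 \<cdot> (k0 \<cdot> (k2 \<cdot> (w3 \<cdot> z)))" .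
  then obtain z' where z': "z' \<in> W" "Cod T z' = Dom T (k0 \<cdot> (k2 \<cdot> (w3 \<cdot> z)))"
    "(d \<cdot> (l \<cdot> z)) \<cdot> z' = (k0 \<cdot> (k2 \<cdot> (w3 \<cdot> z))) \<cdot> z'"
    by (rule cancel[rotated -2]) (use 3(1-4) e t' c(1-5) l h(2) z(1) zc u0(1-5) 2(1-5) in auto)
  define v where "v = w3 \<cdot> (z \<cdot> z')"
  have zc': "Cod T z' = Dom T z" using z' 3(1-4) e t' c(1-5) l h(2) z(1) zc u0(1-5) 2(1-5) by simp
  have v: "v \<in> W" "Dom T v = Dom T z'" "Cod T v = Dom T k2" using 3(1-4) z(1) zc z'(1) zc' h(2) by (auto simp: v_def)
  define y where "y = l \<cdot> (z \<cdot> z')"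
  have y: "y \<in> Arr T" "Dom T y = Dom T z'" "Cod T y = Dom T c" using 3(1-4) z(1) zc z'(1) zc' l by (auto simp: y_def)
  have key1: "k \<cdot> (e \<cdot> v) = c \<cdot> y"
    unfolding v_def y_def
    using cmp_reduce[OF z(3), of z'] 3(1-4) u(1-5) e c(1-5) l h(2) z(1) zc z'(1) zc' by simp
  have key2: "k0 \<cdot> (k2 \<cdot> v) = d \<cdot> y"
    unfolding v_def y_def
    using z'(3) 3(1-4) u0(1-5) 2(1-5) c(1-5) l h(2) z(1) zc z'(1) zc' by simp
  have seq: "(s \<cdot> u) \<cdot> (e \<cdot> v) = (s0 \<cdot> u0) \<cdot> (k2 \<cdot> v)"
  proof -
    have "(s \<cdot> u) \<cdot> (e \<cdot> v) = s \<cdot> ((u \<cdot> e) \<cdot> v)" using u(1-5) e v p(1-11) by simp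
    also have "\<dots> = (s \<cdot> p) \<cdot> (m \<cdot> v)" unfolding ue using m v p(1-11) by simp
    also have "\<dots> = (s0 \<cdot> q) \<cdot> (m \<cdot> v)" by (simp only: p(12))
    also have "\<dots> = s0 \<cdot> ((u0 \<cdot> k2) \<cdot> v)" unfolding ue' using m v p(1-11) by simp
    also have "\<dots> = (s0 \<cdot> u0) \<cdot> (k2 \<cdot> v)" using u0(1-5) 2(1-5) v p(1-11) by simp
    finally show ?thesis .
  qed
  have sW: "(s \<cdot> u) \<cdot> (e \<cdot> v) \<in> W"
  proof -
    have "(s \<cdot> u) \<cdot> (e \<cdot> v) = s \<cdot> ((u \<cdot> e) \<cdot> v)" using u(1-5) e v p(1-11) by simp
    also have "\<dots> = (s \<cdot> p) \<cdot> (m \<cdot> v)" unfolding ue using m v p(1-11) by simp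
    also have "\<dots> \<in> W" by (rule cmp_W) (use p(1-11,13) m v in simp_all)
    finally show ?thesis .
  qed
  have a1: "Re F (e \<cdot> v) (Re F k x) = Re F y (Re F c x)"
  proof -
    have "Re F (e \<cdot> v) (Re F k x) = Re F (k \<cdot> (e \<cdot> v)) x"
      using presheafD(5)[OF F, of "e \<cdot> v" k x] u e v t' by simp
    also have "\<dots> = Re F y (Re F c x)" unfolding key1
      using presheafD(5)[OF F, of y c x] y c t' by simp
    finally show ?thesis .
  qed
  have a2: "Re F (k2 \<cdot> v) (Re F k0 x0) = Re F y (Re F d x0)"
  proof -
    have "Re F (k2 \<cdot> v) (Re F k0 x0) = Re F (k0 \<cdot> (k2 \<cdot> v)) x0"
      using presheafD(5)[OF F, of "k2 \<cdot> v" k0 x0] u0 2 v t' by simp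
    also have "\<dots> = Re F y (Re F d x0)" unfolding key2
      using presheafD(5)[OF F, of y d x0] y c t' by simp
    finally show ?thesis .
  qed
  show ?thesis
    by (rule relI[OF _ _ _ _ _ seq sW]) (use a1 a2 c(8) u u0 e v 2 p in auto)
qed

text \<open>The two comparisons meet over s'. An Ore square makes their composites with s' equal,
  and s' is then cancelled.\<close>

lemma rel_trans:
  assumes F: "presheaf T F" and e: "elt F s a" "elt F s' a'" "elt F s'' a''"
    and r: "rel F s a s' a'" "rel F s' a' s'' a''"
  shows "rel F s a s'' a''"
proof -
  obtain u v where u: "u \<in> Arr T" "v \<in> Arr T" "Dom T u = Dom T v" "Cod T u = Dom T s" "Cod T v = Dom T s'"
     "s \<cdot> u = s' \<cdot> v" "s \<cdot> u \<in> W" "Re F u a = Re F v a'" using r(1) by (rule relE)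
  obtain u' v' where u': "u' \<in> Arr T" "v' \<in> Arr T" "Dom T u' = Dom T v'" "Cod T u' = Dom T s'" "Cod T v' = Dom T s''"
     "s' \<cdot> u' = s'' \<cdot> v'" "s' \<cdot> u' \<in> W" "Re F u' a' = Re F v' a''" using r(2) by (rule relE)
  have s: "s \<in> W" "s' \<in> W" "s'' \<in> W" "a \<in> carrier (Ev F (Dom T s))" "a' \<in> carrier (Ev F (Dom T s'))"
    "a'' \<in> carrier (Ev F (Dom T s''))" using e by (auto simp: elt_def)
  obtain w k where w: "w \<in> W" "k \<in> Arr T" "Dom T w = Dom T k" "Cod T w = Dom T (s' \<cdot> v)" "Cod T k = Dom T (s' \<cdot> u')"
    "(s' \<cdot> v) \<cdot> w = (s' \<cdot> u') \<cdot> k" by (rule ore[of "s' \<cdot> u'" "s' \<cdot> v"]) (use u(1-5) u'(1-5,7) s in auto)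
  have w': "Cod T w = Dom T v" "Cod T k = Dom T u'" using w(4,5) u(1-5) u'(1-5) s by auto
  have "s' \<cdot> (v \<cdot> w) = s' \<cdot> (u' \<cdot> k)" using w(6) w(1-3) w' u(1-5) u'(1-5) s by simp
  then obtain z where z: "z \<in> W" "Cod T z = Dom T (u' \<cdot> k)" "(v \<cdot> w) \<cdot> z = (u' \<cdot> k) \<cdot> z"
    by (rule cancel[rotated -2]) (use w(1-3) w' u(1-5) u'(1-5) s in auto)
  have zc: "Cod T z = Dom T k" using z w(2) w' u' by simp
  have 1: "s \<cdot> (u \<cdot> (w \<cdot> z)) = s' \<cdot> (v \<cdot> (w \<cdot> z))"
    using cmp_reduce[OF u(6), of "w \<cdot> z"] u(1-5) w(1-3) w' z(1) zc s by simp
  have 2: "s' \<cdot> (u' \<cdot> (k \<cdot> z)) = s'' \<cdot> (v' \<cdot> (k \<cdot> z))"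
    using cmp_reduce[OF u'(6), of "k \<cdot> z"] u'(1-5) w(1-3) w' z(1) zc s by simp
  have vz: "v \<cdot> (w \<cdot> z) = u' \<cdot> (k \<cdot> z)" using z(3) w(1-3) w' z(1) zc u(1-5) u'(1-5) by simp
  have W: "s \<cdot> (u \<cdot> (w \<cdot> z)) \<in> W"
  proof -
    have "(s \<cdot> u) \<cdot> (w \<cdot> z) \<in> W" by (rule cmp_W) (use u(1-5,7) w(1-3) w' z(1) zc s in simp_all)
    then show ?thesis using u(1-5) w(1-3) w' z(1) zc s by simp
  qed
  have R: "Re F (g \<cdot> f) x = Re F f (Re F g x)"
    if "f \<in> Arr T" "g \<in> Arr T" "Cod T f = Dom T g" "x \<in> carrier (Ev F (Cod T g))" for f g x
    using presheafD(5)[OF F] that by blast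
  have "Re F (u \<cdot> (w \<cdot> z)) a = Re F (v \<cdot> (w \<cdot> z)) a'"
    using R[of "w \<cdot> z" u a] R[of "w \<cdot> z" v a'] u(1-5,8) w(1-3) w' z(1) zc s by simp
  also have "\<dots> = Re F (v' \<cdot> (k \<cdot> z)) a''" unfolding vz
    using R[of "k \<cdot> z" u' a'] R[of "k \<cdot> z" v' a''] u'(1-5,8) w(1-3) w' z(1) zc s by simp
  finally have e1: "Re F (u \<cdot> (w \<cdot> z)) a = Re F (v' \<cdot> (k \<cdot> z)) a''" .
  have e2: "s \<cdot> (u \<cdot> (w \<cdot> z)) = s'' \<cdot> (v' \<cdot> (k \<cdot> z))" using 1 2 vz by simp
  show ?thesis
    by (rule relI[OF _ _ _ _ _ e2 W e1]) (use u(1-5) u'(1-5) w(1-3) w' z(1) zc in auto)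
qed

lemma cls_eq:
  assumes F: "presheaf T F" and e: "elt F s a" "elt F s' a'"
  shows "cls F s a = cls F s' a' \<longleftrightarrow> rel F s a s' a'"
proof
  assume "cls F s a = cls F s' a'"
  moreover have "(s', a') \<in> cls F s' a'" using e rel_refl[of s'] by (auto simp: cls_def elt_def)
  ultimately show "rel F s a s' a'" by (auto simp: cls_def)
next
  assume r: "rel F s a s' a'"
  show "cls F s a = cls F s' a'"
    unfolding cls_def using rel_trans[OF F] r rel_sym[OF r] e by blast
qed

lemma cls_self: "elt F s a \<Longrightarrow> (s, a) \<in> cls F s a"
  using rel_refl[of s] by (auto simp: cls_def elt_def)

lemma frac_rel: "frac T S s f = {(s', f') \<in> roofs T S. rel (yoneda T Y) s f s' f'}"
  unfolding frac_def rel_def yoneda_simps by blast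

lemma elt_yoneda: "elt (yoneda T Y) s f \<longleftrightarrow> s \<in> W \<and> f \<in> Arr T \<and> Dom T f = Dom T s \<and> Cod T f = Y"
  by (auto simp: elt_def Hom_iff)

text \<open>The class \<open>frac\<close> does not mention a target, but equivalent roofs have the
  same one, so it is a class of fractions of the functor represented by
  \<open>Cod T f\<close>.\<close>

lemma frac_cls:
  assumes "s \<in> W" "f \<in> Arr T" "Dom T f = Dom T s"
  shows "frac T S s f = cls (yoneda T (Cod T f)) s f"
proof -
  have "(s', f') \<in> roofs T S \<longleftrightarrow> elt (yoneda T (Cod T f)) s' f'" if r: "rel (yoneda T (Cod T f)) s f s' f'" for s' f'
  proof -
    obtain u v where u: "u \<in> Arr T" "v \<in> Arr T" "Dom T u = Dom T v" "Cod T u = Dom T s" "Cod T v = Dom T s'"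
     "f \<cdot> u = f' \<cdot> v" using r by (rule relE) auto
    have "Cod T f' = Cod T f" if "f' \<in> Arr T" "Dom T s' = Dom T f'"
      using cmp_simps(3)[of u f] cmp_simps(3)[of v f'] u assms that by simp
    then show ?thesis unfolding roofs_def elt_yoneda by auto
  qed
  then show ?thesis unfolding frac_rel[where Y = "Cod T f"] cls_def by blast
qed

end

section \<open>Localization of a cohomological functor\<close>

text \<open>Elementwise characterization of F -> L_S F as a colimit over maps with cone in S. Being
  invariant under isomorphism, it passes from the model made of fractions to any left adjoint; the
  two functors may take values in different types.\<close>

definition localization ::
  "('o, 'm) tcat \<Rightarrow> 'o set \<Rightarrow> ('o, 'm, 'g) psh \<Rightarrow> ('o, 'm, 'h) psh \<Rightarrow> ('o \<Rightarrow> 'g \<Rightarrow> 'h) \<Rightarrow> bool" where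
  "localization T S F G \<eta> \<longleftrightarrow> cohomological T G \<and> psh_hom T F G \<eta> \<and>
     (\<forall>s \<in> cone_in T S. bij_betw (Re G s) (carrier (Ev G (Cod T s))) (carrier (Ev G (Dom T s)))) \<and>
     (\<forall>X \<in> Obj T. \<forall>x \<in> carrier (Ev G X). \<exists>s \<in> cone_in T S. Cod T s = X \<and>
        (\<exists>a \<in> carrier (Ev F (Dom T s)). Re G s x = \<eta> (Dom T s) a)) \<and>
     (\<forall>X \<in> Obj T. \<forall>a \<in> carrier (Ev F X). \<eta> X a = \<one>\<^bsub>Ev G X\<^esub> \<longrightarrow>
        (\<exists>s \<in> cone_in T S. Cod T s = X \<and> Re F s a = \<one>\<^bsub>Ev F (Dom T s)\<^esub>))"

section \<open>The functor of fractions\<close>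

context verdier begin

definition LC :: "('o, 'm, 'g) psh \<Rightarrow> 'o \<Rightarrow> ('m \<times> 'g) set set" where
  "LC F X = {cls F s a | s a. elt F s a \<and> Cod T s = X}"

definition lmult :: "('o, 'm, 'g) psh \<Rightarrow> ('m \<times> 'g) set \<Rightarrow> ('m \<times> 'g) set \<Rightarrow> ('m \<times> 'g) set" where
  "lmult F c d = \<Union>{cls F s (a \<otimes>\<^bsub>Ev F (Dom T s)\<^esub> b) | s a b. (s, a) \<in> c \<and> (s, b) \<in> d}"

definition lre :: "('o, 'm, 'g) psh \<Rightarrow> 'm \<Rightarrow> ('m \<times> 'g) set \<Rightarrow> ('m \<times> 'g) set" where
  "lre F f c = \<Union>{cls F t (Re F k a) | s a t k. (s, a) \<in> c \<and> t \<in> W \<and> k \<in> Arr T \<and> Dom T t = Dom T k \<and>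
     Cod T t = Dom T f \<and> Cod T k = Dom T s \<and> f \<cdot> t = s \<cdot> k}"

definition lpsh :: "('o, 'm, 'g) psh \<Rightarrow> ('o, 'm, ('m \<times> 'g) set) psh" where
  "lpsh F = \<lparr>Ev = (\<lambda>X. \<lparr>carrier = LC F X, mult = lmult F, one = cls F (Idn T X) \<one>\<^bsub>Ev F X\<^esub>\<rparr>), Re = lre F\<rparr>"

lemma lpsh_simps [simp]:
  "carrier (Ev (lpsh F) X) = LC F X" "mult (Ev (lpsh F) X) = lmult F"
  "one (Ev (lpsh F) X) = cls F (Idn T X) \<one>\<^bsub>Ev F X\<^esub>" "Re (lpsh F) = lre F"
  by (auto simp: lpsh_def)

lemma cls_memD:
  assumes "(s', a') \<in> cls F s a" "elt F s a"
  shows "elt F s' a'" "Cod T s' = Cod T s" "rel F s a s' a'"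
proof -
  show e: "elt F s' a'" and r: "rel F s a s' a'" using assms by (auto simp: cls_def)
  obtain u v where u: "u \<in> Arr T" "v \<in> Arr T" "Dom T u = Dom T v" "Cod T u = Dom T s" "Cod T v = Dom T s'"
    "s \<cdot> u = s' \<cdot> v" using r by (rule relE) auto
  then show "Cod T s' = Cod T s" using cmp_simps(3)[of u s] cmp_simps(3)[of v s'] e assms(2) by (simp add: elt_def)
qed

text \<open>The comparisons of the two factors differ in general. An Ore square and two
  cancellations, of s and of s', produce one comparison that serves both.\<close>

lemma rel_mult:
  assumes F: "presheaf T F" and e: "elt F s a" "elt F s b" "elt F s' a'" "elt F s' b'"
    and r: "rel F s a s' a'" "rel F s b s' b'"
  shows "rel F s (a \<otimes>\<^bsub>Ev F (Dom T s)\<^esub> b) s' (a' \<otimes>\<^bsub>Ev F (Dom T s')\<^esub> b')"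
proof -
  obtain u v where u: "u \<in> Arr T" "v \<in> Arr T" "Dom T u = Dom T v" "Cod T u = Dom T s" "Cod T v = Dom T s'"
     "s \<cdot> u = s' \<cdot> v" "s \<cdot> u \<in> W" "Re F u a = Re F v a'" using r(1) by (rule relE)
  obtain u' v' where u': "u' \<in> Arr T" "v' \<in> Arr T" "Dom T u' = Dom T v'" "Cod T u' = Dom T s" "Cod T v' = Dom T s'"
     "s \<cdot> u' = s' \<cdot> v'" "s \<cdot> u' \<in> W" "Re F u' b = Re F v' b'" using r(2) by (rule relE)
  have s: "s \<in> W" "s' \<in> W" "a \<in> carrier (Ev F (Dom T s))" "a' \<in> carrier (Ev F (Dom T s'))"
    "b \<in> carrier (Ev F (Dom T s))" "b' \<in> carrier (Ev F (Dom T s'))" using e by (auto simp: elt_def)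
  obtain w k where w: "w \<in> W" "k \<in> Arr T" "Dom T w = Dom T k" "Cod T w = Dom T (s \<cdot> u)" "Cod T k = Dom T (s \<cdot> u')"
    "(s \<cdot> u) \<cdot> w = (s \<cdot> u') \<cdot> k" by (rule ore[of "s \<cdot> u'" "s \<cdot> u"]) (use u(1-5) u'(1-5,7) s in auto)
  have w': "Cod T w = Dom T u" "Cod T k = Dom T u'" using w(4,5) u(1-5) u'(1-5) s by auto
  have "s \<cdot> (u \<cdot> w) = s \<cdot> (u' \<cdot> k)" using w(6) w(1-3) w' u(1-5) u'(1-5) s by simp
  then obtain z where z: "z \<in> W" "Cod T z = Dom T (u' \<cdot> k)" "(u \<cdot> w) \<cdot> z = (u' \<cdot> k) \<cdot> z"
    by (rule cancel[rotated -2]) (use w(1-3) w' u(1-5) u'(1-5) s in auto)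
  have zc: "Cod T z = Dom T k" using z w(2) w' u'(1-5) by simp
  have uz: "u \<cdot> (w \<cdot> z) = u' \<cdot> (k \<cdot> z)" using z(3) w(1-3) w' z(1) zc u(1-5) u'(1-5) by simp
  have "s' \<cdot> (v \<cdot> (w \<cdot> z)) = s \<cdot> (u \<cdot> (w \<cdot> z))"
    using cmp_reduce[OF u(6), of "w \<cdot> z"] u(1-5) w(1-3) w' z(1) zc s by simp
  also have "\<dots> = s' \<cdot> (v' \<cdot> (k \<cdot> z))"
    unfolding uz using cmp_reduce[OF u'(6), of "k \<cdot> z"] u'(1-5) w(1-3) w' z(1) zc s by simp
  finally have sv: "s' \<cdot> (v \<cdot> (w \<cdot> z)) = s' \<cdot> (v' \<cdot> (k \<cdot> z))" .
  then obtain z' where z': "z' \<in> W" "Cod T z' = Dom T (v' \<cdot> (k \<cdot> z))" "(v \<cdot> (w \<cdot> z)) \<cdot> z' = (v' \<cdot> (k \<cdot> z)) \<cdot> z'"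
    by (rule cancel[rotated -2]) (use w(1-3) w' z(1) zc u(1-5) u'(1-5) s in auto)
  define m where "m = w \<cdot> (z \<cdot> z')"
  define n where "n = k \<cdot> (z \<cdot> z')"
  have zc': "Cod T z' = Dom T z" using z'(2) w(2,3) w' z(1) zc u'(1-5) by simp
  have m: "m \<in> W" "Cod T m = Dom T u" "Dom T m = Dom T z'" using w(1-3) w' z(1) zc z'(1) zc' by (auto simp: m_def)
  have n: "n \<in> Arr T" "Cod T n = Dom T u'" "Dom T n = Dom T z'" using w(1-3) w' z(1) zc z'(1) zc' by (auto simp: n_def)
  have um: "u \<cdot> m = u' \<cdot> n" unfolding m_def n_def
    using cmp_reduce[OF uz, of z'] w(1-3) w' z(1) zc z'(1) zc' u(1-5) u'(1-5) by simp
  have vm: "v \<cdot> m = v' \<cdot> n" unfolding m_def n_def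
    using z'(3) w(1-3) w' z(1) zc z'(1) zc' u(1-5) u'(1-5) by simp
  have R: "Re F (g \<cdot> f) x = Re F f (Re F g x)"
    if "f \<in> Arr T" "g \<in> Arr T" "Cod T f = Dom T g" "x \<in> carrier (Ev F (Cod T g))" for f g x
    using presheafD(5)[OF F] that by blast
  have A: "Re F (u \<cdot> m) a = Re F (v \<cdot> m) a'"
    using R[of m u a] R[of m v a'] m u(1-5,8) s by simp
  have B: "Re F (u \<cdot> m) b = Re F (v \<cdot> m) b'"
    unfolding um vm using R[of n u' b] R[of n v' b'] n u'(1-5,8) s by simp
  have e1: "Re F (u \<cdot> m) (a \<otimes>\<^bsub>Ev F (Dom T s)\<^esub> b) = Re F (v \<cdot> m) (a' \<otimes>\<^bsub>Ev F (Dom T s')\<^esub> b')"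
    using presheafD(4)[OF F, of "u \<cdot> m" a b] presheafD(4)[OF F, of "v \<cdot> m" a' b'] A B m u(1-5) s by simp
  have e2: "s \<cdot> (u \<cdot> m) = s' \<cdot> (v \<cdot> m)" using cmp_reduce[OF u(6), of m] u(1-5) m s by simp
  have "(s \<cdot> u) \<cdot> m \<in> W" by (rule cmp_W) (use u(1-5,7) m s in simp_all)
  then have e3: "s \<cdot> (u \<cdot> m) \<in> W" using u(1-5) m s by simp
  show ?thesis by (rule relI[OF _ _ _ _ _ e2 e3 e1]) (use u(1-5) m in auto)
qed

lemma elt_mult: "presheaf T F \<Longrightarrow> elt F s a \<Longrightarrow> elt F s b \<Longrightarrow> elt F s (a \<otimes>\<^bsub>Ev F (Dom T s)\<^esub> b)"
proof -
  assume F: "presheaf T F" and e: "elt F s a" "elt F s b"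
  interpret comm_group "Ev F (Dom T s)" using presheafD(1)[OF F] e by (simp add: elt_def)
  show ?thesis using e by (simp add: elt_def)
qed

lemma lmult_cls:
  assumes F: "presheaf T F" and e: "elt F s a" "elt F s b"
  shows "lmult F (cls F s a) (cls F s b) = cls F s (a \<otimes>\<^bsub>Ev F (Dom T s)\<^esub> b)"
proof -
  have "cls F s' (a' \<otimes>\<^bsub>Ev F (Dom T s')\<^esub> b') = cls F s (a \<otimes>\<^bsub>Ev F (Dom T s)\<^esub> b)"
    if m: "(s', a') \<in> cls F s a" "(s', b') \<in> cls F s b" for s' a' b'
  proof -
    note 1 = cls_memD[OF m(1) e(1)] and 2 = cls_memD[OF m(2) e(2)]
    have "rel F s (a \<otimes>\<^bsub>Ev F (Dom T s)\<^esub> b) s' (a' \<otimes>\<^bsub>Ev F (Dom T s')\<^esub> b')"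
      by (rule rel_mult[OF F e 1(1) 2(1) 1(3) 2(3)])
    then show ?thesis using cls_eq[OF F] elt_mult[OF F] e 1 2 by metis
  qed
  moreover have "(s, a) \<in> cls F s a" "(s, b) \<in> cls F s b"
    using cls_self[OF e(1)] cls_self[OF e(2)] .
  ultimately show ?thesis unfolding lmult_def by blast
qed

lemma cls_refine:
  assumes F: "presheaf T F" and e: "elt F s a" and u: "u \<in> Arr T" "Cod T u = Dom T s" "s \<cdot> u \<in> W"
  shows "cls F s a = cls F (s \<cdot> u) (Re F u a)" "elt F (s \<cdot> u) (Re F u a)"
  using rel_refine[OF F e u] cls_eq[OF F e] by auto

lemma common_denominator:
  assumes F: "presheaf T F" and e: "elt F s a" "elt F t b" "Cod T s = Cod T t"
  obtains u v where "u \<in> Arr T" "v \<in> Arr T" "Cod T u = Dom T s" "Cod T v = Dom T t" "Dom T u = Dom T v" "s \<cdot> u = t \<cdot> v"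
    "elt F (s \<cdot> u) (Re F u a)" "elt F (s \<cdot> u) (Re F v b)" "Cod T (s \<cdot> u) = Cod T s"
    "cls F s a = cls F (s \<cdot> u) (Re F u a)" "cls F t b = cls F (s \<cdot> u) (Re F v b)"
proof -
  have st: "s \<in> W" "t \<in> W" using e by (auto simp: elt_def)
  obtain w k where w: "w \<in> W" "k \<in> Arr T" "Dom T w = Dom T k" "Cod T w = Dom T s" "Cod T k = Dom T t" "s \<cdot> w = t \<cdot> k"
    by (rule ore[of t s]) (use st e in auto)
  have 0: "s \<cdot> w \<in> W" by (rule cmp_W) (use w(1,4) st in auto)
  have 1: "cls F s a = cls F (s \<cdot> w) (Re F w a)" "elt F (s \<cdot> w) (Re F w a)"
    using cls_refine[OF F e(1) _ w(4) 0] w(1) by auto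
  have tk: "t \<cdot> k \<in> W" using 0 w(6) by simp
  have 2: "cls F t b = cls F (s \<cdot> w) (Re F k b)" "elt F (s \<cdot> w) (Re F k b)"
    using cls_refine[OF F e(2) w(2,5) tk] w(6) by auto
  show ?thesis by (rule that[of w k]) (use 1 2 w st e(3) in auto)
qed

lemma LC_I: "elt F s a \<Longrightarrow> Cod T s = X \<Longrightarrow> cls F s a \<in> LC F X"
  by (auto simp: LC_def)

lemma LC_E:
  assumes "c \<in> LC F X" obtains s a where "c = cls F s a" "elt F s a" "Cod T s = X"
  using assms by (auto simp: LC_def)

lemma LC_E2:
  assumes F: "presheaf T F" and c: "c \<in> LC F X" "d \<in> LC F X"
  obtains s a b where "c = cls F s a" "d = cls F s b" "elt F s a" "elt F s b" "Cod T s = X"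
proof -
  obtain s a where 1: "c = cls F s a" "elt F s a" "Cod T s = X" using LC_E c(1) by blast
  obtain t b where 2: "d = cls F t b" "elt F t b" "Cod T t = X" using LC_E c(2) by blast
  show ?thesis by (rule common_denominator[OF F 1(2) 2(2)]) (use 1 2 that in metis)+
qed

lemma LC_E3:
  assumes F: "presheaf T F" and c: "c \<in> LC F X" "d \<in> LC F X" "e \<in> LC F X"
  obtains s a b r where "c = cls F s a" "d = cls F s b" "e = cls F s r" "elt F s a" "elt F s b" "elt F s r" "Cod T s = X"
proof -
  obtain s a b where 1: "c = cls F s a" "d = cls F s b" "elt F s a" "elt F s b" "Cod T s = X"
    using LC_E2[OF F c(1,2)] by blast
  obtain t r where 2: "e = cls F t r" "elt F t r" "Cod T t = X" using LC_E c(3) by blast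
  obtain u v where u: "u \<in> Arr T" "v \<in> Arr T" "Cod T u = Dom T s" "Cod T v = Dom T t" "Dom T u = Dom T v" "s \<cdot> u = t \<cdot> v"
    "elt F (s \<cdot> u) (Re F u a)" "elt F (s \<cdot> u) (Re F v r)" "Cod T (s \<cdot> u) = Cod T s"
    "cls F s a = cls F (s \<cdot> u) (Re F u a)" "cls F t r = cls F (s \<cdot> u) (Re F v r)"
    by (rule common_denominator[OF F 1(3) 2(2)]) (use 1 2 in auto)
  have "s \<cdot> u \<in> W" using u(7) by (simp add: elt_def)
  then have "cls F s b = cls F (s \<cdot> u) (Re F u b)" "elt F (s \<cdot> u) (Re F u b)"
    using cls_refine[OF F 1(4) u(1,3)] by auto
  then show ?thesis using that u 1 2 by metis
qed

lemma elt_one: "presheaf T F \<Longrightarrow> s \<in> W \<Longrightarrow> elt F s \<one>\<^bsub>Ev F (Dom T s)\<^esub>"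
proof -
  assume F: "presheaf T F" and s: "s \<in> W"
  interpret comm_group "Ev F (Dom T s)" using presheafD(1)[OF F] s by simp
  show ?thesis using s by (simp add: elt_def)
qed

lemma cls_one:
  assumes F: "presheaf T F" and s: "s \<in> W" "Cod T s = X"
  shows "cls F (Idn T X) \<one>\<^bsub>Ev F X\<^esub> = cls F s \<one>\<^bsub>Ev F (Dom T s)\<^esub>"
proof -
  have X: "X \<in> Obj T" using s by auto
  have "elt F (Idn T X) \<one>\<^bsub>Ev F X\<^esub>" using elt_one[OF F idn_W[OF X]] X by simp
  then have "cls F (Idn T X) \<one>\<^bsub>Ev F X\<^esub> = cls F (Idn T X \<cdot> s) (Re F s \<one>\<^bsub>Ev F X\<^esub>)"
    by (rule cls_refine(1)[OF F]) (use s X in auto)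
  then show ?thesis using presheaf_one[OF F, of s] s by simp
qed

lemma cls_one_iff:
  assumes F: "presheaf T F" and e: "elt F s a"
  shows "cls F s a = cls F (Idn T (Cod T s)) \<one>\<^bsub>Ev F (Cod T s)\<^esub> \<longleftrightarrow>
    (\<exists>u \<in> Arr T. Cod T u = Dom T s \<and> s \<cdot> u \<in> W \<and> Re F u a = \<one>\<^bsub>Ev F (Dom T u)\<^esub>)"
proof
  have s: "s \<in> W" using e by (simp add: elt_def)
  have X: "Cod T s \<in> Obj T" using s by simp
  { assume "cls F s a = cls F (Idn T (Cod T s)) \<one>\<^bsub>Ev F (Cod T s)\<^esub>"
    then have "cls F s a = cls F s \<one>\<^bsub>Ev F (Dom T s)\<^esub>" using cls_one[OF F s] by simp
    then have "rel F s a s \<one>\<^bsub>Ev F (Dom T s)\<^esub>" using cls_eq[OF F e elt_one[OF F s]] by simp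
    then obtain u v where "u \<in> Arr T" "v \<in> Arr T" "Dom T u = Dom T v" "Cod T u = Dom T s" "Cod T v = Dom T s"
     "s \<cdot> u = s \<cdot> v" "s \<cdot> u \<in> W" "Re F u a = Re F v \<one>\<^bsub>Ev F (Dom T s)\<^esub>" by (rule relE)
    then show "\<exists>u \<in> Arr T. Cod T u = Dom T s \<and> s \<cdot> u \<in> W \<and> Re F u a = \<one>\<^bsub>Ev F (Dom T u)\<^esub>"
      using presheaf_one[OF F] by metis }
  assume "\<exists>u \<in> Arr T. Cod T u = Dom T s \<and> s \<cdot> u \<in> W \<and> Re F u a = \<one>\<^bsub>Ev F (Dom T u)\<^esub>"
  then obtain u where u: "u \<in> Arr T" "Cod T u = Dom T s" "s \<cdot> u \<in> W" "Re F u a = \<one>\<^bsub>Ev F (Dom T u)\<^esub>" by blast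
  have "cls F s a = cls F (s \<cdot> u) \<one>\<^bsub>Ev F (Dom T u)\<^esub>" using cls_refine(1)[OF F e u(1-3)] u(4) by simp
  also have "\<dots> = cls F (Idn T (Cod T s)) \<one>\<^bsub>Ev F (Cod T s)\<^esub>" using cls_one[OF F u(3)] u s by simp
  finally show "cls F s a = cls F (Idn T (Cod T s)) \<one>\<^bsub>Ev F (Cod T s)\<^esub>" .
qed

lemma lpsh_group:
  assumes F: "presheaf T F" and X: "X \<in> Obj T" shows "comm_group (Ev (lpsh F) X)"
proof (rule comm_groupI)
  fix x y assume x: "x \<in> carrier (Ev (lpsh F) X)" and y: "y \<in> carrier (Ev (lpsh F) X)"
  then have "x \<in> LC F X" "y \<in> LC F X" by auto
  then obtain s a b where s: "x = cls F s a" "y = cls F s b" "elt F s a" "elt F s b" "Cod T s = X" using LC_E2[OF F] by blast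
  interpret G: comm_group "Ev F (Dom T s)" using presheafD(1)[OF F] s by (simp add: elt_def)
  show "x \<otimes>\<^bsub>Ev (lpsh F) X\<^esub> y \<in> carrier (Ev (lpsh F) X)"
    using s lmult_cls[OF F s(3,4)] LC_I[OF elt_mult[OF F s(3,4)]] by simp
  show "x \<otimes>\<^bsub>Ev (lpsh F) X\<^esub> y = y \<otimes>\<^bsub>Ev (lpsh F) X\<^esub> x"
    using s lmult_cls[OF F s(3,4)] lmult_cls[OF F s(4,3)] G.m_comm[of a b] by (simp add: elt_def)
next
  show "\<one>\<^bsub>Ev (lpsh F) X\<^esub> \<in> carrier (Ev (lpsh F) X)"
    using LC_I[OF elt_one[OF F idn_W[OF X]]] X by simp
next
  fix x y z assume "x \<in> carrier (Ev (lpsh F) X)" "y \<in> carrier (Ev (lpsh F) X)" "z \<in> carrier (Ev (lpsh F) X)"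
  then have "x \<in> LC F X" "y \<in> LC F X" "z \<in> LC F X" by auto
  then obtain s a b c where s: "x = cls F s a" "y = cls F s b" "z = cls F s c" "elt F s a" "elt F s b" "elt F s c"
    using LC_E3[OF F] by metis
  interpret G: comm_group "Ev F (Dom T s)" using presheafD(1)[OF F] s by (simp add: elt_def)
  show "x \<otimes>\<^bsub>Ev (lpsh F) X\<^esub> y \<otimes>\<^bsub>Ev (lpsh F) X\<^esub> z = x \<otimes>\<^bsub>Ev (lpsh F) X\<^esub> (y \<otimes>\<^bsub>Ev (lpsh F) X\<^esub> z)"
    using s lmult_cls[OF F] elt_mult[OF F] G.m_assoc[of a b c] by (simp add: elt_def)
next
  fix x assume "x \<in> carrier (Ev (lpsh F) X)"
  then have "x \<in> LC F X" by simp
  then obtain s a where s: "x = cls F s a" "elt F s a" "Cod T s = X" using LC_E by blast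
  have sW: "s \<in> W" using s by (simp add: elt_def)
  interpret G: comm_group "Ev F (Dom T s)" using presheafD(1)[OF F] sW by simp
  have one: "\<one>\<^bsub>Ev (lpsh F) X\<^esub> = cls F s \<one>\<^bsub>Ev F (Dom T s)\<^esub>" using cls_one[OF F sW s(3)] by simp
  have a: "a \<in> carrier (Ev F (Dom T s))" using s by (simp add: elt_def)
  show "\<one>\<^bsub>Ev (lpsh F) X\<^esub> \<otimes>\<^bsub>Ev (lpsh F) X\<^esub> x = x"
    unfolding one using lmult_cls[OF F elt_one[OF F sW] s(2)] s a by simp
  have i: "elt F s (inv\<^bsub>Ev F (Dom T s)\<^esub> a)" using sW a by (simp add: elt_def)
  show "\<exists>y \<in> carrier (Ev (lpsh F) X). y \<otimes>\<^bsub>Ev (lpsh F) X\<^esub> x = \<one>\<^bsub>Ev (lpsh F) X\<^esub>"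
    unfolding one
    by (rule bexI[of _ "cls F s (inv\<^bsub>Ev F (Dom T s)\<^esub> a)"])
      (use lmult_cls[OF F i s(2)] s a LC_I[OF i] in auto)
qed

lemma lre_cls:
  assumes F: "presheaf T F" and e: "elt F s a" and f: "f \<in> Arr T" "Cod T f = Cod T s"
    and t: "t \<in> W" "k \<in> Arr T" "Dom T t = Dom T k" "Cod T t = Dom T f" "Cod T k = Dom T s" "f \<cdot> t = s \<cdot> k"
  shows "lre F f (cls F s a) = cls F t (Re F k a)" "elt F t (Re F k a)"
proof -
  have E: "elt F t' (Re F k' a')" if "elt F s' a'" "t' \<in> W" "k' \<in> Arr T" "Dom T t' = Dom T k'" "Cod T k' = Dom T s'" for s' a' t' k'
    using presheafD(3)[OF F, of k' a'] that by (simp add: elt_def)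
  show el: "elt F t (Re F k a)" using E[OF e] t by simp
  have "cls F t' (Re F k' a') = cls F t (Re F k a)"
    if m: "(s', a') \<in> cls F s a" and t': "t' \<in> W" "k' \<in> Arr T" "Dom T t' = Dom T k'" "Cod T t' = Dom T f"
      "Cod T k' = Dom T s'" "f \<cdot> t' = s' \<cdot> k'" for s' a' t' k'
  proof -
    note 1 = cls_memD[OF m e]
    \<comment> \<open>The arrow f is regarded as a roof with identity denominator, so that
      \<open>rel_act\<close> applies.\<close>
    let ?i = "Idn T (Dom T f)"
    have X: "Dom T f \<in> Obj T" using f by simp
    have "rel F (?i \<cdot> t) (Re F k a) (?i \<cdot> t') (Re F k' a')"
      by (rule rel_act[OF F, where f = f and f0 = f and p = ?i and q = ?i and t = s and ?t0.0 = s'])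
        (use 1 e f t t' X in \<open>simp_all\<close>)
    then have "rel F t (Re F k a) t' (Re F k' a')" using t t' by simp
    then show ?thesis using cls_eq[OF F el E[OF 1(1) t'(1,2,3,5)]] by simp
  qed
  moreover have "(s, a) \<in> cls F s a" by (rule cls_self[OF e])
  ultimately show "lre F f (cls F s a) = cls F t (Re F k a)" unfolding lre_def using t by blast
qed

lemma square:
  assumes "elt F s a" "f \<in> Arr T" "Cod T f = Cod T s"
  obtains t k where "t \<in> W" "k \<in> Arr T" "Dom T t = Dom T k" "Cod T t = Dom T f" "Cod T k = Dom T s" "f \<cdot> t = s \<cdot> k"
  using ore[of s f] assms by (auto simp: elt_def)

lemma lre_closed:
  assumes F: "presheaf T F" and f: "f \<in> Arr T" and c: "c \<in> LC F (Cod T f)"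
  shows "lre F f c \<in> LC F (Dom T f)"
proof -
  obtain s a where s: "c = cls F s a" "elt F s a" "Cod T s = Cod T f" using LC_E c by blast
  obtain t k where t: "t \<in> W" "k \<in> Arr T" "Dom T t = Dom T k" "Cod T t = Dom T f" "Cod T k = Dom T s" "f \<cdot> t = s \<cdot> k"
    by (rule square[OF s(2) f]) (use s in auto)
  show ?thesis using lre_cls[OF F s(2) f s(3)[symmetric] t] LC_I t s by metis
qed

lemma lpsh_presheaf:
  assumes F: "presheaf T F" shows "presheaf T (lpsh F)"
  unfolding presheaf_def
proof (intro conjI ballI impI)
  show "comm_group (Ev (lpsh F) X)" if "X \<in> Obj T" for X using lpsh_group[OF F that] .
  show "Re (lpsh F) (Idn T X) c = c" if X: "X \<in> Obj T" and c: "c \<in> carrier (Ev (lpsh F) X)" for X c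
  proof -
    obtain s a where s: "c = cls F s a" "elt F s a" "Cod T s = X" using c by (auto simp: LC_def)
    have sW: "s \<in> W" and a: "a \<in> carrier (Ev F (Dom T s))" using s by (auto simp: elt_def)
    have "lre F (Idn T X) (cls F s a) = cls F s (Re F (Idn T (Dom T s)) a)"
      by (rule lre_cls(1)[OF F s(2)]) (use sW s X in auto)
    then show ?thesis using s presheafD(2)[OF F, of "Dom T s" a] sW a by simp
  qed
  show "Re (lpsh F) f \<in> hom (Ev (lpsh F) (Cod T f)) (Ev (lpsh F) (Dom T f))" if f: "f \<in> Arr T" for f
  proof (rule homI)
    show "Re (lpsh F) f c \<in> carrier (Ev (lpsh F) (Dom T f))" if "c \<in> carrier (Ev (lpsh F) (Cod T f))" for c
      using lre_closed[OF F f] that by simp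
    show "Re (lpsh F) f (c \<otimes>\<^bsub>Ev (lpsh F) (Cod T f)\<^esub> d) = Re (lpsh F) f c \<otimes>\<^bsub>Ev (lpsh F) (Dom T f)\<^esub> Re (lpsh F) f d"
      if c: "c \<in> carrier (Ev (lpsh F) (Cod T f))" "d \<in> carrier (Ev (lpsh F) (Cod T f))" for c d
    proof -
      have "c \<in> LC F (Cod T f)" "d \<in> LC F (Cod T f)" using c by auto
      then obtain s a b where s: "c = cls F s a" "d = cls F s b" "elt F s a" "elt F s b" "Cod T s = Cod T f"
        using LC_E2[OF F] by blast
      obtain t k where t: "t \<in> W" "k \<in> Arr T" "Dom T t = Dom T k" "Cod T t = Dom T f" "Cod T k = Dom T s" "f \<cdot> t = s \<cdot> k"
        by (rule square[OF s(3) f]) (use s in auto)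
      note l = lre_cls[OF F _ f s(5)[symmetric] t]
      show ?thesis
        using s l(1)[OF s(3)] l(1)[OF s(4)] l(1)[OF elt_mult[OF F s(3,4)]] lmult_cls[OF F s(3,4)]
          lmult_cls[OF F l(2)[OF s(3)] l(2)[OF s(4)]] presheafD(4)[OF F, of k a b] t by (simp add: elt_def)
    qed
  qed
  show "Re (lpsh F) (g \<cdot> f) c = Re (lpsh F) f (Re (lpsh F) g c)"
    if f: "f \<in> Arr T" "g \<in> Arr T" "Cod T f = Dom T g" and c: "c \<in> carrier (Ev (lpsh F) (Cod T g))" for f g c
  proof -
    obtain s a where s: "c = cls F s a" "elt F s a" "Cod T s = Cod T g" using c by (auto simp: LC_def)
    have sa: "s \<in> W" "a \<in> carrier (Ev F (Dom T s))" using s by (auto simp: elt_def)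
    obtain t k where t: "t \<in> W" "k \<in> Arr T" "Dom T t = Dom T k" "Cod T t = Dom T g" "Cod T k = Dom T s" "g \<cdot> t = s \<cdot> k"
      by (rule square[OF s(2) f(2)]) (use s in auto)
    note l = lre_cls[OF F s(2) f(2) s(3)[symmetric] t]
    obtain t' k' where t': "t' \<in> W" "k' \<in> Arr T" "Dom T t' = Dom T k'" "Cod T t' = Dom T f" "Cod T k' = Dom T t" "f \<cdot> t' = t \<cdot> k'"
      by (rule square[OF l(2) f(1)]) (use f t in auto)
    have l': "lre F f (cls F t (Re F k a)) = cls F t' (Re F k' (Re F k a))"
      by (rule lre_cls[OF F l(2) f(1) _ t']) (use f t in simp)
    have "(g \<cdot> f) \<cdot> t' = s \<cdot> (k \<cdot> k')"
    proof -
      have "(g \<cdot> f) \<cdot> t' = g \<cdot> (f \<cdot> t')" using f t'(1-5) by simp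
      also have "\<dots> = g \<cdot> (t \<cdot> k')" by (simp only: t'(6))
      also have "\<dots> = s \<cdot> (k \<cdot> k')" using cmp_reduce[OF t(6), of k'] f t(1-5) t'(1-5) sa by simp
      finally show ?thesis .
    qed
    then have "lre F (g \<cdot> f) (cls F s a) = cls F t' (Re F (k \<cdot> k') a)"
      by (intro lre_cls(1)[OF F s(2)]) (use f t(1-5) t'(1-5) s in auto)
    then show ?thesis using s l l' presheafD(5)[OF F, of k' k a] t t' sa by simp
  qed
qed

text \<open>The inverse of restriction along r replaces a denominator t by r t. For injectivity, a
  refinement that kills the numerator over the source of r becomes, composed with r, a refinement of
  the original denominator.\<close>

lemma lpsh_inverts:
  assumes F: "presheaf T F" and r: "r \<in> W"
  shows "bij_betw (Re (lpsh F) r) (carrier (Ev (lpsh F) (Cod T r))) (carrier (Ev (lpsh F) (Dom T r)))"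
proof -
  have rA: "r \<in> Arr T" using r by simp
  interpret G: group_hom "Ev (lpsh F) (Cod T r)" "Ev (lpsh F) (Dom T r)" "Re (lpsh F) r"
    using presheaf_group_hom[OF lpsh_presheaf[OF F] rA] .
  have "c = \<one>\<^bsub>Ev (lpsh F) (Cod T r)\<^esub>"
    if c: "c \<in> carrier (Ev (lpsh F) (Cod T r))" and z: "Re (lpsh F) r c = \<one>\<^bsub>Ev (lpsh F) (Dom T r)\<^esub>" for c
  proof -
    obtain s a where s: "c = cls F s a" "elt F s a" "Cod T s = Cod T r" using c by (auto simp: LC_def)
    have sa: "s \<in> W" "a \<in> carrier (Ev F (Dom T s))" using s by (auto simp: elt_def)
    obtain t k where t: "t \<in> W" "k \<in> Arr T" "Dom T t = Dom T k" "Cod T t = Dom T r" "Cod T k = Dom T s" "r \<cdot> t = s \<cdot> k"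
      by (rule square[OF s(2) rA]) (use s in auto)
    note l = lre_cls[OF F s(2) rA s(3)[symmetric] t]
    have "cls F t (Re F k a) = cls F (Idn T (Cod T t)) \<one>\<^bsub>Ev F (Cod T t)\<^esub>" using z s l t by simp
    then obtain u where u: "u \<in> Arr T" "Cod T u = Dom T t" "t \<cdot> u \<in> W" "Re F u (Re F k a) = \<one>\<^bsub>Ev F (Dom T u)\<^esub>"
      using cls_one_iff[OF F l(2)] by blast
    have "s \<cdot> (k \<cdot> u) = r \<cdot> (t \<cdot> u)" using cmp_reduce[OF t(6), of u] u t(1-5) sa r by simp
    also have "\<dots> \<in> W" by (rule cmp_W) (use u t(1-5) r in auto)
    finally have "s \<cdot> (k \<cdot> u) \<in> W" .
    moreover have "Re F (k \<cdot> u) a = \<one>\<^bsub>Ev F (Dom T u)\<^esub>" using presheafD(5)[OF F, of u k a] u t(1-5) sa by simp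
    ultimately have "cls F s a = cls F (Idn T (Cod T s)) \<one>\<^bsub>Ev F (Cod T s)\<^esub>"
      using u t(1-5) sa by (intro cls_one_iff[OF F s(2), THEN iffD2] bexI[of _ "k \<cdot> u"]) auto
    then show ?thesis using s by simp
  qed
  then have inj: "inj_on (Re (lpsh F) r) (carrier (Ev (lpsh F) (Cod T r)))" by (subst G.inj_on_one_iff) auto
  have surj: "d \<in> Re (lpsh F) r ` carrier (Ev (lpsh F) (Cod T r))" if d: "d \<in> carrier (Ev (lpsh F) (Dom T r))" for d
  proof -
    obtain t a where t: "d = cls F t a" "elt F t a" "Cod T t = Dom T r" using d by (auto simp: LC_def)
    have ta: "t \<in> W" "a \<in> carrier (Ev F (Dom T t))" using t by (auto simp: elt_def)
    have e: "elt F (r \<cdot> t) a" using ta t r by (simp add: elt_def)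
    have "lre F r (cls F (r \<cdot> t) a) = cls F t (Re F (Idn T (Dom T t)) a)"
      by (rule lre_cls(1)[OF F e]) (use ta t r in auto)
    then have "Re (lpsh F) r (cls F (r \<cdot> t) a) = d" using t presheafD(2)[OF F, of "Dom T t" a] ta by simp
    moreover have "cls F (r \<cdot> t) a \<in> carrier (Ev (lpsh F) (Cod T r))" using LC_I[OF e] ta t r by simp
    ultimately show ?thesis by (metis imageI)
  qed
  show ?thesis unfolding bij_betw_def using inj surj G.hom_closed by auto
qed

lemma unit_hom:
  assumes F: "presheaf T F" shows "psh_hom T F (lpsh F) (\<lambda>X. cls F (Idn T X))"
  unfolding psh_hom_def
proof (intro conjI ballI)
  have e: "elt F (Idn T X) a" if "X \<in> Obj T" "a \<in> carrier (Ev F X)" for X a using that by (simp add: elt_def)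
  show "cls F (Idn T X) \<in> hom (Ev F X) (Ev (lpsh F) X)" if X: "X \<in> Obj T" for X
    by (rule homI) (use e[OF X] X LC_I[OF e[OF X]] lmult_cls[OF F e[OF X] e[OF X]] in auto)
  show "cls F (Idn T (Dom T f)) (Re F f a) = Re (lpsh F) f (cls F (Idn T (Cod T f)) a)"
    if f: "f \<in> Arr T" "a \<in> carrier (Ev F (Cod T f))" for f a
    using lre_cls(1)[OF F e[OF cod_obj[OF f(1)] f(2)] f(1), of "Idn T (Dom T f)" f] f by simp
qed

text \<open>A fill-in from \<open>TR3\<close> comes without control of its cone. Instead the
  octahedral axiom is applied twice to the diagonal f w = s f': the map from the cone of f' to the
  cone of the diagonal has the cone of s, and the map from there to the cone of f has the suspended
  cone of w.\<close>

lemma W_fill: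
  assumes t: "(f, g, h) \<in> Tri T" "(f', g', h') \<in> Tri T"
    and w: "w \<in> W" "s \<in> W" "Dom T w = Dom T f'" "Cod T w = Dom T f" "Dom T s = Cod T f'" "Cod T s = Cod T f"
    and sq: "f \<cdot> w = s \<cdot> f'"
  obtains z where "z \<in> W" "Dom T z = Cod T g'" "Cod T z = Cod T g" "z \<cdot> g' = g \<cdot> s"
proof -
  note ts = tri_simps[OF t(1)] and ts' = tri_simps[OF t(2)]
  obtain k1 k2 where k: "(f \<cdot> w, k1, k2) \<in> Tri T" using coneE[of "f \<cdot> w"] ts w by auto
  note ks = tri_simps[OF k]
  obtain w1 w2 where w1: "(w, w1, w2) \<in> Tri T" "Cod T w1 \<in> S" using W_E w by blast
  obtain s1 s2 where s1: "(s, s1, s2) \<in> Tri T" "Cod T s1 \<in> S" using W_E w by blast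
  obtain u v x where u: "(u, v, x) \<in> Tri T" "Dom T u = Cod T w1" "Cod T u = Cod T k1" "Cod T v = Cod T g"
    "v \<cdot> k1 = g" using octahedron[OF _ w(4) w1(1) t(1) k] w by (metis W_arr)
  note us = tri_simps[OF u(1)]
  have "Cod T x \<in> S" using us u w1 subcat_sho[OF subcat] by (metis dom_obj)
  then have v: "v \<in> W" using W_I[OF rotate[OF u(1)]] us by simp
  have k': "(s \<cdot> f', k1, k2) \<in> Tri T" using k sq by simp
  obtain u' v' x' where u': "(u', v', x') \<in> Tri T" "Dom T u' = Cod T g'" "Cod T u' = Cod T k1" "Cod T v' = Cod T s1"
    "u' \<cdot> g' = k1 \<cdot> s" using octahedron[OF _ w(5)[symmetric] t(2) s1(1) k'] ts' by metis
  have "u' \<in> W" using W_I[OF u'(1)] u' s1 by simp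
  note us' = tri_simps[OF u'(1)]
  have vd: "Dom T v = Cod T u'" "Dom T v = Cod T k1" using us u u' by auto
  have "(v \<cdot> u') \<cdot> g' = v \<cdot> (k1 \<cdot> s)" using u' us' us vd ts' by simp
  also have "\<dots> = g \<cdot> s" using cmp_reduce1[OF u(5), of s] us vd ks w ts by simp
  finally have "(v \<cdot> u') \<cdot> g' = g \<cdot> s" .
  moreover have "v \<cdot> u' \<in> W" by (rule cmp_W) (use v \<open>u' \<in> W\<close> vd in auto)
  ultimately show ?thesis using that[of "v \<cdot> u'"] u u' vd us us' by simp
qed

text \<open>Exactness of filtered colimits, made concrete. If f kills a / s, then after refinement f
  lifts to an arrow f' into the source of s with a restricted along f' trivial. Exactness of F on
  the triangle of f' gives b on its cone, and \<open>W_fill\<close> supplies a denominator z from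
  this cone to \<open>Cod T g\<close>; the fraction b / z restricts to a / s.\<close>

lemma lpsh_cohomological:
  assumes F: "cohomological T F" shows "cohomological T (lpsh F)"
proof -
  note P = cohomological_presheaf[OF F]
  note L = lpsh_presheaf[OF P]
  have add: "Re (lpsh F) (Add T f g) c = Re (lpsh F) f c \<otimes>\<^bsub>Ev (lpsh F) (Dom T f)\<^esub> Re (lpsh F) g c"
    if f: "f \<in> Arr T" "g \<in> Arr T" "Dom T g = Dom T f" "Cod T g = Cod T f"
      and c: "c \<in> carrier (Ev (lpsh F) (Cod T f))" for f g c
  proof -
    obtain s a where s: "c = cls F s a" "elt F s a" "Cod T s = Cod T f" using c by (auto simp: LC_def)
    have sa: "s \<in> W" "a \<in> carrier (Ev F (Dom T s))" using s by (auto simp: elt_def)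
    obtain t k where t: "t \<in> W" "k \<in> Arr T" "Dom T t = Dom T k" "Cod T t = Dom T f" "Cod T k = Dom T s" "f \<cdot> t = s \<cdot> k"
      by (rule square[OF s(2) f(1)]) (use s in auto)
    \<comment> \<open>A second Ore square, so that f and g act over the common denominator t
      w.\<close>
    obtain w l where w: "w \<in> W" "l \<in> Arr T" "Dom T w = Dom T l" "Cod T w = Dom T t" "Cod T l = Dom T s" "(g \<cdot> t) \<cdot> w = s \<cdot> l"
      by (rule square[OF s(2), of "g \<cdot> t"]) (use s f t(1-5) in auto)
    have tw: "t \<cdot> w \<in> W" by (rule cmp_W) (use t(1-5) w in auto)
    have 1: "f \<cdot> (t \<cdot> w) = s \<cdot> (k \<cdot> w)" using cmp_reduce[OF t(6), of w] f t(1-5) w(1-5) sa by simp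
    have 2: "g \<cdot> (t \<cdot> w) = s \<cdot> l" using w f t(1-5) by simp
    have 3: "Add T f g \<cdot> (t \<cdot> w) = s \<cdot> Add T (k \<cdot> w) l"
      using 1 2 f t(1-5) w(1-5) sa by (simp add: add_cmp cmp_add)
    have D: "Dom T (t \<cdot> w) = Dom T w" using t(1-5) w(1-5) by simp
    have l1: "lre F f c = cls F (t \<cdot> w) (Re F (k \<cdot> w) a)" "elt F (t \<cdot> w) (Re F (k \<cdot> w) a)"
      unfolding s(1) using lre_cls[OF P s(2) f(1) _ tw, of "k \<cdot> w"] 1 f t(1-5) w(1-5) s(3) by auto
    have l2: "lre F g c = cls F (t \<cdot> w) (Re F l a)" "elt F (t \<cdot> w) (Re F l a)"
      unfolding s(1) using lre_cls[OF P s(2) f(2) _ tw, of l] 2 f t(1-5) w(1-5) s(3) by auto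
    have l3: "lre F (Add T f g) c = cls F (t \<cdot> w) (Re F (Add T (k \<cdot> w) l) a)"
      unfolding s(1) by (rule lre_cls(1)[OF P s(2) _ _ tw]) (use 3 f t(1-5) w(1-5) s(3) in auto)
    have "Re F (Add T (k \<cdot> w) l) a = Re F (k \<cdot> w) a \<otimes>\<^bsub>Ev F (Dom T w)\<^esub> Re F l a"
      using F[unfolded cohomological_def, THEN conjunct2, THEN conjunct2, THEN conjunct2, THEN conjunct1,
        rule_format, of "k \<cdot> w" l a] f t(1-5) w(1-5) sa by (simp add: Hom_iff)
    then show ?thesis using l1 l2 l3 lmult_cls[OF P l1(2) l2(2)] D by simp
  qed
  have exact: "Re (lpsh F) g ` carrier (Ev (lpsh F) (Cod T g)) =
      kernel (Ev (lpsh F) (Cod T f)) (Ev (lpsh F) (Dom T f)) (Re (lpsh F) f)" if t: "(f, g, h) \<in> Tri T" for f g h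
  proof
    note ts = tri_simps[OF t]
    show "Re (lpsh F) g ` carrier (Ev (lpsh F) (Cod T g)) \<subseteq>
      kernel (Ev (lpsh F) (Cod T f)) (Ev (lpsh F) (Dom T f)) (Re (lpsh F) f)"
    proof
      fix y assume "y \<in> Re (lpsh F) g ` carrier (Ev (lpsh F) (Cod T g))"
      then obtain x where x: "x \<in> carrier (Ev (lpsh F) (Cod T g))" "y = Re (lpsh F) g x" by blast
      have y: "y \<in> carrier (Ev (lpsh F) (Cod T f))" using presheafD(3)[OF L ts(2) x(1)] x ts by simp
      let ?n = "Nul T (Dom T f) (Cod T g)"
      have n: "?n \<in> Arr T" "Dom T ?n = Dom T f" "Cod T ?n = Cod T g" using ts by auto
      have "Re (lpsh F) f y = Re (lpsh F) (g \<cdot> f) x" using presheafD(5)[OF L ts(1,2,4) x(1)] x by simp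
      also have "g \<cdot> f = ?n" using tri_comp(1)[OF t] ts by simp
      finally have fy: "Re (lpsh F) f y = Re (lpsh F) ?n x" .
      interpret G: comm_group "Ev (lpsh F) (Dom T f)" using presheafD(1)[OF L] ts by simp
      have r: "Re (lpsh F) ?n x \<in> carrier (Ev (lpsh F) (Dom T f))" using presheafD(3)[OF L n(1)] n x by simp
      \<comment> \<open>The zero arrow is its own double, so by additivity its value is an
        idempotent of the group, hence trivial.\<close>
      have "Re (lpsh F) ?n x = Re (lpsh F) ?n x \<otimes>\<^bsub>Ev (lpsh F) (Dom T f)\<^esub> Re (lpsh F) ?n x"
        using add[of ?n ?n x] n x by simp
      then have "Re (lpsh F) ?n x = \<one>\<^bsub>Ev (lpsh F) (Dom T f)\<^esub>" using G.r_cancel_one'[OF r r] by blast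
      then show "y \<in> kernel (Ev (lpsh F) (Cod T f)) (Ev (lpsh F) (Dom T f)) (Re (lpsh F) f)"
        using y fy by (simp add: kernel_def)
    qed
    show "kernel (Ev (lpsh F) (Cod T f)) (Ev (lpsh F) (Dom T f)) (Re (lpsh F) f) \<subseteq>
      Re (lpsh F) g ` carrier (Ev (lpsh F) (Cod T g))"
    proof
      fix y assume "y \<in> kernel (Ev (lpsh F) (Cod T f)) (Ev (lpsh F) (Dom T f)) (Re (lpsh F) f)"
      then have y: "y \<in> LC F (Cod T f)" and fy: "lre F f y = cls F (Idn T (Dom T f)) \<one>\<^bsub>Ev F (Dom T f)\<^esub>"
        by (auto simp: kernel_def)
      obtain s a where s: "y = cls F s a" "elt F s a" "Cod T s = Cod T f" using y by (auto simp: LC_def)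
      have sa: "s \<in> W" "a \<in> carrier (Ev F (Dom T s))" using s by (auto simp: elt_def)
      obtain t' k where t': "t' \<in> W" "k \<in> Arr T" "Dom T t' = Dom T k" "Cod T t' = Dom T f" "Cod T k = Dom T s" "f \<cdot> t' = s \<cdot> k"
        by (rule square[OF s(2) ts(1)]) (use s in auto)
      note l = lre_cls[OF P s(2) ts(1) s(3)[symmetric] t']
      have "cls F t' (Re F k a) = cls F (Idn T (Cod T t')) \<one>\<^bsub>Ev F (Cod T t')\<^esub>" using fy l s t' by simp
      then obtain u where u: "u \<in> Arr T" "Cod T u = Dom T t'" "t' \<cdot> u \<in> W" "Re F u (Re F k a) = \<one>\<^bsub>Ev F (Dom T u)\<^esub>"
        using cls_one_iff[OF P l(2)] by blast
      define f' where "f' = k \<cdot> u"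
      have f': "f' \<in> Arr T" "Dom T f' = Dom T u" "Cod T f' = Dom T s" using u t' by (auto simp: f'_def)
      have sq: "f \<cdot> (t' \<cdot> u) = s \<cdot> f'" unfolding f'_def using cmp_reduce[OF t'(6), of u] u t'(1-5) ts sa by simp
      have fa: "Re F f' a = \<one>\<^bsub>Ev F (Dom T f')\<^esub>"
        unfolding f'(2) unfolding f'_def using presheafD(5)[OF P, of u k a] u t'(1-5) sa by simp
      obtain g' h' where t2: "(f', g', h') \<in> Tri T" using coneE f' by blast
      note ts2 = tri_simps[OF t2]
      have "Re F g' ` carrier (Ev F (Cod T g')) = kernel (Ev F (Cod T f')) (Ev F (Dom T f')) (Re F f')"
        using F t2 unfolding cohomological_def by blast
      moreover have "a \<in> kernel (Ev F (Cod T f')) (Ev F (Dom T f')) (Re F f')" using fa sa f' by (simp add: kernel_def)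
      ultimately obtain b where b: "b \<in> carrier (Ev F (Cod T g'))" "Re F g' b = a" by (metis imageE)
      obtain z where z: "z \<in> W" "Dom T z = Cod T g'" "Cod T z = Cod T g" "z \<cdot> g' = g \<cdot> s"
        by (rule W_fill[OF t t2, of "t' \<cdot> u" s]) (use sq f' u t'(1-5) sa s ts ts2 in auto)
      have ez: "elt F z b" using z b by (simp add: elt_def)
      have "lre F g (cls F z b) = cls F s (Re F g' b)"
        by (rule lre_cls(1)[OF P ez]) (use z ts ts2 sa s f' in auto)
      then have "Re (lpsh F) g (cls F z b) = y" using b s by simp
      moreover have "cls F z b \<in> carrier (Ev (lpsh F) (Cod T g))" using LC_I[OF ez] z by simp
      ultimately show "y \<in> Re (lpsh F) g ` carrier (Ev (lpsh F) (Cod T g))" by (metis imageI)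
    qed
  qed
  show ?thesis unfolding cohomological_def
  proof (intro conjI ballI impI)
    show "comm_group (Ev (lpsh F) X)" if "X \<in> Obj T" for X using presheafD(1)[OF L that] .
    show "Re (lpsh F) (Idn T X) a = a" if "X \<in> Obj T" "a \<in> carrier (Ev (lpsh F) X)" for X a
      using presheafD(2)[OF L that] .
    show "Re (lpsh F) f \<in> hom (Ev (lpsh F) (Cod T f)) (Ev (lpsh F) (Dom T f))" if "f \<in> Arr T" for f
      using L that unfolding presheaf_def by blast
    show "Re (lpsh F) (g \<cdot> f) a = Re (lpsh F) f (Re (lpsh F) g a)"
      if "f \<in> Arr T" "g \<in> Arr T" "Cod T f = Dom T g" "a \<in> carrier (Ev (lpsh F) (Cod T g))" for f g a
      using presheafD(5)[OF L that] .
    show "Re (lpsh F) (Add T f g) a = Re (lpsh F) f a \<otimes>\<^bsub>Ev (lpsh F) (Dom T f)\<^esub> Re (lpsh F) g a"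
      if "f \<in> Arr T" "g \<in> Hom T (Dom T f) (Cod T f)" "a \<in> carrier (Ev (lpsh F) (Cod T f))" for f g a
      using add that unfolding Hom_iff by blast
    show "case t of (f, g, h) \<Rightarrow> Re (lpsh F) g ` carrier (Ev (lpsh F) (Cod T g)) =
      kernel (Ev (lpsh F) (Cod T f)) (Ev (lpsh F) (Dom T f)) (Re (lpsh F) f)" if "t \<in> Tri T" for t
      using exact that by (cases t) blast
  qed
qed

lemma localization_lpsh:
  assumes F: "cohomological T F" shows "localization T S F (lpsh F) (\<lambda>X. cls F (Idn T X))"
  unfolding localization_def
proof (intro conjI ballI impI)
  note P = cohomological_presheaf[OF F]
  show "cohomological T (lpsh F)" by (rule lpsh_cohomological[OF F])
  show "psh_hom T F (lpsh F) (\<lambda>X. cls F (Idn T X))" by (rule unit_hom[OF P])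
  show "bij_betw (Re (lpsh F) s) (carrier (Ev (lpsh F) (Cod T s))) (carrier (Ev (lpsh F) (Dom T s)))" if "s \<in> W" for s
    using lpsh_inverts[OF P that] .
  show "\<exists>s \<in> W. Cod T s = X \<and> (\<exists>a \<in> carrier (Ev F (Dom T s)). Re (lpsh F) s x = cls F (Idn T (Dom T s)) a)"
    if X: "X \<in> Obj T" and x: "x \<in> carrier (Ev (lpsh F) X)" for X x
  proof -
    obtain s a where s: "x = cls F s a" "elt F s a" "Cod T s = X" using x by (auto simp: LC_def)
    have sa: "s \<in> W" "a \<in> carrier (Ev F (Dom T s))" using s by (auto simp: elt_def)
    have "lre F s (cls F s a) = cls F (Idn T (Dom T s)) (Re F (Idn T (Dom T s)) a)"
      by (rule lre_cls(1)[OF P s(2)]) (use sa in auto)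
    also have "Re F (Idn T (Dom T s)) a = a" using presheafD(2)[OF P _ sa(2)] sa by simp
    finally show ?thesis using s sa by auto
  qed
  show "\<exists>s \<in> W. Cod T s = X \<and> Re F s a = \<one>\<^bsub>Ev F (Dom T s)\<^esub>"
    if X: "X \<in> Obj T" and a: "a \<in> carrier (Ev F X)" and z: "cls F (Idn T X) a = \<one>\<^bsub>Ev (lpsh F) X\<^esub>" for X a
  proof -
    have e: "elt F (Idn T X) a" using X a by (simp add: elt_def)
    obtain u where u: "u \<in> Arr T" "Cod T u = X" "Idn T X \<cdot> u \<in> W" "Re F u a = \<one>\<^bsub>Ev F (Dom T u)\<^esub>"
      using z cls_one_iff[OF P e] X by auto
    then show ?thesis by auto
  qed
qed

end

text \<open>For a multiplicative relation, uniqueness of values reduces to triviality over 1: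
  multiply by a value at the inverse. Maps that depend on choices, such as extensions along a
  localization and the connecting map, are obtained in this way, the choices becoming existential
  quantifiers of R.\<close>

lemma additive_relation_hom:
  assumes A: "group A" and B: "group B"
    and dom: "\<And>x y. R x y \<Longrightarrow> x \<in> carrier A \<and> y \<in> carrier B"
    and total: "\<And>x. x \<in> carrier A \<Longrightarrow> \<exists>y. R x y"
    and mult: "\<And>x y x' y'. R x y \<Longrightarrow> R x' y' \<Longrightarrow> R (x \<otimes>\<^bsub>A\<^esub> x') (y \<otimes>\<^bsub>B\<^esub> y')"
    and one: "\<And>y. R \<one>\<^bsub>A\<^esub> y \<Longrightarrow> y = \<one>\<^bsub>B\<^esub>"
  shows "(\<lambda>x. THE y. R x y) \<in> hom A B" "\<And>x y. R x y \<Longrightarrow> (THE y. R x y) = y"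
    "\<And>x. x \<in> carrier A \<Longrightarrow> R x (THE y. R x y)"
proof -
  interpret A: group A by fact
  interpret B: group B by fact
  have uniq: "y = y'" if R: "R x y" "R x y'" for x y y'
  proof -
    have x: "x \<in> carrier A" and y: "y \<in> carrier B" "y' \<in> carrier B" using dom R by auto
    obtain z where z: "R (inv\<^bsub>A\<^esub> x) z" using total x by blast
    then have zB: "z \<in> carrier B" using dom by blast
    have "y \<otimes>\<^bsub>B\<^esub> z = \<one>\<^bsub>B\<^esub>" "y' \<otimes>\<^bsub>B\<^esub> z = \<one>\<^bsub>B\<^esub>"
      using one[of "y \<otimes>\<^bsub>B\<^esub> z"] one[of "y' \<otimes>\<^bsub>B\<^esub> z"] mult[OF R(1) z] mult[OF R(2) z] x by simp_all
    then show ?thesis using B.right_cancel[OF zB y] by simp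
  qed
  show the: "\<And>x y. R x y \<Longrightarrow> (THE y. R x y) = y" using uniq by blast
  show t: "\<And>x. x \<in> carrier A \<Longrightarrow> R x (THE y. R x y)" using total the by metis
  show "(\<lambda>x. THE y. R x y) \<in> hom A B"
  proof (rule homI)
    show "(THE y. R x y) \<in> carrier B" if "x \<in> carrier A" for x using t[OF that] dom by blast
    show "(THE y. R (x \<otimes>\<^bsub>A\<^esub> x') y) = (THE y. R x y) \<otimes>\<^bsub>B\<^esub> (THE y. R x' y)" if "x \<in> carrier A" "x' \<in> carrier A" for x x'
      using the mult t that by blast
  qed
qed

section \<open>Morphisms of functors and the universal property of localizations\<close>

lemma psh_homD:
  assumes "psh_hom T F G \<phi>"
  shows "X \<in> Obj T \<Longrightarrow> a \<in> carrier (Ev F X) \<Longrightarrow> \<phi> X a \<in> carrier (Ev G X)"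
    and "X \<in> Obj T \<Longrightarrow> a \<in> carrier (Ev F X) \<Longrightarrow> b \<in> carrier (Ev F X) \<Longrightarrow>
      \<phi> X (a \<otimes>\<^bsub>Ev F X\<^esub> b) = \<phi> X a \<otimes>\<^bsub>Ev G X\<^esub> \<phi> X b"
    and "f \<in> Arr T \<Longrightarrow> a \<in> carrier (Ev F (Cod T f)) \<Longrightarrow> \<phi> (Dom T f) (Re F f a) = Re G f (\<phi> (Cod T f) a)"
  using assms by (auto simp: psh_hom_def hom_def)

lemma psh_hom_group_hom:
  assumes "psh_hom T F G \<phi>" "presheaf T F" "presheaf T G" "X \<in> Obj T"
  shows "group_hom (Ev F X) (Ev G X) (\<phi> X)"
proof -
  interpret A: comm_group "Ev F X" using presheafD(1)[OF assms(2,4)] .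
  interpret B: comm_group "Ev G X" using presheafD(1)[OF assms(3,4)] .
  show ?thesis by unfold_locales (use assms in \<open>auto simp: psh_hom_def\<close>)
qed

lemma psh_hom_one:
  assumes "psh_hom T F G \<phi>" "presheaf T F" "presheaf T G" "X \<in> Obj T"
  shows "\<phi> X \<one>\<^bsub>Ev F X\<^esub> = \<one>\<^bsub>Ev G X\<^esub>"
  using group_hom.hom_one[OF psh_hom_group_hom[OF assms]] .

lemma (in category) psh_hom_comp:
  assumes "psh_hom T F G \<phi>" "psh_hom T G H \<psi>" shows "psh_hom T F H (mor_comp \<psi> \<phi>)"
  unfolding psh_hom_def mor_comp_def
  using psh_homD[OF assms(1)] psh_homD[OF assms(2)] by (auto intro!: homI)

definition inverts :: "('o, 'm) tcat \<Rightarrow> 'o set \<Rightarrow> ('o, 'm, 'g) psh \<Rightarrow> bool" where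
  "inverts T S H \<longleftrightarrow> (\<forall>s \<in> cone_in T S. bij_betw (Re H s) (carrier (Ev H (Cod T s))) (carrier (Ev H (Dom T s))))"

lemma invertsD:
  assumes "inverts T S H" "s \<in> cone_in T S"
  shows "x \<in> carrier (Ev H (Cod T s)) \<Longrightarrow> y \<in> carrier (Ev H (Cod T s)) \<Longrightarrow> Re H s x = Re H s y \<Longrightarrow> x = y"
    and "z \<in> carrier (Ev H (Dom T s)) \<Longrightarrow> \<exists>x \<in> carrier (Ev H (Cod T s)). Re H s x = z"
proof -
  have b: "bij_betw (Re H s) (carrier (Ev H (Cod T s))) (carrier (Ev H (Dom T s)))"
    using assms by (simp add: inverts_def)
  show "x \<in> carrier (Ev H (Cod T s)) \<Longrightarrow> y \<in> carrier (Ev H (Cod T s)) \<Longrightarrow> Re H s x = Re H s y \<Longrightarrow> x = y"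
    using b by (auto simp: bij_betw_def dest: inj_onD)
  show "z \<in> carrier (Ev H (Dom T s)) \<Longrightarrow> \<exists>x \<in> carrier (Ev H (Cod T s)). Re H s x = z"
    using bij_betw_imp_surj_on[OF b] by (metis imageE)
qed

lemma inverts_mono: "inverts T R H \<Longrightarrow> S \<subseteq> R \<Longrightarrow> inverts T S H"
  unfolding inverts_def cone_in_def by blast

lemma localizationD:
  assumes "localization T S F G \<eta>"
  shows "cohomological T G" "psh_hom T F G \<eta>" "inverts T S G"
    and "X \<in> Obj T \<Longrightarrow> x \<in> carrier (Ev G X) \<Longrightarrow> \<exists>s \<in> cone_in T S. Cod T s = X \<and>
        (\<exists>a \<in> carrier (Ev F (Dom T s)). Re G s x = \<eta> (Dom T s) a)"
    and "X \<in> Obj T \<Longrightarrow> a \<in> carrier (Ev F X) \<Longrightarrow> \<eta> X a = \<one>\<^bsub>Ev G X\<^esub> \<Longrightarrow>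
        \<exists>s \<in> cone_in T S. Cod T s = X \<and> Re F s a = \<one>\<^bsub>Ev F (Dom T s)\<^esub>"
  using assms unfolding localization_def inverts_def by (blast, blast, blast, simp, simp)

context verdier begin

text \<open>Elements x of G and y of H correspond if some restriction along W sends them to the
  images of the same a in F. Existence of y uses that H inverts W. If x = 1, then a dies after a
  further restriction, and injectivity of H along W gives y = 1.\<close>

lemma extension_exists:
  assumes F: "presheaf T F" and L: "localization T S F G \<eta>" and H: "presheaf T H" "inverts T S H"
    and \<phi>: "psh_hom T F H \<phi>"
  obtains \<theta> where "psh_hom T G H \<theta>" "\<And>X a. X \<in> Obj T \<Longrightarrow> a \<in> carrier (Ev F X) \<Longrightarrow> \<theta> X (\<eta> X a) = \<phi> X a"
proof -
  note LD = localizationD[OF L]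
  note G = cohomological_presheaf[OF LD(1)]
  define R where "R = (\<lambda>X x y. x \<in> carrier (Ev G X) \<and> y \<in> carrier (Ev H X) \<and>
    (\<exists>s \<in> W. Cod T s = X \<and> (\<exists>a \<in> carrier (Ev F (Dom T s)). Re G s x = \<eta> (Dom T s) a \<and> Re H s y = \<phi> (Dom T s) a)))"
  have refine: "Re G (s \<cdot> u) x = \<eta> (Dom T u) (Re F u a) \<and> Re H (s \<cdot> u) y = \<phi> (Dom T u) (Re F u a)"
    if s: "s \<in> Arr T" "x \<in> carrier (Ev G (Cod T s))" "y \<in> carrier (Ev H (Cod T s))"
      "a \<in> carrier (Ev F (Dom T s))" "Re G s x = \<eta> (Dom T s) a" "Re H s y = \<phi> (Dom T s) a"
      and u: "u \<in> Arr T" "Cod T u = Dom T s" for s x y a u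
    using s u presheafD(5)[OF G u(1) s(1) u(2) s(2)] presheafD(5)[OF H(1) u(1) s(1) u(2) s(3)]
      psh_homD(3)[OF LD(2) u(1), of a] psh_homD(3)[OF \<phi> u(1), of a] by simp
  have dom: "x \<in> carrier (Ev G X) \<and> y \<in> carrier (Ev H X)" if "R X x y" for X x y using that by (simp add: R_def)
  have total: "\<exists>y. R X x y" if X: "X \<in> Obj T" and x: "x \<in> carrier (Ev G X)" for X x
  proof -
    obtain s a where s: "s \<in> W" "Cod T s = X" "a \<in> carrier (Ev F (Dom T s))" "Re G s x = \<eta> (Dom T s) a"
      using LD(4)[OF X x] by blast
    have "\<phi> (Dom T s) a \<in> carrier (Ev H (Dom T s))" using psh_homD(1)[OF \<phi>] s by simp
    then obtain y where "y \<in> carrier (Ev H X)" "Re H s y = \<phi> (Dom T s) a" using invertsD(2)[OF H(2) s(1)] s by blast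
    then show ?thesis unfolding R_def using s x by blast
  qed
  have mult: "R X (x \<otimes>\<^bsub>Ev G X\<^esub> x') (y \<otimes>\<^bsub>Ev H X\<^esub> y')" if X: "X \<in> Obj T" and r: "R X x y" "R X x' y'" for X x y x' y'
  proof -
    obtain s a where s: "s \<in> W" "Cod T s = X" "a \<in> carrier (Ev F (Dom T s))" "Re G s x = \<eta> (Dom T s) a" "Re H s y = \<phi> (Dom T s) a"
      and xy: "x \<in> carrier (Ev G X)" "y \<in> carrier (Ev H X)" using r(1) by (auto simp: R_def)
    obtain s' a' where s': "s' \<in> W" "Cod T s' = X" "a' \<in> carrier (Ev F (Dom T s'))" "Re G s' x' = \<eta> (Dom T s') a'" "Re H s' y' = \<phi> (Dom T s') a'"
      and xy': "x' \<in> carrier (Ev G X)" "y' \<in> carrier (Ev H X)" using r(2) by (auto simp: R_def)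
    obtain u v where u: "u \<in> W" "v \<in> Arr T" "Dom T u = Dom T v" "Cod T u = Dom T s" "Cod T v = Dom T s'" "s \<cdot> u = s' \<cdot> v"
      by (rule ore[of s' s]) (use s s' in auto)
    define r where "r = s \<cdot> u"
    have rW: "r \<in> W" unfolding r_def by (rule cmp_W) (use u(1-5) s in auto)
    have r: "r \<in> Arr T" "Cod T r = X" "Dom T r = Dom T u" using u(1-5) s by (auto simp: r_def)
    let ?b = "Re F u a" and ?b' = "Re F v a'"
    have b: "?b \<in> carrier (Ev F (Dom T r))" "?b' \<in> carrier (Ev F (Dom T r))"
      using presheafD(3)[OF F, of u a] presheafD(3)[OF F, of v a'] u s s' r by auto
    have e: "Re G r x = \<eta> (Dom T r) ?b" "Re H r y = \<phi> (Dom T r) ?b"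
      using refine[of s x y a u] s xy u r by (auto simp: r_def)
    have rv: "r = s' \<cdot> v" using u by (simp add: r_def)
    have e': "Re G r x' = \<eta> (Dom T r) ?b'" "Re H r y' = \<phi> (Dom T r) ?b'"
      using refine[of s' x' y' a' v] s' xy' u r unfolding rv by auto
    interpret A: comm_group "Ev F (Dom T r)" using presheafD(1)[OF F dom_obj[OF r(1)]] .
    interpret B: comm_group "Ev G X" using presheafD(1)[OF G X] .
    interpret C: comm_group "Ev H X" using presheafD(1)[OF H(1) X] .
    have "Re G r (x \<otimes>\<^bsub>Ev G X\<^esub> x') = \<eta> (Dom T r) (?b \<otimes>\<^bsub>Ev F (Dom T r)\<^esub> ?b')"
      "Re H r (y \<otimes>\<^bsub>Ev H X\<^esub> y') = \<phi> (Dom T r) (?b \<otimes>\<^bsub>Ev F (Dom T r)\<^esub> ?b')"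
      using e e' b xy xy' r presheafD(4)[OF G r(1), of x x'] presheafD(4)[OF H(1) r(1), of y y']
        psh_homD(2)[OF LD(2) dom_obj[OF r(1)] b] psh_homD(2)[OF \<phi> dom_obj[OF r(1)] b] by simp_all
    then show ?thesis unfolding R_def using A.m_closed[OF b] B.m_closed[OF xy(1) xy'(1)] C.m_closed[OF xy(2) xy'(2)] rW r(2) by blast
  qed
  have one: "y = \<one>\<^bsub>Ev H X\<^esub>" if X: "X \<in> Obj T" and r: "R X \<one>\<^bsub>Ev G X\<^esub> y" for X y
  proof -
    obtain s a where s: "s \<in> W" "Cod T s = X" "a \<in> carrier (Ev F (Dom T s))" "Re G s \<one>\<^bsub>Ev G X\<^esub> = \<eta> (Dom T s) a" "Re H s y = \<phi> (Dom T s) a"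
      and y: "y \<in> carrier (Ev H X)" "\<one>\<^bsub>Ev G X\<^esub> \<in> carrier (Ev G X)" using r by (auto simp: R_def)
    have "\<eta> (Dom T s) a = \<one>\<^bsub>Ev G (Dom T s)\<^esub>" using s presheaf_one[OF G, of s] by simp
    then obtain t where t: "t \<in> W" "Cod T t = Dom T s" "Re F t a = \<one>\<^bsub>Ev F (Dom T t)\<^esub>" using LD(5)[of "Dom T s" a] s by auto
    interpret C: comm_group "Ev H X" using presheafD(1)[OF H(1) X] .
    have st: "s \<cdot> t \<in> W" by (rule cmp_W) (use s t in auto)
    have c: "Cod T (s \<cdot> t) = X" "Dom T (s \<cdot> t) = Dom T t" using s t by auto
    have "Re H (s \<cdot> t) y = \<one>\<^bsub>Ev H (Dom T t)\<^esub>"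
      using refine[of s "\<one>\<^bsub>Ev G X\<^esub>" y a t] s y t psh_hom_one[OF \<phi> F H(1), of "Dom T t"] by simp
    moreover have "Re H (s \<cdot> t) \<one>\<^bsub>Ev H X\<^esub> = \<one>\<^bsub>Ev H (Dom T t)\<^esub>" using presheaf_one[OF H(1), of "s \<cdot> t"] st c by simp
    ultimately show ?thesis using invertsD(1)[OF H(2) st, of y "\<one>\<^bsub>Ev H X\<^esub>"] y c by simp
  qed
  define \<theta> where "\<theta> = (\<lambda>X x. THE y. R X x y)"
  have rel: "\<theta> X \<in> hom (Ev G X) (Ev H X)" "\<And>x y. R X x y \<Longrightarrow> \<theta> X x = y" "\<And>x. x \<in> carrier (Ev G X) \<Longrightarrow> R X x (\<theta> X x)"
    if X: "X \<in> Obj T" for X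
  proof -
    have A: "group (Ev G X)" using presheafD(1)[OF G X] comm_group.axioms(2) by blast
    have B: "group (Ev H X)" using presheafD(1)[OF H(1) X] comm_group.axioms(2) by blast
    note h = additive_relation_hom[where R = "R X", OF A B dom total[OF X] mult[OF X] one[OF X]]
    show "\<theta> X \<in> hom (Ev G X) (Ev H X)" unfolding \<theta>_def using h(1) .
    show "\<And>x y. R X x y \<Longrightarrow> \<theta> X x = y" unfolding \<theta>_def using h(2) .
    show "\<And>x. x \<in> carrier (Ev G X) \<Longrightarrow> R X x (\<theta> X x)" unfolding \<theta>_def using h(3) .
  qed
  have nat: "\<theta> (Dom T f) (Re G f x) = Re H f (\<theta> (Cod T f) x)" if f: "f \<in> Arr T" and x: "x \<in> carrier (Ev G (Cod T f))" for f x
  proof -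
    have "R (Cod T f) x (\<theta> (Cod T f) x)" using rel(3) f x by simp
    then obtain s a where s: "s \<in> W" "Cod T s = Cod T f" "a \<in> carrier (Ev F (Dom T s))" "Re G s x = \<eta> (Dom T s) a"
      "Re H s (\<theta> (Cod T f) x) = \<phi> (Dom T s) a"
      and y: "\<theta> (Cod T f) x \<in> carrier (Ev H (Cod T f))" by (auto simp: R_def)
    obtain w k where w: "w \<in> W" "k \<in> Arr T" "Dom T w = Dom T k" "Cod T w = Dom T f" "Cod T k = Dom T s" "f \<cdot> w = s \<cdot> k"
      by (rule ore[OF s(1) f]) (use s in auto)
    have c: "Re F k a \<in> carrier (Ev F (Dom T w))" using presheafD(3)[OF F, of k a] w s by simp
    have "Re G w (Re G f x) = \<eta> (Dom T w) (Re F k a)" "Re H w (Re H f (\<theta> (Cod T f) x)) = \<phi> (Dom T w) (Re F k a)"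
      using refine[of s x "\<theta> (Cod T f) x" a k] s x y w f
        presheafD(5)[OF G, of w f x] presheafD(5)[OF H(1), of w f "\<theta> (Cod T f) x"] by auto
    moreover have "Re G f x \<in> carrier (Ev G (Dom T f))" "Re H f (\<theta> (Cod T f) x) \<in> carrier (Ev H (Dom T f))"
      using presheafD(3)[OF G f x] presheafD(3)[OF H(1) f y] by auto
    ultimately have "R (Dom T f) (Re G f x) (Re H f (\<theta> (Cod T f) x))" unfolding R_def using w c by blast
    then show ?thesis using rel(2) f by simp
  qed
  show ?thesis
  proof (rule that)
    show "psh_hom T G H \<theta>" unfolding psh_hom_def using rel(1) nat by blast
    show "\<theta> X (\<eta> X a) = \<phi> X a" if X: "X \<in> Obj T" and a: "a \<in> carrier (Ev F X)" for X a
    proof (rule rel(2)[OF X])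
      have "\<eta> X a \<in> carrier (Ev G X)" "\<phi> X a \<in> carrier (Ev H X)" using psh_homD(1)[OF LD(2) X a] psh_homD(1)[OF \<phi> X a] by auto
      then show "R X (\<eta> X a) (\<phi> X a)" unfolding R_def
        using X a presheafD(2)[OF G X] presheafD(2)[OF H(1) X] by (intro conjI bexI[of _ "Idn T X"] bexI[of _ a]) auto
    qed
  qed
qed

text \<open>Every element of G comes from F after a restriction along W, and that restriction is
  injective on H.\<close>

lemma extension_unique:
  assumes L: "localization T S F G \<eta>" and H: "inverts T S H"
    and \<theta>: "psh_hom T G H \<theta>" "psh_hom T G H \<theta>'"
    and eq: "\<And>X a. X \<in> Obj T \<Longrightarrow> a \<in> carrier (Ev F X) \<Longrightarrow> \<theta> X (\<eta> X a) = \<theta>' X (\<eta> X a)"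
    and x: "X \<in> Obj T" "x \<in> carrier (Ev G X)"
  shows "\<theta> X x = \<theta>' X x"
proof -
  obtain s a where s: "s \<in> W" "Cod T s = X" "a \<in> carrier (Ev F (Dom T s))" "Re G s x = \<eta> (Dom T s) a"
    using localizationD(4)[OF L x] by blast
  have "Re H s (\<theta> X x) = Re H s (\<theta>' X x)"
    using psh_homD(3)[OF \<theta>(1), of s x] psh_homD(3)[OF \<theta>(2), of s x] eq[of "Dom T s" a] s x by simp
  then show ?thesis using invertsD(1)[OF H s(1)] psh_homD(1)[OF \<theta>(1) x] psh_homD(1)[OF \<theta>(2) x] s by simp
qed

end

text \<open>Naturality and surjectivity of \<theta> determine the restriction maps of G' from those
  of G, so the functor laws, additivity and exactness all carry over.\<close>

lemma (in triangulated_category) localization_transport: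
  assumes F: "presheaf T F" and L: "localization T S F G \<eta>"
    and G': "\<And>X. X \<in> Obj T \<Longrightarrow> comm_group (Ev G' X)"
    and \<theta>: "psh_hom T G G' \<theta>" "\<And>X. X \<in> Obj T \<Longrightarrow> bij_betw (\<theta> X) (carrier (Ev G X)) (carrier (Ev G' X))"
  shows "localization T S F G' (mor_comp \<theta> \<eta>)"
proof -
  note LD = localizationD[OF L]
  note GC = LD(1) note G = cohomological_presheaf[OF GC]
  have sur: "\<exists>x \<in> carrier (Ev G X). \<theta> X x = y" if "X \<in> Obj T" "y \<in> carrier (Ev G' X)" for X y
    using bij_betw_imp_surj_on[OF \<theta>(2)[OF that(1)]] that(2) by (metis imageE)
  have inj: "x = y" if "X \<in> Obj T" "x \<in> carrier (Ev G X)" "y \<in> carrier (Ev G X)" "\<theta> X x = \<theta> X y" for X x y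
    using \<theta>(2)[OF that(1)] that unfolding bij_betw_def inj_on_def by blast
  note cl = psh_homD(1)[OF \<theta>(1)] and mu = psh_homD(2)[OF \<theta>(1)] and na = psh_homD(3)[OF \<theta>(1)]
  have th1: "\<theta> X \<one>\<^bsub>Ev G X\<^esub> = \<one>\<^bsub>Ev G' X\<^esub>" if X: "X \<in> Obj T" for X
  proof -
    interpret A: comm_group "Ev G X" using presheafD(1)[OF G X] .
    interpret B: comm_group "Ev G' X" using G'[OF X] .
    interpret group_hom "Ev G X" "Ev G' X" "\<theta> X" by unfold_locales (use \<theta>(1) X in \<open>auto simp: psh_hom_def\<close>)
    show ?thesis by (rule hom_one)
  qed
  have th1_iff: "\<theta> X x = \<one>\<^bsub>Ev G' X\<^esub> \<longleftrightarrow> x = \<one>\<^bsub>Ev G X\<^esub>" if X: "X \<in> Obj T" "x \<in> carrier (Ev G X)" for X x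
  proof -
    interpret A: comm_group "Ev G X" using presheafD(1)[OF G X(1)] .
    show ?thesis using th1[OF X(1)] inj[OF X A.one_closed] by auto
  qed
  have co: "cohomological T G'" unfolding cohomological_def
  proof (intro conjI ballI impI)
    show "comm_group (Ev G' X)" if "X \<in> Obj T" for X using G' that .
    show "Re G' (Idn T X) y = y" if y: "X \<in> Obj T" "y \<in> carrier (Ev G' X)" for X y
    proof -
      obtain x where "x \<in> carrier (Ev G X)" "\<theta> X x = y" using sur y by blast
      then show ?thesis using na[of "Idn T X" x] y presheafD(2)[OF G y(1)] by simp
    qed
    show "Re G' f \<in> hom (Ev G' (Cod T f)) (Ev G' (Dom T f))" if f: "f \<in> Arr T" for f
    proof (rule homI)
      have f': "Cod T f \<in> Obj T" "Dom T f \<in> Obj T" using f by auto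
      fix y assume y: "y \<in> carrier (Ev G' (Cod T f))"
      obtain x where x: "x \<in> carrier (Ev G (Cod T f))" "\<theta> (Cod T f) x = y" using sur[OF f'(1) y] by blast
      show "Re G' f y \<in> carrier (Ev G' (Dom T f))" using na[OF f x(1)] x cl[OF f'(2) presheafD(3)[OF G f x(1)]] by simp
      fix z assume z: "z \<in> carrier (Ev G' (Cod T f))"
      obtain w where w: "w \<in> carrier (Ev G (Cod T f))" "\<theta> (Cod T f) w = z" using sur[OF f'(1) z] by blast
      interpret A: comm_group "Ev G (Cod T f)" using presheafD(1)[OF G f'(1)] .
      have "y \<otimes>\<^bsub>Ev G' (Cod T f)\<^esub> z = \<theta> (Cod T f) (x \<otimes>\<^bsub>Ev G (Cod T f)\<^esub> w)" using mu[OF f'(1) x(1) w(1)] x w by simp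
      then show "Re G' f (y \<otimes>\<^bsub>Ev G' (Cod T f)\<^esub> z) = Re G' f y \<otimes>\<^bsub>Ev G' (Dom T f)\<^esub> Re G' f z"
        using na[OF f A.m_closed[OF x(1) w(1)]] na[OF f x(1)] na[OF f w(1)] x w presheafD(4)[OF G f x(1) w(1)]
          mu[OF f'(2) presheafD(3)[OF G f x(1)] presheafD(3)[OF G f w(1)]] by simp
    qed
    show "Re G' (g \<cdot> f) y = Re G' f (Re G' g y)"
      if f: "f \<in> Arr T" "g \<in> Arr T" "Cod T f = Dom T g" and y: "y \<in> carrier (Ev G' (Cod T g))" for f g y
    proof -
      obtain x where x: "x \<in> carrier (Ev G (Cod T g))" "\<theta> (Cod T g) x = y" using sur[OF cod_obj[OF f(2)] y] by blast
      show ?thesis using na[of "g \<cdot> f" x] na[of g x] na[of f "Re G g x"] presheafD(5)[OF G f x(1)] f x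
        presheafD(3)[OF G f(2) x(1)] by simp
    qed
    show "Re G' (Add T f g) y = Re G' f y \<otimes>\<^bsub>Ev G' (Dom T f)\<^esub> Re G' g y"
      if f: "f \<in> Arr T" and g: "g \<in> Hom T (Dom T f) (Cod T f)" and y: "y \<in> carrier (Ev G' (Cod T f))" for f g y
    proof -
      obtain x where x: "x \<in> carrier (Ev G (Cod T f))" "\<theta> (Cod T f) x = y" using sur[OF cod_obj[OF f] y] by blast
      have "Re G (Add T f g) x = Re G f x \<otimes>\<^bsub>Ev G (Dom T f)\<^esub> Re G g x"
        using GC f g x unfolding cohomological_def by blast
      then show ?thesis using na[of "Add T f g" x] na[of f x] na[of g x] f g x
        mu[of "Dom T f" "Re G f x" "Re G g x"] presheafD(3)[OF G, of f x] presheafD(3)[OF G, of g x]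
        by (simp add: Hom_iff)
    qed
    show "case t of (f, g, h) \<Rightarrow> Re G' g ` carrier (Ev G' (Cod T g)) =
      kernel (Ev G' (Cod T f)) (Ev G' (Dom T f)) (Re G' f)" if t: "t \<in> Tri T" for t
    proof -
      obtain f g h where tt: "t = (f, g, h)" by (cases t) auto
      note ts = tri_simps[OF t[unfolded tt]]
      have ex: "Re G g ` carrier (Ev G (Cod T g)) = kernel (Ev G (Cod T f)) (Ev G (Dom T f)) (Re G f)"
        using GC t tt unfolding cohomological_def by blast
      have "y \<in> Re G' g ` carrier (Ev G' (Cod T g)) \<longleftrightarrow> y \<in> kernel (Ev G' (Cod T f)) (Ev G' (Dom T f)) (Re G' f)" for y
      proof
        assume "y \<in> Re G' g ` carrier (Ev G' (Cod T g))"
        then obtain v where v: "v \<in> carrier (Ev G' (Cod T g))" "y = Re G' g v" by blast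
        obtain x where x: "x \<in> carrier (Ev G (Cod T g))" "\<theta> (Cod T g) x = v" using sur[OF cod_obj[OF ts(2)] v(1)] by blast
        have "Re G g x \<in> kernel (Ev G (Cod T f)) (Ev G (Dom T f)) (Re G f)" using ex x by blast
        then have k: "Re G g x \<in> carrier (Ev G (Cod T f))" "Re G f (Re G g x) = \<one>\<^bsub>Ev G (Dom T f)\<^esub>" by (auto simp: kernel_def)
        have yx: "y = \<theta> (Cod T f) (Re G g x)" using na[OF ts(2) x(1)] x v ts by simp
        show "y \<in> kernel (Ev G' (Cod T f)) (Ev G' (Dom T f)) (Re G' f)"
          unfolding kernel_def yx using cl[OF _ k(1)] na[OF ts(1) k(1)] k(2) th1 ts by simp
      next
        assume "y \<in> kernel (Ev G' (Cod T f)) (Ev G' (Dom T f)) (Re G' f)"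
        then have y: "y \<in> carrier (Ev G' (Cod T f))" "Re G' f y = \<one>\<^bsub>Ev G' (Dom T f)\<^esub>" by (auto simp: kernel_def)
        obtain x where x: "x \<in> carrier (Ev G (Cod T f))" "\<theta> (Cod T f) x = y" using sur[OF cod_obj[OF ts(1)] y(1)] by blast
        have "Re G f x = \<one>\<^bsub>Ev G (Dom T f)\<^esub>" using na[OF ts(1) x(1)] x y th1_iff[OF dom_obj[OF ts(1)] presheafD(3)[OF G ts(1) x(1)]] by simp
        then have "x \<in> Re G g ` carrier (Ev G (Cod T g))" using ex x by (simp add: kernel_def)
        then obtain v where v: "v \<in> carrier (Ev G (Cod T g))" "x = Re G g v" by blast
        then have "y = Re G' g (\<theta> (Cod T g) v)" using na[OF ts(2) v(1)] x ts by simp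
        then show "y \<in> Re G' g ` carrier (Ev G' (Cod T g))" using cl[OF cod_obj[OF ts(2)] v(1)] by blast
      qed
      then show ?thesis unfolding tt by auto
    qed
  qed
  have fh: "psh_hom T F G' (mor_comp \<theta> \<eta>)" by (rule psh_hom_comp[OF LD(2) \<theta>(1)])
  have W_arr: "s \<in> Arr T" if "s \<in> cone_in T S" for s using that tri_simps(1) unfolding cone_in_def by blast
  show ?thesis unfolding localization_def
  proof (intro conjI ballI impI co fh)
    show "bij_betw (Re G' s) (carrier (Ev G' (Cod T s))) (carrier (Ev G' (Dom T s)))" if s: "s \<in> cone_in T S" for s
    proof -
      have sA: "s \<in> Arr T" and o: "Cod T s \<in> Obj T" "Dom T s \<in> Obj T" using W_arr[OF s] by auto
      have b1: "bij_betw (\<lambda>x. \<theta> (Dom T s) (Re G s x)) (carrier (Ev G (Cod T s))) (carrier (Ev G' (Dom T s)))"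
        using bij_betw_trans[OF LD(3)[unfolded inverts_def, rule_format, OF s] \<theta>(2)[OF o(2)]] by (simp add: o_def)
      have "bij_betw (\<lambda>x. Re G' s (\<theta> (Cod T s) x)) (carrier (Ev G (Cod T s))) (carrier (Ev G' (Dom T s)))"
        using b1 na[OF sA] by (subst bij_betw_cong[where g = "\<lambda>x. \<theta> (Dom T s) (Re G s x)"]) auto
      then show ?thesis using bij_betw_comp_iff[OF \<theta>(2)[OF o(1)], of "Re G' s"] by (simp add: o_def)
    qed
    show "\<exists>s \<in> cone_in T S. Cod T s = X \<and> (\<exists>a \<in> carrier (Ev F (Dom T s)). Re G' s y = mor_comp \<theta> \<eta> (Dom T s) a)"
      if X: "X \<in> Obj T" and y: "y \<in> carrier (Ev G' X)" for X y
    proof -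
      obtain x where x: "x \<in> carrier (Ev G X)" "\<theta> X x = y" using sur[OF X y] by blast
      obtain s a where s: "s \<in> cone_in T S" "Cod T s = X" "a \<in> carrier (Ev F (Dom T s))" "Re G s x = \<eta> (Dom T s) a"
        using LD(4)[OF X x(1)] by blast
      have "Re G' s y = mor_comp \<theta> \<eta> (Dom T s) a" using na[OF W_arr[OF s(1)], of x] s x by (simp add: mor_comp_def)
      then show ?thesis using s by blast
    qed
    show "\<exists>s \<in> cone_in T S. Cod T s = X \<and> Re F s a = \<one>\<^bsub>Ev F (Dom T s)\<^esub>"
      if X: "X \<in> Obj T" and a: "a \<in> carrier (Ev F X)" and z: "mor_comp \<theta> \<eta> X a = \<one>\<^bsub>Ev G' X\<^esub>" for X a
      using LD(5)[OF X a] th1_iff[OF X psh_homD(1)[OF LD(2) X a]] z by (simp add: mor_comp_def)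
  qed
qed

text \<open>Transport of structure along the injections, so that the values become groups carried by
  subsets of \<open>'g\<close>.\<close>

lemma (in category) psh_relabel:
  fixes G :: "('o, 'm, 'h) psh" and \<iota> :: "'o \<Rightarrow> 'h \<Rightarrow> 'g"
  assumes G: "presheaf T G" and inj: "\<And>X. X \<in> Obj T \<Longrightarrow> inj_on (\<iota> X) (carrier (Ev G X))"
  obtains G' :: "('o, 'm, 'g) psh" where "\<And>X. X \<in> Obj T \<Longrightarrow> comm_group (Ev G' X)" "psh_hom T G G' \<iota>"
    "\<And>X. X \<in> Obj T \<Longrightarrow> bij_betw (\<iota> X) (carrier (Ev G X)) (carrier (Ev G' X))"
proof -
  define \<kappa> where "\<kappa> = (\<lambda>X. inv_into (carrier (Ev G X)) (\<iota> X))"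
  have \<kappa>: "\<kappa> X (\<iota> X x) = x" if "X \<in> Obj T" "x \<in> carrier (Ev G X)" for X x
    using inj that by (simp add: \<kappa>_def)
  define G' :: "('o, 'm, 'g) psh" where
    "G' = \<lparr>Ev = (\<lambda>X. \<lparr>carrier = \<iota> X ` carrier (Ev G X), mult = (\<lambda>x y. \<iota> X (\<kappa> X x \<otimes>\<^bsub>Ev G X\<^esub> \<kappa> X y)),
      one = \<iota> X \<one>\<^bsub>Ev G X\<^esub>\<rparr>), Re = (\<lambda>f x. \<iota> (Dom T f) (Re G f (\<kappa> (Cod T f) x)))\<rparr>"
  have 1: "comm_group (Ev G' X)" if X: "X \<in> Obj T" for X
  proof -
    interpret comm_group "Ev G X" using presheafD(1)[OF G X] .
    show ?thesis
    proof (rule comm_groupI)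
      show "\<exists>y \<in> carrier (Ev G' X). y \<otimes>\<^bsub>Ev G' X\<^esub> x = \<one>\<^bsub>Ev G' X\<^esub>" if x: "x \<in> carrier (Ev G' X)" for x
      proof -
        obtain a where "a \<in> carrier (Ev G X)" "x = \<iota> X a" using x by (auto simp: G'_def)
        then show ?thesis using \<kappa>[OF X] by (intro bexI[of _ "\<iota> X (inv\<^bsub>Ev G X\<^esub> a)"]) (auto simp: G'_def)
      qed
    qed (auto simp: G'_def \<kappa>[OF X] m_ac)
  qed
  show ?thesis
  proof (rule that[of G'])
    show "psh_hom T G G' \<iota>" unfolding psh_hom_def
      using \<kappa> by (auto simp: G'_def hom_def)
    show "bij_betw (\<iota> X) (carrier (Ev G X)) (carrier (Ev G' X))" if "X \<in> Obj T" for X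
      using inj[OF that] by (simp add: G'_def bij_betw_def)
  qed (use 1 in auto)
qed

text \<open>A denominator may be composed with an isomorphism into its source, so each class has a
  representative whose denominator starts in the small family B. Composing with an isomorphism from
  X to an object of B places it among the arrows counted by essential smallness, and infinity of
  \<open>'g\<close> absorbs the product with the numerators.\<close>

lemma (in verdier) LC_lepoll:
  fixes F :: "('o, 'm, 'g) psh"
  assumes inf: "infinite (UNIV :: 'g set)" and small: "essentially_small T (UNIV :: 'g set)"
    and F: "presheaf T F" and X: "X \<in> Obj T"
  shows "LC F X \<lesssim> (UNIV :: 'g set)"
proof -
  obtain B where B: "B \<subseteq> Obj T" "\<And>X. X \<in> Obj T \<Longrightarrow> \<exists>Y \<in> B. isomorphic T X Y"
    and A: "{f \<in> Arr T. Dom T f \<in> B \<and> Cod T f \<in> B} \<lesssim> (UNIV :: 'g set)"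
    using small unfolding essentially_small_def by blast
  let ?A = "{f \<in> Arr T. Dom T f \<in> B \<and> Cod T f \<in> B}"
  obtain Y i where i: "Y \<in> B" "i \<in> Arr T" "Dom T i = X" "Cod T i = Y" "iso_arr T i"
    using B(2)[OF X] by (auto simp: isomorphic_def Hom_iff)
  have "\<exists>s a. c = cls F s a \<and> s \<in> Arr T \<and> Cod T s = X \<and> Dom T s \<in> B" if c: "c \<in> LC F X" for c
  proof -
    obtain s a where s: "c = cls F s a" "elt F s a" "Cod T s = X" using c by (auto simp: LC_def)
    have sW: "s \<in> W" using s by (simp add: elt_def)
    obtain D where D: "D \<in> B" "isomorphic T (Dom T s) D" using B(2) sW by (metis W_arr dom_obj)
    obtain j where j: "j \<in> Arr T" "Dom T j = D" "Cod T j = Dom T s" "iso_arr T j"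
      using isomorphic_sym[OF D(2)] by (auto simp: isomorphic_def Hom_iff)
    have "s \<cdot> j \<in> W" by (rule cmp_W) (use iso_W[OF j(4)] sW j in auto)
    then have "cls F s a = cls F (s \<cdot> j) (Re F j a)" using cls_refine(1)[OF F s(2) j(1,3)] by simp
    then show ?thesis using s j D sW by (intro exI[of _ "s \<cdot> j"] exI[of _ "Re F j a"]) auto
  qed
  then obtain \<sigma> \<alpha> where \<sigma>: "\<And>c. c \<in> LC F X \<Longrightarrow> c = cls F (\<sigma> c) (\<alpha> c) \<and> \<sigma> c \<in> Arr T \<and> Cod T (\<sigma> c) = X \<and> Dom T (\<sigma> c) \<in> B"
    by metis
  have "inj_on (\<lambda>c. (i \<cdot> \<sigma> c, \<alpha> c)) (LC F X)"
  proof (rule inj_onI)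
    fix c d assume c: "c \<in> LC F X" "d \<in> LC F X" "(i \<cdot> \<sigma> c, \<alpha> c) = (i \<cdot> \<sigma> d, \<alpha> d)"
    have "\<sigma> c = \<sigma> d" by (rule iso_monic[OF i(5)]) (use c \<sigma> i in auto)
    then show "c = d" using \<sigma>[OF c(1)] \<sigma>[OF c(2)] c(3) by simp
  qed
  moreover have "(\<lambda>c. (i \<cdot> \<sigma> c, \<alpha> c)) ` LC F X \<subseteq> ?A \<times> (UNIV :: 'g set)"
  proof (rule image_subsetI)
    fix c assume "c \<in> LC F X"
    note s = \<sigma>[OF this]
    show "(i \<cdot> \<sigma> c, \<alpha> c) \<in> ?A \<times> UNIV" using s i by simp
  qed
  ultimately have "LC F X \<lesssim> ?A \<times> (UNIV :: 'g set)" unfolding lepoll_def by blast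
  also have "?A \<times> (UNIV :: 'g set) \<lesssim> (UNIV :: 'g set) \<times> (UNIV :: 'g set)" by (rule times_lepoll_mono[OF A lepoll_refl])
  also have "(UNIV :: 'g set) \<times> (UNIV :: 'g set) \<approx> (UNIV :: 'g set)"
    by (simp only: eqpoll_iff_card_of_ordIso card_of_Times_same_infinite[OF inf])
  finally show ?thesis .
qed

lemma (in verdier) localization_exists:
  fixes F :: "('o, 'm, 'g) psh"
  assumes inf: "infinite (UNIV :: 'g set)" and small: "essentially_small T (UNIV :: 'g set)"
    and F: "cohomological T F"
  obtains G :: "('o, 'm, 'g) psh" and \<eta> where "localization T S F G \<eta>"
proof -
  note P = cohomological_presheaf[OF F]
  have "\<exists>f :: ('m \<times> 'g) set \<Rightarrow> 'g. inj_on f (LC F X)" if "X \<in> Obj T" for X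
    using LC_lepoll[OF inf small P that] unfolding lepoll_def by blast
  then obtain \<iota> :: "'o \<Rightarrow> ('m \<times> 'g) set \<Rightarrow> 'g" where \<iota>: "\<And>X. X \<in> Obj T \<Longrightarrow> inj_on (\<iota> X) (carrier (Ev (lpsh F) X))"
    unfolding lpsh_simps by metis
  obtain G' :: "('o, 'm, 'g) psh" where "\<And>X. X \<in> Obj T \<Longrightarrow> comm_group (Ev G' X)" "psh_hom T (lpsh F) G' \<iota>"
    "\<And>X. X \<in> Obj T \<Longrightarrow> bij_betw (\<iota> X) (carrier (Ev (lpsh F) X)) (carrier (Ev G' X))"
    by (rule psh_relabel[OF lpsh_presheaf[OF P] \<iota>]) auto
  then show ?thesis using localization_transport[OF P localization_lpsh[OF F]] that by blast
qed

section \<open>The Verdier quotient\<close>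

context verdier begin

abbreviation Q where "Q \<equiv> quotient T S"

lemma Q_simps [simp]:
  "Obj Q = Obj T" "Arr Q = {frac T S s f | s f. (s, f) \<in> roofs T S}" "Idn Q X = frac T S (Idn T X) (Idn T X)"
  by (auto simp: quotient_def frac_category_def)

lemma roofs_iff: "(s, f) \<in> roofs T S \<longleftrightarrow> s \<in> W \<and> f \<in> Arr T \<and> Dom T s = Dom T f"
  by (simp add: roofs_def)

lemma frac_self: "(s, f) \<in> roofs T S \<Longrightarrow> (s, f) \<in> frac T S s f"
  using frac_cls[of s f] cls_self[of "yoneda T (Cod T f)" s f] by (simp add: roofs_iff elt_yoneda)

lemma frac_mem:
  assumes r: "(s, f) \<in> roofs T S" and m: "(s', f') \<in> frac T S s f"
  shows "(s', f') \<in> roofs T S" "Cod T s' = Cod T s" "Cod T f' = Cod T f" "rel (yoneda T (Cod T f)) s f s' f'"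
    "frac T S s' f' = frac T S s f"
proof -
  have sf: "s \<in> W" "f \<in> Arr T" "Dom T f = Dom T s" using r by (auto simp: roofs_iff)
  have e: "elt (yoneda T (Cod T f)) s f" using sf by (simp add: elt_yoneda)
  have m': "(s', f') \<in> cls (yoneda T (Cod T f)) s f" using m frac_cls[OF sf] by simp
  note c = cls_memD[OF m' e]
  show "(s', f') \<in> roofs T S" "Cod T f' = Cod T f" using c(1) by (auto simp: elt_yoneda roofs_iff)
  show "Cod T s' = Cod T s" "rel (yoneda T (Cod T f)) s f s' f'" using c by auto
  have sf': "s' \<in> W" "f' \<in> Arr T" "Dom T f' = Dom T s'" "Cod T f' = Cod T f" using c(1) by (auto simp: elt_yoneda)
  have "presheaf T (yoneda T (Cod T f))" using yoneda_presheaf sf by simp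
  then show "frac T S s' f' = frac T S s f" using frac_cls[OF sf] frac_cls[OF sf'(1-3)] sf'(4) cls_eq[OF _ e c(1)] c(3) by simp
qed

lemma frac_eqI:
  assumes "(s, f) \<in> roofs T S" "(s', f') \<in> roofs T S" "Cod T f = Cod T f'" "rel (yoneda T (Cod T f)) s f s' f'"
  shows "frac T S s f = frac T S s' f'"
proof -
  have sf: "s \<in> W" "f \<in> Arr T" "Dom T f = Dom T s" "s' \<in> W" "f' \<in> Arr T" "Dom T f' = Dom T s'"
    using assms by (auto simp: roofs_iff)
  have "presheaf T (yoneda T (Cod T f))" using yoneda_presheaf sf by simp
  then show ?thesis using frac_cls[OF sf(1-3)] frac_cls[OF sf(4-6)] assms cls_eq[of "yoneda T (Cod T f)" s f s' f'] sf
    by (simp add: elt_yoneda)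
qed

lemma frac_refine:
  assumes r: "(s, f) \<in> roofs T S" and u: "u \<in> Arr T" "Cod T u = Dom T s" "s \<cdot> u \<in> W"
  shows "frac T S (s \<cdot> u) (f \<cdot> u) = frac T S s f"
proof -
  have sf: "s \<in> W" "f \<in> Arr T" "Dom T f = Dom T s" using r by (auto simp: roofs_iff)
  have P: "presheaf T (yoneda T (Cod T f))" using yoneda_presheaf sf by simp
  have e: "elt (yoneda T (Cod T f)) s f" using sf by (simp add: elt_yoneda)
  show ?thesis using cls_refine(1)[OF P e u] frac_cls[OF sf] frac_cls[of "s \<cdot> u" "f \<cdot> u"] sf u by simp
qed

text \<open>Source and target are read off an arbitrary representative; by \<open>frac_mem\<close>
  all representatives agree.\<close>

lemma Q_dom_cod:
  assumes "(s, f) \<in> roofs T S"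
  shows "frac T S s f \<in> Arr Q" "Dom Q (frac T S s f) = Cod T s" "Cod Q (frac T S s f) = Cod T f"
proof -
  show "frac T S s f \<in> Arr Q" using assms by auto
  obtain r where r: "r = (SOME r. r \<in> frac T S s f)" "r \<in> frac T S s f" using frac_self[OF assms] someI by metis
  obtain s' f' where sf: "r = (s', f')" by (cases r)
  then show "Dom Q (frac T S s f) = Cod T s" "Cod Q (frac T S s f) = Cod T f"
    using r frac_mem[OF assms, of s' f'] by (simp_all add: quotient_def frac_category_def)
qed

lemma Q_arrE:
  assumes "c \<in> Arr Q"
  obtains s f where "(s, f) \<in> roofs T S" "c = frac T S s f" "Dom Q c = Cod T s" "Cod Q c = Cod T f"
    "s \<in> W" "f \<in> Arr T" "Dom T f = Dom T s"
proof -
  obtain s f where "(s, f) \<in> roofs T S" "c = frac T S s f" using assms by auto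
  then show ?thesis using that Q_dom_cod[of s f] by (auto simp: roofs_iff)
qed

lemma Q_obj:
  assumes "c \<in> Arr Q" shows "Dom Q c \<in> Obj T" "Cod Q c \<in> Obj T"
proof -
  obtain s f where "Dom Q c = Cod T s" "Cod Q c = Cod T f" "s \<in> W" "f \<in> Arr T" by (rule Q_arrE[OF assms])
  then show "Dom Q c \<in> Obj T" "Cod Q c \<in> Obj T" by simp_all
qed

text \<open>Composition is the union over all representatives and all Ore squares. By
  \<open>rel_act\<close> for the represented functor they give one class, so any single square
  computes it.\<close>

lemma Q_cmp:
  assumes r: "(s, f) \<in> roofs T S" "(t, g) \<in> roofs T S" "Cod T f = Cod T t"
    and u: "u \<in> W" "k \<in> Arr T" "Dom T u = Dom T k" "Cod T u = Dom T f" "Cod T k = Dom T t" "f \<cdot> u = t \<cdot> k"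
  shows "Cmp Q (frac T S t g) (frac T S s f) = frac T S (s \<cdot> u) (g \<cdot> k)" "(s \<cdot> u, g \<cdot> k) \<in> roofs T S"
proof -
  have comp: "(s' \<cdot> u', g' \<cdot> k') \<in> roofs T S"
    if "(s', f') \<in> roofs T S" "(t', g') \<in> roofs T S" "u' \<in> W" "k' \<in> Arr T" "Dom T u' = Dom T k'" "Cod T u' = Dom T f'" "Cod T k' = Dom T t'"
    for s' f' t' g' u' k' using that by (simp add: roofs_iff)
  show *: "(s \<cdot> u, g \<cdot> k) \<in> roofs T S" by (rule comp[OF r(1,2) u(1-5)])
  have sf: "s \<in> W" "f \<in> Arr T" "Dom T f = Dom T s" "t \<in> W" "g \<in> Arr T" "Dom T g = Dom T t" using r by (auto simp: roofs_iff)
  have P: "presheaf T (yoneda T (Cod T g))" using yoneda_presheaf sf by simp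
  have key: "frac T S (s' \<cdot> u') (g' \<cdot> k') = frac T S (s \<cdot> u) (g \<cdot> k)"
    if m: "(s', f') \<in> frac T S s f" "(t', g') \<in> frac T S t g"
      and u': "u' \<in> W" "k' \<in> Arr T" "Dom T u' = Dom T k'" "Cod T u' = Dom T f'" "Cod T k' = Dom T t'" "f' \<cdot> u' = t' \<cdot> k'"
    for s' f' t' g' u' k'
  proof (rule sym, rule frac_eqI[OF * comp])
    note 1 = frac_mem[OF r(1) m(1)] and 2 = frac_mem[OF r(2) m(2)]
    show "(s', f') \<in> roofs T S" "(t', g') \<in> roofs T S" using 1 2 by auto
    have sf': "s' \<in> W" "f' \<in> Arr T" "Dom T f' = Dom T s'" "t' \<in> W" "g' \<in> Arr T" "Dom T g' = Dom T t'"
      using 1 2 by (auto simp: roofs_iff)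
    show c: "Cod T (g \<cdot> k) = Cod T (g' \<cdot> k')" using 2 sf sf' u u' by simp
    obtain p q where p: "p \<in> Arr T" "q \<in> Arr T" "Dom T p = Dom T q" "Cod T p = Dom T s" "Cod T q = Dom T s'"
     "s \<cdot> p = s' \<cdot> q" "s \<cdot> p \<in> W" "f \<cdot> p = f' \<cdot> q" using 1(4) by (rule relE) auto
    have "rel (yoneda T (Cod T g)) (s \<cdot> u) (Re (yoneda T (Cod T g)) k g) (s' \<cdot> u') (Re (yoneda T (Cod T g)) k' g')"
      by (rule rel_act[OF P sf(1) sf'(1) sf(2) sf'(2) sf(3) sf'(3) p(1-8) 2(4) _ _ u u'])
        (use sf sf' 2(3) in \<open>auto simp: elt_yoneda\<close>)
    then show "rel (yoneda T (Cod T (g \<cdot> k))) (s \<cdot> u) (g \<cdot> k) (s' \<cdot> u') (g' \<cdot> k')" using sf u by simp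
  qed (use u' in auto)
  \<comment> \<open>The set of classes arising from all choices; once it is a singleton, its union
    is that class.\<close>
  define M where "M = {frac T S (s' \<cdot> u') (g' \<cdot> k') | s' f' t' g' u' k'.
              (s', f') \<in> frac T S s f \<and> (t', g') \<in> frac T S t g \<and> u' \<in> W \<and> k' \<in> Arr T \<and>
              Dom T u' = Dom T k' \<and> Cod T u' = Dom T f' \<and> Cod T k' = Dom T t' \<and> f' \<cdot> u' = t' \<cdot> k'}"
  have "A = frac T S (s \<cdot> u) (g \<cdot> k)" if "A \<in> M" for A
    using that key unfolding M_def by clarify
  moreover have "frac T S (s \<cdot> u) (g \<cdot> k) \<in> M"
    unfolding M_def mem_Collect_eq
    by (rule exI[of _ s], rule exI[of _ f], rule exI[of _ t], rule exI[of _ g], rule exI[of _ u], rule exI[of _ k])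
      (use u r frac_self in simp)
  ultimately have "M = {frac T S (s \<cdot> u) (g \<cdot> k)}" by blast
  moreover have "Cmp Q (frac T S t g) (frac T S s f) = \<Union>M"
    unfolding M_def by (simp add: quotient_def frac_category_def)
  ultimately show "Cmp Q (frac T S t g) (frac T S s f) = frac T S (s \<cdot> u) (g \<cdot> k)" by simp
qed

text \<open>The union that defines the sum is the multiplication of fractions for the represented
  functor.\<close>

lemma Q_add:
  assumes r: "(s, f) \<in> roofs T S" "(s, g) \<in> roofs T S" "Cod T f = Cod T g"
  shows "Add Q (frac T S s f) (frac T S s g) = frac T S s (Add T f g)" "(s, Add T f g) \<in> roofs T S"
proof -
  have sf: "s \<in> W" "f \<in> Arr T" "Dom T f = Dom T s" "g \<in> Arr T" "Dom T g = Dom T s" using r by (auto simp: roofs_iff)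
  have P: "presheaf T (yoneda T (Cod T g))" using yoneda_presheaf sf by simp
  show "(s, Add T f g) \<in> roofs T S" using sf r by (simp add: roofs_iff)
  have e: "elt (yoneda T (Cod T g)) s f" "elt (yoneda T (Cod T g)) s g" using sf r by (simp_all add: elt_yoneda)
  have eq: "frac T S s' (Add T f' g') = cls (yoneda T (Cod T g)) s' (Add T f' g')"
    if "(s', f') \<in> frac T S s f" "(s', g') \<in> frac T S s g" for s' f' g'
    using frac_mem[OF r(1) that(1)] frac_mem[OF r(2) that(2)] frac_cls[of s' "Add T f' g'"] r
    by (simp add: roofs_iff)
  have "Add Q (frac T S s f) (frac T S s g) =
     \<Union>{frac T S s' (Add T f' g') | s' f' g'. (s', f') \<in> frac T S s f \<and> (s', g') \<in> frac T S s g}"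
    by (simp add: quotient_def frac_category_def)
  also have "\<dots> = lmult (yoneda T (Cod T g)) (frac T S s f) (frac T S s g)"
    unfolding lmult_def yoneda_simps using eq by (intro arg_cong[where f = Union] Collect_cong) blast
  also have "\<dots> = cls (yoneda T (Cod T g)) s (Add T f g)"
    using lmult_cls[OF P e] frac_cls[OF sf(1-3)] frac_cls[OF sf(1,4,5)] r by simp
  also have "\<dots> = frac T S s (Add T f g)" using frac_cls[of s "Add T f g"] sf r by simp
  finally show "Add Q (frac T S s f) (frac T S s g) = frac T S s (Add T f g)" .
qed

lemma qmap_roof: "f \<in> Arr T \<Longrightarrow> (Idn T (Dom T f), f) \<in> roofs T S"
  by (simp add: roofs_iff)

lemma qmap_simps:
  assumes "f \<in> Arr T"
  shows "qmap T S f \<in> Arr Q" "Dom Q (qmap T S f) = Dom T f" "Cod Q (qmap T S f) = Cod T f"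
  using Q_dom_cod[OF qmap_roof[OF assms]] assms unfolding qmap_def by auto

lemma qmap_cmp:
  assumes "f \<in> Arr T" "g \<in> Arr T" "Cod T f = Dom T g"
  shows "qmap T S (g \<cdot> f) = Cmp Q (qmap T S g) (qmap T S f)"
  using Q_cmp(1)[OF qmap_roof[OF assms(1)] qmap_roof[OF assms(2)], of "Idn T (Dom T f)" f] assms
  by (simp add: qmap_def)

lemma qmap_inverse:
  assumes s: "s \<in> W"
  shows "Cmp Q (qmap T S s) (frac T S s (Idn T (Dom T s))) = Idn Q (Cod T s)"
    "Cmp Q (frac T S s (Idn T (Dom T s))) (qmap T S s) = Idn Q (Dom T s)"
    "(s, Idn T (Dom T s)) \<in> roofs T S"
proof -
  let ?i = "Idn T (Dom T s)"
  have sA: "s \<in> Arr T" using s by simp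
  show r: "(s, ?i) \<in> roofs T S" using s by (simp add: roofs_iff)
  have "Cmp Q (qmap T S s) (frac T S s ?i) = frac T S s s"
    using Q_cmp(1)[OF r qmap_roof[OF sA], of ?i ?i] s by (simp add: qmap_def)
  also have "\<dots> = frac T S (Idn T (Cod T s)) (Idn T (Cod T s))"
    using frac_refine[of "Idn T (Cod T s)" "Idn T (Cod T s)" s] s by (simp add: roofs_iff)
  finally show "Cmp Q (qmap T S s) (frac T S s ?i) = Idn Q (Cod T s)" by simp
  show "Cmp Q (frac T S s ?i) (qmap T S s) = Idn Q (Dom T s)"
    using Q_cmp(1)[OF qmap_roof[OF sA] r, of ?i ?i] s by (simp add: qmap_def)
qed

text \<open>Together with \<open>qmap_inverse\<close> this writes the class of (s, f) as q(f) after
  the inverse of q(s); hence functors and transformations on the quotient are determined by what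
  they do on T.\<close>

lemma frac_qmap:
  assumes r: "(s, f) \<in> roofs T S"
  shows "Cmp Q (frac T S s f) (qmap T S s) = qmap T S f"
proof -
  have sf: "s \<in> W" "s \<in> Arr T" "f \<in> Arr T" "Dom T f = Dom T s" using r by (auto simp: roofs_iff)
  show ?thesis using Q_cmp(1)[OF qmap_roof[OF sf(2)] r, of "Idn T (Dom T s)" "Idn T (Dom T s)"] sf by (simp add: qmap_def)
qed

subsection \<open>Functors on the quotient\<close>

text \<open>A roof (s, f) acts as the inverse of G(s) after G(f), computed on an arbitrary
  representative; \<open>extq_rep\<close> removes the choice.\<close>

definition extq :: "('o, 'm, 'g) psh \<Rightarrow> ('o, ('m \<times> 'm) set, 'g) psh" where
  "extq G = \<lparr>Ev = Ev G, Re = (\<lambda>c. case SOME r. r \<in> c of (s, f) \<Rightarrow>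
     (\<lambda>x. SOME y. y \<in> carrier (Ev G (Cod T s)) \<and> Re G s y = Re G f x))\<rparr>"

lemma Ev_extq [simp]: "Ev (extq G) = Ev G"
  by (simp add: extq_def)

context
  fixes G :: "('o, 'm, 'g) psh"
  assumes G: "presheaf T G" and inv: "inverts T S G"
begin

text \<open>The values computed from the chosen representative and from (s, f) agree after
  restriction to the common refinement s u, along which G is injective.\<close>

lemma extq_rep:
  assumes r: "(s, f) \<in> roofs T S" and x: "x \<in> carrier (Ev G (Cod T f))"
  shows "Re (extq G) (frac T S s f) x \<in> carrier (Ev G (Cod T s))"
    "Re G s (Re (extq G) (frac T S s f) x) = Re G f x"
proof -
  let ?c = "frac T S s f"
  have sf: "s \<in> W" "f \<in> Arr T" "Dom T f = Dom T s" using r by (auto simp: roofs_iff)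
  obtain s0 f0 where m: "(SOME r. r \<in> ?c) = (s0, f0)" "(s0, f0) \<in> ?c"
    using frac_self[OF r] someI by (metis surj_pair)
  note m0 = frac_mem[OF r m(2)]
  have sf0: "s0 \<in> W" "f0 \<in> Arr T" "Dom T f0 = Dom T s0" using m0 by (auto simp: roofs_iff)
  define y where "y = Re (extq G) ?c x"
  have "Re G f0 x \<in> carrier (Ev G (Dom T s0))" using presheafD(3)[OF G sf0(2), of x] x m0 sf0 by simp
  then have "\<exists>y. y \<in> carrier (Ev G (Cod T s0)) \<and> Re G s0 y = Re G f0 x" using invertsD(2)[OF inv sf0(1)] by blast
  then have y: "y \<in> carrier (Ev G (Cod T s0))" "Re G s0 y = Re G f0 x"
    unfolding y_def extq_def using m someI_ex[of "\<lambda>y. y \<in> carrier (Ev G (Cod T s0)) \<and> Re G s0 y = Re G f0 x"] by auto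
  show yc: "Re (extq G) ?c x \<in> carrier (Ev G (Cod T s))" using y m0 by (simp add: y_def[symmetric])
  have "Re G f x \<in> carrier (Ev G (Dom T s))" using presheafD(3)[OF G sf(2) x] sf by simp
  then obtain z where z: "z \<in> carrier (Ev G (Cod T s))" "Re G s z = Re G f x" using invertsD(2)[OF inv sf(1)] by blast
  obtain u v where u: "u \<in> Arr T" "v \<in> Arr T" "Dom T u = Dom T v" "Cod T u = Dom T s" "Cod T v = Dom T s0"
    "s \<cdot> u = s0 \<cdot> v" "s \<cdot> u \<in> W" "f \<cdot> u = f0 \<cdot> v" using m0(4) by (rule relE) auto
  have y': "y \<in> carrier (Ev G (Cod T s))" using y m0 by simp
  have "Re G (s \<cdot> u) z = Re G (f \<cdot> u) x"
    using presheafD(5)[OF G, of u s z] presheafD(5)[OF G, of u f x] z x u(1-5) sf by simp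
  moreover have "Re G (s0 \<cdot> v) y = Re G (f0 \<cdot> v) x"
    using presheafD(5)[OF G, of v s0 y] presheafD(5)[OF G, of v f0 x] y x u(1-5) sf0 m0 by simp
  ultimately have "Re G (s \<cdot> u) z = Re G (s \<cdot> u) y" by (simp only: u(6,8))
  then have "z = y" using invertsD(1)[OF inv u(7)] z y' u(1-5) sf by simp
  then show "Re G s (Re (extq G) ?c x) = Re G f x" using z by (simp add: y_def)
qed

lemma extq_eq:
  assumes r: "(s, f) \<in> roofs T S" and x: "x \<in> carrier (Ev G (Cod T f))"
    and y: "y \<in> carrier (Ev G (Cod T s))" "Re G s y = Re G f x"
  shows "Re (extq G) (frac T S s f) x = y"
  using extq_rep[OF r x] y invertsD(1)[OF inv, of s] r by (simp add: roofs_iff)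

lemma extq_qmap: "f \<in> Arr T \<Longrightarrow> x \<in> carrier (Ev G (Cod T f)) \<Longrightarrow> Re (extq G) (qmap T S f) x = Re G f x"
  unfolding qmap_def using presheafD(2,3)[OF G] by (intro extq_eq[OF qmap_roof]) auto

lemma extq_presheaf: "presheaf Q (extq G)"
  unfolding presheaf_def
proof (intro conjI ballI impI)
  show "comm_group (Ev (extq G) X)" if "X \<in> Obj Q" for X using presheafD(1)[OF G] that by simp
  show "Re (extq G) (Idn Q X) a = a" if "X \<in> Obj Q" "a \<in> carrier (Ev (extq G) X)" for X a
    using extq_eq[of "Idn T X" "Idn T X" a a] that by (simp add: roofs_iff)
  show "Re (extq G) c \<in> hom (Ev (extq G) (Cod Q c)) (Ev (extq G) (Dom Q c))" if c: "c \<in> Arr Q" for c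
  proof -
    obtain s f where sf: "(s, f) \<in> roofs T S" "c = frac T S s f" "Dom Q c = Cod T s" "Cod Q c = Cod T f"
      "s \<in> W" "f \<in> Arr T" "Dom T f = Dom T s" by (rule Q_arrE[OF c])
    interpret A: comm_group "Ev G (Cod T s)" using presheafD(1)[OF G cod_obj] sf by simp
    interpret B: comm_group "Ev G (Cod T f)" using presheafD(1)[OF G cod_obj] sf by simp
    have "Re (extq G) c (x \<otimes>\<^bsub>Ev G (Cod T f)\<^esub> y) = Re (extq G) c x \<otimes>\<^bsub>Ev G (Cod T s)\<^esub> Re (extq G) c y"
      if x: "x \<in> carrier (Ev G (Cod T f))" "y \<in> carrier (Ev G (Cod T f))" for x y
      unfolding sf(2)
    proof (rule extq_eq[OF sf(1) B.m_closed[OF x]])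
      note ex = extq_rep[OF sf(1) x(1)] and ey = extq_rep[OF sf(1) x(2)]
      show "Re (extq G) (frac T S s f) x \<otimes>\<^bsub>Ev G (Cod T s)\<^esub> Re (extq G) (frac T S s f) y \<in> carrier (Ev G (Cod T s))"
        using ex ey by simp
      show "Re G s (Re (extq G) (frac T S s f) x \<otimes>\<^bsub>Ev G (Cod T s)\<^esub> Re (extq G) (frac T S s f) y) =
        Re G f (x \<otimes>\<^bsub>Ev G (Cod T f)\<^esub> y)"
        using presheafD(4)[OF G _ ex(1) ey(1)] presheafD(4)[OF G _ x] ex ey sf by simp
    qed
    then show ?thesis using extq_rep(1)[OF sf(1)] sf by (auto intro!: homI)
  qed
  show "Re (extq G) (Cmp Q d c) x = Re (extq G) c (Re (extq G) d x)"
    if c: "c \<in> Arr Q" "d \<in> Arr Q" "Cod Q c = Dom Q d" and x: "x \<in> carrier (Ev (extq G) (Cod Q d))" for c d x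
  proof -
    obtain s f where sf: "(s, f) \<in> roofs T S" "c = frac T S s f" "Dom Q c = Cod T s" "Cod Q c = Cod T f"
      "s \<in> W" "f \<in> Arr T" "Dom T f = Dom T s" by (rule Q_arrE[OF c(1)])
    obtain t g where tg: "(t, g) \<in> roofs T S" "d = frac T S t g" "Dom Q d = Cod T t" "Cod Q d = Cod T g"
      "t \<in> W" "g \<in> Arr T" "Dom T g = Dom T t" by (rule Q_arrE[OF c(2)])
    have ft: "Cod T f = Cod T t" using sf tg c by simp
    obtain u k where u: "u \<in> W" "k \<in> Arr T" "Dom T u = Dom T k" "Cod T u = Dom T f" "Cod T k = Dom T t" "f \<cdot> u = t \<cdot> k"
      by (rule ore[OF tg(5) sf(6) ft])
    note q = Q_cmp[OF sf(1) tg(1) ft u]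
    have x': "x \<in> carrier (Ev G (Cod T g))" using x tg by simp
    note dx = extq_rep[OF tg(1) x', folded tg(2)]
    have dx': "Re (extq G) d x \<in> carrier (Ev G (Cod T f))" using dx ft by simp
    note cx = extq_rep[OF sf(1) dx', folded sf(2)]
    have "Re (extq G) (frac T S (s \<cdot> u) (g \<cdot> k)) x = Re (extq G) c (Re (extq G) d x)"
    proof (rule extq_eq[OF q(2)])
      show "x \<in> carrier (Ev G (Cod T (g \<cdot> k)))" using x' u tg by simp
      show "Re (extq G) c (Re (extq G) d x) \<in> carrier (Ev G (Cod T (s \<cdot> u)))" using cx u sf by simp
      have "Re G (s \<cdot> u) (Re (extq G) c (Re (extq G) d x)) = Re G u (Re G f (Re (extq G) d x))"
        using presheafD(5)[OF G, of u s] cx u(1-5) sf by simp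
      also have "\<dots> = Re G (f \<cdot> u) (Re (extq G) d x)" using presheafD(5)[OF G, of u f] dx' u(1-5) sf by simp
      also have "\<dots> = Re G (t \<cdot> k) (Re (extq G) d x)" by (simp only: u(6))
      also have "\<dots> = Re G k (Re G g x)" using presheafD(5)[OF G, of k t] dx u(1-5) tg by simp
      also have "\<dots> = Re G (g \<cdot> k) x" using presheafD(5)[OF G, of k g] x' u(1-5) tg by simp
      finally show "Re G (s \<cdot> u) (Re (extq G) c (Re (extq G) d x)) = Re G (g \<cdot> k) x" .
    qed
    then show ?thesis using q sf tg by simp
  qed
qed

lemma extq_add:
  assumes c: "c \<in> Arr Q" "d \<in> Arr Q" "Dom Q d = Dom Q c" "Cod Q d = Cod Q c" and x: "x \<in> carrier (Ev G (Cod Q c))"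
    and add: "\<And>f g a. f \<in> Arr T \<Longrightarrow> g \<in> Hom T (Dom T f) (Cod T f) \<Longrightarrow> a \<in> carrier (Ev G (Cod T f)) \<Longrightarrow>
        Re G (Add T f g) a = Re G f a \<otimes>\<^bsub>Ev G (Dom T f)\<^esub> Re G g a"
  shows "Re (extq G) (Add Q c d) x = Re (extq G) c x \<otimes>\<^bsub>Ev G (Dom Q c)\<^esub> Re (extq G) d x"
proof -
  obtain s0 f0 where sf: "(s0, f0) \<in> roofs T S" "c = frac T S s0 f0" "Dom Q c = Cod T s0" "Cod Q c = Cod T f0"
      "s0 \<in> W" "f0 \<in> Arr T" "Dom T f0 = Dom T s0" by (rule Q_arrE[OF c(1)])
  obtain t0 g0 where tg: "(t0, g0) \<in> roofs T S" "d = frac T S t0 g0" "Dom Q d = Cod T t0" "Cod Q d = Cod T g0"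
      "t0 \<in> W" "g0 \<in> Arr T" "Dom T g0 = Dom T t0" by (rule Q_arrE[OF c(2)])
  obtain u v where u: "u \<in> W" "v \<in> Arr T" "Dom T u = Dom T v" "Cod T u = Dom T s0" "Cod T v = Dom T t0" "s0 \<cdot> u = t0 \<cdot> v"
    by (rule ore[OF tg(5), of s0]) (use sf tg c in auto)
  have sW: "s0 \<cdot> u \<in> W" by (rule cmp_W) (use u(1-5) sf in auto)
  then have tW: "t0 \<cdot> v \<in> W" by (simp only: u(6))
  define s f g where "s = s0 \<cdot> u" and "f = f0 \<cdot> u" and "g = g0 \<cdot> v"
  have c': "c = frac T S s f" using frac_refine[OF sf(1) _ u(4) sW] u(1) sf by (simp add: s_def f_def)
  have d': "d = frac T S s g" using frac_refine[OF tg(1) u(2,5) tW] tg by (simp add: s_def g_def u(6))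
  have ty: "s \<in> W" "f \<in> Arr T" "g \<in> Arr T" "Dom T f = Dom T s" "Dom T g = Dom T s" "Cod T f = Cod Q c" "Cod T g = Cod Q c" "Cod T s = Dom Q c"
    using sW u(1-5) sf tg c by (auto simp: s_def f_def g_def)
  have r: "(s, f) \<in> roofs T S" "(s, g) \<in> roofs T S" "Cod T f = Cod T g" using ty by (auto simp: roofs_iff)
  note q = Q_add[OF r]
  have xf: "x \<in> carrier (Ev G (Cod T f))" "x \<in> carrier (Ev G (Cod T g))" using x ty by auto
  note cx = extq_rep[OF r(1) xf(1), folded c'] and dx = extq_rep[OF r(2) xf(2), folded d']
  interpret A: comm_group "Ev G (Dom Q c)" using presheafD(1)[OF G cod_obj[OF W_arr[OF ty(1)]]] ty(8) by simp
  have "Re (extq G) (frac T S s (Add T f g)) x = Re (extq G) c x \<otimes>\<^bsub>Ev G (Dom Q c)\<^esub> Re (extq G) d x"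
  proof (rule extq_eq[OF q(2)])
    show "x \<in> carrier (Ev G (Cod T (Add T f g)))" using x ty by simp
    show "Re (extq G) c x \<otimes>\<^bsub>Ev G (Dom Q c)\<^esub> Re (extq G) d x \<in> carrier (Ev G (Cod T s))" using cx dx ty by simp
    have "Re G s (Re (extq G) c x \<otimes>\<^bsub>Ev G (Dom Q c)\<^esub> Re (extq G) d x) = Re G f x \<otimes>\<^bsub>Ev G (Dom T s)\<^esub> Re G g x"
      using presheafD(4)[OF G, of s "Re (extq G) c x" "Re (extq G) d x"] cx dx ty by simp
    also have "\<dots> = Re G (Add T f g) x" using add[of f g x] xf ty by (simp add: Hom_iff)
    finally show "Re G s (Re (extq G) c x \<otimes>\<^bsub>Ev G (Dom Q c)\<^esub> Re (extq G) d x) = Re G (Add T f g) x" .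
  qed
  then show ?thesis using q c' d' by simp
qed

end

lemma restrict_simps [simp]: "Ev (restrict_q T S H) = Ev H" "Re (restrict_q T S H) f = Re H (qmap T S f)"
  by (auto simp: restrict_q_def)

lemma restrict_presheaf:
  assumes H: "presheaf Q H"
  shows "presheaf T (restrict_q T S H)"
  unfolding presheaf_def
proof (intro conjI ballI impI)
  show "comm_group (Ev (restrict_q T S H) X)" if "X \<in> Obj T" for X using presheafD(1)[OF H] that by simp
  show "Re (restrict_q T S H) (Idn T X) a = a" if "X \<in> Obj T" "a \<in> carrier (Ev (restrict_q T S H) X)" for X a
    using presheafD(2)[OF H, of X a] that by (simp add: qmap_def)
  show "Re (restrict_q T S H) f \<in> hom (Ev (restrict_q T S H) (Cod T f)) (Ev (restrict_q T S H) (Dom T f))" if "f \<in> Arr T" for f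
  proof -
    have "Re H (qmap T S f) \<in> hom (Ev H (Cod Q (qmap T S f))) (Ev H (Dom Q (qmap T S f)))"
      using H qmap_simps(1)[OF that] unfolding presheaf_def by blast
    then show ?thesis using qmap_simps[OF that] by simp
  qed
  show "Re (restrict_q T S H) (g \<cdot> f) a = Re (restrict_q T S H) f (Re (restrict_q T S H) g a)"
    if "f \<in> Arr T" "g \<in> Arr T" "Cod T f = Dom T g" "a \<in> carrier (Ev (restrict_q T S H) (Cod T g))" for f g a
    using presheafD(5)[OF H, of "qmap T S f" "qmap T S g" a] that qmap_simps[of f] qmap_simps[of g] qmap_cmp[of f g] by simp
qed

text \<open>The image of s under q is an isomorphism whose inverse is the roof (s, id).\<close>

lemma restrict_inverts:
  assumes H: "presheaf Q H"
  shows "inverts T S (restrict_q T S H)"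
  unfolding inverts_def
proof
  fix s assume s: "s \<in> W"
  note i = qmap_inverse[OF s] and q = qmap_simps[OF W_arr[OF s]]
  let ?j = "frac T S s (Idn T (Dom T s))"
  have j: "?j \<in> Arr Q" "Dom Q ?j = Cod T s" "Cod Q ?j = Dom T s" using Q_dom_cod[OF i(3)] s by auto
  have "Re H ?j (Re H (qmap T S s) x) = x" if x: "x \<in> carrier (Ev H (Cod T s))" for x
    using presheafD(5)[OF H j(1) q(1)] presheafD(2)[OF H, of "Cod T s" x] x i(1) q j s by simp
  moreover have "Re H (qmap T S s) (Re H ?j x) = x" if x: "x \<in> carrier (Ev H (Dom T s))" for x
    using presheafD(5)[OF H q(1) j(1)] presheafD(2)[OF H, of "Dom T s" x] x i(2) q j s by simp
  moreover have "Re H (qmap T S s) x \<in> carrier (Ev H (Dom T s))" if "x \<in> carrier (Ev H (Cod T s))" for x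
    using presheafD(3)[OF H q(1), of x] that q by simp
  moreover have "Re H ?j x \<in> carrier (Ev H (Cod T s))" if "x \<in> carrier (Ev H (Dom T s))" for x
    using presheafD(3)[OF H j(1), of x] that j by simp
  ultimately show "bij_betw (Re (restrict_q T S H) s) (carrier (Ev (restrict_q T S H) (Cod T s))) (carrier (Ev (restrict_q T S H) (Dom T s)))"
    by (intro bij_betw_byWitness[where f' = "Re H ?j"]) auto
qed

text \<open>Fullness of restriction along q. Naturality for a roof (s, f) is tested after
  restriction along q(s), which is injective and turns the roof into q(f).\<close>

lemma psh_hom_quotient:
  assumes K: "presheaf Q K" and H: "presheaf Q H" and \<theta>: "psh_hom T (restrict_q T S K) (restrict_q T S H) \<theta>"
  shows "psh_hom Q K H \<theta>"
  unfolding psh_hom_def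
proof (intro conjI ballI)
  show "\<theta> X \<in> hom (Ev K X) (Ev H X)" if "X \<in> Obj Q" for X using \<theta> that by (simp add: psh_hom_def)
  show "\<theta> (Dom Q c) (Re K c x) = Re H c (\<theta> (Cod Q c) x)" if c: "c \<in> Arr Q" and x: "x \<in> carrier (Ev K (Cod Q c))" for c x
  proof -
    obtain s f where sf: "(s, f) \<in> roofs T S" "c = frac T S s f" "Dom Q c = Cod T s" "Cod Q c = Cod T f"
      "s \<in> W" "f \<in> Arr T" "Dom T f = Dom T s" by (rule Q_arrE[OF c])
    have sA: "s \<in> Arr T" using sf by simp
    note qs = qmap_simps[OF sA] and qf = qmap_simps[OF sf(6)]
    have e: "Re L (qmap T S s) (Re L c y) = Re L (qmap T S f) y" if "presheaf Q L" "y \<in> carrier (Ev L (Cod T f))" for L :: "('o, ('m \<times> 'm) set, 'x) psh" and y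
      using presheafD(5)[OF that(1) qs(1) c, of y] that frac_qmap[OF sf(1)] qs sf by simp
    have x': "x \<in> carrier (Ev K (Cod T f))" using x sf by simp
    have y: "\<theta> (Cod T f) x \<in> carrier (Ev H (Cod T f))" using psh_homD(1)[OF \<theta>, of "Cod T f" x] x' sf by simp
    have kc: "Re K c x \<in> carrier (Ev K (Cod T s))" using presheafD(3)[OF K c x] sf by simp
    have "Re H (qmap T S s) (\<theta> (Cod T s) (Re K c x)) = \<theta> (Dom T s) (Re K (qmap T S s) (Re K c x))"
      using psh_homD(3)[OF \<theta> sA, of "Re K c x"] kc by simp
    also have "\<dots> = \<theta> (Dom T f) (Re K (qmap T S f) x)" using e[OF K x'] sf by simp
    also have "\<dots> = Re H (qmap T S f) (\<theta> (Cod T f) x)" using psh_homD(3)[OF \<theta> sf(6), of x] x' by simp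
    also have "\<dots> = Re H (qmap T S s) (Re H c (\<theta> (Cod T f) x))" using e[OF H y] by simp
    finally have "Re H (qmap T S s) (\<theta> (Cod T s) (Re K c x)) = Re H (qmap T S s) (Re H c (\<theta> (Cod T f) x))" .
    moreover have "\<theta> (Cod T s) (Re K c x) \<in> carrier (Ev H (Cod T s))" using psh_homD(1)[OF \<theta>, of "Cod T s"] kc sA by simp
    moreover have "Re H c (\<theta> (Cod T f) x) \<in> carrier (Ev H (Cod T s))" using presheafD(3)[OF H c, of "\<theta> (Cod T f) x"] y sf by simp
    ultimately show ?thesis using invertsD(1)[OF restrict_inverts[OF H] sf(5)] sf by simp
  qed
qed

lemma psh_hom_restrict:
  assumes "psh_hom Q K H \<theta>" shows "psh_hom T (restrict_q T S K) (restrict_q T S H) \<theta>"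
  unfolding psh_hom_def
proof (intro conjI ballI)
  show "\<theta> X \<in> hom (Ev (restrict_q T S K) X) (Ev (restrict_q T S H) X)" if "X \<in> Obj T" for X
    using assms that by (simp add: psh_hom_def)
  show "\<theta> (Dom T f) (Re (restrict_q T S K) f x) = Re (restrict_q T S H) f (\<theta> (Cod T f) x)"
    if "f \<in> Arr T" "x \<in> carrier (Ev (restrict_q T S K) (Cod T f))" for f x
    using psh_homD(3)[OF assms, of "qmap T S f" x] that qmap_simps[of f] by simp
qed

text \<open>A triangle of the quotient is isomorphic to the image of one of T, for which exactness
  is that of G. The components of the isomorphism act bijectively and carry images and kernels
  along.\<close>

lemma extq_cohomological:
  assumes C: "cohomological T G" and inv: "inverts T S G"
  shows "cohomological Q (extq G)"
proof -
  note G = cohomological_presheaf[OF C]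
  note P = extq_presheaf[OF G inv]
  let ?E = "extq G"
  have exact: "Re ?E g ` carrier (Ev ?E (Cod Q g)) = kernel (Ev ?E (Cod Q f)) (Ev ?E (Dom Q f)) (Re ?E f)"
    if t: "(f, g, h) \<in> Tri Q" for f g h
  proof -
    let ?R = "frac_category T S"
    have QR: "Arr ?R = Arr Q" "Dom ?R = Dom Q" "Cod ?R = Cod Q" "Obj ?R = Obj Q" "Idn ?R = Idn Q" "Cmp ?R = Cmp Q" "Sho ?R = Sho T"
      by (auto simp: quotient_def frac_category_def)
    obtain f0 g0 h0 where t0: "(f0, g0, h0) \<in> Tri T"
      and c: "candidate_triangle ?R (f, g, h)"
      and iso: "triangles_isomorphic ?R (qmap T S f0, qmap T S g0, qmap T S h0) (f, g, h)"
      using t by (auto simp: quotient_def)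
    note ts = tri_simps[OF t0]
    note q = qmap_simps[OF ts(1)] qmap_simps[OF ts(2)] qmap_simps[OF ts(3)]
    have c': "f \<in> Arr Q" "g \<in> Arr Q" "Cod Q f = Dom Q g" "Cod Q g = Dom Q h" "h \<in> Arr Q"
      using c unfolding candidate_triangle_def case_prod_conv QR by blast+
    obtain i j k where m: "triangle_mor ?R (qmap T S f0, qmap T S g0, qmap T S h0) (f, g, h) (i, j, k)"
      and isos: "iso_arr ?R i" "iso_arr ?R j" "iso_arr ?R k" using iso unfolding triangles_isomorphic_def by blast
    have i: "i \<in> Arr Q" "Dom Q i = Dom T f0" "Cod Q i = Dom Q f"
      and j: "j \<in> Arr Q" "Dom Q j = Cod T f0" "Cod Q j = Cod Q f"
      and k: "k \<in> Arr Q" "Dom Q k = Cod T g0" "Cod Q k = Cod Q g"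
      and sq: "Cmp Q j (qmap T S f0) = Cmp Q f i" "Cmp Q k (qmap T S g0) = Cmp Q g j"
      using m q ts c' unfolding triangle_mor_def case_prod_conv Hom_iff QR by auto
    have bij: "bij_betw (Re ?E l) (carrier (Ev G (Cod Q l))) (carrier (Ev G (Dom Q l)))" if iso: "iso_arr ?R l" for l
    proof -
      obtain l' where l: "l \<in> Arr Q" "l' \<in> Arr Q" "Dom Q l' = Cod Q l" "Cod Q l' = Dom Q l"
        "Cmp Q l' l = Idn Q (Dom Q l)" "Cmp Q l l' = Idn Q (Cod Q l)"
        using iso unfolding iso_arr_def Bex_def Hom_iff QR by blast
      have o: "Dom Q l \<in> Obj Q" "Cod Q l \<in> Obj Q" using Q_obj[OF l(1)] by simp_all
      show ?thesis
      proof (rule bij_betw_byWitness[where f' = "Re ?E l'"])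
        show "\<forall>a \<in> carrier (Ev G (Cod Q l)). Re ?E l' (Re ?E l a) = a"
          using presheafD(5)[OF P l(2,1,4)] presheafD(2)[OF P o(2)] l(6) by simp
        show "\<forall>a \<in> carrier (Ev G (Dom Q l)). Re ?E l (Re ?E l' a) = a"
          using presheafD(5)[OF P l(1,2) l(3)[symmetric]] presheafD(2)[OF P o(1)] l(4,5) by simp
        show "Re ?E l ` carrier (Ev G (Cod Q l)) \<subseteq> carrier (Ev G (Dom Q l))"
          using presheafD(3)[OF P l(1)] by auto
        show "Re ?E l' ` carrier (Ev G (Dom Q l)) \<subseteq> carrier (Ev G (Cod Q l))"
          using presheafD(3)[OF P l(2)] l by auto
      qed
    qed
    have ex: "Re G g0 ` carrier (Ev G (Cod T g0)) = kernel (Ev G (Cod T f0)) (Ev G (Dom T f0)) (Re G f0)"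
      using C t0 unfolding cohomological_def by blast
    have fi: "Re ?E i (Re ?E f y) = Re G f0 (Re ?E j y)" if y: "y \<in> carrier (Ev G (Cod Q f))" for y
    proof -
      have "Re ?E i (Re ?E f y) = Re ?E (Cmp Q f i) y" using presheafD(5)[OF P i(1) c'(1) i(3), of y] y by simp
      also have "\<dots> = Re ?E (qmap T S f0) (Re ?E j y)"
        unfolding sq(1)[symmetric] using presheafD(5)[OF P q(1) j(1), of y] y j q by simp
      also have "\<dots> = Re G f0 (Re ?E j y)"
        using extq_qmap[OF G inv ts(1)] presheafD(3)[OF P j(1), of y] j y by simp
      finally show ?thesis .
    qed
    have gj: "Re ?E j (Re ?E g y) = Re G g0 (Re ?E k y)" if y: "y \<in> carrier (Ev G (Cod Q g))" for y
    proof -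
      have "Re ?E j (Re ?E g y) = Re ?E (Cmp Q g j) y" using presheafD(5)[OF P j(1) c'(2), of y] j c' y by simp
      also have "\<dots> = Re ?E (qmap T S g0) (Re ?E k y)"
        unfolding sq(2)[symmetric] using presheafD(5)[OF P q(4) k(1), of y] y k q by simp
      also have "\<dots> = Re G g0 (Re ?E k y)"
        using extq_qmap[OF G inv ts(2)] presheafD(3)[OF P k(1), of y] k y by simp
      finally show ?thesis .
    qed
    have o: "Dom Q f \<in> Obj T" "Cod Q f \<in> Obj T" using Q_obj[OF c'(1)] by simp_all
    have one_i: "Re ?E i z = \<one>\<^bsub>Ev G (Dom T f0)\<^esub> \<longleftrightarrow> z = \<one>\<^bsub>Ev G (Dom Q f)\<^esub>" if z: "z \<in> carrier (Ev G (Dom Q f))" for z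
    proof -
      interpret A: comm_group "Ev G (Dom Q f)" using presheafD(1)[OF G o(1)] .
      interpret B: comm_group "Ev G (Dom T f0)" using presheafD(1)[OF G dom_obj[OF ts(1)]] .
      interpret group_hom "Ev G (Dom Q f)" "Ev G (Dom T f0)" "Re ?E i"
        by unfold_locales (use P i in \<open>auto simp: presheaf_def simp del: Q_simps\<close>)
      have "inj_on (Re ?E i) (carrier (Ev G (Dom Q f)))" using bij[OF isos(1)] i by (simp add: bij_betw_def)
      then show ?thesis using hom_one z inj_onD[of "Re ?E i" "carrier (Ev G (Dom Q f))" z "\<one>\<^bsub>Ev G (Dom Q f)\<^esub>"] by auto
    qed
    have "y \<in> Re ?E g ` carrier (Ev G (Cod Q g)) \<longleftrightarrow> y \<in> kernel (Ev G (Cod Q f)) (Ev G (Dom Q f)) (Re ?E f)" for y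
    proof
      assume "y \<in> Re ?E g ` carrier (Ev G (Cod Q g))"
      then obtain z where z: "z \<in> carrier (Ev G (Cod Q g))" "y = Re ?E g z" by blast
      have y: "y \<in> carrier (Ev G (Cod Q f))" using presheafD(3)[OF P c'(2), of z] z c' by simp
      have "Re ?E k z \<in> carrier (Ev G (Cod T g0))" using presheafD(3)[OF P k(1), of z] z k by simp
      then have "Re ?E j y \<in> kernel (Ev G (Cod T f0)) (Ev G (Dom T f0)) (Re G f0)" using gj[OF z(1)] z ex by blast
      then have "Re ?E i (Re ?E f y) = \<one>\<^bsub>Ev G (Dom T f0)\<^esub>" using fi[OF y] by (simp add: kernel_def)
      then have "Re ?E f y = \<one>\<^bsub>Ev G (Dom Q f)\<^esub>" using one_i presheafD(3)[OF P c'(1), of y] y by simp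
      then show "y \<in> kernel (Ev G (Cod Q f)) (Ev G (Dom Q f)) (Re ?E f)" using y by (simp add: kernel_def)
    next
      assume "y \<in> kernel (Ev G (Cod Q f)) (Ev G (Dom Q f)) (Re ?E f)"
      then have y: "y \<in> carrier (Ev G (Cod Q f))" "Re ?E f y = \<one>\<^bsub>Ev G (Dom Q f)\<^esub>" by (auto simp: kernel_def)
      interpret A: comm_group "Ev G (Dom Q f)" using presheafD(1)[OF G o(1)] .
      have "Re G f0 (Re ?E j y) = \<one>\<^bsub>Ev G (Dom T f0)\<^esub>" using fi[OF y(1)] one_i[of "\<one>\<^bsub>Ev G (Dom Q f)\<^esub>"] y by simp
      then have "Re ?E j y \<in> kernel (Ev G (Cod T f0)) (Ev G (Dom T f0)) (Re G f0)"
        using presheafD(3)[OF P j(1), of y] y j by (simp add: kernel_def)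
      then obtain b where b: "b \<in> carrier (Ev G (Cod T g0))" "Re ?E j y = Re G g0 b" using ex by blast
      obtain z where z: "z \<in> carrier (Ev G (Cod Q g))" "Re ?E k z = b"
        using bij_betw_imp_surj_on[OF bij[OF isos(3)]] b k by (metis imageE)
      have "Re ?E j y = Re ?E j (Re ?E g z)" using gj[OF z(1)] z b by simp
      moreover have "Re ?E g z \<in> carrier (Ev G (Cod Q f))" using presheafD(3)[OF P c'(2), of z] z c' by simp
      moreover have "inj_on (Re ?E j) (carrier (Ev G (Cod Q f)))" using bij[OF isos(2)] j by (simp add: bij_betw_def)
      ultimately have "y = Re ?E g z" using y by (meson inj_onD)
      then show "y \<in> Re ?E g ` carrier (Ev G (Cod Q g))" using z by blast
    qed
    then show ?thesis by auto
  qed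
  show ?thesis unfolding cohomological_def
  proof (intro conjI ballI impI)
    show "comm_group (Ev ?E X)" if "X \<in> Obj Q" for X using presheafD(1)[OF P that] .
    show "Re ?E (Idn Q X) a = a" if "X \<in> Obj Q" "a \<in> carrier (Ev ?E X)" for X a using presheafD(2)[OF P that] .
    show "Re ?E f \<in> hom (Ev ?E (Cod Q f)) (Ev ?E (Dom Q f))" if "f \<in> Arr Q" for f
      using P that unfolding presheaf_def by blast
    show "Re ?E (Cmp Q g f) a = Re ?E f (Re ?E g a)"
      if "f \<in> Arr Q" "g \<in> Arr Q" "Cod Q f = Dom Q g" "a \<in> carrier (Ev ?E (Cod Q g))" for f g a
      using presheafD(5)[OF P that] .
    show "Re ?E (Add Q f g) a = Re ?E f a \<otimes>\<^bsub>Ev ?E (Dom Q f)\<^esub> Re ?E g a"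
      if f: "f \<in> Arr Q" and g: "g \<in> Hom Q (Dom Q f) (Cod Q f)" and a: "a \<in> carrier (Ev ?E (Cod Q f))" for f g a
    proof -
      have g': "g \<in> Arr Q" "Dom Q g = Dom Q f" "Cod Q g = Cod Q f" using g unfolding Hom_iff by auto
      have "Re (extq G) (Add Q f g) a = Re (extq G) f a \<otimes>\<^bsub>Ev G (Dom Q f)\<^esub> Re (extq G) g a"
        by (rule extq_add[OF G inv f g']) (use a C in \<open>simp_all add: cohomological_def\<close>)
      then show ?thesis by simp
    qed
    show "case t of (f, g, h) \<Rightarrow> Re ?E g ` carrier (Ev ?E (Cod Q g)) =
      kernel (Ev ?E (Cod Q f)) (Ev ?E (Dom Q f)) (Re ?E f)" if "t \<in> Tri Q" for t
      using exact that by (cases t) blast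
  qed
qed

end

section \<open>The left adjoint\<close>

context verdier begin

text \<open>Restricting \<open>extq G\<close> gives back G up to the values of restriction maps on
  carriers. The comparison is therefore stated for morphisms and not as an equation of
  functors.\<close>

lemma psh_hom_extq_left:
  assumes G: "presheaf T G" "inverts T S G"
  shows "psh_hom T (restrict_q T S (extq G)) H \<theta> \<longleftrightarrow> psh_hom T G H \<theta>"
  unfolding psh_hom_def using extq_qmap[OF G] by simp

lemma psh_hom_extq_right:
  assumes G: "presheaf T G" "inverts T S G"
  shows "psh_hom T F (restrict_q T S (extq G)) \<theta> \<longleftrightarrow> psh_hom T F G \<theta>"
proof -
  have "Re G f (\<theta> (Cod T f) a) = Re (extq G) (qmap T S f) (\<theta> (Cod T f) a)"
    if "\<forall>X \<in> Obj T. \<theta> X \<in> hom (Ev F X) (Ev G X)" "f \<in> Arr T" "a \<in> carrier (Ev F (Cod T f))" for f a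
  proof -
    have "\<theta> (Cod T f) a \<in> carrier (Ev G (Cod T f))" using that by (auto simp: hom_def)
    then show ?thesis using extq_qmap[OF G that(2)] by simp
  qed
  then show ?thesis unfolding psh_hom_def by (auto simp del: Q_simps)
qed

text \<open>A localization is chosen for every F. The action on a morphism is the extension of its
  composite with the unit; functoriality and the universal property follow from existence and
  uniqueness of extensions.\<close>

lemma left_adjoint_exists:
  assumes inf: "infinite (UNIV :: 'g set)" and small: "essentially_small T (UNIV :: 'g set)"
  shows "\<exists>A :: ('o, 'm, 'g) ladj. is_left_adjoint T S A"
proof -
  have "\<forall>F :: ('o, 'm, 'g) psh. \<exists>p :: ('o, 'm, 'g) psh \<times> ('o \<Rightarrow> 'g \<Rightarrow> 'g). cohomological T F \<longrightarrow> localization T S F (fst p) (snd p)"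
    using localization_exists[OF inf small] by (metis fst_conv snd_conv)
  then obtain p :: "('o, 'm, 'g) psh \<Rightarrow> ('o, 'm, 'g) psh \<times> ('o \<Rightarrow> 'g \<Rightarrow> 'g)"
    where p: "\<And>F. cohomological T F \<Longrightarrow> localization T S F (fst (p F)) (snd (p F))" by metis
  define K \<eta> where "K = (\<lambda>F. fst (p F))" and "\<eta> = (\<lambda>F. snd (p F))"
  have L: "localization T S F (K F) (\<eta> F)" if "cohomological T F" for F using p[OF that] by (simp add: K_def \<eta>_def)
  have Kc: "cohomological T (K F)" "presheaf T (K F)" "inverts T S (K F)" "presheaf Q (extq (K F))" if "cohomological T F" for F
    using localizationD[OF L[OF that]] cohomological_presheaf extq_presheaf by blast+
  have ex: "\<exists>\<theta>. psh_hom T (K F) (K G) \<theta> \<and> (\<forall>X \<in> Obj T. \<forall>a \<in> carrier (Ev F X). \<theta> X (\<eta> F X a) = \<eta> G X (\<phi> X a))"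
    if "cohomological T F" "cohomological T G" "psh_hom T F G \<phi>" for F G \<phi>
  proof -
    have "psh_hom T F (K G) (mor_comp (\<eta> G) \<phi>)" by (rule psh_hom_comp[OF that(3) localizationD(2)[OF L[OF that(2)]]])
    from extension_exists[OF cohomological_presheaf[OF that(1)] L[OF that(1)] Kc(2,3)[OF that(2)] this]
    show ?thesis unfolding mor_comp_def by metis
  qed
  define M where "M = (\<lambda>F G \<phi>. SOME \<theta>. psh_hom T (K F) (K G) \<theta> \<and>
    (\<forall>X \<in> Obj T. \<forall>a \<in> carrier (Ev F X). \<theta> X (\<eta> F X a) = \<eta> G X (\<phi> X a)))"
  have M: "psh_hom T (K F) (K G) (M F G \<phi>)"
    "\<And>X a. X \<in> Obj T \<Longrightarrow> a \<in> carrier (Ev F X) \<Longrightarrow> M F G \<phi> X (\<eta> F X a) = \<eta> G X (\<phi> X a)"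
    if "cohomological T F" "cohomological T G" "psh_hom T F G \<phi>" for F G \<phi>
    using someI_ex[OF ex[OF that]] unfolding M_def by blast+
  have uniq: "\<theta> X x = \<theta>' X x"
    if "cohomological T F" "inverts T S H" "psh_hom T (K F) H \<theta>" "psh_hom T (K F) H \<theta>'"
      "\<And>X a. X \<in> Obj T \<Longrightarrow> a \<in> carrier (Ev F X) \<Longrightarrow> \<theta> X (\<eta> F X a) = \<theta>' X (\<eta> F X a)" "X \<in> Obj T" "x \<in> carrier (Ev (K F) X)"
    for F and H :: "('o, 'm, 'g) psh" and \<theta> \<theta>' X x
    using extension_unique[OF L[OF that(1)] that(2-7)] .
  have idh: "psh_hom T F F (\<lambda>X a. a)" if "cohomological T F" for F :: "('o, 'm, 'g) psh"
    by (auto simp: psh_hom_def hom_def)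
  define A :: "('o, 'm, 'g) ladj" where "A = \<lparr>Lob = (\<lambda>F. extq (K F)), Lmor = M, Unit = \<eta>\<rparr>"
  have "is_left_adjoint T S A"
    unfolding is_left_adjoint_def
  proof (intro conjI allI impI)
    fix F :: "('o, 'm, 'g) psh" assume F: "cohomological T F"
    show "cohomological Q (Lob A F)" using extq_cohomological[OF Kc(1,3)[OF F]] by (simp add: A_def)
    show "mor_eq Q (Lob A F) (Lmor A F F (\<lambda>X a. a)) (\<lambda>X a. a)"
      unfolding mor_eq_def
    proof (intro ballI)
      fix X x assume "X \<in> Obj Q" "x \<in> carrier (Ev (Lob A F) X)"
      then have X: "X \<in> Obj T" "x \<in> carrier (Ev (K F) X)" by (auto simp: A_def)
      have "M F F (\<lambda>X a. a) X x = (\<lambda>X a. a) X x"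
        by (rule uniq[OF F Kc(3)[OF F] M(1)[OF F F idh[OF F]] idh[OF Kc(1)[OF F]] _ X]) (use M(2)[OF F F idh[OF F]] in simp)
      then show "Lmor A F F (\<lambda>X a. a) X x = x" by (simp add: A_def)
    qed
    show "psh_hom T F (restrict_q T S (Lob A F)) (Unit A F)"
      using localizationD(2)[OF L[OF F]] by (simp add: A_def psh_hom_extq_right[OF Kc(2,3)[OF F]])
  next
    fix F G :: "('o, 'm, 'g) psh" and \<phi> assume a: "cohomological T F \<and> cohomological T G \<and> psh_hom T F G \<phi>"
    then have F: "cohomological T F" and G: "cohomological T G" and \<phi>: "psh_hom T F G \<phi>" by auto
    show "psh_hom Q (Lob A F) (Lob A G) (Lmor A F G \<phi>)"
      using psh_hom_quotient[OF Kc(4)[OF F] Kc(4)[OF G]] M(1)[OF F G \<phi>]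
      by (simp add: A_def psh_hom_extq_left[OF Kc(2,3)[OF F]] psh_hom_extq_right[OF Kc(2,3)[OF G]])
    show "mor_eq T F (mor_comp (Unit A G) \<phi>) (mor_comp (Lmor A F G \<phi>) (Unit A F))"
      using M(2)[OF F G \<phi>] by (simp add: A_def mor_eq_def mor_comp_def)
  next
    fix F G H :: "('o, 'm, 'g) psh" and \<phi> \<psi>
    assume "cohomological T F \<and> cohomological T G \<and> cohomological T H \<and> psh_hom T F G \<phi> \<and> psh_hom T G H \<psi>"
    then have F: "cohomological T F" and G: "cohomological T G" and H: "cohomological T H"
      and \<phi>: "psh_hom T F G \<phi>" and \<psi>: "psh_hom T G H \<psi>" by auto
    note c = psh_hom_comp[OF \<phi> \<psi>]
    show "mor_eq Q (Lob A F) (Lmor A F H (mor_comp \<psi> \<phi>)) (mor_comp (Lmor A G H \<psi>) (Lmor A F G \<phi>))"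
      unfolding mor_eq_def
    proof (intro ballI)
      fix X x assume "X \<in> Obj Q" "x \<in> carrier (Ev (Lob A F) X)"
      then have X: "X \<in> Obj T" "x \<in> carrier (Ev (K F) X)" by (auto simp: A_def)
      have "M F H (mor_comp \<psi> \<phi>) X x = mor_comp (M G H \<psi>) (M F G \<phi>) X x"
        by (rule uniq[OF F Kc(3)[OF H] M(1)[OF F H c] psh_hom_comp[OF M(1)[OF F G \<phi>] M(1)[OF G H \<psi>]] _ X])
          (use M(2)[OF F H c] M(2)[OF F G \<phi>] M(2)[OF G H \<psi>] psh_homD(1)[OF \<phi>] in \<open>simp add: mor_comp_def\<close>)
      then show "Lmor A F H (mor_comp \<psi> \<phi>) X x = mor_comp (Lmor A G H \<psi>) (Lmor A F G \<phi>) X x" by (simp add: A_def)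
    qed
  next
    fix F :: "('o, 'm, 'g) psh" and G :: "('o, ('m \<times> 'm) set, 'g) psh" and \<phi>
    assume "cohomological T F \<and> cohomological Q G \<and> psh_hom T F (restrict_q T S G) \<phi>"
    then have F: "cohomological T F" and G: "presheaf Q G" and \<phi>: "psh_hom T F (restrict_q T S G) \<phi>"
      using cohomological_presheaf by auto
    note R = restrict_presheaf[OF G] restrict_inverts[OF G]
    obtain \<theta> where \<theta>: "psh_hom T (K F) (restrict_q T S G) \<theta>" "\<And>X a. X \<in> Obj T \<Longrightarrow> a \<in> carrier (Ev F X) \<Longrightarrow> \<theta> X (\<eta> F X a) = \<phi> X a"
      using extension_exists[OF cohomological_presheaf[OF F] L[OF F] R \<phi>] by blast
    have \<theta>': "psh_hom Q (Lob A F) G \<theta>"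
      using psh_hom_quotient[OF Kc(4)[OF F] G] \<theta>(1) by (simp add: A_def psh_hom_extq_left[OF Kc(2,3)[OF F]])
    show "\<exists>\<psi>. psh_hom Q (Lob A F) G \<psi> \<and> mor_eq T F (mor_comp \<psi> (Unit A F)) \<phi> \<and>
      (\<forall>\<psi>'. psh_hom Q (Lob A F) G \<psi>' \<and> mor_eq T F (mor_comp \<psi>' (Unit A F)) \<phi> \<longrightarrow> mor_eq Q (Lob A F) \<psi>' \<psi>)"
    proof (intro exI[of _ \<theta>] conjI allI impI \<theta>')
      show "mor_eq T F (mor_comp \<theta> (Unit A F)) \<phi>" using \<theta>(2) by (simp add: mor_eq_def mor_comp_def A_def)
      fix \<psi>' assume \<psi>': "psh_hom Q (Lob A F) G \<psi>' \<and> mor_eq T F (mor_comp \<psi>' (Unit A F)) \<phi>"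
      have h: "psh_hom T (K F) (restrict_q T S G) \<psi>'"
        using psh_hom_restrict[of "Lob A F" G \<psi>'] \<psi>' by (simp add: A_def psh_hom_extq_left[OF Kc(2,3)[OF F]])
      show "mor_eq Q (Lob A F) \<psi>' \<theta>" unfolding mor_eq_def
      proof (intro ballI)
        fix X x assume "X \<in> Obj Q" "x \<in> carrier (Ev (Lob A F) X)"
        then have X: "X \<in> Obj T" "x \<in> carrier (Ev (K F) X)" by (auto simp: A_def)
        show "\<psi>' X x = \<theta> X x"
          by (rule uniq[OF F R(2) h \<theta>(1) _ X]) (use \<psi>' \<theta>(2) in \<open>simp add: mor_eq_def mor_comp_def A_def\<close>)
      qed
    qed
  qed
  then show ?thesis by blast
qed

lemma pull_q_left_adjoint:
  assumes "infinite (UNIV :: 'g set)" "essentially_small T (UNIV :: 'g set)"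
  shows "is_left_adjoint T S (pull_q T S :: ('o, 'm, 'g) ladj)"
  unfolding pull_q_def using someI_ex[OF left_adjoint_exists[OF assms]] .

lemma left_adjointD:
  fixes A :: "('o, 'm, 'g) ladj" and H :: "('o, ('m \<times> 'm) set, 'g) psh"
  assumes "is_left_adjoint T S A"
  shows "cohomological T F \<Longrightarrow> cohomological Q (Lob A F)"
    and "cohomological T F \<Longrightarrow> cohomological T G \<Longrightarrow> psh_hom T F G \<phi> \<Longrightarrow> psh_hom Q (Lob A F) (Lob A G) (Lmor A F G \<phi>)"
    and "cohomological T F \<Longrightarrow> psh_hom T F (restrict_q T S (Lob A F)) (Unit A F)"
    and "cohomological T F \<Longrightarrow> cohomological T G \<Longrightarrow> psh_hom T F G \<phi> \<Longrightarrow>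
      mor_eq T F (mor_comp (Unit A G) \<phi>) (mor_comp (Lmor A F G \<phi>) (Unit A F))"
    and "cohomological T F \<Longrightarrow> cohomological Q H \<Longrightarrow> psh_hom T F (restrict_q T S H) \<phi>' \<Longrightarrow>
      \<exists>\<psi>. psh_hom Q (Lob A F) H \<psi> \<and> mor_eq T F (mor_comp \<psi> (Unit A F)) \<phi>' \<and>
          (\<forall>\<psi>'. psh_hom Q (Lob A F) H \<psi>' \<and> mor_eq T F (mor_comp \<psi>' (Unit A F)) \<phi>' \<longrightarrow> mor_eq Q (Lob A F) \<psi>' \<psi>)"
proof -
  note a = assms[unfolded is_left_adjoint_def]
  note a1 = a[THEN conjunct1, rule_format] and a2 = a[THEN conjunct2, THEN conjunct1, rule_format]
  note b = a[THEN conjunct2, THEN conjunct2, THEN conjunct2, THEN conjunct2]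
  note b1 = b[THEN conjunct1, rule_format] and b2 = b[THEN conjunct2, THEN conjunct1, rule_format]
    and b3 = b[THEN conjunct2, THEN conjunct2, THEN spec, THEN spec, THEN spec, THEN mp]
  show "cohomological T F \<Longrightarrow> cohomological Q (Lob A F)" by (rule a1)
  show "cohomological T F \<Longrightarrow> cohomological T G \<Longrightarrow> psh_hom T F G \<phi> \<Longrightarrow> psh_hom Q (Lob A F) (Lob A G) (Lmor A F G \<phi>)"
    by (rule a2) blast
  show "cohomological T F \<Longrightarrow> psh_hom T F (restrict_q T S (Lob A F)) (Unit A F)" by (rule b1)
  show "cohomological T F \<Longrightarrow> cohomological T G \<Longrightarrow> psh_hom T F G \<phi> \<Longrightarrow>
      mor_eq T F (mor_comp (Unit A G) \<phi>) (mor_comp (Lmor A F G \<phi>) (Unit A F))" by (rule b2) blast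
  show "cohomological T F \<Longrightarrow> cohomological Q H \<Longrightarrow> psh_hom T F (restrict_q T S H) \<phi>' \<Longrightarrow>
      \<exists>\<psi>. psh_hom Q (Lob A F) H \<psi> \<and> mor_eq T F (mor_comp \<psi> (Unit A F)) \<phi>' \<and>
          (\<forall>\<psi>'. psh_hom Q (Lob A F) H \<psi>' \<and> mor_eq T F (mor_comp \<psi>' (Unit A F)) \<phi>' \<longrightarrow> mor_eq Q (Lob A F) \<psi>' \<psi>)"
    by (rule b3) blast
qed

text \<open>By uniqueness of adjoints, the chosen left adjoint is a localization as well.\<close>

lemma Lfun_localization:
  fixes F :: "('o, 'm, 'g) psh"
  assumes inf: "infinite (UNIV :: 'g set)" and small: "essentially_small T (UNIV :: 'g set)"
    and F: "cohomological T F"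
  shows "localization T S F (Fo (Lfun T S) F) (Unit (pull_q T S) F)"
proof -
  define A :: "('o, 'm, 'g) ladj" where "A = pull_q T S"
  note A = left_adjointD[OF pull_q_left_adjoint[OF inf small, folded A_def]]
  obtain G :: "('o, 'm, 'g) psh" and \<eta> where L: "localization T S F G \<eta>" by (rule localization_exists[OF inf small F])
  note LD = localizationD[OF L]
  note P = cohomological_presheaf[OF F] and GP = cohomological_presheaf[OF LD(1)]
  note KC = A(1)[OF F] note KP = cohomological_presheaf[OF KC]
  let ?K = "Lob A F"
  note R = restrict_presheaf[OF KP] restrict_inverts[OF KP]
  note EP = extq_presheaf[OF GP LD(3)]
  obtain \<psi> where \<psi>: "psh_hom T G (restrict_q T S ?K) \<psi>" "\<And>X a. X \<in> Obj T \<Longrightarrow> a \<in> carrier (Ev F X) \<Longrightarrow> \<psi> X (\<eta> X a) = Unit A F X a"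
    using extension_exists[OF P L R A(3)[OF F]] by blast
  have "psh_hom T F (restrict_q T S (extq G)) \<eta>" by (rule psh_hom_extq_right[OF GP LD(3), THEN iffD2, OF LD(2)])
  from A(5)[OF F extq_cohomological[OF LD(1,3)] this]
  obtain \<chi> where \<chi>: "psh_hom Q ?K (extq G) \<chi>" "mor_eq T F (mor_comp \<chi> (Unit A F)) \<eta>" by blast
  have \<chi>': "psh_hom T (restrict_q T S ?K) G \<chi>" by (rule psh_hom_extq_right[OF GP LD(3), THEN iffD1, OF psh_hom_restrict[OF \<chi>(1)]])
  have \<psi>': "psh_hom Q (extq G) ?K \<psi>"
    using psh_hom_quotient[OF EP KP] \<psi>(1) by (simp add: psh_hom_extq_left[OF GP LD(3)])
  have 1: "\<chi> X (\<psi> X x) = x" if X: "X \<in> Obj T" "x \<in> carrier (Ev G X)" for X x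
  proof -
    have "mor_comp \<chi> \<psi> X x = (\<lambda>X a. a) X x"
    proof (rule extension_unique[OF L LD(3) psh_hom_comp[OF \<psi>(1) \<chi>'] _ _ X])
      show "psh_hom T G G (\<lambda>X a. a)" by (auto simp: psh_hom_def hom_def)
      show "mor_comp \<chi> \<psi> X (\<eta> X a) = \<eta> X a" if "X \<in> Obj T" "a \<in> carrier (Ev F X)" for X a
        using \<psi>(2)[OF that] \<chi>(2) that by (simp add: mor_eq_def mor_comp_def)
    qed
    then show ?thesis by (simp add: mor_comp_def)
  qed
  have 2: "\<psi> X (\<chi> X y) = y" if X: "X \<in> Obj T" "y \<in> carrier (Ev ?K X)" for X y
  proof -
    \<comment> \<open>On the side of the adjoint, uniqueness is its universal property for the unit
      itself: both endomorphisms agree with \<xi>.\<close>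
    obtain \<xi> where \<xi>: "\<And>\<psi>'. psh_hom Q ?K ?K \<psi>' \<Longrightarrow> mor_eq T F (mor_comp \<psi>' (Unit A F)) (Unit A F) \<Longrightarrow> mor_eq Q ?K \<psi>' \<xi>"
      using A(5)[OF F KC A(3)[OF F]] by blast
    have "psh_hom T (restrict_q T S ?K) (restrict_q T S ?K) (mor_comp \<psi> \<chi>)" by (rule psh_hom_comp[OF \<chi>' \<psi>(1)])
    then have "mor_eq Q ?K (mor_comp \<psi> \<chi>) \<xi>"
      using \<xi>[OF psh_hom_quotient[OF KP KP]] \<psi>(2) \<chi>(2) by (simp add: mor_eq_def mor_comp_def)
    moreover have "mor_eq Q ?K (\<lambda>X a. a) \<xi>" by (rule \<xi>) (auto simp: psh_hom_def hom_def mor_eq_def mor_comp_def)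
    ultimately show ?thesis using X by (simp add: mor_eq_def mor_comp_def)
  qed
  have bij: "bij_betw (\<psi> X) (carrier (Ev G X)) (carrier (Ev (restrict_q T S ?K) X))" if X: "X \<in> Obj T" for X
    by (rule bij_betw_byWitness[where f' = "\<chi> X"])
      (use 1[OF X] 2[OF X] psh_homD(1)[OF \<psi>(1) X] psh_homD(1)[OF \<chi>' X] in auto)
  have "localization T S F (restrict_q T S ?K) (mor_comp \<psi> \<eta>)"
    by (rule localization_transport[OF P L presheafD(1)[OF R(1)] \<psi>(1) bij])
  moreover have "psh_hom T F (restrict_q T S ?K) (Unit A F)" by (rule A(3)[OF F])
  ultimately have "localization T S F (restrict_q T S ?K) (Unit A F)"
    unfolding localization_def using \<psi>(2) by (simp add: mor_comp_def)
  then show ?thesis by (simp add: Lfun_def A_def)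
qed

lemma Lfun_functor:
  fixes F G :: "('o, 'm, 'g) psh"
  assumes inf: "infinite (UNIV :: 'g set)" and small: "essentially_small T (UNIV :: 'g set)"
    and F: "cohomological T F" and G: "cohomological T G" and \<phi>: "psh_hom T F G \<phi>"
  shows "psh_hom T (Fo (Lfun T S) F) (Fo (Lfun T S) G) (Fm (Lfun T S) F G \<phi>)"
    "\<And>X a. X \<in> Obj T \<Longrightarrow> a \<in> carrier (Ev F X) \<Longrightarrow>
      Fm (Lfun T S) F G \<phi> X (Unit (pull_q T S) F X a) = Unit (pull_q T S) G X (\<phi> X a)"
proof -
  note A = left_adjointD[OF pull_q_left_adjoint[OF inf small]]
  show "psh_hom T (Fo (Lfun T S) F) (Fo (Lfun T S) G) (Fm (Lfun T S) F G \<phi>)"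
    using psh_hom_restrict[OF A(2)[OF F G \<phi>]] by (simp add: Lfun_def)
  show "\<And>X a. X \<in> Obj T \<Longrightarrow> a \<in> carrier (Ev F X) \<Longrightarrow>
      Fm (Lfun T S) F G \<phi> X (Unit (pull_q T S) F X a) = Unit (pull_q T S) G X (\<phi> X a)"
    using A(4)[OF F G \<phi>] by (simp add: Lfun_def mor_eq_def mor_comp_def)
qed

end

text \<open>The localization at R inverts in particular the maps with cone in S, so its unit extends
  along that of S. This gives the choice in \<open>canon\<close> a witness.\<close>

lemma (in triangulated_category) canon_hom:
  fixes F :: "('a, 'b, 'g) psh"
  assumes inf: "infinite (UNIV :: 'g set)" and small: "essentially_small T (UNIV :: 'g set)"
    and S: "triangulated_subcategory T S" and R: "triangulated_subcategory T R" and SR: "S \<subseteq> R"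
    and F: "cohomological T F"
  shows "psh_hom T (Fo (Lfun T S) F) (Fo (Lfun T R) F) (canon T S R F)"
    "\<And>X a. X \<in> Obj T \<Longrightarrow> a \<in> carrier (Ev F X) \<Longrightarrow> canon T S R F X (Unit (pull_q T S) F X a) = Unit (pull_q T R) F X a"
proof -
  interpret VS: verdier T S by unfold_locales (rule S)
  interpret VR: verdier T R by unfold_locales (rule R)
  note LS = VS.Lfun_localization[OF inf small F] and LR = VR.Lfun_localization[OF inf small F]
  note D = localizationD[OF LR]
  obtain \<theta> where "psh_hom T (Fo (Lfun T S) F) (Fo (Lfun T R) F) \<theta>"
    "\<And>X a. X \<in> Obj T \<Longrightarrow> a \<in> carrier (Ev F X) \<Longrightarrow> \<theta> X (Unit (pull_q T S) F X a) = Unit (pull_q T R) F X a"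
    using VS.extension_exists[OF cohomological_presheaf[OF F] LS cohomological_presheaf[OF D(1)] inverts_mono[OF D(3) SR] D(2)] by blast
  then have "\<exists>\<theta>. psh_hom T (Fo (Lfun T S) F) (Fo (Lfun T R) F) \<theta> \<and>
     mor_eq T F (mor_comp \<theta> (Unit (pull_q T S) F)) (Unit (pull_q T R) F)" by (auto simp: mor_eq_def mor_comp_def)
  from someI_ex[OF this] have c: "psh_hom T (Fo (Lfun T S) F) (Fo (Lfun T R) F) (canon T S R F)"
     "mor_eq T F (mor_comp (canon T S R F) (Unit (pull_q T S) F)) (Unit (pull_q T R) F)" unfolding canon_def by blast+
  show "psh_hom T (Fo (Lfun T S) F) (Fo (Lfun T R) F) (canon T S R F)" by (rule c(1))
  show "\<And>X a. X \<in> Obj T \<Longrightarrow> a \<in> carrier (Ev F X) \<Longrightarrow> canon T S R F X (Unit (pull_q T S) F X a) = Unit (pull_q T R) F X a"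
    using c(2) by (simp add: mor_eq_def mor_comp_def)
qed

text \<open>Both composites are morphisms out of a localization of F that agree on elements of
  F.\<close>

lemma (in triangulated_category) canon_natural:
  fixes F G :: "('a, 'b, 'g) psh"
  assumes inf: "infinite (UNIV :: 'g set)" and small: "essentially_small T (UNIV :: 'g set)"
    and S: "triangulated_subcategory T S" and R: "triangulated_subcategory T R" and SR: "S \<subseteq> R"
    and F: "cohomological T F" and G: "cohomological T G" and \<phi>: "psh_hom T F G \<phi>"
    and X: "X \<in> Obj T" "x \<in> carrier (Ev (Fo (Lfun T S) F) X)"
  shows "canon T S R G X (Fm (Lfun T S) F G \<phi> X x) = Fm (Lfun T R) F G \<phi> X (canon T S R F X x)"
proof -
  interpret VS: verdier T S by unfold_locales (rule S)
  interpret VR: verdier T R by unfold_locales (rule R)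
  note cF = canon_hom[OF inf small S R SR F] and cG = canon_hom[OF inf small S R SR G]
  note fS = VS.Lfun_functor[OF inf small F G \<phi>] and fR = VR.Lfun_functor[OF inf small F G \<phi>]
  note LR = localizationD(3)[OF VR.Lfun_localization[OF inf small G]]
  have "mor_comp (canon T S R G) (Fm (Lfun T S) F G \<phi>) X x = mor_comp (Fm (Lfun T R) F G \<phi>) (canon T S R F) X x"
    by (rule VS.extension_unique[OF VS.Lfun_localization[OF inf small F] inverts_mono[OF LR SR]
          psh_hom_comp[OF fS(1) cG(1)] psh_hom_comp[OF cF(1) fR(1)] _ X])
      (use fS(2) fR(2) cF(2) cG(2) psh_homD(1)[OF \<phi>] in \<open>simp add: mor_comp_def\<close>)
  then show ?thesis by (simp add: mor_comp_def)
qed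

section \<open>Commuting subcategories\<close>

lemma (in triangulated_category) subcat_first:
  assumes "triangulated_subcategory T S" "(f, g, h) \<in> Tri T" "Cod T f \<in> S" "Cod T g \<in> S"
  shows "Dom T f \<in> S"
  using subcat_cone[OF assms(1) rotate[OF assms(2)]] tri_simps[OF assms(2)] assms subcat_sho[OF assms(1)] by simp

context verdier begin

text \<open>Independence of the chosen cone, by the octahedral axiom for s composed with an
  identity: \<open>Cod T g\<close> becomes an extension of a cone in S by a zero object.\<close>

lemma W_any:
  assumes "s \<in> W" "(s, g, h) \<in> Tri T" shows "Cod T g \<in> S"
proof -
  obtain g1 g2 where g1: "(s, g1, g2) \<in> Tri T" "Cod T g1 \<in> S" using W_E assms(1) by blast
  obtain Z where z: "zero_object T Z" using zero_exists by blast
  then have Z: "Z \<in> S" "Z \<in> Obj T" using subcat_zero[OF subcat] zero_object_iff by blast+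
  have s: "s \<in> Arr T" using assms by simp
  have t: "(s \<cdot> Idn T (Dom T s), g, h) \<in> Tri T" using assms s by simp
  have d: "Dom T s \<in> Obj T" "Idn T (Dom T s) \<in> Arr T" "Cod T (Idn T (Dom T s)) = Dom T s" using s by auto
  obtain u v w where "(u, v, w) \<in> Tri T" "Dom T u = Cod T (Nul T (Dom T s) Z)" "Cod T u = Cod T g" "Cod T v = Cod T g1"
    using octahedron[OF d(2,3) zero_tri(1)[OF z d(1)] g1(1) t] by metis
  then show ?thesis using subcat_mid[OF subcat, of u v w] g1 Z d by simp
qed

lemma neg_W:
  assumes "s \<in> W" shows "Neg T s \<in> W"
proof -
  let ?n = "Neg T (Idn T (Dom T s))"
  have s: "s \<in> Arr T" using assms by simp
  have "iso_arr T ?n" by (rule iso_arrI[of ?n ?n]) (use s in auto)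
  then have "?n \<in> W" by (rule iso_W)
  then have "s \<cdot> ?n \<in> W" by (rule cmp_W) (use assms s in auto)
  then show ?thesis using s by simp
qed

text \<open>Three rotations turn the triangle of s into one starting with the negative of \<Sigma>s,
  whose cone is the suspended cone of s; \<open>neg_W\<close> removes the sign.\<close>

lemma sha_W_iff:
  assumes s: "s \<in> Arr T" shows "Sha T s \<in> W \<longleftrightarrow> s \<in> W"
proof -
  obtain a b where t: "(s, a, b) \<in> Tri T" using coneE[OF s] by blast
  note ts = tri_simps[OF t]
  have t3: "(Neg T (Sha T s), Neg T (Sha T a), Neg T (Sha T b)) \<in> Tri T"
    using rotate[OF rotate[OF rotate[OF t]]] .
  have c: "Cod T (Neg T (Sha T a)) \<in> S \<longleftrightarrow> Cod T a \<in> S" using ts subcat_sho[OF subcat] by simp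
  show ?thesis
  proof
    assume "Sha T s \<in> W"
    then have "Cod T (Neg T (Sha T a)) \<in> S" using W_any[OF neg_W t3] by blast
    then show "s \<in> W" using W_I[OF t] c by simp
  next
    assume "s \<in> W"
    then have "Neg T (Sha T s) \<in> W" using W_I[OF t3] c W_any[OF _ t] by blast
    then have "Neg T (Neg T (Sha T s)) \<in> W" by (rule neg_W)
    then show "Sha T s \<in> W" using s by simp
  qed
qed

end

section \<open>Exchange and refinement of U-maps and V-maps for a commuting pair\<close>

locale commuting = triangulated_category T for T :: "('o, 'm) tcat" (structure) +
  fixes U V :: "'o set"
  assumes U: "U \<in> Thick T" and V: "V \<in> Thick T" and comm: "commuting_pair T U V"
begin

sublocale VU: verdier T U by unfold_locales (rule thick_subcat[OF U])
sublocale VV: verdier T V by unfold_locales (rule thick_subcat[OF V])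

text \<open>Let p be the map from \<open>Dom T v\<close> to the cone of u. The composite from the
  cone of v through \<Sigma>(\<open>Dom T v\<close>) to the suspended cone of u goes from V to U,
  hence is b a through U \<inter> V; this is the use of commutation. Over a U-map u1 the map to the
  cone of v lifts to the fibre of a, an object of V. The fibre of this lift is a V-map v1, and it
  comes with r such that v r = u1 v1. As the composite b a dies on the fibre of a, the map p r
  extends along v1. A second U-map u2 kills the extension, so a restriction of r lifts through u,
  and u' = u1 u2.\<close>

lemma swap:
  assumes v: "v \<in> cone_in T V" and u: "u \<in> cone_in T U" and uv: "Cod T u = Dom T v"
  obtains u' v' r where "u' \<in> cone_in T U" "v' \<in> cone_in T V" "r \<in> Arr T" "Cod T u' = Cod T v" "Cod T v' = Dom T u'"
    "Dom T r = Dom T v'" "Cod T r = Dom T u" "v \<cdot> (u \<cdot> r) = u' \<cdot> v'"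
proof -
  obtain g h where g: "(v, g, h) \<in> Tri T" "Cod T g \<in> V" using VV.W_E[OF v] by blast
  obtain p q where p: "(u, p, q) \<in> Tri T" "Cod T p \<in> U" using VU.W_E[OF u] by blast
  note gs = tri_simps[OF g(1)] and ps = tri_simps[OF p(1)]
  have "factors_through T (U \<inter> V) (Sha T p \<cdot> h)"
    using comm[unfolded commuting_pair_iff, rule_format, of "Sha T p \<cdot> h"] g p gs ps uv subcat_sho[OF VU.subcat] by simp
  then obtain a b where ab: "a \<in> Arr T" "b \<in> Arr T" "Cod T a = Dom T b" "Cod T a \<in> U \<inter> V"
      "Dom T a = Dom T (Sha T p \<cdot> h)" "Cod T b = Cod T (Sha T p \<cdot> h)" "Sha T p \<cdot> h = b \<cdot> a"
    unfolding factors_through_def by blast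
  have ad: "Dom T a = Dom T h" using ab(5) gs ps uv by simp
  obtain u1 where u1: "u1 \<in> cone_in T U" "Cod T u1 = Dom T (a \<cdot> g)" "(a \<cdot> g) \<cdot> u1 = Nul T (Dom T u1) (Cod T (a \<cdot> g))"
    by (rule VU.killE[of "a \<cdot> g"]) (use ab(1,4) ad gs in auto)
  have u1c: "Cod T u1 = Dom T g" "u1 \<in> Arr T" using u1 ab(1) ad gs by auto
  obtain c d where c: "(c, a, d) \<in> Tri T" using VU.fibreE[OF ab(1)] by blast
  note cs = tri_simps[OF c]
  have V1: "Dom T c \<in> V"
  proof -
    have "Cod T d \<in> V" using subcat_cone[OF VV.subcat rotate[OF c]] cs ab(4) ad g gs by simp
    then show ?thesis using cs subcat_sho[OF VV.subcat] by simp
  qed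
  obtain e where e: "e \<in> Arr T" "Dom T e = Dom T (g \<cdot> u1)" "Cod T e = Dom T c" "c \<cdot> e = g \<cdot> u1"
    by (rule weak_kernel[OF c, of "g \<cdot> u1"]) (use u1 u1c gs ab(1) ad cs in auto)
  have ed: "Dom T e = Dom T u1" using e u1c gs by simp
  obtain v1 k where v1: "(v1, e, k) \<in> Tri T" using VV.fibreE[OF e(1)] by blast
  note v1s = tri_simps[OF v1]
  have v1W: "v1 \<in> cone_in T V" using VV.W_I[OF v1] e V1 by simp
  obtain r where r: "r \<in> Arr T" "Dom T r = Dom T v1" "Cod T r = Dom T v" "u1 \<cdot> v1 = v \<cdot> r" "Sha T r \<cdot> k = h \<cdot> c"
    by (rule tri_fill_first[OF v1 g(1), of u1 c]) (use u1c ed e cs ad gs v1s in auto)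
  have pr: "p \<cdot> r \<in> Arr T" "Dom T (p \<cdot> r) = Dom T v1" "Cod T (p \<cdot> r) = Cod T p" using r ps uv by auto
  have "Sha T (p \<cdot> r) \<cdot> k = Sha T p \<cdot> (Sha T r \<cdot> k)" using r(1-3) ps uv v1s by (simp add: sha_cmp)
  also have "\<dots> = (Sha T p \<cdot> h) \<cdot> c" unfolding r(5) using ps gs cs ad uv by simp
  also have "\<dots> = b \<cdot> (a \<cdot> c)" unfolding ab(7) using ab(1-3) cs by simp
  also have "\<dots> = Nul T (Dom T c) (Sho T (Cod T p))" unfolding tri_comp(1)[OF c] using ab(2,3,6) cs ps gs uv by simp
  finally have z: "Sha T (p \<cdot> r) \<cdot> k = Nul T (Dom T k) (Cod T (Sha T (p \<cdot> r)))" using v1s e pr by simp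
  obtain x where x: "x \<in> Arr T" "Dom T x = Dom T (Neg T (Sha T e))" "Cod T x = Cod T (Sha T (p \<cdot> r))"
    "x \<cdot> Neg T (Sha T v1) = Sha T (p \<cdot> r)"
    by (rule weak_cokernel[OF rotate[OF rotate[OF v1]] _ _ z]) (use pr v1s in auto)
  obtain y where y: "y \<in> Arr T" "Dom T y = Dom T e" "Cod T y = Cod T p" "Sha T y = x"
    by (rule sha_full[of x "Dom T e" "Cod T p"]) (use x(1-3) pr e(1) ps in auto)
  have ny: "Neg T y \<cdot> v1 = p \<cdot> r"
  proof (rule sha_faithful)
    show "Sha T (Neg T y \<cdot> v1) = Sha T (p \<cdot> r)" using x(4) x(1,2) y v1s by (simp add: sha_cmp)
  qed (use y v1s pr in auto)
  obtain u2 where u2: "u2 \<in> cone_in T U" "Cod T u2 = Dom T (Neg T y)" "Neg T y \<cdot> u2 = Nul T (Dom T u2) (Cod T (Neg T y))"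
    by (rule VU.killE[of "Neg T y"]) (use y p in auto)
  have u2c: "Cod T u2 = Cod T v1" "u2 \<in> Arr T" using u2 y v1s by auto
  \<comment> \<open>An Ore square moves v1 past u2; its V-map w becomes v'.\<close>
  obtain w l where w: "w \<in> cone_in T V" "l \<in> Arr T" "Dom T w = Dom T l" "Cod T w = Dom T u2" "Cod T l = Dom T v1" "u2 \<cdot> w = v1 \<cdot> l"
    by (rule VV.ore[OF v1W u2c(2,1)])
  have rl: "r \<cdot> l \<in> Arr T" "Dom T (r \<cdot> l) = Dom T w" "Cod T (r \<cdot> l) = Dom T v" using r(1-3) w(1-5) by auto
  have "p \<cdot> (r \<cdot> l) = Neg T y \<cdot> (v1 \<cdot> l)"
    using cmp_reduce[OF ny, of l] r(1-3) w(1-5) y(1,2) v1s ps uv by simp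
  also have "\<dots> = Neg T y \<cdot> (u2 \<cdot> w)" by (simp only: w(6))
  also have "\<dots> = Nul T (Dom T w) (Cod T p)"
    using cmp_reduce1[OF u2(3), of w] w(1-5) u2(1,2) u2c y(1-3) ps by simp
  finally have prl: "p \<cdot> (r \<cdot> l) = Nul T (Dom T (r \<cdot> l)) (Dom T q)" using rl ps by simp
  obtain y' where y': "y' \<in> Arr T" "Dom T y' = Dom T (r \<cdot> l)" "Cod T y' = Dom T u" "u \<cdot> y' = r \<cdot> l"
    by (rule weak_kernel[OF p(1) rl(1) _ prl]) (use rl ps uv in auto)
  have u1d: "Dom T u1 = Cod T v1" using ed v1s by simp
  have "v \<cdot> (u \<cdot> y') = v \<cdot> (r \<cdot> l)" by (simp only: y'(4))
  also have "\<dots> = u1 \<cdot> (v1 \<cdot> l)" using cmp_reduce[OF r(4), of l] r(1-3) w(1-5) v1s u1c u1d gs by simp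
  also have "\<dots> = u1 \<cdot> (u2 \<cdot> w)" by (simp only: w(6))
  also have "\<dots> = (u1 \<cdot> u2) \<cdot> w" using u1c u1d u2c w(1-5) by simp
  finally have "v \<cdot> (u \<cdot> y') = (u1 \<cdot> u2) \<cdot> w" .
  moreover have "u1 \<cdot> u2 \<in> cone_in T U" by (rule VU.cmp_W) (use u1 u2 u2c u1d in auto)
  ultimately show ?thesis
    using that[of "u1 \<cdot> u2" w y'] w(1-5) y' rl u1c u1d u2c gs by simp
qed

text \<open>Auxiliary to \<open>refine_UV\<close>: U and V consist of such objects, one of the two
  maps being an identity, so thickness of the class puts the whole join into it.\<close>

definition killed :: "'o \<Rightarrow> bool" where
  "killed Y \<longleftrightarrow> Y \<in> Obj T \<and> (\<forall>h \<in> Arr T. Cod T h = Y \<longrightarrow> (\<exists>u \<in> cone_in T U. \<exists>v \<in> cone_in T V.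
     Cod T u = Dom T h \<and> Cod T v = Dom T u \<and> h \<cdot> (u \<cdot> v) = Nul T (Dom T v) Y))"

lemma killedE:
  assumes "killed Y" "h \<in> Arr T" "Cod T h = Y"
  obtains u v where "u \<in> cone_in T U" "v \<in> cone_in T V" "Cod T u = Dom T h" "Cod T v = Dom T u" "h \<cdot> (u \<cdot> v) = Nul T (Dom T v) Y"
  using assms unfolding killed_def by blast

text \<open>For an extension, u v kills g h, so h u v lifts to the first object of the triangle,
  where some u' v' kills the lift. The total refinement u v u' v' has its factors in the wrong
  order, and \<open>swap\<close> exchanges v with u'.\<close>

lemma killed_thick: "{Y. killed Y} \<in> Thick T"
proof (rule thickI)
  show "{Y. killed Y} \<subseteq> Obj T" by (auto simp: killed_def)
  show "Z \<in> {Y. killed Y}" if z: "zero_object T Z" for Z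
  proof -
    have Z: "Z \<in> Obj T" using z zero_object_iff by blast
    have "\<exists>u \<in> cone_in T U. \<exists>v \<in> cone_in T V. Cod T u = Dom T h \<and> Cod T v = Dom T u \<and> h \<cdot> (u \<cdot> v) = Nul T (Dom T v) Z"
      if h: "h \<in> Arr T" "Cod T h = Z" for h
    proof (rule bexI[of _ "Idn T (Dom T h)"], rule bexI[of _ "Idn T (Dom T h)"], intro conjI)
      have "h = Nul T (Dom T h) Z" using zero_objectD(2)[OF z h(1), of "Nul T (Dom T h) Z"] h Z by simp
      then show "h \<cdot> (Idn T (Dom T h) \<cdot> Idn T (Dom T h)) = Nul T (Dom T (Idn T (Dom T h))) Z" using h by simp
    qed (use h in auto)
    then show ?thesis using Z by (auto simp: killed_def)
  qed
  show "X \<in> {Y. killed Y}" if B: "B \<in> {Y. killed Y}" and i: "i \<in> Arr T" "p \<in> Arr T" "Dom T i = X" "Cod T i = B" "Dom T p = B" "Cod T p = X"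
    "p \<cdot> i = Idn T X" for B i p X
  proof -
    have X: "X \<in> Obj T" using i dom_obj by blast
    have "\<exists>u \<in> cone_in T U. \<exists>v \<in> cone_in T V. Cod T u = Dom T h \<and> Cod T v = Dom T u \<and> h \<cdot> (u \<cdot> v) = Nul T (Dom T v) X"
      if h: "h \<in> Arr T" "Cod T h = X" for h
    proof -
      obtain u v where u: "u \<in> cone_in T U" "v \<in> cone_in T V" "Cod T u = Dom T (i \<cdot> h)" "Cod T v = Dom T u"
        "(i \<cdot> h) \<cdot> (u \<cdot> v) = Nul T (Dom T v) B" by (rule killedE[of B "i \<cdot> h"]) (use B h i in auto)
      have uc: "Cod T u = Dom T h" using u h i by simp
      have "h \<cdot> (u \<cdot> v) = p \<cdot> ((i \<cdot> h) \<cdot> (u \<cdot> v))"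
        using cmp_reduce1[OF i(7), of "h \<cdot> (u \<cdot> v)"] h i(1-6) u(1,2,4) uc by simp
      also have "\<dots> = Nul T (Dom T v) X" unfolding u(5) using u i by simp
      finally show ?thesis using u uc by blast
    qed
    then show ?thesis using X by (auto simp: killed_def)
  qed
  show "Sho T X \<in> {Y. killed Y}" if X: "X \<in> Obj T" and S: "X \<in> {Y. killed Y}" for X
  proof -
    have "\<exists>u \<in> cone_in T U. \<exists>v \<in> cone_in T V. Cod T u = Dom T h \<and> Cod T v = Dom T u \<and> h \<cdot> (u \<cdot> v) = Nul T (Dom T v) (Sho T X)"
      if h: "h \<in> Arr T" "Cod T h = Sho T X" for h
    proof -
      obtain D where D: "D \<in> Obj T" "Dom T h = D" using h dom_obj by blast
      obtain e i where e: "e \<in> Arr T" "Dom T e = D" "Cod T e = Sho T (Usho T D)"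
        and i: "i \<in> Arr T" "Dom T i = Sho T (Usho T D)" "Cod T i = D" "i \<cdot> e = Idn T D" "e \<cdot> i = Idn T (Sho T (Usho T D))"
        by (rule counit_isoE[OF D(1)]) blast
      have ii: "iso_arr T i" by (rule iso_arrI[of i e]) (use e i in auto)
      obtain k where k: "k \<in> Arr T" "Dom T k = Usho T D" "Cod T k = X" "Sha T k = h \<cdot> i"
        by (rule sha_full[of "h \<cdot> i" "Usho T D" X]) (use h D i X in auto)
      obtain u v where u: "u \<in> cone_in T U" "v \<in> cone_in T V" "Cod T u = Dom T k" "Cod T v = Dom T u"
        "k \<cdot> (u \<cdot> v) = Nul T (Dom T v) X" by (rule killedE[of X k]) (use S k in auto)
      have uA: "u \<in> Arr T" "v \<in> Arr T" using u by auto
      have su: "Sha T u \<in> cone_in T U" "Sha T v \<in> cone_in T V" using VU.sha_W_iff[OF uA(1)] VV.sha_W_iff[OF uA(2)] u by auto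
      have iu: "i \<cdot> Sha T u \<in> cone_in T U" by (rule VU.cmp_W) (use VU.iso_W[OF ii] su u uA k i in auto)
      have "Sha T k \<cdot> (Sha T u \<cdot> Sha T v) = Sha T (k \<cdot> (u \<cdot> v))" using k(1-3) u(3,4) uA by (simp add: sha_cmp)
      also have "\<dots> = Nul T (Sho T (Dom T v)) (Sho T X)" unfolding u(5) using uA X by simp
      finally have "h \<cdot> ((i \<cdot> Sha T u) \<cdot> Sha T v) = Nul T (Dom T (Sha T v)) (Sho T X)"
        unfolding k(4) using h D i(1-3) u(3,4) uA k(1-3) by simp
      then show ?thesis using iu su(2) u(3,4) uA k(1-3) i(1-3) D by (intro bexI[of _ "i \<cdot> Sha T u"] bexI[of _ "Sha T v"]) auto
    qed
    then show ?thesis using X by (auto simp: killed_def)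
  qed
  show "X \<in> {Y. killed Y}" if X: "X \<in> Obj T" and S: "Sho T X \<in> {Y. killed Y}" for X
  proof -
    have "\<exists>u \<in> cone_in T U. \<exists>v \<in> cone_in T V. Cod T u = Dom T h \<and> Cod T v = Dom T u \<and> h \<cdot> (u \<cdot> v) = Nul T (Dom T v) X"
      if h: "h \<in> Arr T" "Cod T h = X" for h
    proof -
      obtain u v where u: "u \<in> cone_in T U" "v \<in> cone_in T V" "Cod T u = Dom T (Sha T h)" "Cod T v = Dom T u"
        "Sha T h \<cdot> (u \<cdot> v) = Nul T (Dom T v) (Sho T X)" by (rule killedE[of "Sho T X" "Sha T h"]) (use S h in auto)
      have uA: "u \<in> Arr T" "v \<in> Arr T" using u by auto
      obtain B C where B: "B \<in> Obj T" "Dom T u = B" and C: "C \<in> Obj T" "Dom T v = C" using uA dom_obj by blast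
      obtain e i where e: "e \<in> Arr T" "Dom T e = B" "Cod T e = Sho T (Usho T B)" "iso_arr T e"
        and i: "i \<in> Arr T" "Dom T i = Sho T (Usho T B)" "Cod T i = B" "i \<cdot> e = Idn T B" "e \<cdot> i = Idn T (Sho T (Usho T B))"
        by (rule counit_isoE[OF B(1)]) blast
      have ii: "iso_arr T i" by (rule iso_arrI[of i e]) (use e i in auto)
      obtain e' i' where e': "e' \<in> Arr T" "Dom T e' = C" "Cod T e' = Sho T (Usho T C)"
        and i': "i' \<in> Arr T" "Dom T i' = Sho T (Usho T C)" "Cod T i' = C" "i' \<cdot> e' = Idn T C" "e' \<cdot> i' = Idn T (Sho T (Usho T C))"
        by (rule counit_isoE[OF C(1)]) blast
      have ii': "iso_arr T i'" by (rule iso_arrI[of i' e']) (use e' i' in auto)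
      obtain x where x: "x \<in> Arr T" "Dom T x = Usho T B" "Cod T x = Dom T h" "Sha T x = u \<cdot> i"
        by (rule sha_full[of "u \<cdot> i" "Usho T B" "Dom T h"]) (use u(3) uA i B h in auto)
      obtain y where y: "y \<in> Arr T" "Dom T y = Usho T C" "Cod T y = Usho T B" "Sha T y = e \<cdot> (v \<cdot> i')"
        by (rule sha_full[of "e \<cdot> (v \<cdot> i')" "Usho T C" "Usho T B"]) (use u(4) uA e i' B C in auto)
      have "u \<cdot> i \<in> cone_in T U" by (rule VU.cmp_W) (use VU.iso_W[OF ii] u(1) i B in auto)
      then have xW: "x \<in> cone_in T U" using VU.sha_W_iff[OF x(1)] x(4) by simp
      have "v \<cdot> i' \<in> cone_in T V" by (rule VV.cmp_W) (use VV.iso_W[OF ii'] u(2) i' C in auto)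
      then have "e \<cdot> (v \<cdot> i') \<in> cone_in T V" by (rule VV.cmp_W) (use VV.iso_W[OF e(4)] u(4) uA i' C B e in auto)
      then have yW: "y \<in> cone_in T V" using VV.sha_W_iff[OF y(1)] y(4) by simp
      have "Sha T (h \<cdot> (x \<cdot> y)) = Sha T h \<cdot> ((u \<cdot> i) \<cdot> (e \<cdot> (v \<cdot> i')))" using h x y by (simp add: sha_cmp)
      also have "\<dots> = Sha T h \<cdot> (u \<cdot> (v \<cdot> i'))"
        using cmp_reduce1[OF i(4), of "v \<cdot> i'"] u(3,4) uA i(1-3) e(1-3) i'(1-3) B C h by simp
      also have "\<dots> = (Sha T h \<cdot> (u \<cdot> v)) \<cdot> i'" using u(3,4) uA i'(1-3) B C h by simp
      also have "\<dots> = Nul T (Sho T (Usho T C)) (Sho T X)" unfolding u(5) using i' C X by simp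
      also have "\<dots> = Sha T (Nul T (Usho T C) X)" using C X by simp
      finally have "h \<cdot> (x \<cdot> y) = Nul T (Usho T C) X" by - (rule sha_faithful, use h x y C X in auto)
      then show ?thesis using xW yW x y by (intro bexI[of _ x] bexI[of _ y]) auto
    qed
    then show ?thesis using X by (auto simp: killed_def)
  qed
  show "Cod T f \<in> {Y. killed Y}" if t: "(f, g, k) \<in> Tri T" and S: "Dom T f \<in> {Y. killed Y}" "Cod T g \<in> {Y. killed Y}" for f g k
  proof -
    note ts = tri_simps[OF t]
    have "\<exists>u \<in> cone_in T U. \<exists>v \<in> cone_in T V. Cod T u = Dom T h \<and> Cod T v = Dom T u \<and> h \<cdot> (u \<cdot> v) = Nul T (Dom T v) (Cod T f)"
      if h: "h \<in> Arr T" "Cod T h = Cod T f" for h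
    proof -
      obtain u v where u: "u \<in> cone_in T U" "v \<in> cone_in T V" "Cod T u = Dom T (g \<cdot> h)" "Cod T v = Dom T u"
        "(g \<cdot> h) \<cdot> (u \<cdot> v) = Nul T (Dom T v) (Cod T g)" by (rule killedE[of "Cod T g" "g \<cdot> h"]) (use S h ts in auto)
      have uA: "u \<in> Arr T" "v \<in> Arr T" "Cod T u = Dom T h" using u h ts by auto
      obtain x where x: "x \<in> Arr T" "Dom T x = Dom T (h \<cdot> (u \<cdot> v))" "Cod T x = Dom T f" "f \<cdot> x = h \<cdot> (u \<cdot> v)"
        by (rule weak_kernel[OF t, of "h \<cdot> (u \<cdot> v)"]) (use u(4,5) uA h ts in auto)
      have xd: "Dom T x = Dom T v" using x u(4) uA h by simp
      obtain u' v' where u': "u' \<in> cone_in T U" "v' \<in> cone_in T V" "Cod T u' = Dom T x" "Cod T v' = Dom T u'"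
        "x \<cdot> (u' \<cdot> v') = Nul T (Dom T v') (Dom T f)" by (rule killedE[of "Dom T f" x]) (use S x in auto)
      have uA': "u' \<in> Arr T" "v' \<in> Arr T" "Cod T u' = Dom T v" using u' xd by auto
      \<comment> \<open>Up to the arrow r, the composite v u' is replaced by u2 v2; the next Ore
        square moves v' along r.\<close>
      obtain u2 v2 r where w: "u2 \<in> cone_in T U" "v2 \<in> cone_in T V" "r \<in> Arr T" "Cod T u2 = Cod T v" "Cod T v2 = Dom T u2"
        "Dom T r = Dom T v2" "Cod T r = Dom T u'" "v \<cdot> (u' \<cdot> r) = u2 \<cdot> v2" by (rule swap[OF u(2) u'(1) uA'(3)])
      obtain z l where z: "z \<in> cone_in T V" "l \<in> Arr T" "Dom T z = Dom T l" "Cod T z = Dom T r" "Cod T l = Dom T v'" "r \<cdot> z = v' \<cdot> l"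
        by (rule VV.ore[OF u'(2) w(3)]) (use w u'(4) in auto)
      have W2: "u2 \<in> Arr T" "v2 \<in> Arr T" "z \<in> Arr T" using w z by auto
      have uu: "u \<cdot> u2 \<in> cone_in T U" by (rule VU.cmp_W) (use u w in auto)
      have vv: "v2 \<cdot> z \<in> cone_in T V" by (rule VV.cmp_W) (use w z in auto)
      have "h \<cdot> ((u \<cdot> u2) \<cdot> (v2 \<cdot> z)) = (h \<cdot> u) \<cdot> ((u2 \<cdot> v2) \<cdot> z)"
        using h uA u(4) W2 w(4-6) z(1-5) by simp
      also have "\<dots> = (h \<cdot> u) \<cdot> ((v \<cdot> (u' \<cdot> r)) \<cdot> z)" by (simp only: w(8))
      also have "\<dots> = (h \<cdot> (u \<cdot> v)) \<cdot> (u' \<cdot> (r \<cdot> z))" using h uA u(4) uA' w(3,6,7) W2 z(1-5) by simp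
      also have "\<dots> = (f \<cdot> x) \<cdot> (u' \<cdot> (v' \<cdot> l))" by (simp only: z(6) x(4))
      also have "\<dots> = f \<cdot> ((x \<cdot> (u' \<cdot> v')) \<cdot> l)" using x(1,3) xd ts uA' u'(4) z(2,5) by simp
      also have "\<dots> = Nul T (Dom T z) (Cod T f)" unfolding u'(5) using uA' ts z by simp
      finally have "h \<cdot> ((u \<cdot> u2) \<cdot> (v2 \<cdot> z)) = Nul T (Dom T (v2 \<cdot> z)) (Cod T f)" using W2 z(4) w(6) by simp
      moreover have "Cod T (u \<cdot> u2) = Dom T h" "Cod T (v2 \<cdot> z) = Dom T (u \<cdot> u2)" using uA W2 w(4-6) u(4) z(4) by simp_all
      ultimately show ?thesis using uu vv by blast
    qed
    then show ?thesis using ts by (auto simp: killed_def)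
  qed
qed

text \<open>The map from \<open>Cod T s\<close> to the cone of s vanishes after some u v because the
  cone is \<open>killed\<close>, so u v lifts through s.\<close>

lemma refine_UV:
  assumes s: "s \<in> cone_in T (thick_hull T (U \<union> V))"
  obtains u v r where "u \<in> cone_in T U" "v \<in> cone_in T V" "r \<in> Arr T" "Cod T u = Cod T s" "Cod T v = Dom T u"
    "Dom T r = Dom T v" "Cod T r = Dom T s" "s \<cdot> r = u \<cdot> v"
proof -
  obtain g h where g: "(s, g, h) \<in> Tri T" "Cod T g \<in> thick_hull T (U \<union> V)" using s by (auto simp: cone_in_def)
  note gs = tri_simps[OF g(1)]
  have "killed Y" if Y: "Y \<in> U" for Y
  proof -
    have "\<exists>u \<in> cone_in T U. \<exists>v \<in> cone_in T V. Cod T u = Dom T h \<and> Cod T v = Dom T u \<and> h \<cdot> (u \<cdot> v) = Nul T (Dom T v) Y"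
      if h: "h \<in> Arr T" "Cod T h = Y" for h
    proof -
      obtain w where "w \<in> cone_in T U" "Cod T w = Dom T h" "h \<cdot> w = Nul T (Dom T w) (Cod T h)"
        by (rule VU.killE[OF h(1)]) (use h Y in auto)
      then show ?thesis using h by (intro bexI[of _ w] bexI[of _ "Idn T (Dom T w)"]) auto
    qed
    then show ?thesis using thick_obj[OF U Y] by (auto simp: killed_def)
  qed
  moreover have "killed Y" if Y: "Y \<in> V" for Y
  proof -
    have "\<exists>u \<in> cone_in T U. \<exists>v \<in> cone_in T V. Cod T u = Dom T h \<and> Cod T v = Dom T u \<and> h \<cdot> (u \<cdot> v) = Nul T (Dom T v) Y"
      if h: "h \<in> Arr T" "Cod T h = Y" for h
    proof -
      obtain w where "w \<in> cone_in T V" "Cod T w = Dom T h" "h \<cdot> w = Nul T (Dom T w) (Cod T h)"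
        by (rule VV.killE[OF h(1)]) (use h Y in auto)
      then show ?thesis using h by (intro bexI[of _ w] bexI[of _ "Idn T (Dom T h)"]) auto
    qed
    then show ?thesis using thick_obj[OF V Y] by (auto simp: killed_def)
  qed
  ultimately have "thick_hull T (U \<union> V) \<subseteq> {Y. killed Y}" by (intro thick_hull_least[OF killed_thick]) auto
  then have "killed (Cod T g)" using g by auto
  then obtain u v where u: "u \<in> cone_in T U" "v \<in> cone_in T V" "Cod T u = Dom T g" "Cod T v = Dom T u"
    "g \<cdot> (u \<cdot> v) = Nul T (Dom T v) (Cod T g)" by (rule killedE) (use gs in auto)
  have uA: "u \<in> Arr T" "v \<in> Arr T" using u by auto
  obtain r where "r \<in> Arr T" "Dom T r = Dom T (u \<cdot> v)" "Cod T r = Dom T s" "s \<cdot> r = u \<cdot> v"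
    by (rule weak_kernel[OF g(1), of "u \<cdot> v"]) (use u uA gs in auto)
  then show ?thesis using that[of u v r] u uA gs by simp
qed

text \<open>The map from \<open>Cod T s\<close>, in U, to the cone of s, in V, passes through U
  \<inter> V. A map with cone there already kills it and therefore lifts through s. Hence the
  localizations at U \<inter> V and at V agree on U.\<close>

lemma refine_Int:
  assumes C: "Cod T s \<in> U" and s: "s \<in> cone_in T V"
  obtains t r where "t \<in> cone_in T (U \<inter> V)" "r \<in> Arr T" "Cod T t = Cod T s" "Dom T r = Dom T t" "Cod T r = Dom T s" "t = s \<cdot> r"
proof -
  interpret VI: verdier T "U \<inter> V" by unfold_locales (rule thick_subcat[OF thick_Int[OF U V]])
  obtain g h where g: "(s, g, h) \<in> Tri T" "Cod T g \<in> V" using VV.W_E[OF s] by blast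
  note gs = tri_simps[OF g(1)]
  have "factors_through T (U \<inter> V) g"
    using comm[unfolded commuting_pair_iff, rule_format, of g] g gs C by simp
  then obtain a b where ab: "a \<in> Arr T" "b \<in> Arr T" "Cod T a = Dom T b" "Cod T a \<in> U \<inter> V"
      "Dom T a = Dom T g" "Cod T b = Cod T g" "g = b \<cdot> a" unfolding factors_through_def by blast
  obtain t where t: "t \<in> cone_in T (U \<inter> V)" "Cod T t = Dom T a" "a \<cdot> t = Nul T (Dom T t) (Cod T a)"
    by (rule VI.killE[OF ab(1,4)])
  have tA: "t \<in> Arr T" using t by auto
  have "g \<cdot> t = b \<cdot> (a \<cdot> t)" unfolding ab(7) using ab(1-3) t(2) tA by simp
  also have "\<dots> = Nul T (Dom T t) (Cod T b)" unfolding t(3) using ab tA by simp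
  finally have gt: "g \<cdot> t = Nul T (Dom T t) (Dom T h)" using ab(6) gs by simp
  obtain r where r: "r \<in> Arr T" "Dom T r = Dom T t" "Cod T r = Dom T s" "s \<cdot> r = t"
    by (rule weak_kernel[OF g(1) tA _ gt]) (use t(2) ab(5) in simp)
  have "Cod T t = Cod T s" using t(2) ab(5) gs(4) by simp
  then show ?thesis using that[OF t(1) r(1) _ r(2,3) r(4)[symmetric]] by blast
qed

end

section \<open>The Mayer--Vietoris sequence\<close>

lemma cohomological_exact:
  assumes "cohomological T F" "(f, g, h) \<in> Tri T" "y \<in> carrier (Ev F (Cod T f))" "Re F f y = \<one>\<^bsub>Ev F (Dom T f)\<^esub>"
  obtains z where "z \<in> carrier (Ev F (Cod T g))" "Re F g z = y"
proof -
  have "Re F g ` carrier (Ev F (Cod T g)) = kernel (Ev F (Cod T f)) (Ev F (Dom T f)) (Re F f)"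
    using assms(1,2) unfolding cohomological_def by blast
  moreover have "y \<in> kernel (Ev F (Cod T f)) (Ev F (Dom T f)) (Re F f)" using assms by (simp add: kernel_def)
  ultimately have "y \<in> Re F g ` carrier (Ev F (Cod T g))" by simp
  then show ?thesis by (rule imageE) (rule that, auto)
qed

lemma cohomological_complex:
  assumes "cohomological T F" "(f, g, h) \<in> Tri T" "z \<in> carrier (Ev F (Cod T g))"
  shows "Re F f (Re F g z) = \<one>\<^bsub>Ev F (Dom T f)\<^esub>"
proof -
  have "Re F g ` carrier (Ev F (Cod T g)) = kernel (Ev F (Cod T f)) (Ev F (Dom T f)) (Re F f)"
    using assms(1,2) unfolding cohomological_def by blast
  then have "Re F g z \<in> kernel (Ev F (Cod T f)) (Ev F (Dom T f)) (Re F f)" using assms(3) by blast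
  then show ?thesis by (simp add: kernel_def)
qed

lemma psh_hom_inv:
  assumes "psh_hom T F G \<phi>" "presheaf T F" "presheaf T G" "X \<in> Obj T" "a \<in> carrier (Ev F X)"
  shows "\<phi> X (inv\<^bsub>Ev F X\<^esub> a) = inv\<^bsub>Ev G X\<^esub> (\<phi> X a)"
  using group_hom.hom_inv[OF psh_hom_group_hom[OF assms(1-4)] assms(5)] .

text \<open>
  The connecting map \<open>J(\<Sigma>Z) \<rightarrow> M(Z)\<close>: choose a triangle \<open>Z \<rightarrow> C \<rightarrow> X \<rightarrow> \<Sigma>Z\<close> with \<open>C\<close> in \<open>S\<close> such that
  the restriction of \<open>j\<close> to \<open>X\<close> comes from \<open>n \<in> N(X)\<close>, restrict \<open>n\<close> to \<open>C\<close>, where \<open>M\<close> and \<open>N\<close> agree, and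
  then to \<open>Z\<close>.
\<close>

definition conn_rel where
  "conn_rel T S M N J b d Z j m0 \<longleftrightarrow> j \<in> carrier (Ev J (Sho T Z)) \<and>
     (\<exists>f g s n m. (f, g, s) \<in> Tri T \<and> Dom T f = Z \<and> Cod T f \<in> S \<and> n \<in> carrier (Ev N (Dom T s)) \<and>
       Re J s j = d (Dom T s) n \<and> m \<in> carrier (Ev M (Cod T f)) \<and> b (Cod T f) m = Re N g n \<and> m0 = Re M f m)"

lemma conn_relI:
  assumes "j \<in> carrier (Ev J (Sho T Z))" "(f, g, s) \<in> Tri T" "Dom T f = Z" "Cod T f \<in> S" "n \<in> carrier (Ev N (Dom T s))"
       "Re J s j = d (Dom T s) n" "m \<in> carrier (Ev M (Cod T f))" "b (Cod T f) m = Re N g n" "m0 = Re M f m"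
  shows "conn_rel T S M N J b d Z j m0"
  unfolding conn_rel_def using assms by blast

lemma conn_relE:
  assumes "conn_rel T S M N J b d Z j m0"
  obtains f g s n m where "j \<in> carrier (Ev J (Sho T Z))" "(f, g, s) \<in> Tri T" "Dom T f = Z" "Cod T f \<in> S" "n \<in> carrier (Ev N (Dom T s))"
       "Re J s j = d (Dom T s) n" "m \<in> carrier (Ev M (Cod T f))" "b (Cod T f) m = Re N g n" "m0 = Re M f m"
  using assms unfolding conn_rel_def by blast

definition conn where
  "conn T S M N J b d Z j = (THE m0. conn_rel T S M N J b d Z j m0)"

text \<open>Desuspend the map h from \<Sigma>Z to the cone of s1 to an arrow f that starts at Z. The
  third map of the triangle of f is killed by h, so it lifts through s1. Denominators are brought to
  this shape for \<open>conn_rel\<close>.\<close>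

lemma (in verdier) third_refineE:
  assumes s1: "s1 \<in> W" "Cod T s1 = Sho T Z" and Z: "Z \<in> Obj T"
  obtains f g s t where "(f, g, s) \<in> Tri T" "Dom T f = Z" "Cod T f \<in> S" "t \<in> Arr T" "Cod T t = Dom T s1" "s = s1 \<cdot> t" "s \<in> W"
proof -
  obtain h k where h: "(s1, h, k) \<in> Tri T" "Cod T h \<in> S" using W_E s1 by blast
  note hs = tri_simps[OF h(1)]
  define C where "C = Cod T h"
  have C: "C \<in> Obj T" "C \<in> S" "Cod T h = C" using h hs by (auto simp: C_def)
  obtain e i where e: "e \<in> Arr T" "Dom T e = C" "Cod T e = Sho T (Usho T C)"
    and i: "i \<in> Arr T" "Dom T i = Sho T (Usho T C)" "Cod T i = C" "i \<cdot> e = Idn T C"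
    by (rule counit_isoE[OF C(1)]) blast
  obtain f where f: "f \<in> Arr T" "Dom T f = Z" "Cod T f = Usho T C" "Sha T f = e \<cdot> h"
    by (rule sha_full[of "e \<cdot> h" Z "Usho T C"]) (use e hs C Z s1 in auto)
  have fS: "Cod T f \<in> S" using f C subcat_usho[OF subcat] by simp
  obtain g s where t: "(f, g, s) \<in> Tri T" using coneE f by blast
  note ts = tri_simps[OF t]
  have "Neg T (Sha T f) \<cdot> s = Nul T (Dom T s) (Sho T (Cod T f))" using tri_comp(2)[OF rotate[OF t]] ts by simp
  then have "Sha T f \<cdot> s = Nul T (Dom T s) (Sho T (Cod T f))"
    using ts neg_inj[of "Sha T f \<cdot> s" "Nul T (Dom T s) (Sho T (Cod T f))"] by simp
  then have "i \<cdot> ((e \<cdot> h) \<cdot> s) = Nul T (Dom T s) C" unfolding f(4) using i f(3) ts C by simp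
  moreover have "i \<cdot> ((e \<cdot> h) \<cdot> s) = h \<cdot> s"
    using cmp_reduce1[OF i(4), of "h \<cdot> s"] e i(1-3) hs ts C s1 f(2) by simp
  ultimately have hs0: "h \<cdot> s = Nul T (Dom T s) (Dom T k)" using hs C by simp
  obtain t' where t': "t' \<in> Arr T" "Dom T t' = Dom T s" "Cod T t' = Dom T s1" "s1 \<cdot> t' = s"
    by (rule weak_kernel[OF h(1) ts(3) _ hs0]) (use hs ts s1 f(2) in auto)
  have "s \<in> W" using W_I[OF rotate[OF rotate[OF t]]] ts fS subcat_sho[OF subcat] by simp
  then show ?thesis using that[OF t f(2) fS t'(1,3)] t'(4) by simp
qed

text \<open>The exactness arguments are separated from commutation: they rest on P and J being
  localizations of M and N at S and on b being bijective on S. In the application S is U.\<close>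

locale mv_square = verdier T S for T :: "('o, 'm) tcat" (structure) and S +
  fixes M P N J :: "('o, 'm, 'g) psh" and a b c d :: "'o \<Rightarrow> 'g \<Rightarrow> 'g"
  assumes MC: "cohomological T M" and NC: "cohomological T N"
    and locP: "localization T S M P a" and locJ: "localization T S N J d"
    and bh: "psh_hom T M N b" and ch: "psh_hom T P J c"
    and square: "\<And>X x. X \<in> Obj T \<Longrightarrow> x \<in> carrier (Ev M X) \<Longrightarrow> c X (a X x) = d X (b X x)"
    and b_inj: "\<And>X x. X \<in> S \<Longrightarrow> x \<in> carrier (Ev M X) \<Longrightarrow> b X x = \<one>\<^bsub>Ev N X\<^esub> \<Longrightarrow> x = \<one>\<^bsub>Ev M X\<^esub>"
    and b_surj: "\<And>X y. X \<in> S \<Longrightarrow> y \<in> carrier (Ev N X) \<Longrightarrow> \<exists>x \<in> carrier (Ev M X). b X x = y"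
begin

lemmas PD = localizationD[OF locP] and JD = localizationD[OF locJ]
lemmas ah = PD(2) and dh = JD(2)
lemmas PC = PD(1) and JC = JD(1)
lemmas Mp = cohomological_presheaf[OF MC] and Np = cohomological_presheaf[OF NC]
  and Pp = cohomological_presheaf[OF PC] and Jp = cohomological_presheaf[OF JC]

lemma S_obj: "X \<in> S \<Longrightarrow> X \<in> Obj T"
  using subcat_obj[OF subcat] .

abbreviation R where "R \<equiv> conn_rel T S M N J b d"

lemmas RI = conn_relI[where M = M and N = N and J = J and b = b and d = d]

text \<open>For X in S the map 0 -> X lies in W, so restriction along it is injective on P; the
  triangle 0 -> X -> X shows that it is trivial.\<close>

lemma P_trivial:
  assumes X: "X \<in> S" and x: "x \<in> carrier (Ev P X)" shows "x = \<one>\<^bsub>Ev P X\<^esub>"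
proof -
  obtain Z where z: "zero_object T Z" using zero_exists by blast
  have XO: "X \<in> Obj T" and ZO: "Z \<in> Obj T" using S_obj X z zero_object_iff by auto
  note t = zero_tri(2)[OF z XO]
  let ?n = "Nul T Z X"
  have nW: "?n \<in> W" using W_I[OF t] X XO by simp
  have n: "?n \<in> Arr T" "Dom T ?n = Z" "Cod T ?n = X" using XO ZO by auto
  have "Re P ?n (Re P (Idn T X) x) = \<one>\<^bsub>Ev P Z\<^esub>" using cohomological_complex[OF PC t, of x] x n XO by simp
  then have 1: "Re P ?n x = \<one>\<^bsub>Ev P Z\<^esub>" using presheafD(2)[OF Pp XO x] by simp
  interpret G: comm_group "Ev P X" using presheafD(1)[OF Pp XO] .
  show ?thesis using invertsD(1)[OF PD(3) nW, of x "\<one>\<^bsub>Ev P X\<^esub>"] x n 1 presheaf_one[OF Pp n(1)] by simp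
qed

lemma tri_third_W: "(f, g, s) \<in> Tri T \<Longrightarrow> Cod T f \<in> S \<Longrightarrow> s \<in> W"
  using W_I[OF rotate[OF rotate]] tri_simps subcat_sho[OF subcat] by (metis cod_neg cod_obj cod_sha sha_arr)

text \<open>A map of triangles that is the identity on Z carries the data over to the finer third
  map s t. The element m restricts along its middle component, which leaves its restriction to Z
  unchanged.\<close>

lemma conn_refine:
  assumes t: "(f, g, s) \<in> Tri T" "Dom T f = Z" "Cod T f \<in> S" and n: "n \<in> carrier (Ev N (Dom T s))"
    and j: "j \<in> carrier (Ev J (Sho T Z))" "Re J s j = d (Dom T s) n"
    and m: "m \<in> carrier (Ev M (Cod T f))" "b (Cod T f) m = Re N g n"
    and t': "t \<in> Arr T" "Cod T t = Dom T s" "(f3, g3, s \<cdot> t) \<in> Tri T" "Dom T f3 = Z" "Cod T f3 \<in> S"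
  obtains m3 where "Re N t n \<in> carrier (Ev N (Dom T (s \<cdot> t)))" "Re J (s \<cdot> t) j = d (Dom T (s \<cdot> t)) (Re N t n)"
    "m3 \<in> carrier (Ev M (Cod T f3))" "b (Cod T f3) m3 = Re N g3 (Re N t n)" "Re M f3 m3 = Re M f m"
proof -
  note ts = tri_simps[OF t(1)] and ts3 = tri_simps[OF t'(3)]
  have Z: "Z \<in> Obj T" using ts t by auto
  have st: "Dom T (s \<cdot> t) = Dom T t" "Cod T (s \<cdot> t) = Cod T s" using t' ts by auto
  obtain k where k: "k \<in> Arr T" "Dom T k = Dom T g3" "Cod T k = Dom T g" "k \<cdot> f3 = f \<cdot> Idn T Z" "t \<cdot> g3 = g \<cdot> k"
    by (rule tri_fill_mid[OF t'(3) t(1), of "Idn T Z" t]) (use t t' ts ts3 Z st in auto)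
  have kf: "k \<cdot> f3 = f" using k(4) ts t by simp
  show ?thesis
  proof (rule that[of "Re M k m"])
    show "Re N t n \<in> carrier (Ev N (Dom T (s \<cdot> t)))" using presheafD(3)[OF Np t'(1), of n] n t' st by simp
    show "Re J (s \<cdot> t) j = d (Dom T (s \<cdot> t)) (Re N t n)"
      using presheafD(5)[OF Jp t'(1) ts(3) t'(2), of j] j ts t psh_homD(3)[OF dh t'(1), of n] n t' st by simp
    show "Re M k m \<in> carrier (Ev M (Cod T f3))" using presheafD(3)[OF Mp k(1), of m] m k ts ts3 by simp
    have "b (Cod T f3) (Re M k m) = Re N k (Re N g n)" using psh_homD(3)[OF bh k(1), of m] m k ts ts3 by simp
    also have "\<dots> = Re N (g \<cdot> k) n" using presheafD(5)[OF Np k(1) ts(2) k(3), of n] n ts by simp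
    also have "\<dots> = Re N g3 (Re N t n)" unfolding k(5)[symmetric]
      using presheafD(5)[OF Np ts3(2) t'(1), of n] n t' ts3 st by simp
    finally show "b (Cod T f3) (Re M k m) = Re N g3 (Re N t n)" .
    show "Re M f3 (Re M k m) = Re M f m" using presheafD(5)[OF Mp ts3(1) k(1), of m] m k(1-3) kf ts ts3 by simp
  qed
qed

lemma conn_dom: "Z \<in> Obj T \<Longrightarrow> R Z j m0 \<Longrightarrow> j \<in> carrier (Ev J (Sho T Z)) \<and> m0 \<in> carrier (Ev M Z)"
  by (elim conn_relE) (use presheafD(3)[OF Mp] tri_simps(1) in blast)

lemma conn_total:
  assumes Z: "Z \<in> Obj T" and j: "j \<in> carrier (Ev J (Sho T Z))" shows "\<exists>m0. R Z j m0"
proof -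
  obtain s1 n1 where s1: "s1 \<in> W" "Cod T s1 = Sho T Z" "n1 \<in> carrier (Ev N (Dom T s1))" "Re J s1 j = d (Dom T s1) n1"
    using JD(4)[of "Sho T Z" j] Z j by auto
  obtain f g s t where t: "(f, g, s) \<in> Tri T" "Dom T f = Z" "Cod T f \<in> S" "t \<in> Arr T" "Cod T t = Dom T s1" "s = s1 \<cdot> t"
    by (rule third_refineE[OF s1(1,2) Z])
  note ts = tri_simps[OF t(1)]
  have sd: "Dom T s = Dom T t" using t s1 by simp
  have n: "Re N t n1 \<in> carrier (Ev N (Dom T s))" using presheafD(3)[OF Np t(4), of n1] s1 t sd by simp
  have jn: "Re J s j = d (Dom T s) (Re N t n1)"
    unfolding t(6) using presheafD(5)[OF Jp t(4), of s1 j] j s1 t(4,5) psh_homD(3)[OF dh t(4), of n1] by simp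
  have "Re N g (Re N t n1) \<in> carrier (Ev N (Cod T f))" using presheafD(3)[OF Np ts(2), of "Re N t n1"] n ts by simp
  then obtain m where m: "m \<in> carrier (Ev M (Cod T f))" "b (Cod T f) m = Re N g (Re N t n1)" using b_surj[OF t(3)] by blast
  have "R Z j (Re M f m)" by (rule RI[OF j t(1-3) n jn m]) simp
  then show ?thesis ..
qed

text \<open>An Ore square followed by \<open>third_refineE\<close> gives a triangle finer than both
  given ones, over which the data are multiplied.\<close>

lemma conn_mult:
  assumes Z: "Z \<in> Obj T" and r: "R Z j m" "R Z j' m'"
  shows "R Z (j \<otimes>\<^bsub>Ev J (Sho T Z)\<^esub> j') (m \<otimes>\<^bsub>Ev M Z\<^esub> m')"
proof -
  obtain f1 g1 s1 n1 m1 where 1: "j \<in> carrier (Ev J (Sho T Z))" "(f1, g1, s1) \<in> Tri T" "Dom T f1 = Z" "Cod T f1 \<in> S" "n1 \<in> carrier (Ev N (Dom T s1))"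
       "Re J s1 j = d (Dom T s1) n1" "m1 \<in> carrier (Ev M (Cod T f1))" "b (Cod T f1) m1 = Re N g1 n1" "m = Re M f1 m1"
    using r(1) by (rule conn_relE)
  obtain f2 g2 s2 n2 m2 where 2: "j' \<in> carrier (Ev J (Sho T Z))" "(f2, g2, s2) \<in> Tri T" "Dom T f2 = Z" "Cod T f2 \<in> S" "n2 \<in> carrier (Ev N (Dom T s2))"
       "Re J s2 j' = d (Dom T s2) n2" "m2 \<in> carrier (Ev M (Cod T f2))" "b (Cod T f2) m2 = Re N g2 n2" "m' = Re M f2 m2"
    using r(2) by (rule conn_relE)
  note t1 = tri_simps[OF 1(2)] and t2 = tri_simps[OF 2(2)]
  have W: "s1 \<in> W" "s2 \<in> W" using tri_third_W 1 2 by auto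
  have cs: "Cod T s1 = Sho T Z" "Cod T s2 = Sho T Z" using t1 t2 1 2 by auto
  obtain u v where u: "u \<in> W" "v \<in> Arr T" "Dom T u = Dom T v" "Cod T u = Dom T s1" "Cod T v = Dom T s2" "s1 \<cdot> u = s2 \<cdot> v"
    by (rule ore[OF W(2) t1(3)]) (use cs in auto)
  have uA: "u \<in> Arr T" using u by simp
  have su: "s1 \<cdot> u \<in> W" "Cod T (s1 \<cdot> u) = Sho T Z" using W u(1-5) cs by auto
  obtain f g s t where t: "(f, g, s) \<in> Tri T" "Dom T f = Z" "Cod T f \<in> S" "t \<in> Arr T" "Cod T t = Dom T (s1 \<cdot> u)" "s = (s1 \<cdot> u) \<cdot> t"
    by (rule third_refineE[OF su Z])
  have td: "Cod T t = Dom T u" using t(5) u(1-5) uA t1 by simp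
  have e1: "s = s1 \<cdot> (u \<cdot> t)" using t(6) td t(4) u(4) uA t1 by simp
  have "s = (s2 \<cdot> v) \<cdot> t" unfolding t(6) by (simp only: u(6))
  then have e2: "s = s2 \<cdot> (v \<cdot> t)" using td t(4) u(2-5) t2 by simp
  have c1: "u \<cdot> t \<in> Arr T" "Cod T (u \<cdot> t) = Dom T s1" and c2: "v \<cdot> t \<in> Arr T" "Cod T (v \<cdot> t) = Dom T s2"
    using td t(4) u(2-5) uA by auto
  note ts = tri_simps[OF t(1)]
  obtain m3 where m3: "Re N (u \<cdot> t) n1 \<in> carrier (Ev N (Dom T s))" "Re J s j = d (Dom T s) (Re N (u \<cdot> t) n1)"
    "m3 \<in> carrier (Ev M (Cod T f))" "b (Cod T f) m3 = Re N g (Re N (u \<cdot> t) n1)" "Re M f m3 = m"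
    by (rule conn_refine[OF 1(2-5,1,6-8) c1 t(1)[unfolded e1] t(2,3)]) (use 1(9) e1 in auto)
  obtain m4 where m4: "Re N (v \<cdot> t) n2 \<in> carrier (Ev N (Dom T s))" "Re J s j' = d (Dom T s) (Re N (v \<cdot> t) n2)"
    "m4 \<in> carrier (Ev M (Cod T f))" "b (Cod T f) m4 = Re N g (Re N (v \<cdot> t) n2)" "Re M f m4 = m'"
    by (rule conn_refine[OF 2(2-5,1,6-8) c2 t(1)[unfolded e2] t(2,3)]) (use 2(9) e2 in auto)
  have csZ: "Cod T s = Sho T Z" using ts t by simp
  have o: "Dom T s \<in> Obj T" "Cod T f \<in> Obj T" using ts by auto
  interpret A: comm_group "Ev N (Dom T s)" using presheafD(1)[OF Np o(1)] .
  interpret B: comm_group "Ev M (Cod T f)" using presheafD(1)[OF Mp o(2)] .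
  interpret C: comm_group "Ev J (Sho T Z)" using presheafD(1)[OF Jp sho_obj[OF Z]] .
  show ?thesis
  proof (rule RI[OF _ t(1-3)])
    show "j \<otimes>\<^bsub>Ev J (Sho T Z)\<^esub> j' \<in> carrier (Ev J (Sho T Z))" using 1(1) 2(1) by simp
    show "Re N (u \<cdot> t) n1 \<otimes>\<^bsub>Ev N (Dom T s)\<^esub> Re N (v \<cdot> t) n2 \<in> carrier (Ev N (Dom T s))" using m3 m4 by simp
    show "Re J s (j \<otimes>\<^bsub>Ev J (Sho T Z)\<^esub> j') = d (Dom T s) (Re N (u \<cdot> t) n1 \<otimes>\<^bsub>Ev N (Dom T s)\<^esub> Re N (v \<cdot> t) n2)"
      using presheafD(4)[OF Jp ts(3), of j j'] csZ 1(1) 2(1) m3 m4 psh_homD(2)[OF dh o(1) m3(1) m4(1)] by simp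
    show "m3 \<otimes>\<^bsub>Ev M (Cod T f)\<^esub> m4 \<in> carrier (Ev M (Cod T f))" using m3 m4 by simp
    show "b (Cod T f) (m3 \<otimes>\<^bsub>Ev M (Cod T f)\<^esub> m4) = Re N g (Re N (u \<cdot> t) n1 \<otimes>\<^bsub>Ev N (Dom T s)\<^esub> Re N (v \<cdot> t) n2)"
      using psh_homD(2)[OF bh o(2) m3(3) m4(3)] m3 m4 presheafD(4)[OF Np ts(2), of "Re N (u \<cdot> t) n1" "Re N (v \<cdot> t) n2"] ts by simp
    show "m \<otimes>\<^bsub>Ev M Z\<^esub> m' = Re M f (m3 \<otimes>\<^bsub>Ev M (Cod T f)\<^esub> m4)"
      using presheafD(4)[OF Mp ts(1) m3(3) m4(3)] m3 m4 t by simp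
  qed
qed

text \<open>If j = 1, then n dies after a refinement. In the finer triangle b sends the element of M
  to 1, and b is injective on S.\<close>

lemma conn_one:
  assumes Z: "Z \<in> Obj T" and r: "R Z \<one>\<^bsub>Ev J (Sho T Z)\<^esub> m" shows "m = \<one>\<^bsub>Ev M Z\<^esub>"
proof -
  obtain f1 g1 s1 n1 m1 where 1: "\<one>\<^bsub>Ev J (Sho T Z)\<^esub> \<in> carrier (Ev J (Sho T Z))" "(f1, g1, s1) \<in> Tri T" "Dom T f1 = Z" "Cod T f1 \<in> S" "n1 \<in> carrier (Ev N (Dom T s1))"
       "Re J s1 \<one>\<^bsub>Ev J (Sho T Z)\<^esub> = d (Dom T s1) n1" "m1 \<in> carrier (Ev M (Cod T f1))" "b (Cod T f1) m1 = Re N g1 n1" "m = Re M f1 m1"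
    using r(1) by (rule conn_relE)
  note t1 = tri_simps[OF 1(2)]
  have W: "s1 \<in> W" using tri_third_W 1 by auto
  have cs: "Cod T s1 = Sho T Z" using t1 1 by auto
  have "d (Dom T s1) n1 = \<one>\<^bsub>Ev J (Dom T s1)\<^esub>" using presheaf_one[OF Jp t1(3)] 1(6) cs by simp
  then obtain w where w: "w \<in> W" "Cod T w = Dom T s1" "Re N w n1 = \<one>\<^bsub>Ev N (Dom T w)\<^esub>" using JD(5)[OF dom_obj[OF t1(3)] 1(5)] by blast
  have wA: "w \<in> Arr T" using w by simp
  have sw: "s1 \<cdot> w \<in> W" "Cod T (s1 \<cdot> w) = Sho T Z" using W w cs by auto
  obtain f g s t where t: "(f, g, s) \<in> Tri T" "Dom T f = Z" "Cod T f \<in> S" "t \<in> Arr T" "Cod T t = Dom T (s1 \<cdot> w)" "s = (s1 \<cdot> w) \<cdot> t"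
    by (rule third_refineE[OF sw Z])
  have td: "Cod T t = Dom T w" using t(5) w wA t1 by simp
  have e1: "s = s1 \<cdot> (w \<cdot> t)" using t(6) td t(4) w(2) wA t1 by simp
  have c1: "w \<cdot> t \<in> Arr T" "Cod T (w \<cdot> t) = Dom T s1" using td t(4) w wA by auto
  note ts = tri_simps[OF t(1)]
  obtain m3 where m3: "m3 \<in> carrier (Ev M (Cod T f))" "b (Cod T f) m3 = Re N g (Re N (w \<cdot> t) n1)" "Re M f m3 = m"
    by (rule conn_refine[OF 1(2-5,1,6-8) c1 t(1)[unfolded e1] t(2,3)]) (use 1(9) in auto)
  have "Re N (w \<cdot> t) n1 = \<one>\<^bsub>Ev N (Dom T t)\<^esub>"
    using presheafD(5)[OF Np t(4) wA td, of n1] w 1(5) presheaf_one[OF Np t(4)] td by simp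
  moreover have "Dom T t = Cod T g" using ts e1 td t(4) w(2) wA t1 c1 by simp
  ultimately have "b (Cod T f) m3 = \<one>\<^bsub>Ev N (Cod T f)\<^esub>" using m3 presheaf_one[OF Np ts(2)] ts by simp
  then have "m3 = \<one>\<^bsub>Ev M (Cod T f)\<^esub>" using b_inj[OF t(3) m3(1)] by simp
  then show ?thesis using m3(3) presheaf_one[OF Mp ts(1)] t by simp
qed

lemma conn_hom:
  assumes Z: "Z \<in> Obj T"
  shows "conn T S M N J b d Z \<in> hom (Ev J (Sho T Z)) (Ev M Z)"
    "\<And>j m. R Z j m \<Longrightarrow> conn T S M N J b d Z j = m"
    "\<And>j. j \<in> carrier (Ev J (Sho T Z)) \<Longrightarrow> R Z j (conn T S M N J b d Z j)"
proof -
  have A: "group (Ev J (Sho T Z))" using presheafD(1)[OF Jp sho_obj[OF Z]] comm_group.axioms(2) by blast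
  have B: "group (Ev M Z)" using presheafD(1)[OF Mp Z] comm_group.axioms(2) by blast
  note h = additive_relation_hom[where R = "R Z", OF A B conn_dom[OF Z] conn_total[OF Z] conn_mult[OF Z] conn_one[OF Z]]
  show "conn T S M N J b d Z \<in> hom (Ev J (Sho T Z)) (Ev M Z)" using h(1) unfolding conn_def .
  show "\<And>j m. R Z j m \<Longrightarrow> conn T S M N J b d Z j = m" using h(2) unfolding conn_def .
  show "\<And>j. j \<in> carrier (Ev J (Sho T Z)) \<Longrightarrow> R Z j (conn T S M N J b d Z j)" using h(3) unfolding conn_def .
qed

text \<open>The triangle of f z has the same middle object as that of f, so m is kept; the third
  component t of the map of triangles (z, id, t) transports n.\<close>

lemma conn_natural:
  assumes z: "z \<in> Arr T" and j: "j \<in> carrier (Ev J (Sho T (Cod T z)))"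
  shows "conn T S M N J b d (Dom T z) (Re J (Sha T z) j) = Re M z (conn T S M N J b d (Cod T z) j)"
proof -
  let ?Z = "Cod T z"
  have Z: "?Z \<in> Obj T" "Dom T z \<in> Obj T" using z by auto
  obtain f g s n m where 1: "(f, g, s) \<in> Tri T" "Dom T f = ?Z" "Cod T f \<in> S" "n \<in> carrier (Ev N (Dom T s))"
       "Re J s j = d (Dom T s) n" "m \<in> carrier (Ev M (Cod T f))" "b (Cod T f) m = Re N g n" "conn T S M N J b d ?Z j = Re M f m"
    using conn_hom(3)[OF Z(1) j] by (rule conn_relE)
  note ts = tri_simps[OF 1(1)]
  obtain g' s' where t': "(f \<cdot> z, g', s') \<in> Tri T" using coneE[of "f \<cdot> z"] ts z 1 by auto
  note ts' = tri_simps[OF t']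
  have fz: "Dom T (f \<cdot> z) = Dom T z" "Cod T (f \<cdot> z) = Cod T f" using ts z 1 by auto
  have i: "Idn T (Cod T f) \<in> Arr T" using ts by simp
  obtain t where t: "t \<in> Arr T" "Dom T t = Dom T s'" "Cod T t = Dom T s" "t \<cdot> g' = g \<cdot> Idn T (Cod T f)" "Sha T z \<cdot> s' = s \<cdot> t"
    by (rule tri_fill_last[OF t' 1(1), of z "Idn T (Cod T f)"]) (use 1 fz ts ts' z in auto)
  have tg: "t \<cdot> g' = g" using t(4) ts by simp
  have "R (Dom T z) (Re J (Sha T z) j) (Re M z (Re M f m))"
  proof (rule RI[OF _ t'])
    have sz: "Sha T z \<in> Arr T" "Cod T (Sha T z) = Sho T ?Z" "Dom T (Sha T z) = Sho T (Dom T z)" using z by auto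
    show "Re J (Sha T z) j \<in> carrier (Ev J (Sho T (Dom T z)))" using presheafD(3)[OF Jp sz(1), of j] j sz by simp
    show "Dom T (f \<cdot> z) = Dom T z" "Cod T (f \<cdot> z) \<in> S" using fz 1 by auto
    show "Re N t n \<in> carrier (Ev N (Dom T s'))" using presheafD(3)[OF Np t(1), of n] t 1 by simp
    have s': "s' \<in> Arr T" "Cod T s' = Sho T (Dom T z)" using ts' fz by auto
    have "Re J s' (Re J (Sha T z) j) = Re J (Sha T z \<cdot> s') j" using presheafD(5)[OF Jp s'(1) sz(1), of j] s' sz j by simp
    also have "\<dots> = Re J t (Re J s j)" unfolding t(5) using presheafD(5)[OF Jp t(1) ts(3) t(3), of j] j ts 1 by simp
    also have "\<dots> = d (Dom T s') (Re N t n)" using psh_homD(3)[OF dh t(1), of n] t 1 by simp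
    finally show "Re J s' (Re J (Sha T z) j) = d (Dom T s') (Re N t n)" .
    show "m \<in> carrier (Ev M (Cod T (f \<cdot> z)))" using 1 fz by simp
    show "b (Cod T (f \<cdot> z)) m = Re N g' (Re N t n)"
      using presheafD(5)[OF Np ts'(2) t(1), of n] tg t(2,3) ts' 1 fz by simp
    show "Re M z (Re M f m) = Re M (f \<cdot> z) m" using presheafD(5)[OF Mp z ts(1), of m] 1 by simp
  qed
  then show ?thesis using conn_hom(2)[OF Z(2)] 1(8) by simp
qed

text \<open>In the notation Z -> C -> X -> \<Sigma>Z: an element p of P restricts to the image of
  some m on X, so c p has data b m and the restriction of m to C, which dies on Z. For d n take the
  restriction of n to X, which dies on C. Conversely, if the connecting map kills j, then m comes
  from m1 on X. The quotient of n by b m1 dies on C and comes from N(\<Sigma>Z), while a m1 comes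
  from P(\<Sigma>Z); together these account for j after restriction along s.\<close>

lemma exact_J:
  assumes Z: "Z \<in> Obj T" and j: "j \<in> carrier (Ev J (Sho T Z))"
  shows "conn T S M N J b d Z j = \<one>\<^bsub>Ev M Z\<^esub> \<longleftrightarrow> (\<exists>p \<in> carrier (Ev P (Sho T Z)). \<exists>n \<in> carrier (Ev N (Sho T Z)).
    j = c (Sho T Z) p \<otimes>\<^bsub>Ev J (Sho T Z)\<^esub> inv\<^bsub>Ev J (Sho T Z)\<^esub> d (Sho T Z) n)"
proof
  have Y: "Sho T Z \<in> Obj T" using Z by simp
  interpret JG: comm_group "Ev J (Sho T Z)" using presheafD(1)[OF Jp Y] .
  interpret MG: comm_group "Ev M Z" using presheafD(1)[OF Mp Z] .
  interpret NG: comm_group "Ev N (Sho T Z)" using presheafD(1)[OF Np Y] .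
  interpret CH: group_hom "Ev J (Sho T Z)" "Ev M Z" "conn T S M N J b d Z"
    by unfold_locales (rule conn_hom(1)[OF Z])
  {
    assume "\<exists>p \<in> carrier (Ev P (Sho T Z)). \<exists>n \<in> carrier (Ev N (Sho T Z)).
      j = c (Sho T Z) p \<otimes>\<^bsub>Ev J (Sho T Z)\<^esub> inv\<^bsub>Ev J (Sho T Z)\<^esub> d (Sho T Z) n"
    then obtain p n where p: "p \<in> carrier (Ev P (Sho T Z))" and n: "n \<in> carrier (Ev N (Sho T Z))"
      and jpn: "j = c (Sho T Z) p \<otimes>\<^bsub>Ev J (Sho T Z)\<^esub> inv\<^bsub>Ev J (Sho T Z)\<^esub> d (Sho T Z) n" by blast
    have cp: "c (Sho T Z) p \<in> carrier (Ev J (Sho T Z))" using psh_homD(1)[OF ch Y p] .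
    have dn: "d (Sho T Z) n \<in> carrier (Ev J (Sho T Z))" using psh_homD(1)[OF dh Y n] .
    have 1: "R Z (c (Sho T Z) p) \<one>\<^bsub>Ev M Z\<^esub>"
    proof -
      obtain s1 m1 where s1: "s1 \<in> W" "Cod T s1 = Sho T Z" "m1 \<in> carrier (Ev M (Dom T s1))" "Re P s1 p = a (Dom T s1) m1"
        using PD(4)[OF Y p] by blast
      obtain f g s t where t: "(f, g, s) \<in> Tri T" "Dom T f = Z" "Cod T f \<in> S" "t \<in> Arr T" "Cod T t = Dom T s1" "s = s1 \<cdot> t"
        by (rule third_refineE[OF s1(1,2) Z])
      note ts = tri_simps[OF t(1)]
      have sd: "Dom T s = Dom T t" using t s1 by simp
      let ?m = "Re M t m1"
      have m: "?m \<in> carrier (Ev M (Dom T s))" using presheafD(3)[OF Mp t(4), of m1] s1 t sd by simp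
      have o: "Dom T s \<in> Obj T" using ts by simp
      have ps: "Re P s p = a (Dom T s) ?m"
        unfolding t(6) using presheafD(5)[OF Pp t(4), of s1 p] p s1 t(4,5) psh_homD(3)[OF ah t(4), of m1] by simp
      have cs: "Cod T s = Sho T Z" using ts t by simp
      have gm: "Re M g ?m \<in> carrier (Ev M (Cod T f))" using presheafD(3)[OF Mp ts(2), of ?m] m ts by simp
      show ?thesis
      proof (rule RI[OF cp t(1-3) psh_homD(1)[OF bh o m] _ gm])
        show "Re J s (c (Sho T Z) p) = d (Dom T s) (b (Dom T s) ?m)"
          using psh_homD(3)[OF ch ts(3), of p] cs p ps square[OF o m] by simp
        show "b (Cod T f) (Re M g ?m) = Re N g (b (Dom T s) ?m)" using psh_homD(3)[OF bh ts(2), of ?m] m ts by simp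
        show "\<one>\<^bsub>Ev M Z\<^esub> = Re M f (Re M g ?m)" using cohomological_complex[OF MC t(1), of ?m] m ts t by simp
      qed
    qed
    have 2: "R Z (d (Sho T Z) n) \<one>\<^bsub>Ev M Z\<^esub>"
    proof -
      obtain f g s where t: "(f, g, s) \<in> Tri T" "Dom T f = Z" "Cod T f \<in> S"
        by (rule third_refineE[of "Idn T (Sho T Z)" Z]) (use Z in auto)
      note ts = tri_simps[OF t(1)]
      have cs: "Cod T s = Sho T Z" using ts t by simp
      interpret MC: comm_group "Ev M (Cod T f)" using presheafD(1)[OF Mp cod_obj[OF ts(1)]] .
      show ?thesis
      proof (rule RI[OF dn t])
        show "Re N s n \<in> carrier (Ev N (Dom T s))" using presheafD(3)[OF Np ts(3), of n] n cs by simp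
        show "Re J s (d (Sho T Z) n) = d (Dom T s) (Re N s n)" using psh_homD(3)[OF dh ts(3), of n] n cs by simp
        show "\<one>\<^bsub>Ev M (Cod T f)\<^esub> \<in> carrier (Ev M (Cod T f))" by simp
        show "b (Cod T f) \<one>\<^bsub>Ev M (Cod T f)\<^esub> = Re N g (Re N s n)"
          using cohomological_complex[OF NC rotate[OF t(1)], of n] n cs psh_hom_one[OF bh Mp Np cod_obj[OF ts(1)]] ts by simp
        show "\<one>\<^bsub>Ev M Z\<^esub> = Re M f \<one>\<^bsub>Ev M (Cod T f)\<^esub>" using presheaf_one[OF Mp ts(1)] t by simp
      qed
    qed
    show "conn T S M N J b d Z j = \<one>\<^bsub>Ev M Z\<^esub>"
      unfolding jpn using CH.hom_mult[OF cp JG.inv_closed[OF dn]] CH.hom_inv[OF dn] conn_hom(2)[OF Z 1] conn_hom(2)[OF Z 2] by simp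
  }
  assume c1: "conn T S M N J b d Z j = \<one>\<^bsub>Ev M Z\<^esub>"
  obtain f g s n m where 1: "(f, g, s) \<in> Tri T" "Dom T f = Z" "Cod T f \<in> S" "n \<in> carrier (Ev N (Dom T s))"
       "Re J s j = d (Dom T s) n" "m \<in> carrier (Ev M (Cod T f))" "b (Cod T f) m = Re N g n" "\<one>\<^bsub>Ev M Z\<^esub> = Re M f m"
    using conn_hom(3)[OF Z j, unfolded c1] by (rule conn_relE)
  note ts = tri_simps[OF 1(1)]
  have sW: "s \<in> W" using tri_third_W 1 by blast
  have cs: "Cod T s = Sho T Z" using ts 1 by simp
  have o: "Dom T s \<in> Obj T" using ts by simp
  obtain m1 where m1: "m1 \<in> carrier (Ev M (Cod T g))" "Re M g m1 = m"
    by (rule cohomological_exact[OF MC 1(1,6)]) (use 1 in auto)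
  have m1': "m1 \<in> carrier (Ev M (Dom T s))" using m1 ts by simp
  interpret NS: comm_group "Ev N (Dom T s)" using presheafD(1)[OF Np o] .
  interpret JS: comm_group "Ev J (Dom T s)" using presheafD(1)[OF Jp o] .
  interpret NC': comm_group "Ev N (Cod T f)" using presheafD(1)[OF Np cod_obj[OF ts(1)]] .
  let ?bm = "b (Dom T s) m1"
  have bm: "?bm \<in> carrier (Ev N (Dom T s))" using psh_homD(1)[OF bh o m1'] .
  let ?n1 = "n \<otimes>\<^bsub>Ev N (Dom T s)\<^esub> inv\<^bsub>Ev N (Dom T s)\<^esub> ?bm"
  have n1: "?n1 \<in> carrier (Ev N (Dom T s))" using 1 bm by simp
  have gbm: "Re N g ?bm = Re N g n" using psh_homD(3)[OF bh ts(2), of m1] m1 1 ts by simp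
  have gn: "Re N g n \<in> carrier (Ev N (Dom T g))" using presheafD(3)[OF Np ts(2), of n] 1 ts by simp
  interpret GH: group_hom "Ev N (Dom T s)" "Ev N (Dom T g)" "Re N g"
    using presheaf_group_hom[OF Np ts(2)] ts by simp
  have "Re N g ?n1 = \<one>\<^bsub>Ev N (Dom T g)\<^esub>" using GH.hom_mult[OF 1(4) NS.inv_closed[OF bm]] GH.hom_inv[OF bm] gbm gn by simp
  then obtain n2 where n2: "n2 \<in> carrier (Ev N (Cod T s))" "Re N s n2 = ?n1"
    by (rule cohomological_exact[OF NC rotate[OF 1(1)], rotated]) (use n1 ts in auto)
  have n2': "n2 \<in> carrier (Ev N (Sho T Z))" using n2 cs by simp
  have am: "a (Dom T s) m1 \<in> carrier (Ev P (Dom T s))" using psh_homD(1)[OF ah o m1'] .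
  obtain p where p: "p \<in> carrier (Ev P (Sho T Z))" "Re P s p = a (Dom T s) m1" using invertsD(2)[OF PD(3) sW am] cs by auto
  let ?Y = "Sho T Z"
  have cp: "c ?Y p \<in> carrier (Ev J ?Y)" using psh_homD(1)[OF ch Y p(1)] .
  have dn2: "d ?Y n2 \<in> carrier (Ev J ?Y)" using psh_homD(1)[OF dh Y n2'] .
  interpret DH: group_hom "Ev N (Dom T s)" "Ev J (Dom T s)" "d (Dom T s)" using psh_hom_group_hom[OF dh Np Jp o] .
  have dbm: "d (Dom T s) ?bm \<in> carrier (Ev J (Dom T s))" and ddn: "d (Dom T s) n \<in> carrier (Ev J (Dom T s))" using bm 1 by auto
  have e1: "Re J s (c ?Y p) = d (Dom T s) ?bm" using psh_homD(3)[OF ch ts(3), of p] cs p square[OF o m1'] by simp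
  have e2: "Re J s (d ?Y n2) = d (Dom T s) ?n1" using psh_homD(3)[OF dh ts(3), of n2] n2 cs by simp
  have "Re J s (c ?Y p \<otimes>\<^bsub>Ev J ?Y\<^esub> d ?Y n2) = Re J s j"
    using presheafD(4)[OF Jp ts(3), of "c ?Y p" "d ?Y n2"] cs cp dn2 e1 e2 DH.hom_mult[OF 1(4) NS.inv_closed[OF bm]] DH.hom_inv[OF bm]
      1(5) dbm ddn by (simp add: JS.m_ac JS.m_lcomm[of "d (Dom T s) ?bm"])
  then have "c ?Y p \<otimes>\<^bsub>Ev J ?Y\<^esub> d ?Y n2 = j" using invertsD(1)[OF JD(3) sW] cs cp dn2 j by simp
  moreover have "d ?Y (inv\<^bsub>Ev N ?Y\<^esub> n2) = inv\<^bsub>Ev J ?Y\<^esub> d ?Y n2" using psh_hom_inv[OF dh Np Jp Y n2'] .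
  \<comment> \<open>The construction gives a product; replacing n2 by its inverse brings it into the
    form of a difference.\<close>
  ultimately have "j = c ?Y p \<otimes>\<^bsub>Ev J ?Y\<^esub> inv\<^bsub>Ev J ?Y\<^esub> d ?Y (inv\<^bsub>Ev N ?Y\<^esub> n2)" using dn2 by simp
  then show "\<exists>p \<in> carrier (Ev P ?Y). \<exists>n \<in> carrier (Ev N ?Y). j = c ?Y p \<otimes>\<^bsub>Ev J ?Y\<^esub> inv\<^bsub>Ev J ?Y\<^esub> d ?Y n"
    using p(1) NG.inv_closed[OF n2'] by blast
qed

text \<open>Values of the connecting map die in P because they come from an object of S, where P
  vanishes, and in N because they come from X through two consecutive maps of the triangle.
  Conversely, if m0 dies in P, it dies along some s0 in W and so comes from m on the cone of s0.
  Since b m0 = 1, the image of m in N comes from N(X), and inverting the third map on J produces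
  j.\<close>

lemma exact_M:
  assumes Z: "Z \<in> Obj T" and m0: "m0 \<in> carrier (Ev M Z)"
  shows "(a Z m0 = \<one>\<^bsub>Ev P Z\<^esub> \<and> b Z m0 = \<one>\<^bsub>Ev N Z\<^esub>) \<longleftrightarrow> (\<exists>j \<in> carrier (Ev J (Sho T Z)). conn T S M N J b d Z j = m0)"
proof
  assume "\<exists>j \<in> carrier (Ev J (Sho T Z)). conn T S M N J b d Z j = m0"
  then obtain j where j: "j \<in> carrier (Ev J (Sho T Z))" "conn T S M N J b d Z j = m0" by blast
  obtain f g s n m where 1: "(f, g, s) \<in> Tri T" "Dom T f = Z" "Cod T f \<in> S" "n \<in> carrier (Ev N (Dom T s))"
       "Re J s j = d (Dom T s) n" "m \<in> carrier (Ev M (Cod T f))" "b (Cod T f) m = Re N g n" "m0 = Re M f m"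
    using conn_hom(3)[OF Z j(1), unfolded j(2)] by (rule conn_relE)
  note ts = tri_simps[OF 1(1)]
  have "a (Cod T f) m = \<one>\<^bsub>Ev P (Cod T f)\<^esub>" using P_trivial[OF 1(3) psh_homD(1)[OF ah cod_obj[OF ts(1)] 1(6)]] .
  then have "a Z m0 = \<one>\<^bsub>Ev P Z\<^esub>" using psh_homD(3)[OF ah ts(1) 1(6)] 1 presheaf_one[OF Pp ts(1)] by simp
  moreover have "b Z m0 = \<one>\<^bsub>Ev N Z\<^esub>"
    using psh_homD(3)[OF bh ts(1) 1(6)] 1 cohomological_complex[OF NC 1(1), of n] ts by simp
  ultimately show "a Z m0 = \<one>\<^bsub>Ev P Z\<^esub> \<and> b Z m0 = \<one>\<^bsub>Ev N Z\<^esub>" by simp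
next
  assume k: "a Z m0 = \<one>\<^bsub>Ev P Z\<^esub> \<and> b Z m0 = \<one>\<^bsub>Ev N Z\<^esub>"
  obtain s0 where s0: "s0 \<in> W" "Cod T s0 = Z" "Re M s0 m0 = \<one>\<^bsub>Ev M (Dom T s0)\<^esub>" using PD(5)[OF Z m0] k by blast
  obtain f h where t0: "(s0, f, h) \<in> Tri T" "Cod T f \<in> S" using W_E[OF s0(1)] by blast
  note ts0 = tri_simps[OF t0(1)]
  obtain m where m: "m \<in> carrier (Ev M (Cod T f))" "Re M f m = m0"
    by (rule cohomological_exact[OF MC t0(1), of m0]) (use m0 s0 in auto)
  have fZ: "Dom T f = Z" using ts0 s0 by simp
  obtain g s where t: "(f, g, s) \<in> Tri T" using coneE[OF ts0(2)] by blast
  note ts = tri_simps[OF t]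
  have bm: "b (Cod T f) m \<in> carrier (Ev N (Cod T f))" using psh_homD(1)[OF bh cod_obj[OF ts(1)] m(1)] .
  have "Re N f (b (Cod T f) m) = \<one>\<^bsub>Ev N (Dom T f)\<^esub>" using psh_homD(3)[OF bh ts(1) m(1)] m k fZ by simp
  then obtain n where n: "n \<in> carrier (Ev N (Cod T g))" "Re N g n = b (Cod T f) m"
    by (rule cohomological_exact[OF NC t bm])
  have n': "n \<in> carrier (Ev N (Dom T s))" using n ts by simp
  have sW: "s \<in> W" using tri_third_W[OF t t0(2)] .
  have cs: "Cod T s = Sho T Z" using ts fZ by simp
  obtain j where j: "j \<in> carrier (Ev J (Sho T Z))" "Re J s j = d (Dom T s) n"
    using invertsD(2)[OF JD(3) sW psh_homD(1)[OF dh dom_obj[OF ts(3)] n']] cs by auto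
  have "R Z j m0" by (rule RI[OF j(1) t fZ t0(2) n' j(2) m(1)]) (use n m in auto)
  then show "\<exists>j \<in> carrier (Ev J (Sho T Z)). conn T S M N J b d Z j = m0" using conn_hom(2)[OF Z] j by blast
qed

text \<open>A solution m' is first found on the source of some s in W: p comes from M there, and the
  discrepancy with n dies after refinement because d is a localization. On the fibre of s, an object
  of S, m' is trivial by injectivity of b, so m' extends to X with the right value in P. The error
  left in N dies along s and comes from the cone of s, where b is onto. Correcting by it keeps the
  value in P, which vanishes on S.\<close>

lemma exact_middle:
  assumes X: "X \<in> Obj T" and p: "p \<in> carrier (Ev P X)" and n: "n \<in> carrier (Ev N X)"
  shows "c X p = d X n \<longleftrightarrow> (\<exists>m \<in> carrier (Ev M X). a X m = p \<and> b X m = n)"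
proof
  assume "\<exists>m \<in> carrier (Ev M X). a X m = p \<and> b X m = n"
  then show "c X p = d X n" using square[OF X] by blast
next
  assume eq: "c X p = d X n"
  obtain s1 m1 where s1: "s1 \<in> W" "Cod T s1 = X" "m1 \<in> carrier (Ev M (Dom T s1))" "Re P s1 p = a (Dom T s1) m1"
    using PD(4)[OF X p] by blast
  have s1A: "s1 \<in> Arr T" and o1: "Dom T s1 \<in> Obj T" using s1 by auto
  interpret N1: comm_group "Ev N (Dom T s1)" using presheafD(1)[OF Np o1] .
  let ?b1 = "b (Dom T s1) m1" and ?n1 = "Re N s1 n"
  have b1: "?b1 \<in> carrier (Ev N (Dom T s1))" "?n1 \<in> carrier (Ev N (Dom T s1))"
    using psh_homD(1)[OF bh o1 s1(3)] presheafD(3)[OF Np s1A, of n] n s1 by auto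
  have "d (Dom T s1) ?b1 = Re J s1 (c X p)" using square[OF o1 s1(3)] s1 psh_homD(3)[OF ch s1A, of p] p by simp
  also have "\<dots> = d (Dom T s1) ?n1" unfolding eq using psh_homD(3)[OF dh s1A, of n] n s1 by simp
  finally have dd: "d (Dom T s1) ?b1 = d (Dom T s1) ?n1" .
  interpret D1: group_hom "Ev N (Dom T s1)" "Ev J (Dom T s1)" "d (Dom T s1)" using psh_hom_group_hom[OF dh Np Jp o1] .
  let ?x = "?b1 \<otimes>\<^bsub>Ev N (Dom T s1)\<^esub> inv\<^bsub>Ev N (Dom T s1)\<^esub> ?n1"
  have x: "?x \<in> carrier (Ev N (Dom T s1))" using b1 by simp
  have dn1: "d (Dom T s1) ?n1 \<in> carrier (Ev J (Dom T s1))" using b1 by simp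
  have "d (Dom T s1) ?x = \<one>\<^bsub>Ev J (Dom T s1)\<^esub>"
    using D1.hom_mult[OF b1(1) N1.inv_closed[OF b1(2)]] D1.hom_inv[OF b1(2)] dd D1.H.r_inv[OF dn1] by simp
  then obtain t where t: "t \<in> W" "Cod T t = Dom T s1" "Re N t ?x = \<one>\<^bsub>Ev N (Dom T t)\<^esub>" using JD(5)[OF o1 x] by blast
  have tA: "t \<in> Arr T" using t by simp
  define s where "s = s1 \<cdot> t"
  have sW: "s \<in> W" unfolding s_def by (rule cmp_W) (use s1 t in auto)
  have s: "s \<in> Arr T" "Dom T s = Dom T t" "Cod T s = X" using s1 t tA s1A by (auto simp: s_def)
  define m' where "m' = Re M t m1"
  have m': "m' \<in> carrier (Ev M (Dom T s))" using presheafD(3)[OF Mp tA, of m1] s1 t s by (simp add: m'_def)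
  have pm: "Re P s p = a (Dom T s) m'"
    using presheafD(5)[OF Pp tA s1A t(2), of p] p s1 psh_homD(3)[OF ah tA, of m1] t s by (simp add: s_def m'_def)
  have bn: "b (Dom T s) m' = Re N s n"
  proof -
    interpret Nt: comm_group "Ev N (Dom T t)" using presheafD(1)[OF Np dom_obj[OF tA]] .
    interpret T1: group_hom "Ev N (Dom T s1)" "Ev N (Dom T t)" "Re N t" using presheaf_group_hom[OF Np tA] t by simp
    have tb: "Re N t ?b1 \<in> carrier (Ev N (Dom T t))" "Re N t ?n1 \<in> carrier (Ev N (Dom T t))" using b1 by auto
    have "Re N t ?b1 \<otimes>\<^bsub>Ev N (Dom T t)\<^esub> inv\<^bsub>Ev N (Dom T t)\<^esub> Re N t ?n1 = \<one>\<^bsub>Ev N (Dom T t)\<^esub>"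
      using t(3) T1.hom_mult[OF b1(1) N1.inv_closed[OF b1(2)]] T1.hom_inv[OF b1(2)] by simp
    then have "Re N t ?b1 = Re N t ?n1" using Nt.inv_solve_right'[OF tb(1) Nt.one_closed tb(2)] tb by (metis Nt.inv_equality Nt.inv_inv Nt.inv_closed)
    then show ?thesis using presheafD(5)[OF Np tA s1A t(2), of n] n s1 psh_homD(3)[OF bh tA, of m1] t s by (simp add: s_def m'_def)
  qed
  obtain h k where th: "(s, h, k) \<in> Tri T" "Cod T h \<in> S" using W_E[OF sW] by blast
  note hs = tri_simps[OF th(1)]
  obtain w e where w: "(w, s, e \<cdot> h) \<in> Tri T" "Dom T w = Usho T (Cod T h)" by (rule rotate_back[OF th(1)])
  note ws = tri_simps[OF w(1)]
  have wS: "Dom T w \<in> S" using w th subcat_usho[OF subcat cod_obj[OF hs(2)]] by simp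
  have wm: "Re M w m' \<in> carrier (Ev M (Dom T w))" using presheafD(3)[OF Mp ws(1), of m'] m' ws by simp
  have "b (Dom T w) (Re M w m') = Re N w (Re N s n)" using psh_homD(3)[OF bh ws(1), of m'] m' ws bn by simp
  also have "\<dots> = \<one>\<^bsub>Ev N (Dom T w)\<^esub>" using cohomological_complex[OF NC w(1), of n] n s by simp
  finally have "Re M w m' = \<one>\<^bsub>Ev M (Dom T w)\<^esub>" using b_inj[OF wS wm] by simp
  then obtain m1' where m1': "m1' \<in> carrier (Ev M (Cod T s))" "Re M s m1' = m'"
    by (rule cohomological_exact[OF MC w(1), rotated]) (use m' ws in auto)
  have m2: "m1' \<in> carrier (Ev M X)" using m1' s by simp
  have "Re P s (a X m1') = Re P s p" using psh_homD(3)[OF ah s(1), of m1'] m1' s pm by simp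
  then have ap: "a X m1' = p" using invertsD(1)[OF PD(3) sW] s psh_homD(1)[OF ah X m2] p by simp
  interpret NX: comm_group "Ev N X" using presheafD(1)[OF Np X] .
  interpret MX: comm_group "Ev M X" using presheafD(1)[OF Mp X] .
  interpret PX: comm_group "Ev P X" using presheafD(1)[OF Pp X] .
  have bm: "b X m1' \<in> carrier (Ev N X)" using psh_homD(1)[OF bh X m2] .
  let ?y = "b X m1' \<otimes>\<^bsub>Ev N X\<^esub> inv\<^bsub>Ev N X\<^esub> n"
  have y: "?y \<in> carrier (Ev N (Cod T s))" using bm n s by simp
  interpret SX: group_hom "Ev N X" "Ev N (Dom T s)" "Re N s" using presheaf_group_hom[OF Np s(1)] s by simp
  have sn: "Re N s n \<in> carrier (Ev N (Dom T s))" using n by simp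
  have "Re N s (b X m1') = Re N s n" using psh_homD(3)[OF bh s(1), of m1'] m1' s bn by simp
  then have "Re N s ?y = \<one>\<^bsub>Ev N (Dom T s)\<^esub>"
    using SX.hom_mult[OF bm NX.inv_closed[OF n]] SX.hom_inv[OF n] SX.H.r_inv[OF sn] by simp
  then obtain z where z: "z \<in> carrier (Ev N (Cod T h))" "Re N h z = ?y" by (rule cohomological_exact[OF NC th(1) y])
  obtain z' where z': "z' \<in> carrier (Ev M (Cod T h))" "b (Cod T h) z' = z" using b_surj[OF th(2) z(1)] by blast
  have hX: "Dom T h = X" using hs s by simp
  let ?q = "Re M h z'"
  have q: "?q \<in> carrier (Ev M X)" using presheafD(3)[OF Mp hs(2), of z'] z' hX by simp
  have bq: "b X ?q = ?y" using psh_homD(3)[OF bh hs(2) z'(1)] z z' hX by simp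
  have "a (Cod T h) z' = \<one>\<^bsub>Ev P (Cod T h)\<^esub>" using P_trivial[OF th(2) psh_homD(1)[OF ah cod_obj[OF hs(2)] z'(1)]] .
  then have aq: "a X ?q = \<one>\<^bsub>Ev P X\<^esub>" using psh_homD(3)[OF ah hs(2) z'(1)] hX presheaf_one[OF Pp hs(2)] by simp
  interpret AX: group_hom "Ev M X" "Ev P X" "a X" using psh_hom_group_hom[OF ah Mp Pp X] .
  interpret BX: group_hom "Ev M X" "Ev N X" "b X" using psh_hom_group_hom[OF bh Mp Np X] .
  let ?m = "m1' \<otimes>\<^bsub>Ev M X\<^esub> inv\<^bsub>Ev M X\<^esub> ?q"
  have "a X ?m = p" using AX.hom_mult[OF m2 MX.inv_closed[OF q]] AX.hom_inv[OF q] aq ap p by simp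
  moreover have "b X ?m = n"
    using BX.hom_mult[OF m2 MX.inv_closed[OF q]] BX.hom_inv[OF q] bq bm n
    by (simp add: NX.inv_mult NX.m_assoc[symmetric])
  moreover have "?m \<in> carrier (Ev M X)" using m2 q by simp
  ultimately show "\<exists>m \<in> carrier (Ev M X). a X m = p \<and> b X m = n" by blast
qed

end

text \<open>Morphisms compatible with b and d carry each instance of the relation to an instance
  over the same triangle; this is naturality of the connecting map in F.\<close>

lemma conn_rel_map:
  assumes r: "conn_rel T S M N J b d Z j m" and Z: "Sho T Z \<in> Obj T"
    and tri: "\<And>f g s. (f, g, s) \<in> Tri T \<Longrightarrow> f \<in> Arr T \<and> g \<in> Arr T \<and> s \<in> Arr T \<and> Cod T f = Dom T g \<and> Cod T g = Dom T s \<and>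
      Cod T s = Sho T (Dom T f) \<and> Cod T f \<in> Obj T \<and> Dom T s \<in> Obj T"
    and h: "psh_hom T M M' \<psi>M" "psh_hom T N N' \<psi>N" "psh_hom T J J' \<psi>J"
    and d: "\<And>X x. X \<in> Obj T \<Longrightarrow> x \<in> carrier (Ev N X) \<Longrightarrow> d' X (\<psi>N X x) = \<psi>J X (d X x)"
    and b: "\<And>X x. X \<in> Obj T \<Longrightarrow> x \<in> carrier (Ev M X) \<Longrightarrow> b' X (\<psi>M X x) = \<psi>N X (b X x)"
  shows "conn_rel T S M' N' J' b' d' Z (\<psi>J (Sho T Z) j) (\<psi>M Z m)"
proof -
  obtain f g s n m1 where 1: "j \<in> carrier (Ev J (Sho T Z))" "(f, g, s) \<in> Tri T" "Dom T f = Z" "Cod T f \<in> S" "n \<in> carrier (Ev N (Dom T s))"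
       "Re J s j = d (Dom T s) n" "m1 \<in> carrier (Ev M (Cod T f))" "b (Cod T f) m1 = Re N g n" "m = Re M f m1"
    using r by (rule conn_relE)
  note ts = tri[OF 1(2)]
  have fo: "Cod T f \<in> Obj T" and so: "Dom T s \<in> Obj T" using ts by blast+
  show ?thesis
  proof (rule conn_relI[where n = "\<psi>N (Dom T s) n" and m = "\<psi>M (Cod T f) m1", OF _ 1(2-4)])
    show "\<psi>J (Sho T Z) j \<in> carrier (Ev J' (Sho T Z))" using psh_homD(1)[OF h(3) Z 1(1)] .
    show "\<psi>N (Dom T s) n \<in> carrier (Ev N' (Dom T s))" using psh_homD(1)[OF h(2) so 1(5)] .
    show "Re J' s (\<psi>J (Sho T Z) j) = d' (Dom T s) (\<psi>N (Dom T s) n)"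
      using psh_homD(3)[OF h(3), of s j] ts 1 d[of "Dom T s" n] by simp
    show "\<psi>M (Cod T f) m1 \<in> carrier (Ev M' (Cod T f))" using psh_homD(1)[OF h(1) fo 1(7)] .
    show "b' (Cod T f) (\<psi>M (Cod T f) m1) = Re N' g (\<psi>N (Dom T s) n)"
      using psh_homD(3)[OF h(2), of g n] ts 1 b[OF fo 1(7)] by simp
    show "\<psi>M Z m = Re M' f (\<psi>M (Cod T f) m1)" using psh_homD(3)[OF h(1), of f m1] ts 1 by simp
  qed
qed

section \<open>The square of localizations of F for a commuting pair\<close>

context commuting begin

abbreviation I where "I \<equiv> U \<inter> V"
abbreviation K where "K \<equiv> thick_hull T (U \<union> V)"

lemma thick_I: "triangulated_subcategory T I" and thick_K: "triangulated_subcategory T K"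
  and thick_U: "triangulated_subcategory T U" and thick_V: "triangulated_subcategory T V"
proof -
  show "triangulated_subcategory T K" using thick_subcat[OF thick_hull_thick[of "U \<union> V"]] thick_obj[OF U] thick_obj[OF V] by blast
qed (rule thick_subcat[OF thick_Int[OF U V]] thick_subcat[OF U] thick_subcat[OF V])+

lemma sub: "I \<subseteq> U" "I \<subseteq> V" "U \<subseteq> K" "V \<subseteq> K" "I \<subseteq> K"
  using thick_hull_superset[of "U \<union> V"] by auto

sublocale VI: verdier T I by unfold_locales (rule thick_I)
sublocale VK: verdier T K by unfold_locales (rule thick_K)

lemma cone_mono: "s \<in> cone_in T A \<Longrightarrow> A \<subseteq> B \<Longrightarrow> s \<in> cone_in T B"
  unfolding cone_in_def by blast

text \<open>Surjectivity and kernel of M -> P reduce to those of F -> P, since maps with cone in U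
  \<inter> V also have cone in U. For N -> J a denominator with cone in U \<or> V is refined to u v;
  the V-map v is inverted by N, so only u remains. Bijectivity of b on U comes from
  \<open>refine_Int\<close>.\<close>

lemma mv_square:
  fixes F :: "('o, 'm, 'g) psh"
  assumes inf: "infinite (UNIV :: 'g set)" and small: "essentially_small T (UNIV :: 'g set)"
    and F: "cohomological T F"
  shows "mv_square T U (Fo (Lfun T I) F) (Fo (Lfun T U) F) (Fo (Lfun T V) F) (Fo (Lfun T K) F)
    (canon T I U F) (canon T I V F) (canon T U K F) (canon T V K F)"
proof -
  let ?M = "Fo (Lfun T I) F" and ?P = "Fo (Lfun T U) F" and ?N = "Fo (Lfun T V) F" and ?J = "Fo (Lfun T K) F"
  let ?uM = "Unit (pull_q T I) F" and ?uP = "Unit (pull_q T U) F" and ?uN = "Unit (pull_q T V) F" and ?uJ = "Unit (pull_q T K) F"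
  note P0 = cohomological_presheaf[OF F]
  note lM = VI.Lfun_localization[OF inf small F] and lP = VU.Lfun_localization[OF inf small F]
    and lN = VV.Lfun_localization[OF inf small F] and lJ = VK.Lfun_localization[OF inf small F]
  note dM = localizationD[OF lM] and dP = localizationD[OF lP] and dN = localizationD[OF lN] and dJ = localizationD[OF lJ]
  note pM = cohomological_presheaf[OF dM(1)] and pP = cohomological_presheaf[OF dP(1)]
    and pN = cohomological_presheaf[OF dN(1)] and pJ = cohomological_presheaf[OF dJ(1)]
  note a = canon_hom[OF inf small thick_I thick_U sub(1) F] and b = canon_hom[OF inf small thick_I thick_V sub(2) F]
    and c = canon_hom[OF inf small thick_U thick_K sub(3) F] and d = canon_hom[OF inf small thick_V thick_K sub(4) F]
  let ?a = "canon T I U F" and ?b = "canon T I V F" and ?c = "canon T U K F" and ?d = "canon T V K F"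
  have sq: "?c X (?a X x) = ?d X (?b X x)" if X: "X \<in> Obj T" "x \<in> carrier (Ev ?M X)" for X x
  proof -
    have "mor_comp ?c ?a X x = mor_comp ?d ?b X x"
      by (rule VI.extension_unique[OF lM inverts_mono[OF dJ(3) sub(5)] psh_hom_comp[OF a(1) c(1)] psh_hom_comp[OF b(1) d(1)] _ X])
        (use a(2) b(2) c(2) d(2) in \<open>simp add: mor_comp_def\<close>)
    then show ?thesis by (simp add: mor_comp_def)
  qed
  have locP: "localization T U ?M ?P ?a" unfolding localization_def
  proof (intro conjI ballI impI)
    show "cohomological T ?P" by (rule dP(1))
    show "psh_hom T ?M ?P ?a" by (rule a(1))
    show "bij_betw (Re ?P s) (carrier (Ev ?P (Cod T s))) (carrier (Ev ?P (Dom T s)))" if "s \<in> cone_in T U" for s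
      using dP(3) that by (simp add: inverts_def)
    show "\<exists>s \<in> cone_in T U. Cod T s = X \<and> (\<exists>m \<in> carrier (Ev ?M (Dom T s)). Re ?P s x = ?a (Dom T s) m)"
      if X: "X \<in> Obj T" and x: "x \<in> carrier (Ev ?P X)" for X x
    proof -
      obtain s y where s: "s \<in> cone_in T U" "Cod T s = X" "y \<in> carrier (Ev F (Dom T s))" "Re ?P s x = ?uP (Dom T s) y"
        using dP(4)[OF X x] by blast
      have o: "Dom T s \<in> Obj T" using VU.W_arr[OF s(1)] by simp
      show ?thesis using s a(2)[OF o s(3)] psh_homD(1)[OF dM(2) o s(3)] by (metis (no_types))
    qed
    show "\<exists>s \<in> cone_in T U. Cod T s = X \<and> Re ?M s m = \<one>\<^bsub>Ev ?M (Dom T s)\<^esub>"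
      if X: "X \<in> Obj T" and m: "m \<in> carrier (Ev ?M X)" and z: "?a X m = \<one>\<^bsub>Ev ?P X\<^esub>" for X m
    proof -
      obtain t y where t: "t \<in> cone_in T I" "Cod T t = X" "y \<in> carrier (Ev F (Dom T t))" "Re ?M t m = ?uM (Dom T t) y"
        using dM(4)[OF X m] by blast
      have tA: "t \<in> Arr T" using VI.W_arr[OF t(1)] .
      have o: "Dom T t \<in> Obj T" using tA by simp
      have "?uP (Dom T t) y = ?a (Dom T t) (Re ?M t m)" using a(2)[OF o t(3)] t by simp
      also have "\<dots> = \<one>\<^bsub>Ev ?P (Dom T t)\<^esub>" using psh_homD(3)[OF a(1) tA, of m] m t z presheaf_one[OF pP tA] by simp
      finally obtain u where u: "u \<in> cone_in T U" "Cod T u = Dom T t" "Re F u y = \<one>\<^bsub>Ev F (Dom T u)\<^esub>" using dP(5)[OF o t(3)] by blast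
      have uA: "u \<in> Arr T" using VU.W_arr[OF u(1)] .
      have tu: "t \<cdot> u \<in> cone_in T U" by (rule VU.cmp_W[OF u(1) cone_mono[OF t(1) sub(1)] u(2)])
      have "Re ?M (t \<cdot> u) m = Re ?M u (?uM (Dom T t) y)" using presheafD(5)[OF pM uA tA u(2), of m] m t by simp
      also have "\<dots> = ?uM (Dom T u) (Re F u y)" using psh_homD(3)[OF dM(2) uA, of y] t u by simp
      also have "\<dots> = \<one>\<^bsub>Ev ?M (Dom T u)\<^esub>" using psh_hom_one[OF dM(2) P0 pM dom_obj[OF uA]] u by simp
      finally show ?thesis using tu tA uA t u by (intro bexI[of _ "t \<cdot> u"]) auto
    qed
  qed
  have locJ: "localization T U ?N ?J ?d" unfolding localization_def
  proof (intro conjI ballI impI)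
    show "cohomological T ?J" by (rule dJ(1))
    show "psh_hom T ?N ?J ?d" by (rule d(1))
    show "bij_betw (Re ?J s) (carrier (Ev ?J (Cod T s))) (carrier (Ev ?J (Dom T s)))" if "s \<in> cone_in T U" for s
      using dJ(3) cone_mono[OF that sub(3)] by (simp add: inverts_def)
    show "\<exists>s \<in> cone_in T U. Cod T s = X \<and> (\<exists>n \<in> carrier (Ev ?N (Dom T s)). Re ?J s j = ?d (Dom T s) n)"
      if X: "X \<in> Obj T" and j: "j \<in> carrier (Ev ?J X)" for X j
    proof -
      obtain s y where s: "s \<in> cone_in T K" "Cod T s = X" "y \<in> carrier (Ev F (Dom T s))" "Re ?J s j = ?uJ (Dom T s) y"
        using dJ(4)[OF X j] by blast
      obtain u v r where r: "u \<in> cone_in T U" "v \<in> cone_in T V" "r \<in> Arr T" "Cod T u = Cod T s" "Cod T v = Dom T u"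
        "Dom T r = Dom T v" "Cod T r = Dom T s" "s \<cdot> r = u \<cdot> v" by (rule refine_UV[OF s(1)])
      have A: "s \<in> Arr T" "u \<in> Arr T" "v \<in> Arr T" using s r VK.W_arr VU.W_arr VV.W_arr by auto
      let ?y = "Re F r y"
      have y: "?y \<in> carrier (Ev F (Dom T v))" using presheafD(3)[OF P0 r(3), of y] s r by simp
      have o: "Dom T v \<in> Obj T" using A by simp
      obtain n where n: "n \<in> carrier (Ev ?N (Cod T v))" "Re ?N v n = ?uN (Dom T v) ?y"
        using invertsD(2)[OF dN(3) r(2) psh_homD(1)[OF dN(2) o y]] by blast
      have uj: "Re ?J u j \<in> carrier (Ev ?J (Cod T v))" using presheafD(3)[OF pJ A(2), of j] j s r by simp
      have dn: "?d (Cod T v) n \<in> carrier (Ev ?J (Cod T v))" using psh_homD(1)[OF d(1) cod_obj[OF A(3)] n(1)] .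
      have "Re ?J v (Re ?J u j) = Re ?J (u \<cdot> v) j" using presheafD(5)[OF pJ A(3,2) r(5), of j] j s r by simp
      also have "\<dots> = Re ?J (s \<cdot> r) j" by (simp only: r(8))
      also have "\<dots> = ?uJ (Dom T v) ?y"
        using presheafD(5)[OF pJ r(3) A(1) r(7), of j] j s(2-4) psh_homD(3)[OF dJ(2) r(3), of y] r(6,7) by simp
      also have "\<dots> = Re ?J v (?d (Cod T v) n)" using d(2)[OF o y] psh_homD(3)[OF d(1) A(3) n(1)] n by simp
      finally have "Re ?J u j = ?d (Cod T v) n" using invertsD(1)[OF dJ(3) cone_mono[OF r(2) sub(4)] uj dn] by simp
      then show ?thesis using n r s by auto
    qed
    show "\<exists>s \<in> cone_in T U. Cod T s = X \<and> Re ?N s n = \<one>\<^bsub>Ev ?N (Dom T s)\<^esub>"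
      if X: "X \<in> Obj T" and n: "n \<in> carrier (Ev ?N X)" and z: "?d X n = \<one>\<^bsub>Ev ?J X\<^esub>" for X n
    proof -
      obtain t y where t: "t \<in> cone_in T V" "Cod T t = X" "y \<in> carrier (Ev F (Dom T t))" "Re ?N t n = ?uN (Dom T t) y"
        using dN(4)[OF X n] by blast
      have tA: "t \<in> Arr T" using VV.W_arr[OF t(1)] .
      have o: "Dom T t \<in> Obj T" using tA by simp
      have "?uJ (Dom T t) y = ?d (Dom T t) (Re ?N t n)" using d(2)[OF o t(3)] t by simp
      also have "\<dots> = \<one>\<^bsub>Ev ?J (Dom T t)\<^esub>" using psh_homD(3)[OF d(1) tA, of n] n t z presheaf_one[OF pJ tA] by simp
      finally obtain s where s: "s \<in> cone_in T K" "Cod T s = Dom T t" "Re F s y = \<one>\<^bsub>Ev F (Dom T s)\<^esub>" using dJ(5)[OF o t(3)] by blast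
      have sA: "s \<in> Arr T" using VK.W_arr[OF s(1)] .
      have ts: "t \<cdot> s \<in> cone_in T K" by (rule VK.cmp_W[OF s(1) cone_mono[OF t(1) sub(4)] s(2)])
      have tsd: "Cod T (t \<cdot> s) = X" "Dom T (t \<cdot> s) = Dom T s" "t \<cdot> s \<in> Arr T" using tA sA s t by auto
      obtain u v r where r: "u \<in> cone_in T U" "v \<in> cone_in T V" "r \<in> Arr T" "Cod T u = Cod T (t \<cdot> s)" "Cod T v = Dom T u"
        "Dom T r = Dom T v" "Cod T r = Dom T (t \<cdot> s)" "(t \<cdot> s) \<cdot> r = u \<cdot> v" by (rule refine_UV[OF ts])
      have A: "u \<in> Arr T" "v \<in> Arr T" using r VU.W_arr VV.W_arr by auto
      have rd: "Cod T r = Dom T s" "Cod T u = X" using r tsd by auto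
      have un: "Re ?N u n \<in> carrier (Ev ?N (Cod T v))" using presheafD(3)[OF pN A(1), of n] n rd r(5) by simp
      have "Re ?N v (Re ?N u n) = Re ?N (u \<cdot> v) n" using presheafD(5)[OF pN A(2,1) r(5), of n] n rd by simp
      also have "\<dots> = Re ?N ((t \<cdot> s) \<cdot> r) n" by (simp only: r(8))
      also have "\<dots> = Re ?N r (Re ?N (t \<cdot> s) n)" using presheafD(5)[OF pN r(3) tsd(3) r(7), of n] n tsd by simp
      also have "Re ?N (t \<cdot> s) n = Re ?N s (?uN (Dom T t) y)" using presheafD(5)[OF pN sA tA s(2), of n] n t by simp
      also have "\<dots> = ?uN (Dom T s) (Re F s y)" using psh_homD(3)[OF dN(2) sA, of y] t s by simp
      also have "\<dots> = \<one>\<^bsub>Ev ?N (Dom T s)\<^esub>" using psh_hom_one[OF dN(2) P0 pN dom_obj[OF sA]] s by simp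
      also have "Re ?N r \<one>\<^bsub>Ev ?N (Dom T s)\<^esub> = \<one>\<^bsub>Ev ?N (Dom T v)\<^esub>" using presheaf_one[OF pN r(3)] rd r(6) by simp
      also have "\<dots> = Re ?N v \<one>\<^bsub>Ev ?N (Cod T v)\<^esub>" using presheaf_one[OF pN A(2)] by simp
      finally have e: "Re ?N v (Re ?N u n) = Re ?N v \<one>\<^bsub>Ev ?N (Cod T v)\<^esub>" .
      interpret G: comm_group "Ev ?N (Cod T v)" using presheafD(1)[OF pN cod_obj[OF A(2)]] .
      have "Re ?N u n = \<one>\<^bsub>Ev ?N (Cod T v)\<^esub>" using invertsD(1)[OF dN(3) r(2) un G.one_closed e] .
      then show ?thesis using r(1,5) rd by auto
    qed
  qed
  have b_inj: "x = \<one>\<^bsub>Ev ?M X\<^esub>" if X: "X \<in> U" and x: "x \<in> carrier (Ev ?M X)" and z: "?b X x = \<one>\<^bsub>Ev ?N X\<^esub>" for X x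
  proof -
    have XO: "X \<in> Obj T" using thick_obj[OF U X] .
    obtain t y where t: "t \<in> cone_in T I" "Cod T t = X" "y \<in> carrier (Ev F (Dom T t))" "Re ?M t x = ?uM (Dom T t) y"
      using dM(4)[OF XO x] by blast
    have tA: "t \<in> Arr T" using VI.W_arr[OF t(1)] .
    have o: "Dom T t \<in> Obj T" using tA by simp
    obtain g h where g: "(t, g, h) \<in> Tri T" "Cod T g \<in> I" using VI.W_E[OF t(1)] by blast
    \<comment> \<open>The source of t stays in U, so \<open>refine_Int\<close> applies to V-maps
      into it.\<close>
    have tU: "Dom T t \<in> U" using subcat_first[OF thick_U g(1)] t X g by auto
    have "?uN (Dom T t) y = ?b (Dom T t) (Re ?M t x)" using b(2)[OF o t(3)] t by simp
    also have "\<dots> = \<one>\<^bsub>Ev ?N (Dom T t)\<^esub>" using psh_homD(3)[OF b(1) tA, of x] x t z presheaf_one[OF pN tA] by simp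
    finally obtain s where s: "s \<in> cone_in T V" "Cod T s = Dom T t" "Re F s y = \<one>\<^bsub>Ev F (Dom T s)\<^esub>" using dN(5)[OF o t(3)] by blast
    have sA: "s \<in> Arr T" using VV.W_arr[OF s(1)] .
    obtain w r where w: "w \<in> cone_in T I" "r \<in> Arr T" "Cod T w = Cod T s" "Dom T r = Dom T w" "Cod T r = Dom T s" "w = s \<cdot> r"
      by (rule refine_Int[OF _ s(1)]) (use tU s in auto)
    have wA: "w \<in> Arr T" "Cod T w = Dom T t" using VI.W_arr[OF w(1)] w(3) s by auto
    have tw: "t \<cdot> w \<in> cone_in T I" by (rule VI.cmp_W[OF w(1) t(1) wA(2)])
    have twd: "Cod T (t \<cdot> w) = X" "Dom T (t \<cdot> w) = Dom T w" using tA wA t by auto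
    have "Re F w y = Re F r (Re F s y)" unfolding w(6) using presheafD(5)[OF P0 w(2) sA w(5), of y] t s by simp
    also have "\<dots> = \<one>\<^bsub>Ev F (Dom T w)\<^esub>" using s presheaf_one[OF P0 w(2)] w(4,5) by simp
    finally have wy: "Re F w y = \<one>\<^bsub>Ev F (Dom T w)\<^esub>" .
    have "Re ?M (t \<cdot> w) x = Re ?M w (?uM (Dom T t) y)" using presheafD(5)[OF pM wA(1) tA wA(2), of x] x t by simp
    also have "\<dots> = ?uM (Dom T w) (Re F w y)" using psh_homD(3)[OF dM(2) wA(1), of y] t wA by simp
    also have "\<dots> = \<one>\<^bsub>Ev ?M (Dom T w)\<^esub>" using psh_hom_one[OF dM(2) P0 pM dom_obj[OF wA(1)]] wy by simp
    also have "\<dots> = Re ?M (t \<cdot> w) \<one>\<^bsub>Ev ?M X\<^esub>" using presheaf_one[OF pM, of "t \<cdot> w"] twd VI.W_arr[OF tw] by simp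
    finally have e: "Re ?M (t \<cdot> w) x = Re ?M (t \<cdot> w) \<one>\<^bsub>Ev ?M X\<^esub>" .
    interpret G: comm_group "Ev ?M X" using presheafD(1)[OF pM XO] .
    show ?thesis using invertsD(1)[OF dM(3) tw _ _ e] x twd by simp
  qed
  have b_surj: "\<exists>x \<in> carrier (Ev ?M X). ?b X x = y" if X: "X \<in> U" and y: "y \<in> carrier (Ev ?N X)" for X y
  proof -
    have XO: "X \<in> Obj T" using thick_obj[OF U X] .
    obtain s x where s: "s \<in> cone_in T V" "Cod T s = X" "x \<in> carrier (Ev F (Dom T s))" "Re ?N s y = ?uN (Dom T s) x"
      using dN(4)[OF XO y] by blast
    have sA: "s \<in> Arr T" using VV.W_arr[OF s(1)] .
    obtain w r where w: "w \<in> cone_in T I" "r \<in> Arr T" "Cod T w = Cod T s" "Dom T r = Dom T w" "Cod T r = Dom T s" "w = s \<cdot> r"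
      by (rule refine_Int[OF _ s(1)]) (use X s in auto)
    have wA: "w \<in> Arr T" "Cod T w = X" using VI.W_arr[OF w(1)] w(3) s by auto
    have o: "Dom T w \<in> Obj T" using wA by simp
    have rx: "Re F r x \<in> carrier (Ev F (Dom T w))" using presheafD(3)[OF P0 w(2), of x] s w(4,5) by simp
    obtain m where m: "m \<in> carrier (Ev ?M X)" "Re ?M w m = ?uM (Dom T w) (Re F r x)"
      using invertsD(2)[OF dM(3) w(1) psh_homD(1)[OF dM(2) o rx]] wA by auto
    have bm: "?b X m \<in> carrier (Ev ?N X)" using psh_homD(1)[OF b(1) XO m(1)] .
    have "Re ?N w (?b X m) = ?uN (Dom T w) (Re F r x)" using psh_homD(3)[OF b(1) wA(1), of m] m wA b(2)[OF o rx] by simp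
    also have "\<dots> = Re ?N r (Re ?N s y)" using psh_homD(3)[OF dN(2) w(2), of x] s w(4,5) by simp
    also have "\<dots> = Re ?N w y" unfolding w(6) using presheafD(5)[OF pN w(2) sA w(5), of y] y s by simp
    finally have "?b X m = y" using invertsD(1)[OF dN(3) cone_mono[OF w(1) sub(2)]] bm y wA by simp
    then show ?thesis using m by blast
  qed
  show ?thesis
    by unfold_locales (fact dM(1) dN(1) locP locJ b(1) c(1) sq b_inj b_surj)+
qed

end

subsection \<open>Iterated suspensions\<close>

context triangulated_category begin

lemma Sho_pow_obj: "X \<in> Obj T \<Longrightarrow> Sho_pow T n X \<in> Obj T"
proof -
  assume X: "X \<in> Obj T"
  have "(Sho T ^^ k) X \<in> Obj T" "(Usho T ^^ k) X \<in> Obj T" for k using X by (induction k) auto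
  then show ?thesis by (simp add: Sho_pow_def)
qed

lemma Sha_pow_arr:
  assumes f: "f \<in> Arr T"
  shows "Sha_pow T n f \<in> Arr T" "Dom T (Sha_pow T n f) = Sho_pow T n (Dom T f)" "Cod T (Sha_pow T n f) = Sho_pow T n (Cod T f)"
proof -
  have "(Sha T ^^ k) f \<in> Arr T \<and> Dom T ((Sha T ^^ k) f) = (Sho T ^^ k) (Dom T f) \<and> Cod T ((Sha T ^^ k) f) = (Sho T ^^ k) (Cod T f)"
    "(Usha T ^^ k) f \<in> Arr T \<and> Dom T ((Usha T ^^ k) f) = (Usho T ^^ k) (Dom T f) \<and> Cod T ((Usha T ^^ k) f) = (Usho T ^^ k) (Cod T f)" for k
    using f by (induction k) auto
  then show "Sha_pow T n f \<in> Arr T" "Dom T (Sha_pow T n f) = Sho_pow T n (Dom T f)" "Cod T (Sha_pow T n f) = Sho_pow T n (Cod T f)"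
    by (simp_all add: Sho_pow_def Sha_pow_def)
qed

text \<open>For negative n the two objects are equal, being the same iterate of \<open>Sho\<close>.
  For n at least 0 the source is \<open>Sho\<close> applied to \<open>Usho\<close> iterated n + 1
  times, and the inverse of X -> \<open>Sho T (Usho T X)\<close> cancels one pair.\<close>

lemma shift_isoE:
  obtains e where "\<And>X. X \<in> Obj T \<Longrightarrow> e X \<in> Arr T \<and> Dom T (e X) = Sho T (Sho_pow T (- (n + 1)) X) \<and> Cod T (e X) = Sho_pow T (- n) X \<and> iso_arr T (e X)"
    "\<And>f. f \<in> Arr T \<Longrightarrow> e (Cod T f) \<cdot> Sha T (Sha_pow T (- (n + 1)) f) = Sha_pow T (- n) f \<cdot> e (Dom T f)"
proof (cases "n < 0")
  case True
  have "nat (- n) = Suc (nat (- (n + 1)))" using True by simp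
  then have e: "Sho T (Sho_pow T (- (n + 1)) X) = Sho_pow T (- n) X" "Sha T (Sha_pow T (- (n + 1)) f) = Sha_pow T (- n) f" for X f
    using True by (simp_all add: Sho_pow_def Sha_pow_def)
  show ?thesis
  proof (rule that[of "\<lambda>X. Idn T (Sho_pow T (- n) X)"])
    show "Idn T (Sho_pow T (- n) X) \<in> Arr T \<and> Dom T (Idn T (Sho_pow T (- n) X)) = Sho T (Sho_pow T (- (n + 1)) X) \<and>
      Cod T (Idn T (Sho_pow T (- n) X)) = Sho_pow T (- n) X \<and> iso_arr T (Idn T (Sho_pow T (- n) X))" if "X \<in> Obj T" for X
      unfolding e using Sho_pow_obj[OF that] iso_idn by simp
    show "Idn T (Sho_pow T (- n) (Cod T f)) \<cdot> Sha T (Sha_pow T (- (n + 1)) f) = Sha_pow T (- n) f \<cdot> Idn T (Sho_pow T (- n) (Dom T f))"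
      if "f \<in> Arr T" for f unfolding e using Sha_pow_arr[OF that] by simp
  qed
next
  case False
  then have k: "nat (n + 1) = Suc (nat n)" "nat (1 + n) = Suc (nat n)" by simp_all
  have o: "Sho_pow T (- n) X = (Usho T ^^ nat n) X" "Sho_pow T (- (n + 1)) X = Usho T ((Usho T ^^ nat n) X)" for X
    using False k by (auto simp: Sho_pow_def)
  have ar: "Sha_pow T (- n) f = (Usha T ^^ nat n) f" "Sha_pow T (- (n + 1)) f = Usha T ((Usha T ^^ nat n) f)" for f
    using False k by (auto simp: Sha_pow_def)
  obtain E where E: "\<And>X. X \<in> Obj T \<Longrightarrow> E X \<in> Arr T \<and> Dom T (E X) = X \<and> Cod T (E X) = Sho T (Usho T X) \<and> iso_arr T (E X)"
    "\<And>f. f \<in> Arr T \<Longrightarrow> Sha T (Usha T f) \<cdot> E (Dom T f) = E (Cod T f) \<cdot> f" by (rule counitE) blast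
  have "\<forall>X. \<exists>i. X \<in> Obj T \<longrightarrow> i \<in> Arr T \<and> Dom T i = Sho T (Usho T X) \<and> Cod T i = X \<and> i \<cdot> E X = Idn T X \<and> E X \<cdot> i = Idn T (Sho T (Usho T X))"
    using E(1) iso_arrE by metis
  then obtain i where i: "\<And>X. X \<in> Obj T \<Longrightarrow> i X \<in> Arr T \<and> Dom T (i X) = Sho T (Usho T X) \<and> Cod T (i X) = X \<and> i X \<cdot> E X = Idn T X \<and> E X \<cdot> i X = Idn T (Sho T (Usho T X))"
    by metis
  show ?thesis
  proof (rule that[of "\<lambda>X. i (Sho_pow T (- n) X)"])
    show "i (Sho_pow T (- n) X) \<in> Arr T \<and> Dom T (i (Sho_pow T (- n) X)) = Sho T (Sho_pow T (- (n + 1)) X) \<and>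
      Cod T (i (Sho_pow T (- n) X)) = Sho_pow T (- n) X \<and> iso_arr T (i (Sho_pow T (- n) X))" if X: "X \<in> Obj T" for X
    proof -
      have Y: "Sho_pow T (- n) X \<in> Obj T" using Sho_pow_obj[OF X] .
      have s: "Sho_pow T (- (n + 1)) X = Usho T (Sho_pow T (- n) X)" using o by simp
      have "iso_arr T (i (Sho_pow T (- n) X))" by (rule iso_arrI[of _ "E (Sho_pow T (- n) X)"]) (use i[OF Y] E(1)[OF Y] in auto)
      then show ?thesis unfolding s using i[OF Y] by simp
    qed
    show "i (Sho_pow T (- n) (Cod T f)) \<cdot> Sha T (Sha_pow T (- (n + 1)) f) = Sha_pow T (- n) f \<cdot> i (Sho_pow T (- n) (Dom T f))"
      if f: "f \<in> Arr T" for f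
    proof -
      define g where "g = Sha_pow T (- n) f"
      have g: "g \<in> Arr T" "Dom T g = Sho_pow T (- n) (Dom T f)" "Cod T g = Sho_pow T (- n) (Cod T f)"
        using Sha_pow_arr[OF f] by (auto simp: g_def)
      have s: "Sha_pow T (- (n + 1)) f = Usha T g" using ar by (simp add: g_def)
      note iD = i[OF dom_obj[OF g(1)]] and iC = i[OF cod_obj[OF g(1)]]
      note ED = E(1)[OF dom_obj[OF g(1)]] and EC = E(1)[OF cod_obj[OF g(1)]]
      have isoD: "iso_arr T (E (Dom T g))" using ED by simp
      have "i (Cod T g) \<cdot> Sha T (Usha T g) = g \<cdot> i (Dom T g)"
      proof (rule iso_epic[OF isoD])
        have "(i (Cod T g) \<cdot> Sha T (Usha T g)) \<cdot> E (Dom T g) = i (Cod T g) \<cdot> (E (Cod T g) \<cdot> g)"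
          using iC ED g(1) E(2)[OF g(1)] by simp
        also have "\<dots> = g" using cmp_reduce1[of "i (Cod T g)" "E (Cod T g)" "Idn T (Cod T g)" g] iC EC g(1) by simp
        also have "\<dots> = (g \<cdot> i (Dom T g)) \<cdot> E (Dom T g)" using iD ED g(1) by simp
        finally show "(i (Cod T g) \<cdot> Sha T (Usha T g)) \<cdot> E (Dom T g) = (g \<cdot> i (Dom T g)) \<cdot> E (Dom T g)" .
      qed (use iC iD ED g(1) in auto)
      then show ?thesis unfolding s using g by (simp add: g_def)
    qed
  qed
qed

lemma presheaf_iso:
  assumes G: "presheaf T G" and e: "e \<in> Arr T" "iso_arr T e"
  shows "y \<in> carrier (Ev G (Dom T e)) \<Longrightarrow> \<exists>x \<in> carrier (Ev G (Cod T e)). Re G e x = y"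
    and "x \<in> carrier (Ev G (Cod T e)) \<Longrightarrow> x' \<in> carrier (Ev G (Cod T e)) \<Longrightarrow> Re G e x = Re G e x' \<Longrightarrow> x = x'"
proof -
  obtain i where i: "i \<in> Arr T" "Dom T i = Cod T e" "Cod T i = Dom T e" "i \<cdot> e = Idn T (Dom T e)" "e \<cdot> i = Idn T (Cod T e)"
    using iso_arrE[OF e(2)] by metis
  have 1: "Re G i (Re G e x) = x" if "x \<in> carrier (Ev G (Cod T e))" for x
    using presheafD(5)[OF G i(1) e(1) i(3) that] presheafD(2)[OF G cod_obj[OF e(1)] that] i(5) by simp
  have 2: "Re G e (Re G i y) = y" if "y \<in> carrier (Ev G (Dom T e))" for y
    using presheafD(5)[OF G e(1) i(1) i(2)[symmetric], of y] presheafD(2)[OF G dom_obj[OF e(1)] that] i that by simp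
  show "y \<in> carrier (Ev G (Dom T e)) \<Longrightarrow> \<exists>x \<in> carrier (Ev G (Cod T e)). Re G e x = y"
    using 2 presheafD(3)[OF G i(1), of y] i by auto
  show "x \<in> carrier (Ev G (Cod T e)) \<Longrightarrow> x' \<in> carrier (Ev G (Cod T e)) \<Longrightarrow> Re G e x = Re G e x' \<Longrightarrow> x = x'"
    using 1 by metis
qed

end

section \<open>Assembly of the long exact sequence\<close>

lemma dsum_simps [simp]:
  "Ev (Fo (dsum A B) F) X = Ev (Fo A F) X \<times>\<times> Ev (Fo B F) X"
  "Re (Fo (dsum A B) F) f = map_prod (Re (Fo A F) f) (Re (Fo B F) f)"
  "Fm (dsum A B) F G \<phi> X = map_prod (Fm A F G \<phi> X) (Fm B F G \<phi> X)"
  by (auto simp: dsum_def)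

lemma susp_simps [simp]:
  "Ev (Fo (susp T n A) F) X = Ev (Fo A F) (Sho_pow T (- n) X)"
  "Re (Fo (susp T n A) F) f = Re (Fo A F) (Sha_pow T (- n) f)"
  "Fm (susp T n A) F G \<phi> X = Fm A F G \<phi> (Sho_pow T (- n) X)"
  by (auto simp: susp_def)

lemma DirProd_simps:
  "carrier (G \<times>\<times> H) = carrier G \<times> carrier H" "(x, y) \<otimes>\<^bsub>G \<times>\<times> H\<^esub> (x', y') = (x \<otimes>\<^bsub>G\<^esub> x', y \<otimes>\<^bsub>H\<^esub> y')"
  "\<one>\<^bsub>G \<times>\<times> H\<^esub> = (\<one>\<^bsub>G\<^esub>, \<one>\<^bsub>H\<^esub>)"
  by (auto simp: DirProd_def)

lemma (in commuting) mayer_vietoris_exists: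
  assumes inf: "infinite (UNIV :: 'g set)" and small: "essentially_small T (UNIV :: 'g set)"
  shows "\<exists>(\<beta> :: ('o, 'm, 'g) psh \<Rightarrow> 'o \<Rightarrow> 'g \<times> 'g \<Rightarrow> 'g) \<gamma>. mayer_vietoris T U V \<beta> \<gamma>"
proof -
  define M P N J :: "('o, 'm, 'g, 'g) cohfun" where "M = Lfun T I" and "P = Lfun T U" and "N = Lfun T V" and "J = Lfun T K"
  define a b c d :: "('o, 'm, 'g) psh \<Rightarrow> 'o \<Rightarrow> 'g \<Rightarrow> 'g"
    where "a = canon T I U" and "b = canon T I V" and "c = canon T U K" and "d = canon T V K"
  note defs = M_def P_def N_def J_def a_def b_def c_def d_def
  have sq: "mv_square T U (Fo M F) (Fo P F) (Fo N F) (Fo J F) (a F) (b F) (c F) (d F)" if "cohomological T F" for F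
    unfolding defs by (rule mv_square[OF inf small that])
  have fM: "psh_hom T (Fo M F) (Fo M G) (Fm M F G \<phi>)" and fP: "psh_hom T (Fo P F) (Fo P G) (Fm P F G \<phi>)"
    and fN: "psh_hom T (Fo N F) (Fo N G) (Fm N F G \<phi>)" and fJ: "psh_hom T (Fo J F) (Fo J G) (Fm J F G \<phi>)"
    if "cohomological T F" "cohomological T G" "psh_hom T F G \<phi>" for F G \<phi>
    unfolding defs using VI.Lfun_functor(1)[OF inf small that] VU.Lfun_functor(1)[OF inf small that]
      VV.Lfun_functor(1)[OF inf small that] VK.Lfun_functor(1)[OF inf small that] by auto
  have na: "a G X (Fm M F G \<phi> X x) = Fm P F G \<phi> X (a F X x)" and nb: "b G X (Fm M F G \<phi> X x) = Fm N F G \<phi> X (b F X x)"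
    if "cohomological T F" "cohomological T G" "psh_hom T F G \<phi>" "X \<in> Obj T" "x \<in> carrier (Ev (Fo M F) X)" for F G \<phi> X x
    unfolding defs using canon_natural[OF inf small thick_I thick_U sub(1) that[unfolded defs]]
      canon_natural[OF inf small thick_I thick_V sub(2) that[unfolded defs]] by auto
  have nc: "c G X (Fm P F G \<phi> X x) = Fm J F G \<phi> X (c F X x)"
    if "cohomological T F" "cohomological T G" "psh_hom T F G \<phi>" "X \<in> Obj T" "x \<in> carrier (Ev (Fo P F) X)" for F G \<phi> X x
    unfolding defs using canon_natural[OF inf small thick_U thick_K sub(3) that[unfolded defs]] .
  have nd: "d G X (Fm N F G \<phi> X x) = Fm J F G \<phi> X (d F X x)"
    if "cohomological T F" "cohomological T G" "psh_hom T F G \<phi>" "X \<in> Obj T" "x \<in> carrier (Ev (Fo N F) X)" for F G \<phi> X x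
    unfolding defs using canon_natural[OF inf small thick_V thick_K sub(4) that[unfolded defs]] .
  have "\<forall>n :: int. \<exists>e. (\<forall>X \<in> Obj T. e X \<in> Arr T \<and> Dom T (e X) = Sho T (Sho_pow T (- (n + 1)) X) \<and> Cod T (e X) = Sho_pow T (- n) X \<and> iso_arr T (e X)) \<and>
    (\<forall>f \<in> Arr T. e (Cod T f) \<cdot> Sha T (Sha_pow T (- (n + 1)) f) = Sha_pow T (- n) f \<cdot> e (Dom T f))"
    using shift_isoE by metis
  then obtain e where e: "\<And>n X. X \<in> Obj T \<Longrightarrow> e n X \<in> Arr T \<and> Dom T (e n X) = Sho T (Sho_pow T (- (n + 1)) X) \<and> Cod T (e n X) = Sho_pow T (- n) X \<and> iso_arr T (e n X)"
    and en: "\<And>n f. f \<in> Arr T \<Longrightarrow> e n (Cod T f) \<cdot> Sha T (Sha_pow T (- (n + 1)) f) = Sha_pow T (- n) f \<cdot> e n (Dom T f)" by metis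
  \<comment> \<open>In multiplicative notation the difference of c p and d q; with this sign the
    composite with (a, b) is trivial.\<close>
  define \<beta> :: "('o, 'm, 'g) psh \<Rightarrow> 'o \<Rightarrow> 'g \<times> 'g \<Rightarrow> 'g"
    where "\<beta> = (\<lambda>F X (p, q). c F X p \<otimes>\<^bsub>Ev (Fo J F) X\<^esub> inv\<^bsub>Ev (Fo J F) X\<^esub> d F X q)"
  \<comment> \<open>With Z = \<Sigma>^(-n-1) X the connecting map starts at J(\<Sigma>Z);
    restriction along the isomorphism e identifies J(\<Sigma>^(-n) X) with it.\<close>
  define \<gamma> :: "int \<Rightarrow> ('o, 'm, 'g) psh \<Rightarrow> 'o \<Rightarrow> 'g \<Rightarrow> 'g"
    where "\<gamma> = (\<lambda>n F X j. conn T U (Fo M F) (Fo N F) (Fo J F) (b F) (d F) (Sho_pow T (- (n + 1)) X) (Re (Fo J F) (e n X) j))"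
  have \<alpha>: "canon_pair T U V F X x = (a F X x, b F X x)" for F X x by (simp add: canon_pair_def defs)
  have nat\<alpha>: "nat_trans T M (dsum P N) (canon_pair T U V)"
    unfolding nat_trans_def
  proof (intro conjI allI impI)
    fix F :: "('o, 'm, 'g) psh" assume F: "cohomological T F"
    interpret S: mv_square T U "Fo M F" "Fo P F" "Fo N F" "Fo J F" "a F" "b F" "c F" "d F" by (rule sq[OF F])
    show "psh_hom T (Fo M F) (Fo (dsum P N) F) (canon_pair T U V F)"
      unfolding psh_hom_def using psh_homD[OF S.ah] psh_homD[OF S.bh]
      by (auto intro!: homI simp: \<alpha> DirProd_simps)
  next
    fix F G :: "('o, 'm, 'g) psh" and \<phi> assume "cohomological T F \<and> cohomological T G \<and> psh_hom T F G \<phi>"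
    then show "mor_eq T (Fo M F) (mor_comp (canon_pair T U V G) (Fm M F G \<phi>)) (mor_comp (Fm (dsum P N) F G \<phi>) (canon_pair T U V F))"
      using na nb by (simp add: mor_eq_def mor_comp_def \<alpha>)
  qed
  have nat\<beta>: "nat_trans T (dsum P N) J \<beta>"
    unfolding nat_trans_def
  proof (intro conjI allI impI)
    fix F :: "('o, 'm, 'g) psh" assume F: "cohomological T F"
    interpret S: mv_square T U "Fo M F" "Fo P F" "Fo N F" "Fo J F" "a F" "b F" "c F" "d F" by (rule sq[OF F])
    show "psh_hom T (Fo (dsum P N) F) (Fo J F) (\<beta> F)"
      unfolding psh_hom_def
    proof (intro conjI ballI)
      fix X assume X: "X \<in> Obj T"
      interpret JX: comm_group "Ev (Fo J F) X" using presheafD(1)[OF S.Jp X] .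
      note cl = psh_homD(1)[OF S.ch X] psh_homD(1)[OF S.dh X]
      show "\<beta> F X \<in> hom (Ev (Fo (dsum P N) F) X) (Ev (Fo J F) X)"
      proof (rule homI)
        show "\<beta> F X x \<in> carrier (Ev (Fo J F) X)" if "x \<in> carrier (Ev (Fo (dsum P N) F) X)" for x
          using that cl by (auto simp: \<beta>_def DirProd_simps)
        fix x y assume "x \<in> carrier (Ev (Fo (dsum P N) F) X)" "y \<in> carrier (Ev (Fo (dsum P N) F) X)"
        then obtain p q p' q' where xy: "x = (p, q)" "y = (p', q')" "p \<in> carrier (Ev (Fo P F) X)" "q \<in> carrier (Ev (Fo N F) X)"
          "p' \<in> carrier (Ev (Fo P F) X)" "q' \<in> carrier (Ev (Fo N F) X)" by (auto simp: DirProd_simps)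
        show "\<beta> F X (x \<otimes>\<^bsub>Ev (Fo (dsum P N) F) X\<^esub> y) = \<beta> F X x \<otimes>\<^bsub>Ev (Fo J F) X\<^esub> \<beta> F X y"
          unfolding xy(1,2) using psh_homD(2)[OF S.ch X xy(3,5)] psh_homD(2)[OF S.dh X xy(4,6)] cl(1)[OF xy(3)] cl(1)[OF xy(5)] cl(2)[OF xy(4)] cl(2)[OF xy(6)]
          by (simp add: \<beta>_def DirProd_simps JX.inv_mult JX.m_ac)
      qed
    next
      fix f x assume f: "f \<in> Arr T" and "x \<in> carrier (Ev (Fo (dsum P N) F) (Cod T f))"
      then obtain p q where xy: "x = (p, q)" "p \<in> carrier (Ev (Fo P F) (Cod T f))" "q \<in> carrier (Ev (Fo N F) (Cod T f))" by (auto simp: DirProd_simps)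
      have o: "Cod T f \<in> Obj T" using f by simp
      interpret JX: comm_group "Ev (Fo J F) (Cod T f)" using presheafD(1)[OF S.Jp o] .
      have cl: "c F (Cod T f) p \<in> carrier (Ev (Fo J F) (Cod T f))" "d F (Cod T f) q \<in> carrier (Ev (Fo J F) (Cod T f))"
        using psh_homD(1)[OF S.ch o xy(2)] psh_homD(1)[OF S.dh o xy(3)] .
      show "\<beta> F (Dom T f) (Re (Fo (dsum P N) F) f x) = Re (Fo J F) f (\<beta> F (Cod T f) x)"
        unfolding xy(1) using psh_homD(3)[OF S.ch f xy(2)] psh_homD(3)[OF S.dh f xy(3)] presheafD(4)[OF S.Jp f cl(1) JX.inv_closed[OF cl(2)]]
          presheaf_inv[OF S.Jp f cl(2)] by (simp add: \<beta>_def)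
    qed
  next
    fix F G :: "('o, 'm, 'g) psh" and \<phi> assume FG: "cohomological T F \<and> cohomological T G \<and> psh_hom T F G \<phi>"
    then have F: "cohomological T F" and G: "cohomological T G" and \<phi>: "psh_hom T F G \<phi>" by auto
    interpret S: mv_square T U "Fo M F" "Fo P F" "Fo N F" "Fo J F" "a F" "b F" "c F" "d F" by (rule sq[OF F])
    interpret S': mv_square T U "Fo M G" "Fo P G" "Fo N G" "Fo J G" "a G" "b G" "c G" "d G" by (rule sq[OF G])
    show "mor_eq T (Fo (dsum P N) F) (mor_comp (\<beta> G) (Fm (dsum P N) F G \<phi>)) (mor_comp (Fm J F G \<phi>) (\<beta> F))"
      unfolding mor_eq_def
    proof (intro ballI)
      fix X x assume X: "X \<in> Obj T" and "x \<in> carrier (Ev (Fo (dsum P N) F) X)"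
      then obtain p q where xy: "x = (p, q)" "p \<in> carrier (Ev (Fo P F) X)" "q \<in> carrier (Ev (Fo N F) X)" by (auto simp: DirProd_simps)
      have cl: "c F X p \<in> carrier (Ev (Fo J F) X)" "d F X q \<in> carrier (Ev (Fo J F) X)"
        using psh_homD(1)[OF S.ch X xy(2)] psh_homD(1)[OF S.dh X xy(3)] .
      interpret JX: comm_group "Ev (Fo J F) X" using presheafD(1)[OF S.Jp X] .
      show "mor_comp (\<beta> G) (Fm (dsum P N) F G \<phi>) X x = mor_comp (Fm J F G \<phi>) (\<beta> F) X x"
        unfolding xy(1) using nc[OF F G \<phi> X xy(2)] nd[OF F G \<phi> X xy(3)] psh_homD(2)[OF fJ[OF F G \<phi>] X cl(1) JX.inv_closed[OF cl(2)]]
          psh_hom_inv[OF fJ[OF F G \<phi>] S.Jp S'.Jp X cl(2)] by (simp add: \<beta>_def mor_comp_def)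
    qed
  qed
  have nat\<gamma>: "nat_trans T (susp T n J) (susp T (n + 1) M) (\<gamma> n)" for n
    unfolding nat_trans_def
  proof (intro conjI allI impI)
    fix F :: "('o, 'm, 'g) psh" assume F: "cohomological T F"
    interpret S: mv_square T U "Fo M F" "Fo P F" "Fo N F" "Fo J F" "a F" "b F" "c F" "d F" by (rule sq[OF F])
    show "psh_hom T (Fo (susp T n J) F) (Fo (susp T (n + 1) M) F) (\<gamma> n F)"
      unfolding psh_hom_def
    proof (intro conjI ballI)
      fix X assume X: "X \<in> Obj T"
      note eX = e[OF X, of n]
      let ?Z = "Sho_pow T (- (n + 1)) X"
      have Z: "?Z \<in> Obj T" using Sho_pow_obj[OF X] .
      note h = S.conn_hom(1)[OF Z]
      have "Re (Fo J F) (e n X) \<in> hom (Ev (Fo J F) (Sho_pow T (- n) X)) (Ev (Fo J F) (Sho T ?Z))"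
        using S.Jp eX unfolding presheaf_def by metis
      then show "\<gamma> n F X \<in> hom (Ev (Fo (susp T n J) F) X) (Ev (Fo (susp T (n + 1) M) F) X)"
        using h unfolding hom_def \<gamma>_def by (auto simp: Pi_iff)
    next
      fix f x assume f: "f \<in> Arr T" and x: "x \<in> carrier (Ev (Fo (susp T n J) F) (Cod T f))"
      let ?z = "Sha_pow T (- (n + 1)) f" and ?w = "Sha_pow T (- n) f"
      note z = Sha_pow_arr[OF f, of "- (n + 1)"] and w = Sha_pow_arr[OF f, of "- n"]
      note eD = e[OF dom_obj[OF f], of n] and eC = e[OF cod_obj[OF f], of n]
      have x': "x \<in> carrier (Ev (Fo J F) (Cod T ?w))" using x w by simp
      have "Re (Fo J F) (e n (Dom T f)) (Re (Fo J F) ?w x) = Re (Fo J F) (?w \<cdot> e n (Dom T f)) x"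
        using presheafD(5)[OF S.Jp _ w(1) _ x', of "e n (Dom T f)"] eD w by simp
      also have "\<dots> = Re (Fo J F) (e n (Cod T f) \<cdot> Sha T ?z) x" by (simp only: en[OF f])
      also have "\<dots> = Re (Fo J F) (Sha T ?z) (Re (Fo J F) (e n (Cod T f)) x)"
        using presheafD(5)[OF S.Jp sha_arr[OF z(1)], of "e n (Cod T f)" x] eC z x by simp
      finally have q: "Re (Fo J F) (e n (Dom T f)) (Re (Fo J F) ?w x) = Re (Fo J F) (Sha T ?z) (Re (Fo J F) (e n (Cod T f)) x)" .
      have ex: "Re (Fo J F) (e n (Cod T f)) x \<in> carrier (Ev (Fo J F) (Sho T (Cod T ?z)))"
        using presheafD(3)[OF S.Jp, of "e n (Cod T f)" x] eC x z by simp
      show "\<gamma> n F (Dom T f) (Re (Fo (susp T n J) F) f x) = Re (Fo (susp T (n + 1) M) F) f (\<gamma> n F (Cod T f) x)"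
        using S.conn_natural[OF z(1) ex] z q by (simp add: \<gamma>_def)
    qed
  next
    fix F G :: "('o, 'm, 'g) psh" and \<phi> assume FG: "cohomological T F \<and> cohomological T G \<and> psh_hom T F G \<phi>"
    then have F: "cohomological T F" and G: "cohomological T G" and \<phi>: "psh_hom T F G \<phi>" by auto
    interpret S: mv_square T U "Fo M F" "Fo P F" "Fo N F" "Fo J F" "a F" "b F" "c F" "d F" by (rule sq[OF F])
    interpret S': mv_square T U "Fo M G" "Fo P G" "Fo N G" "Fo J G" "a G" "b G" "c G" "d G" by (rule sq[OF G])
    show "mor_eq T (Fo (susp T n J) F) (mor_comp (\<gamma> n G) (Fm (susp T n J) F G \<phi>)) (mor_comp (Fm (susp T (n + 1) M) F G \<phi>) (\<gamma> n F))"
      unfolding mor_eq_def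
    proof (intro ballI)
      fix X x assume X: "X \<in> Obj T" and x: "x \<in> carrier (Ev (Fo (susp T n J) F) X)"
      let ?Z = "Sho_pow T (- (n + 1)) X"
      have Z: "?Z \<in> Obj T" "Sho T ?Z \<in> Obj T" using Sho_pow_obj[OF X] by auto
      note eX = e[OF X, of n]
      let ?j = "Re (Fo J F) (e n X) x"
      have j: "?j \<in> carrier (Ev (Fo J F) (Sho T ?Z))" using presheafD(3)[OF S.Jp, of "e n X" x] eX x by simp
      have j': "Fm J F G \<phi> (Sho T ?Z) ?j = Re (Fo J G) (e n X) (Fm J F G \<phi> (Sho_pow T (- n) X) x)"
        using psh_homD(3)[OF fJ[OF F G \<phi>], of "e n X" x] eX x by simp
      \<comment> \<open>Values of the relation are unique, so it suffices that the image of the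
        value for F is a value for G.\<close>
      have "conn_rel T U (Fo M G) (Fo N G) (Fo J G) (b G) (d G) ?Z (Fm J F G \<phi> (Sho T ?Z) ?j)
        (Fm M F G \<phi> ?Z (conn T U (Fo M F) (Fo N F) (Fo J F) (b F) (d F) ?Z ?j))"
        by (rule conn_rel_map[OF S.conn_hom(3)[OF Z(1) j] Z(2) _ fM[OF F G \<phi>] fN[OF F G \<phi>] fJ[OF F G \<phi>]])
          (use nd[OF F G \<phi>] nb[OF F G \<phi>] tri_simps in auto)
      from S'.conn_hom(2)[OF Z(1) this]
      show "mor_comp (\<gamma> n G) (Fm (susp T n J) F G \<phi>) X x = mor_comp (Fm (susp T (n + 1) M) F G \<phi>) (\<gamma> n F) X x"
        using j' by (simp add: mor_comp_def \<gamma>_def)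
    qed
  qed
  have ex1: "exact_at T (susp T n M) (susp T n (dsum P N)) (susp T n J) (susp_trans T n (canon_pair T U V)) (susp_trans T n \<beta>)" for n
    unfolding exact_at_def
  proof (intro allI impI ballI)
    fix F :: "('o, 'm, 'g) psh" and X assume F: "cohomological T F" and X: "X \<in> Obj T"
    interpret S: mv_square T U "Fo M F" "Fo P F" "Fo N F" "Fo J F" "a F" "b F" "c F" "d F" by (rule sq[OF F])
    let ?Y = "Sho_pow T (- n) X"
    have Y: "?Y \<in> Obj T" using Sho_pow_obj[OF X] .
    interpret JX: comm_group "Ev (Fo J F) ?Y" using presheafD(1)[OF S.Jp Y] .
    have iff: "\<beta> F ?Y (p, q) = \<one>\<^bsub>Ev (Fo J F) ?Y\<^esub> \<longleftrightarrow> (\<exists>m \<in> carrier (Ev (Fo M F) ?Y). a F ?Y m = p \<and> b F ?Y m = q)"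
      if pq: "p \<in> carrier (Ev (Fo P F) ?Y)" "q \<in> carrier (Ev (Fo N F) ?Y)" for p q
    proof -
      note cl = psh_homD(1)[OF S.ch Y pq(1)] psh_homD(1)[OF S.dh Y pq(2)]
      have "\<beta> F ?Y (p, q) = \<one>\<^bsub>Ev (Fo J F) ?Y\<^esub> \<longleftrightarrow> c F ?Y p = d F ?Y q"
        unfolding \<beta>_def case_prod_conv using cl JX.inv_solve_right[OF JX.one_closed cl] JX.r_inv by (metis JX.inv_equality JX.inv_inv JX.inv_closed)
      then show ?thesis using S.exact_middle[OF Y pq] by simp
    qed
    have cl: "a F ?Y m \<in> carrier (Ev (Fo P F) ?Y)" "b F ?Y m \<in> carrier (Ev (Fo N F) ?Y)" if "m \<in> carrier (Ev (Fo M F) ?Y)" for m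
      using psh_homD(1)[OF S.ah Y that] psh_homD(1)[OF S.bh Y that] .
    have "z \<in> (\<lambda>m. (a F ?Y m, b F ?Y m)) ` carrier (Ev (Fo M F) ?Y) \<longleftrightarrow>
       z \<in> {z \<in> carrier (Ev (Fo P F) ?Y) \<times> carrier (Ev (Fo N F) ?Y). \<beta> F ?Y z = \<one>\<^bsub>Ev (Fo J F) ?Y\<^esub>}" for z
    proof (cases z)
      case (Pair p q)
      then show ?thesis using iff cl by blast
    qed
    then show "susp_trans T n (canon_pair T U V) F X ` carrier (Ev (Fo (susp T n M) F) X) =
      kernel (Ev (Fo (susp T n (dsum P N)) F) X) (Ev (Fo (susp T n J) F) X) (susp_trans T n \<beta> F X)"
      unfolding kernel_def susp_trans_def by (auto simp: \<alpha> DirProd_simps)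
  qed
  have ex2: "exact_at T (susp T n (dsum P N)) (susp T n J) (susp T (n + 1) M) (susp_trans T n \<beta>) (\<gamma> n)" for n
    unfolding exact_at_def
  proof (intro allI impI ballI)
    fix F :: "('o, 'm, 'g) psh" and X assume F: "cohomological T F" and X: "X \<in> Obj T"
    interpret S: mv_square T U "Fo M F" "Fo P F" "Fo N F" "Fo J F" "a F" "b F" "c F" "d F" by (rule sq[OF F])
    let ?Y = "Sho_pow T (- n) X" and ?Z = "Sho_pow T (- (n + 1)) X"
    have Y: "?Y \<in> Obj T" and Z: "?Z \<in> Obj T" "Sho T ?Z \<in> Obj T" using Sho_pow_obj[OF X] by auto
    note eX = e[OF X, of n]
    then have eA: "e n X \<in> Arr T" and eI: "iso_arr T (e n X)" and eD: "Dom T (e n X) = Sho T ?Z" and eC: "Cod T (e n X) = ?Y" by auto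
    interpret JX: comm_group "Ev (Fo J F) ?Y" using presheafD(1)[OF S.Jp Y] .
    \<comment> \<open>\<open>exact_J\<close> speaks of \<Sigma>Z; naturality of \<beta> along the
      isomorphism e moves it to \<Sigma>^(-n) X.\<close>
    have b_nat: "Re (Fo J F) (e n X) (\<beta> F ?Y (p, q)) = \<beta> F (Sho T ?Z) (Re (Fo P F) (e n X) p, Re (Fo N F) (e n X) q)"
      if "p \<in> carrier (Ev (Fo P F) ?Y)" "q \<in> carrier (Ev (Fo N F) ?Y)" for p q
    proof -
      have "psh_hom T (Fo (dsum P N) F) (Fo J F) (\<beta> F)" using nat\<beta> F unfolding nat_trans_def by blast
      from psh_homD(3)[OF this eA, of "(p, q)"] show ?thesis using that eD eC by (simp add: DirProd_simps)
    qed
    have b_cl: "\<beta> F ?Y (p, q) \<in> carrier (Ev (Fo J F) ?Y)"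
      if "p \<in> carrier (Ev (Fo P F) ?Y)" "q \<in> carrier (Ev (Fo N F) ?Y)" for p q
      using psh_homD(1)[OF S.ch Y that(1)] psh_homD(1)[OF S.dh Y that(2)] by (simp add: \<beta>_def)
    have iff: "\<gamma> n F X j = \<one>\<^bsub>Ev (Fo M F) ?Z\<^esub> \<longleftrightarrow> (\<exists>p \<in> carrier (Ev (Fo P F) ?Y). \<exists>q \<in> carrier (Ev (Fo N F) ?Y). j = \<beta> F ?Y (p, q))"
      if j: "j \<in> carrier (Ev (Fo J F) ?Y)" for j
    proof -
      let ?j = "Re (Fo J F) (e n X) j"
      have j': "?j \<in> carrier (Ev (Fo J F) (Sho T ?Z))" using presheafD(3)[OF S.Jp eA, of j] j eC eD by simp
      have "\<gamma> n F X j = \<one>\<^bsub>Ev (Fo M F) ?Z\<^esub> \<longleftrightarrow> (\<exists>p \<in> carrier (Ev (Fo P F) (Sho T ?Z)). \<exists>q \<in> carrier (Ev (Fo N F) (Sho T ?Z)).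
        ?j = \<beta> F (Sho T ?Z) (p, q))" unfolding \<gamma>_def using S.exact_J[OF Z(1) j'] by (simp add: \<beta>_def)
      also have "\<dots> \<longleftrightarrow> (\<exists>p \<in> carrier (Ev (Fo P F) ?Y). \<exists>q \<in> carrier (Ev (Fo N F) ?Y). j = \<beta> F ?Y (p, q))"
      proof
        assume "\<exists>p \<in> carrier (Ev (Fo P F) (Sho T ?Z)). \<exists>q \<in> carrier (Ev (Fo N F) (Sho T ?Z)). ?j = \<beta> F (Sho T ?Z) (p, q)"
        then obtain p q where p: "p \<in> carrier (Ev (Fo P F) (Sho T ?Z))" "q \<in> carrier (Ev (Fo N F) (Sho T ?Z))" "?j = \<beta> F (Sho T ?Z) (p, q)" by blast
        obtain p' where p': "p' \<in> carrier (Ev (Fo P F) ?Y)" "Re (Fo P F) (e n X) p' = p" using presheaf_iso(1)[OF S.Pp eA eI, of p] p eC eD by auto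
        obtain q' where q': "q' \<in> carrier (Ev (Fo N F) ?Y)" "Re (Fo N F) (e n X) q' = q" using presheaf_iso(1)[OF S.Np eA eI, of q] p eC eD by auto
        have "?j = Re (Fo J F) (e n X) (\<beta> F ?Y (p', q'))" using b_nat[OF p'(1) q'(1)] p' q' p by simp
        then have "j = \<beta> F ?Y (p', q')" using presheaf_iso(2)[OF S.Jp eA eI] j b_cl[OF p'(1) q'(1)] eC by simp
        then show "\<exists>p \<in> carrier (Ev (Fo P F) ?Y). \<exists>q \<in> carrier (Ev (Fo N F) ?Y). j = \<beta> F ?Y (p, q)" using p' q' by blast
      next
        assume "\<exists>p \<in> carrier (Ev (Fo P F) ?Y). \<exists>q \<in> carrier (Ev (Fo N F) ?Y). j = \<beta> F ?Y (p, q)"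
        then obtain p q where p: "p \<in> carrier (Ev (Fo P F) ?Y)" "q \<in> carrier (Ev (Fo N F) ?Y)" "j = \<beta> F ?Y (p, q)" by blast
        have "Re (Fo P F) (e n X) p \<in> carrier (Ev (Fo P F) (Sho T ?Z))" "Re (Fo N F) (e n X) q \<in> carrier (Ev (Fo N F) (Sho T ?Z))"
          using presheafD(3)[OF S.Pp eA, of p] presheafD(3)[OF S.Np eA, of q] p eC eD by auto
        then show "\<exists>p \<in> carrier (Ev (Fo P F) (Sho T ?Z)). \<exists>q \<in> carrier (Ev (Fo N F) (Sho T ?Z)). ?j = \<beta> F (Sho T ?Z) (p, q)"
          using b_nat[OF p(1,2)] p(3) by blast
      qed
      finally show ?thesis .
    qed
    have "j \<in> \<beta> F ?Y ` (carrier (Ev (Fo P F) ?Y) \<times> carrier (Ev (Fo N F) ?Y)) \<longleftrightarrow>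
      j \<in> {j \<in> carrier (Ev (Fo J F) ?Y). \<gamma> n F X j = \<one>\<^bsub>Ev (Fo M F) ?Z\<^esub>}" for j
      using iff b_cl by blast
    then show "susp_trans T n \<beta> F X ` carrier (Ev (Fo (susp T n (dsum P N)) F) X) =
      kernel (Ev (Fo (susp T n J) F) X) (Ev (Fo (susp T (n + 1) M) F) X) (\<gamma> n F X)"
      unfolding kernel_def susp_trans_def susp_simps dsum_simps DirProd_simps by blast
  qed
  have ex3: "exact_at T (susp T n J) (susp T (n + 1) M) (susp T (n + 1) (dsum P N)) (\<gamma> n) (susp_trans T (n + 1) (canon_pair T U V))" for n
    unfolding exact_at_def
  proof (intro allI impI ballI)
    fix F :: "('o, 'm, 'g) psh" and X assume F: "cohomological T F" and X: "X \<in> Obj T"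
    interpret S: mv_square T U "Fo M F" "Fo P F" "Fo N F" "Fo J F" "a F" "b F" "c F" "d F" by (rule sq[OF F])
    let ?Y = "Sho_pow T (- n) X" and ?Z = "Sho_pow T (- (n + 1)) X"
    have Y: "?Y \<in> Obj T" and Z: "?Z \<in> Obj T" "Sho T ?Z \<in> Obj T" using Sho_pow_obj[OF X] by auto
    note eX = e[OF X, of n]
    then have eA: "e n X \<in> Arr T" and eI: "iso_arr T (e n X)" and eD: "Dom T (e n X) = Sho T ?Z" and eC: "Cod T (e n X) = ?Y" by auto
    have im: "Re (Fo J F) (e n X) ` carrier (Ev (Fo J F) ?Y) = carrier (Ev (Fo J F) (Sho T ?Z))"
      using presheafD(3)[OF S.Jp eA] presheaf_iso(1)[OF S.Jp eA eI] eC eD by (auto simp: image_iff)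
    have "\<gamma> n F X ` carrier (Ev (Fo J F) ?Y) = conn T U (Fo M F) (Fo N F) (Fo J F) (b F) (d F) ?Z ` carrier (Ev (Fo J F) (Sho T ?Z))"
      unfolding im[symmetric] image_image \<gamma>_def ..
    also have "\<dots> = {m \<in> carrier (Ev (Fo M F) ?Z). a F ?Z m = \<one>\<^bsub>Ev (Fo P F) ?Z\<^esub> \<and> b F ?Z m = \<one>\<^bsub>Ev (Fo N F) ?Z\<^esub>}"
      using S.exact_M[OF Z(1)] S.conn_hom(1)[OF Z(1)] unfolding hom_def by (auto simp: image_iff Pi_iff)
    finally show "\<gamma> n F X ` carrier (Ev (Fo (susp T n J) F) X) =
      kernel (Ev (Fo (susp T (n + 1) M) F) X) (Ev (Fo (susp T (n + 1) (dsum P N)) F) X) (susp_trans T (n + 1) (canon_pair T U V) F X)"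
      unfolding kernel_def susp_trans_def by (simp add: \<alpha> DirProd_simps)
  qed
  have "mayer_vietoris T U V \<beta> \<gamma>"
    unfolding mayer_vietoris_def Let_def
    using nat\<alpha> nat\<beta> nat\<gamma> ex1 ex2 ex3 unfolding M_def P_def N_def J_def by blast
  then show ?thesis by blast
qed

theorem corollary3p14:
  fixes T :: "('o, 'm) tcat"
  assumes "triangulated_category T"
    and "infinite (UNIV :: 'g set)"
    and "essentially_small T (UNIV :: 'g set)"
  shows "frame_iso (ZThick T) (Opens (ZThick T)) (supp_cent T) \<and>
    (\<forall>\<U> \<in> Thick T. \<forall>\<V> \<in> Thick T. central T \<U> \<or> central T \<V> \<longrightarrow>
       (\<exists>(\<beta> :: ('o, 'm, 'g) psh \<Rightarrow> 'o \<Rightarrow> 'g \<times> 'g \<Rightarrow> 'g) \<gamma>. mayer_vietoris T \<U> \<V> \<beta> \<gamma>))"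
proof (intro conjI ballI impI)
  interpret triangulated_category T by fact
  show "frame_iso (ZThick T) (Opens (ZThick T)) (supp_cent T)" by (rule central_frame_iso)
  fix U V assume U: "U \<in> Thick T" and V: "V \<in> Thick T" and c: "central T U \<or> central T V"
  \<comment> \<open>The commuting condition is symmetric, so centrality of either subcategory gives
    it.\<close>
  interpret commuting T U V
    by unfold_locales (use U V c commuting_sym in \<open>auto simp: central_def\<close>)
  show "\<exists>(\<beta> :: ('o, 'm, 'g) psh \<Rightarrow> 'o \<Rightarrow> 'g \<times> 'g \<Rightarrow> 'g) \<gamma>. mayer_vietoris T U V \<beta> \<gamma>"
    by (rule mayer_vietoris_exists[OF assms(2,3)])
qed

end
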